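(* The Lyapunov exponent functions $L^\pm:\mathrm{GL}_2(\mathbb{R})^k\to\mathbb{R}$ are continuous at every point. Furthermore, let $A\in\mathrm{GL}_2(\mathbb{R})^k$ with $L^+(A)>L^-(A)$. If $A$ is diagonalizable, then $L^+$ and $L^-$ are locally weak-Hölder continuous near $A$; moreover, on a neighborhood of $A$ the maps $B\mapsto\mathcal{E}^\pm_B\in L^1(X,\mathbb{P}(\mathbb{R}^2))$ are well defined and locally weak-Hölder continuous near $A$. If $A$ is not diagonalizable, then the same conclusions hold with locally Hölder continuity in place of locally weak-Hölder continuity.
   Context: Let $\Sigma=\{1,\dots,k\}$, $p=(p_1,\dots,p_k)$ a probability vector with all $p_i>0$, $X=\Sigma^{\mathbb{Z}}$ with $\mathbb{P}=p^{\mathbb{Z}}$ and the shift $T$. A cocycle is $A=(A_1,\dots,A_k)\in\mathrm{GL}_2(\mathbb{R})^k$, viewed as $A(x)=A_{x_0}$, with iterates $A^{(n)}(x)=A_{x_{n-1}}\cdots A_{x_0}$ and distance $d(A,B)=\max_j\|A_j-B_j\|$. $L^+(A)$ and $L^-(A)$ are the $\mathbb{P}$-a.s. limits of $\frac1n\log\|A^{(n)}(x)\|$ and $\frac1n\log\|A^{(n)}(x)^{-1}\|^{-1}$. $A$ is diagonalizable if $A_1,\dots,A_k$ are simultaneously diagonalizable over $\mathbb{R}$. When $L^+(A)>L^-(A)$, the Oseledets theorem gives a measurable splitting $\mathbb{R}^2=\mathcal{E}^+_A(x)\oplus\mathcal{E}^-_A(x)$ into lines with $A(x)\mathcal{E}^\pm_A(x)=\mathcal{E}^\pm_A(Tx)$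 a.s. and $\lim_{n\to\pm\infty}\frac1n\log\|A^{(n)}(x)v\|=L^\pm(A)$ for nonzero $v\in\mathcal{E}^\pm_A(x)$; these are regarded as functions $X\to\mathbb{P}(\mathbb{R}^2)$. The projective line $\mathbb{P}(\mathbb{R}^2)$ carries the metric $d(\hat p,\hat q)=|\sin\angle(p,q)|$, and $L^1(X,\mathbb{P}(\mathbb{R}^2))$ is the space of Borel maps $X\to\mathbb{P}(\mathbb{R}^2)$ with distance $d(\mathcal{E}_1,\mathcal{E}_2)=\mathbb{E}_x\, d(\mathcal{E}_1(x),\mathcal{E}_2(x))$. For metric spaces $M,N$, $f:M\to N$ is locally Hölder near $a$ if there are a neighborhood $\mathscr{N}_a$ and $C<\infty$, $\alpha>0$ with $d(f(b_1),f(b_2))\le C\,d(b_1,b_2)^\alpha$ for $b_1,b_2\in\mathscr{N}_a$; it is locally weak-Hölder near $a$ if there are $\mathscr{N}_a$, $C<\infty$, $\alpha>0$, $\sigma\in(0,1]$ with $d(f(b_1),f(b_2))\le C\exp\big(-\alpha(\log\frac{1}{d(b_1,b_2)})^\sigma\big)$ for $b_1,b_2\in\mathscr{N}_a$. *)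

theory Defs
  imports "HOL-Analysis.Analysis" "HOL-Probability.Probability"
begin

text \<open>Alphabet: a finite type 'a (so k = CARD('a)); p is a probability vector given as a pmf
  on 'a with full support (all p_i > 0). Cocycles are maps 'a \<Rightarrow> real^2^2.\<close>

type_synonym 'a cocycle = "'a \<Rightarrow> real^2^2"

definition bern :: "'a pmf \<Rightarrow> (int \<Rightarrow> 'a) measure" where
  "bern p = (\<Pi>\<^sub>M i\<in>(UNIV::int set). measure_pmf p)"

definition shift :: "(int \<Rightarrow> 'a) \<Rightarrow> (int \<Rightarrow> 'a)" where
  "shift x = (\<lambda>i. x (i + 1))"

definition mnorm :: "real^2^2 \<Rightarrow> real" where
  "mnorm M = onorm (\<lambda>v. M *v v)"

definition GLk :: "'a::finite cocycle set" where
  "GLk = {A. \<forall>j. invertible (A j)}"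

definition cdist :: "'a::finite cocycle \<Rightarrow> 'a cocycle \<Rightarrow> real" where
  "cdist A B = Max (range (\<lambda>j. mnorm (A j - B j)))"

fun citer :: "'a cocycle \<Rightarrow> nat \<Rightarrow> (int \<Rightarrow> 'a) \<Rightarrow> real^2^2" where
  "citer A 0 x = mat 1"
| "citer A (Suc n) x = A (x (int n)) ** citer A n x"

definition ziter :: "'a cocycle \<Rightarrow> int \<Rightarrow> (int \<Rightarrow> 'a) \<Rightarrow> real^2^2" where
  "ziter A n x = (if 0 \<le> n then citer A (nat n) x
                  else matrix_inv (citer A (nat (- n)) (\<lambda>i. x (i + n))))"

definition Lplus :: "'a pmf \<Rightarrow> 'a cocycle \<Rightarrow> real" where
  "Lplus p A = (THE c. AE x in bern p. (\<lambda>n. ln (mnorm (citer A n x)) / real n) \<longlonglongrightarrow> c)"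

definition Lminus :: "'a pmf \<Rightarrow> 'a cocycle \<Rightarrow> real" where
  "Lminus p A = (THE c. AE x in bern p.
      (\<lambda>n. ln (inverse (mnorm (matrix_inv (citer A n x)))) / real n) \<longlonglongrightarrow> c)"

definition diagonalizable :: "'a cocycle \<Rightarrow> bool" where
  "diagonalizable A \<longleftrightarrow> (\<exists>P::real^2^2. invertible P \<and>
     (\<forall>j. \<exists>D::real^2^2. (\<forall>i i'. i \<noteq> i' \<longrightarrow> D $ i $ i' = 0) \<and> A j = P ** D ** matrix_inv P))"

text \<open>Projective line: points are lines (1-dimensional subspaces) of R^2,
  with metric |sin angle(p,q)| for nonzero representatives.\<close>
definition vec_angle :: "real^2 \<Rightarrow> real^2 \<Rightarrow> real" where
  "vec_angle u v = arccos ((u \<bullet> v) / (norm u * norm v))"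

definition proj_dist :: "(real^2) set \<Rightarrow> (real^2) set \<Rightarrow> real" where
  "proj_dist L M = \<bar>sin (vec_angle (SOME u. u \<in> L \<and> u \<noteq> 0) (SOME v. v \<in> M \<and> v \<noteq> 0))\<bar>"

text \<open>Borel map X \<rightarrow> P(R^2): a line field spanned by a Borel measurable nonvanishing vector field.\<close>
definition borel_line_field :: "'a pmf \<Rightarrow> ((int \<Rightarrow> 'a) \<Rightarrow> (real^2) set) \<Rightarrow> bool" where
  "borel_line_field p E \<longleftrightarrow> (\<exists>e. e \<in> borel_measurable (bern p) \<and>
      (\<forall>x. e x \<noteq> 0 \<and> E x = span {e x}))"

definition L1dist :: "'a pmf \<Rightarrow> ((int \<Rightarrow> 'a) \<Rightarrow> (real^2) set) \<Rightarrow> ((int \<Rightarrow> 'a) \<Rightarrow> (real^2) set) \<Rightarrow> real" where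
  "L1dist p E1 E2 = (\<integral>x. proj_dist (E1 x) (E2 x) \<partial>bern p)"

definition oseledets :: "'a pmf \<Rightarrow> 'a cocycle \<Rightarrow> ((int \<Rightarrow> 'a) \<Rightarrow> (real^2) set) \<Rightarrow>
    ((int \<Rightarrow> 'a) \<Rightarrow> (real^2) set) \<Rightarrow> bool" where
  "oseledets p A Ep Em \<longleftrightarrow>
     borel_line_field p Ep \<and> borel_line_field p Em \<and>
     (AE x in bern p. Ep x \<inter> Em x = {0} \<and>
        (\<lambda>v. A (x 0) *v v) ` Ep x = Ep (shift x) \<and>
        (\<lambda>v. A (x 0) *v v) ` Em x = Em (shift x) \<and>
        (\<forall>v\<in>Ep x. v \<noteq> 0 \<longrightarrow>
           ((\<lambda>n::int. ln (norm (ziter A n x *v v)) / real_of_int n) \<longlongrightarrow> Lplus p A) at_top \<and>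
           ((\<lambda>n::int. ln (norm (ziter A n x *v v)) / real_of_int n) \<longlongrightarrow> Lplus p A) at_bot) \<and>
        (\<forall>v\<in>Em x. v \<noteq> 0 \<longrightarrow>
           ((\<lambda>n::int. ln (norm (ziter A n x *v v)) / real_of_int n) \<longlongrightarrow> Lminus p A) at_top \<and>
           ((\<lambda>n::int. ln (norm (ziter A n x *v v)) / real_of_int n) \<longlongrightarrow> Lminus p A) at_bot))"

text \<open>The Oseledets directions B \<mapsto> E^\<plusminus>_B (a choice; unique up to null sets when it exists).\<close>
definition Eplus :: "'a pmf \<Rightarrow> 'a cocycle \<Rightarrow> ((int \<Rightarrow> 'a) \<Rightarrow> (real^2) set)" where
  "Eplus p A = fst (SOME E. oseledets p A (fst E) (snd E))"

definition Eminus :: "'a pmf \<Rightarrow> 'a cocycle \<Rightarrow> ((int \<Rightarrow> 'a) \<Rightarrow> (real^2) set)" where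
  "Eminus p A = snd (SOME E. oseledets p A (fst E) (snd E))"

definition loc_holder :: "'b set \<Rightarrow> ('b \<Rightarrow> 'b \<Rightarrow> real) \<Rightarrow> ('c \<Rightarrow> 'c \<Rightarrow> real) \<Rightarrow> ('b \<Rightarrow> 'c) \<Rightarrow> 'b \<Rightarrow> bool" where
  "loc_holder S d1 d2 f a \<longleftrightarrow> (\<exists>\<epsilon>>0. \<exists>C \<alpha>. \<alpha> > 0 \<and>
     (\<forall>b1\<in>S. \<forall>b2\<in>S. d1 a b1 < \<epsilon> \<longrightarrow> d1 a b2 < \<epsilon> \<longrightarrow>
        d2 (f b1) (f b2) \<le> C * d1 b1 b2 powr \<alpha>))"

definition loc_weak_holder :: "'b set \<Rightarrow> ('b \<Rightarrow> 'b \<Rightarrow> real) \<Rightarrow> ('c \<Rightarrow> 'c \<Rightarrow> real) \<Rightarrow> ('b \<Rightarrow> 'c) \<Rightarrow> 'b \<Rightarrow> bool" where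
  "loc_weak_holder S d1 d2 f a \<longleftrightarrow> (\<exists>\<epsilon>>0. \<exists>C \<alpha> \<sigma>. \<alpha> > 0 \<and> 0 < \<sigma> \<and> \<sigma> \<le> 1 \<and>
     (\<forall>b1\<in>S. \<forall>b2\<in>S. d1 a b1 < \<epsilon> \<longrightarrow> d1 a b2 < \<epsilon> \<longrightarrow> 0 < d1 b1 b2 \<longrightarrow> d1 b1 b2 < 1 \<longrightarrow>
        d2 (f b1) (f b2) \<le> C * exp (- \<alpha> * (ln (1 / d1 b1 b2)) powr \<sigma>)))"

definition rdist :: "real \<Rightarrow> real \<Rightarrow> real" where
  "rdist a b = \<bar>a - b\<bar>"

end

theory Submission
  imports Defs
begin

text \<open>Write \<open>M = B^(n)(x)\<close> and \<open>r(M) = |det M| / norm(M)^2 <= 1\<close>. The direction that M contracts most moves by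
  at most a constant times \<open>r(M)\<close> when one more matrix is multiplied on, so everything follows from one
  estimate: if \<open>L+(A) > L-(A)\<close>, there are \<open>a > 0\<close> and \<open>\<kappa> < 1\<close> with \<open>E r(B^(n))^a <= C \<kappa>^n\<close> for all B near A.
  Given this, the contracted directions converge exponentially fast in L1, uniformly in B, to the slow
  line; comparing time-n approximations for B and B' gives \<open>C \<kappa>^n + D^n d(B, B')\<close>, and optimising n gives
  Hoelder continuity of the slow line, also in the diagonalizable case. Its exponent is the mean of
  \<open>ln |B e|\<close> for the unit vector e on that line, hence Hoelder as well, and the inverse cocycle read
  backwards yields the fast line and \<open>L+\<close>. When \<open>L+(A) = L-(A)\<close>, continuity is just upper semicontinuity of
  \<open>L+\<close> and lower semicontinuity of \<open>L-\<close>.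

  For the estimate, either no fixed vector lies on the slow line of A with positive probability, and then
  every vector expands on average after boundedly many steps; or some fixed line is almost surely the slow
  line and is invariant, so A is triangular. In that case a homogeneous function which is large near the
  invariant line, but capped at the scale of the perturbation, is contracted on average by every B near A.\<close>

section \<open>Planar linear algebra\<close>

text \<open>The obstacle is an invariant slow line of A. A perturbation of size \<eta> lets a vector
  on that line leave it only after about ln (1/\<eta>) steps, so no bounded number of steps expands
  every direction uniformly in B. The capped function answers this: inside the cap, a fixed gain
  occurs with a probability bounded below along words whose length does not depend on \<eta>;
  outside the cap, the drift of A itself contracts. An invariant fast line alone is harmless, since
  the slow line is then random and the first alternative applies.

  The coordinates of the second alternative depend on B. A letter \<open>j0\<close> is fixed at
  which A stretches the invariant line less than the transversal direction, and the second axis is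
  taken to be an eigenvector of \<open>B j0\<close>. Repeating \<open>j0\<close> then moves a vector
  away from that axis geometrically.

  The moment estimate is unchanged when matrices are inverted and words reversed, so it serves the
  fast line as well. It also forces \<open>Lminus p B < Lplus p B\<close>, hence persistence of the
  gap does not rest on continuity of the exponents.\<close>

definition cr :: "real^2 \<Rightarrow> real^2 \<Rightarrow> real" where
  "cr u v = u$1 * v$2 - u$2 * v$1"

lemma vec2_eq_iff: "(u::real^2) = v \<longleftrightarrow> u$1 = v$1 \<and> u$2 = v$2"
  by (simp add: vec_eq_iff forall_2)

lemma matvec2: "((M::real^2^2) *v v)$i = M$i$1 * v$1 + M$i$2 * v$2"
  by (simp add: matrix_vector_mult_def sum_2)

lemma norm2: "norm (v::real^2) = sqrt ((v$1)\<^sup>2 + (v$2)\<^sup>2)"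
  by (simp add: norm_vec_def L2_set_def sum_2)

lemma inner2: "(u::real^2) \<bullet> v = u$1 * v$1 + u$2 * v$2"
  by (simp add: inner_vec_def sum_2)

lemma cr_simps [simp]:
  "cr u u = 0" "cr (c *\<^sub>R u) v = c * cr u v" "cr u (c *\<^sub>R v) = c * cr u v"
  "cr (-u) v = - cr u v" "cr u (-v) = - cr u v" "cr 0 v = 0" "cr u 0 = 0"
  by (simp_all add: cr_def algebra_simps)

lemma cr_add: "cr (u + w) v = cr u v + cr w v" "cr u (v + w) = cr u v + cr u w"
  by (simp_all add: cr_def algebra_simps)

lemma cr_commute: "cr u v = - cr v u"
  by (simp add: cr_def)

lemma cr_abs_commute: "\<bar>cr u v\<bar> = \<bar>cr v u\<bar>"
  by (subst cr_commute) simp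

lemma cr_matvec: "cr (M *v u) (M *v v) = det M * cr u v"
  by (simp add: cr_def matvec2 det_2 algebra_simps)

text \<open>As \<open>u \<bullet> v\<close> carries the cosine of the angle,
  \<open>\<bar>cr u v\<bar>\<close> carries the sine: for unit vectors it is the projective
  distance. All distances between lines are estimated in this polynomial form.\<close>

lemma cr_lagrange: "(cr u v)\<^sup>2 + (u \<bullet> v)\<^sup>2 = (norm u)\<^sup>2 * (norm v)\<^sup>2"
  by (simp add: cr_def inner2 norm2 real_sqrt_pow2 power2_eq_square algebra_simps)

lemma cr_le_norm: "\<bar>cr u v\<bar> \<le> norm u * norm v"
proof -
  have "(cr u v)\<^sup>2 \<le> (norm u * norm v)\<^sup>2"
    using cr_lagrange[of u v] zero_le_power2[of "u \<bullet> v"] unfolding power_mult_distrib by linarith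
  thus ?thesis by (metis abs_le_square_iff abs_of_nonneg norm_ge_zero mult_nonneg_nonneg)
qed

text \<open>Three vectors of the plane are dependent, with their cross products as coefficients
  (Cramer's rule). It is the source of the triangle inequality for lines, of coordinates in a basis
  and of \<open>cr_mnorm_le\<close>.\<close>

lemma cr_identity: "cr u w *\<^sub>R v = cr v w *\<^sub>R u + cr u v *\<^sub>R w"
  by (simp add: vec2_eq_iff cr_def algebra_simps)

lemma cr_triangle:
  assumes "norm v = 1"
  shows "\<bar>cr u w\<bar> \<le> \<bar>cr v w\<bar> * norm u + \<bar>cr u v\<bar> * norm w"
proof -
  have "\<bar>cr u w\<bar> = norm (cr u w *\<^sub>R v)" using assms by simp
  also have "\<dots> \<le> norm (cr v w *\<^sub>R u) + norm (cr u v *\<^sub>R w)"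
    unfolding cr_identity[of u w v] by (rule norm_triangle_ineq)
  finally show ?thesis by simp
qed

section \<open>Operator norm, determinant and inverse of a planar matrix\<close>

lemma mnorm_bound: "norm (M *v v) \<le> mnorm M * norm v"
  unfolding mnorm_def by (rule onorm) (rule matrix_vector_mul_bounded_linear)

lemma mnorm_le: "(\<And>v. norm (M *v v) \<le> c * norm v) \<Longrightarrow> mnorm M \<le> c"
  unfolding mnorm_def by (rule onorm_le)

lemma mnorm_nonneg: "0 \<le> mnorm M"
  unfolding mnorm_def by (rule onorm_pos_le) (rule matrix_vector_mul_bounded_linear)

lemma mnorm_zero [simp]: "mnorm 0 = 0"
  by (simp add: mnorm_def onorm_zero)

lemma mnorm_one [simp]: "mnorm (mat 1) = 1"
proof (rule antisym)
  show "mnorm (mat 1) \<le> 1" by (rule mnorm_le) simp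
  show "1 \<le> mnorm (mat 1)" using mnorm_bound[of "mat 1" "axis 1 1"] by simp
qed

lemma mnorm_mult: "mnorm (M ** N) \<le> mnorm M * mnorm N"
proof (rule mnorm_le)
  fix v
  have "norm ((M ** N) *v v) = norm (M *v (N *v v))" by (simp add: matrix_vector_mul_assoc)
  also have "\<dots> \<le> mnorm M * norm (N *v v)" by (rule mnorm_bound)
  also have "\<dots> \<le> mnorm M * (mnorm N * norm v)"
    by (intro mult_left_mono mnorm_bound mnorm_nonneg)
  finally show "norm ((M ** N) *v v) \<le> mnorm M * mnorm N * norm v" by (simp add: mult.assoc)
qed

lemma mnorm_triangle: "mnorm (M + N) \<le> mnorm M + mnorm N"
proof (rule mnorm_le)
  fix v
  have "norm ((M + N) *v v) \<le> norm (M *v v) + norm (N *v v)"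
    by (simp add: matrix_vector_mult_add_rdistrib norm_triangle_ineq)
  also have "\<dots> \<le> mnorm M * norm v + mnorm N * norm v" by (intro add_mono mnorm_bound)
  finally show "norm ((M + N) *v v) \<le> (mnorm M + mnorm N) * norm v" by (simp add: algebra_simps)
qed

lemma matvec_uminus: "(- (M::real^2^2)) *v v = - (M *v v)"
  by (simp add: vec2_eq_iff matvec2)

lemma mnorm_uminus: "mnorm (- M) = mnorm M"
  by (simp add: mnorm_def matvec_uminus onorm_neg)

lemma mnorm_minus_commute: "mnorm (M - N) = mnorm (N - M)"
  using mnorm_uminus[of "M - N"] by simp

lemma mnorm_triangle_diff: "mnorm M \<le> mnorm N + mnorm (M - N)"
  using mnorm_triangle[of N "M - N"] by simp

lemma mnorm_diff_abs: "\<bar>mnorm M - mnorm N\<bar> \<le> mnorm (M - N)"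
  using mnorm_triangle_diff[of M N] mnorm_triangle_diff[of N M] by (simp add: mnorm_minus_commute)

lemma entry_le_mnorm: "\<bar>M$i$j\<bar> \<le> mnorm M"
proof -
  have "\<bar>(M *v axis j 1)$i\<bar> \<le> norm (M *v axis j 1)" by (rule component_le_norm_cart)
  also have "\<dots> \<le> mnorm M" using mnorm_bound[of M "axis j 1"] by simp
  finally show ?thesis by (simp add: matrix_vector_mul_component inner_axis)
qed

lemma mnorm_le_norm: "mnorm M \<le> norm M"
proof (rule mnorm_le)
  fix v
  have "norm (M *v v) = sqrt (\<Sum>i\<in>UNIV. (M $ i \<bullet> v)\<^sup>2)"
    by (simp add: norm_vec_def L2_set_def matrix_vector_mul_component)
  also have "\<dots> \<le> sqrt (\<Sum>i\<in>UNIV. (norm (M $ i) * norm v)\<^sup>2)"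
    by (intro real_sqrt_le_mono sum_mono) (metis Cauchy_Schwarz_ineq2 abs_ge_zero power2_abs power_mono)
  also have "\<dots> = norm M * norm v"
    by (simp add: norm_vec_def[of M] L2_set_def power_mult_distrib sum_distrib_right[symmetric] real_sqrt_mult)
  finally show "norm (M *v v) \<le> norm M * norm v" .
qed

lemma norm_le_mnorm: "norm M \<le> 4 * mnorm (M::real^2^2)"
proof -
  have "norm M \<le> (\<Sum>i\<in>UNIV. norm (M$i))" by (rule norm_le_componentwise_cart[THEN order_trans, of M "\<chi> i. M$i"]) (auto simp: norm_le_l1_cart L2_set_le_sum norm_vec_def)
  also have "\<dots> \<le> (\<Sum>i\<in>(UNIV::2 set). \<Sum>j\<in>(UNIV::2 set). \<bar>M$i$j\<bar>)" by (intro sum_mono norm_le_l1_cart)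
  also have "\<dots> \<le> (\<Sum>i\<in>(UNIV::2 set). \<Sum>j\<in>(UNIV::2 set). mnorm M)" by (intro sum_mono entry_le_mnorm)
  finally show ?thesis by simp
qed

definition perp :: "real^2 \<Rightarrow> real^2" where "perp v = vector [- v$2, v$1]"

lemma perp_simps [simp]: "perp v $ 1 = - v$2" "perp v $ 2 = v$1" "norm (perp v) = norm v"
  by (simp_all add: perp_def norm2 add.commute)

lemma cr_perp: "cr v (perp v) = (norm v)\<^sup>2"
  by (simp add: cr_def norm2 power2_eq_square)

text \<open>Compare areas: the square on \<open>v\<close> and \<open>perp v\<close> goes to a
  parallelogram of area \<open>\<bar>det M\<bar> * (norm v)\<^sup>2\<close>, at most the product of
  its sides. So no unit vector is stretched by less than \<open>\<bar>det M\<bar> / mnorm M\<close>,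
  a value attained by \<open>contracted_exists\<close>.\<close>

lemma det_le_norm_mnorm: "\<bar>det M\<bar> * norm v \<le> norm (M *v v) * mnorm M"
proof (cases "v = 0")
  case False
  have "\<bar>det M\<bar> * (norm v)\<^sup>2 = \<bar>cr (M *v v) (M *v perp v)\<bar>"
    by (simp add: cr_matvec cr_perp abs_mult)
  also have "\<dots> \<le> norm (M *v v) * norm (M *v perp v)" by (rule cr_le_norm)
  also have "\<dots> \<le> norm (M *v v) * (mnorm M * norm v)"
    using mnorm_bound[of M "perp v"] by (intro mult_left_mono) auto
  finally have "(\<bar>det M\<bar> * norm v) * norm v \<le> (norm (M *v v) * mnorm M) * norm v"
    by (simp add: power2_eq_square mult_ac)
  thus ?thesis using False by simp
qed simp

lemma det_le_mnorm_sq: "\<bar>det M\<bar> \<le> (mnorm M)\<^sup>2"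
proof -
  have "\<bar>det M\<bar> \<le> norm (M *v axis 1 1) * mnorm M"
    using det_le_norm_mnorm[of M "axis 1 1"] by simp
  also have "\<dots> \<le> mnorm M * mnorm M"
    using mnorm_bound[of M "axis 1 1"] by (intro mult_right_mono mnorm_nonneg) auto
  finally show ?thesis by (simp add: power2_eq_square)
qed

lemma mnorm_pos: "invertible M \<Longrightarrow> 0 < mnorm M"
  using det_le_mnorm_sq[of M] mnorm_nonneg[of M] invertible_det_nz[of M]
  by (metis abs_le_zero_iff less_eq_real_def zero_power2)

lemma matvec_pos: "invertible (M::real^2^2) \<Longrightarrow> v \<noteq> 0 \<Longrightarrow> 0 < norm (M *v v)"
proof -
  assume M: "invertible M" and v: "v \<noteq> 0"
  have "0 < \<bar>det M\<bar> * norm v" using M v by (simp add: invertible_det_nz)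
  also have "\<dots> \<le> norm (M *v v) * mnorm M" by (rule det_le_norm_mnorm)
  finally show ?thesis using mnorm_nonneg[of M] by (auto simp: zero_less_mult_iff)
qed

text \<open>In a basis of unit vectors u, w a unit vector has coordinates of size at most 1 / |cr u
  w|, so M cannot contract two well separated directions far below its norm. Conversely, two
  directions that are both contracted by M are close; all comparisons of contracted directions rest
  on this.\<close>

lemma cr_mnorm_le: "\<bar>cr u w\<bar> * mnorm M \<le> norm u * norm (M *v w) + norm w * norm (M *v u)"
proof (cases "cr u w = 0")
  case True thus ?thesis by simp
next
  case False
  have "mnorm M \<le> (norm u * norm (M *v w) + norm w * norm (M *v u)) / \<bar>cr u w\<bar>"
  proof (rule mnorm_le)
    fix v
    have "\<bar>cr u w\<bar> * norm (M *v v) = norm (M *v (cr u w *\<^sub>R v))" by (simp add: matrix_vector_mult_scaleR)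
    also have "\<dots> = norm (cr v w *\<^sub>R (M *v u) + cr u v *\<^sub>R (M *v w))"
      by (simp add: cr_identity[of u w v] matrix_vector_right_distrib matrix_vector_mult_scaleR)
    also have "\<dots> \<le> \<bar>cr v w\<bar> * norm (M *v u) + \<bar>cr u v\<bar> * norm (M *v w)"
      by (metis norm_scaleR norm_triangle_ineq)
    also have "\<dots> \<le> (norm v * norm w) * norm (M *v u) + (norm u * norm v) * norm (M *v w)"
      by (intro add_mono mult_right_mono cr_le_norm) auto
    finally show "norm (M *v v) \<le> (norm u * norm (M *v w) + norm w * norm (M *v u)) / \<bar>cr u w\<bar> * norm v"
      using False by (simp add: field_simps)
  qed
  thus ?thesis using False by (simp add: field_simps)
qed

lemma matrix_inv_eqI:
  assumes "M ** N = mat 1" "N ** M = mat 1" shows "matrix_inv M = N"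
proof -
  have *: "M ** matrix_inv M = mat 1 \<and> matrix_inv M ** M = mat 1"
    unfolding matrix_inv_def by (rule someI[of _ N]) (use assms in auto)
  have "matrix_inv M = matrix_inv M ** (M ** N)" using assms by (simp add: matrix_mul_rid)
  also have "\<dots> = N" using * by (simp add: matrix_mul_assoc matrix_mul_lid)
  finally show ?thesis .
qed

lemma matrix_inv_cancel:
  assumes "invertible (M::real^2^2)"
  shows "M ** matrix_inv M = mat 1" "matrix_inv M ** M = mat 1" "invertible (matrix_inv M)"
    "matrix_inv (matrix_inv M) = M" "M *v (matrix_inv M *v v) = v" "matrix_inv M *v (M *v v) = v"
    "det (matrix_inv M) = inverse (det M)"
proof -
  have "M ** matrix_inv M = mat 1 \<and> matrix_inv M ** M = mat 1"
    using assms unfolding matrix_inv_def invertible_def by (rule someI_ex)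
  thus 1: "M ** matrix_inv M = mat 1" "matrix_inv M ** M = mat 1" by auto
  thus 3: "invertible (matrix_inv M)" unfolding invertible_def by blast
  show "matrix_inv (matrix_inv M) = M"
    by (rule matrix_inv_eqI) (auto simp: 1)
  show "M *v (matrix_inv M *v v) = v" "matrix_inv M *v (M *v v) = v"
    by (simp_all add: matrix_vector_mul_assoc 1)
  have "det M * det (matrix_inv M) = 1" by (metis 1(1) det_mul det_I)
  thus "det (matrix_inv M) = inverse (det M)" by (metis inverse_unique)
qed

text \<open>The larger singular value of the inverse is the reciprocal of the smaller one of M. One
  inequality comes from \<open>det_le_norm_mnorm\<close>, the other from applying it to the
  inverse.\<close>

lemma mnorm_matrix_inv:
  assumes "invertible M" shows "mnorm (matrix_inv M) = mnorm M / \<bar>det M\<bar>"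
proof -
  have *: "mnorm (matrix_inv M) \<le> mnorm M / \<bar>det M\<bar>" if "invertible M" for M
  proof (rule mnorm_le)
    fix v
    have "\<bar>det M\<bar> * norm (matrix_inv M *v v) \<le> norm v * mnorm M"
      using det_le_norm_mnorm[of M "matrix_inv M *v v"] matrix_inv_cancel(5)[OF that] by simp
    thus "norm (matrix_inv M *v v) \<le> mnorm M / \<bar>det M\<bar> * norm v"
      using that by (simp add: field_simps invertible_det_nz)
  qed
  have d: "det M \<noteq> 0" using assms by (simp add: invertible_det_nz)
  have "mnorm M \<le> mnorm (matrix_inv M) * \<bar>det M\<bar>"
    using *[OF matrix_inv_cancel(3)[OF assms]] matrix_inv_cancel(4,7)[OF assms] by (simp add: abs_inverse divide_inverse)
  thus ?thesis using *[OF assms] d by (intro antisym) (auto simp: field_simps)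
qed

lemma mnorm_attained: "\<exists>u. norm u = 1 \<and> norm (M *v u) = mnorm M"
proof -
  have "\<exists>u\<in>sphere 0 1. \<forall>v\<in>sphere (0::real^2) 1. norm (M *v v) \<le> norm (M *v u)"
  proof (rule continuous_attains_sup)
    show "sphere (0::real^2) 1 \<noteq> {}" by (metis mem_sphere_0 norm_axis_1 empty_iff)
    show "continuous_on (sphere 0 1) (\<lambda>v. norm (M *v v))"
      by (intro continuous_intros)
  qed auto
  then obtain u where u: "norm u = 1" "\<And>v. norm v = 1 \<Longrightarrow> norm (M *v v) \<le> norm (M *v u)" by auto
  have "mnorm M \<le> norm (M *v u)"
  proof (rule mnorm_le)
    fix v show "norm (M *v v) \<le> norm (M *v u) * norm v"
    proof (cases "v = 0")
      case False
      have "norm (M *v ((1/norm v) *\<^sub>R v)) \<le> norm (M *v u)" using False by (intro u) simp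
      thus ?thesis using False by (simp add: matrix_vector_mult_scaleR field_simps)
    qed simp
  qed
  thus ?thesis using u(1) mnorm_bound[of M u] by (intro exI[of _ u]) auto
qed

text \<open>The witness is the normalised image, under the inverse, of a unit vector that the
  inverse stretches most.\<close>

lemma contracted_exists:
  assumes "invertible M" shows "\<exists>u. norm u = 1 \<and> norm (M *v u) = \<bar>det M\<bar> / mnorm M"
proof -
  obtain w where w: "norm w = 1" "norm (matrix_inv M *v w) = mnorm M / \<bar>det M\<bar>"
    using mnorm_attained mnorm_matrix_inv[OF assms] by metis
  let ?c = "mnorm M / \<bar>det M\<bar>"
  have c: "?c > 0" using mnorm_pos[OF assms] assms by (simp add: invertible_det_nz)
  show ?thesis
  proof (intro exI conjI)
    show "norm ((1 / ?c) *\<^sub>R (matrix_inv M *v w)) = 1"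
      using w c mnorm_pos[OF assms] assms by (simp add: invertible_det_nz)
    show "norm (M *v ((1 / ?c) *\<^sub>R (matrix_inv M *v w))) = \<bar>det M\<bar> / mnorm M"
      using w c mnorm_pos[OF assms] by (simp add: matrix_vector_mult_scaleR matrix_inv_cancel(5)[OF assms])
  qed
qed

section \<open>The ratio of the smaller to the larger singular value; the projective metric in terms
  of \<open>cr\<close>\<close>

definition rat :: "real^2^2 \<Rightarrow> real" where "rat M = \<bar>det M\<bar> / (mnorm M)\<^sup>2"

lemma rat_nonneg: "0 \<le> rat M" by (simp add: rat_def)

lemma rat_pos: "invertible M \<Longrightarrow> 0 < rat M"
  using mnorm_pos[of M] by (simp add: rat_def invertible_det_nz)

lemma rat_le_1: "rat M \<le> 1"
  using det_le_mnorm_sq[of M] by (cases "mnorm M = 0") (simp_all add: rat_def divide_le_eq)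

lemma rat_matrix_inv: "invertible M \<Longrightarrow> rat (matrix_inv M) = rat M"
  using mnorm_pos[of M] by (simp add: rat_def mnorm_matrix_inv matrix_inv_cancel(7) power2_eq_square invertible_det_nz field_simps)

lemma span_eq_iff_cr:
  assumes "u \<noteq> 0" shows "v \<in> span {u} \<longleftrightarrow> cr u v = 0"
proof
  assume "v \<in> span {u}" thus "cr u v = 0" by (auto simp: span_singleton)
next
  assume c: "cr u v = 0"
  have "(norm u)\<^sup>2 *\<^sub>R v = cr u (perp u) *\<^sub>R v" by (simp add: cr_perp)
  also have "\<dots> = cr v (perp u) *\<^sub>R u" using cr_identity[of u "perp u" v] c by simp
  finally have "v = (cr v (perp u) / (norm u)\<^sup>2) *\<^sub>R u" using assms
    by (metis (no_types, lifting) divide_inverse_commute norm_eq_zero power_eq_0_iff scaleR_scaleR real_vector.scale_left_imp_eq divideR_right)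
  thus "v \<in> span {u}" by (metis rangeI span_singleton)
qed

text \<open>\<open>SOME\<close> selects unknown nonzero representatives of the two lines. They are
  multiples of u and v, and the scalars cancel in the quotient; the sine of the arccosine becomes
  \<open>cr\<close> through \<open>cr_lagrange\<close>.\<close>

lemma proj_dist_span:
  assumes "u \<noteq> 0" "v \<noteq> 0"
  shows "proj_dist (span {u}) (span {v}) = \<bar>cr u v\<bar> / (norm u * norm v)"
proof -
  have ex: "\<exists>c. c \<noteq> 0 \<and> (SOME w. w \<in> span {u} \<and> w \<noteq> 0) = c *\<^sub>R u" if "u \<noteq> 0" for u :: "real^2"
  proof -
    have "(SOME w. w \<in> span {u} \<and> w \<noteq> 0) \<in> span {u} \<and> (SOME w. w \<in> span {u} \<and> w \<noteq> 0) \<noteq> 0"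
      by (rule someI[of _ u]) (use that in \<open>auto intro: span_base\<close>)
    thus ?thesis by (auto simp: span_singleton)
  qed
  obtain a b where a: "a \<noteq> 0" "(SOME w. w \<in> span {u} \<and> w \<noteq> 0) = a *\<^sub>R u"
    and b: "b \<noteq> 0" "(SOME w. w \<in> span {v} \<and> w \<noteq> 0) = b *\<^sub>R v"
    using ex[OF assms(1)] ex[OF assms(2)] by auto
  let ?u = "a *\<^sub>R u" and ?v = "b *\<^sub>R v"
  define t where "t = (?u \<bullet> ?v) / (norm ?u * norm ?v)"
  have pos: "norm ?u * norm ?v > 0" using a b assms by simp
  have t: "\<bar>t\<bar> \<le> 1" using Cauchy_Schwarz_ineq2[of ?u ?v] pos unfolding t_def by (simp add: abs_div)
  have "(norm ?u)\<^sup>2 * (norm ?v)\<^sup>2 \<noteq> 0" using pos by auto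
  hence "1 - t\<^sup>2 = (cr ?u ?v / (norm ?u * norm ?v))\<^sup>2"
    unfolding t_def power_divide power_mult_distrib[of "norm ?u"] cr_lagrange[of ?u ?v, symmetric]
    by (metis add_diff_cancel_right' diff_divide_distrib divide_self)
  moreover have "sin (arccos t) = sqrt (1 - t\<^sup>2)" using t by (intro sin_arccos) auto
  ultimately have "sin (arccos t) = \<bar>cr ?u ?v / (norm ?u * norm ?v)\<bar>"
    by (simp only: real_sqrt_abs)
  hence "proj_dist (span {u}) (span {v}) = \<bar>cr ?u ?v / (norm ?u * norm ?v)\<bar>"
    by (simp only: proj_dist_def vec_angle_def a b t_def[symmetric] abs_abs)
  also have "\<dots> = \<bar>cr u v\<bar> / (norm u * norm v)"
    using a b by (simp add: abs_mult)
  finally show ?thesis .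
qed

section \<open>Words and the Bernoulli measure\<close>

text \<open>Expectation over n independent letters as a finite sum, so that decompositions of words
  into blocks are plain algebra without integrability conditions. \<open>integral_word\<close>
  identifies it with an integral over \<open>bern p\<close>.\<close>

primrec EW :: "'a::finite pmf \<Rightarrow> nat \<Rightarrow> ('a list \<Rightarrow> real) \<Rightarrow> real" where
  "EW p 0 F = F []"
| "EW p (Suc n) F = (\<Sum>j\<in>UNIV. pmf p j * EW p n (\<lambda>w. F (j # w)))"

lemma EW_mono: "(\<And>w. length w = n \<Longrightarrow> F w \<le> G w) \<Longrightarrow> EW p n F \<le> EW p n G"
  by (induction n arbitrary: F G) (auto intro!: sum_mono mult_left_mono)

lemma EW_cong: "(\<And>w. length w = n \<Longrightarrow> F w = G w) \<Longrightarrow> EW p n F = EW p n G"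
  by (intro antisym EW_mono) auto

lemma sum_pmf_UNIV: "(\<Sum>j\<in>UNIV. pmf p j) = (1::real)" for p :: "'a::finite pmf"
  by (rule sum_pmf_eq_1) auto

lemma EW_const [simp]: "EW p n (\<lambda>w. c) = c"
  by (induction n) (auto simp: sum_distrib_right[symmetric] sum_pmf_UNIV)

lemma EW_add: "EW p n (\<lambda>w. F w + G w) = EW p n F + EW p n G"
  by (induction n arbitrary: F G) (auto simp: sum.distrib algebra_simps)

lemma EW_cmult: "EW p n (\<lambda>w. c * F w) = c * EW p n F"
  by (induction n arbitrary: F) (auto simp: sum_distrib_left mult_ac)

lemma EW_uminus: "EW p n (\<lambda>w. - F w) = - EW p n F"
  using EW_cmult[of p n "-1" F] by simp

lemma EW_diff: "EW p n (\<lambda>w. F w - G w) = EW p n F - EW p n G"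
  using EW_add[of p n F "\<lambda>w. - G w"] by (simp add: EW_uminus)

lemma EW_sum: "finite J \<Longrightarrow> EW p n (\<lambda>w. \<Sum>j\<in>J. F j w) = (\<Sum>j\<in>J. EW p n (F j))"
  by (induction J rule: finite_induct) (auto simp: EW_add)

lemma EW_nonneg: "(\<And>w. length w = n \<Longrightarrow> 0 \<le> F w) \<Longrightarrow> 0 \<le> EW p n F"
  using EW_mono[of n "\<lambda>_. 0" F p] by simp

lemma EW_append: "EW p (n + m) F = EW p n (\<lambda>u. EW p m (\<lambda>v. F (u @ v)))"
  by (induction n arbitrary: F) auto

lemma EW_snoc: "EW p (Suc n) F = EW p n (\<lambda>u. \<Sum>j\<in>UNIV. pmf p j * F (u @ [j]))"
  using EW_append[of p n 1 F] by simp

text \<open>Independent, identically distributed letters may be read backwards. This transfers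
  estimates for A to the inverse cocycle along the past.\<close>

lemma EW_rev: "EW p n (\<lambda>w. F (rev w)) = EW p n F"
proof (induction n arbitrary: F)
  case (Suc n)
  have "EW p (Suc n) (\<lambda>w. F (rev w)) = (\<Sum>j\<in>UNIV. pmf p j * EW p n (\<lambda>w. F (w @ [j])))"
    using Suc.IH[of "\<lambda>w. F (w @ [_])"] by simp
  also have "\<dots> = EW p (Suc n) F"
    by (simp only: EW_snoc EW_sum[OF finite] EW_cmult)
  finally show ?case .
qed simp

text \<open>A single word of length n has probability at least \<pi>^n, so a smaller value at that
  word lowers the average by that share of the gain. It is used in \<open>steps_inside\<close>,
  where only one escaping word is available.\<close>

lemma EW_le_special:
  assumes "\<And>w. length w = n \<Longrightarrow> F w \<le> c" "F w0 \<le> c'" "length w0 = n" "c' \<le> c"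
    and "\<And>j. \<pi> \<le> pmf p j" "0 \<le> \<pi>"
  shows "EW p n F \<le> c - \<pi> ^ n * (c - c')"
  using assms(1-3)
proof (induction n arbitrary: F w0)
  case (Suc n)
  then obtain j0 w1 where w0: "w0 = j0 # w1" "length w1 = n" by (cases w0) auto
  have 1: "EW p n (\<lambda>w. F (j # w)) \<le> c" for j
    using EW_mono[of n "\<lambda>w. F (j # w)" "\<lambda>_. c" p] Suc.prems by auto
  have 2: "EW p n (\<lambda>w. F (j0 # w)) \<le> c - \<pi> ^ n * (c - c')"
    using Suc.prems w0 by (intro Suc.IH[of _ w1]) auto
  have "EW p (Suc n) F = pmf p j0 * EW p n (\<lambda>w. F (j0 # w)) + (\<Sum>j\<in>UNIV-{j0}. pmf p j * EW p n (\<lambda>w. F (j # w)))"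
    by (simp add: sum.remove[of UNIV j0])
  also have "\<dots> \<le> pmf p j0 * (c - \<pi> ^ n * (c - c')) + (\<Sum>j\<in>UNIV-{j0}. pmf p j * c)"
    by (intro add_mono sum_mono mult_left_mono 1 2) auto
  also have "\<dots> = (\<Sum>j\<in>UNIV. pmf p j) * c - pmf p j0 * (\<pi> ^ n * (c - c'))"
    by (simp add: sum.remove[of UNIV j0] sum_distrib_right sum_distrib_left algebra_simps)
  also have "\<dots> \<le> c - \<pi> * (\<pi> ^ n * (c - c'))"
    using assms by (simp add: sum_pmf_UNIV mult_right_mono)
  finally show ?case by (simp add: mult_ac)
qed auto

section \<open>The Bernoulli measure, its symmetries and its disintegration over one letter\<close>

lemma prob_space_bern: "prob_space (bern p)"
  unfolding bern_def by (intro prob_space_PiM prob_space_measure_pmf)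

lemma space_bern [simp]: "space (bern p) = UNIV"
  by (auto simp: bern_def space_PiM)

lemma measure_bern_UNIV [simp]: "measure (bern p) UNIV = 1"
  using prob_space.prob_space[OF prob_space_bern[of p]] by simp

lemma sets_bern: "sets (bern p) = sets (\<Pi>\<^sub>M i\<in>(UNIV::int set). count_space UNIV)"
  unfolding bern_def by (intro sets_PiM_cong) auto

lemma measurable_coord: "(\<lambda>x. x i) \<in> measurable (bern p) (count_space UNIV)"
proof -
  have "(\<lambda>x. x i) \<in> measurable (\<Pi>\<^sub>M i\<in>(UNIV::int set). count_space UNIV) (count_space UNIV)"
    by (rule measurable_component_singleton) auto
  thus ?thesis using measurable_cong_sets[OF sets_bern refl] by blast
qed

lemma measurable_bern_reindex: "(\<lambda>x i. x (f i)) \<in> measurable (bern p) (bern p)"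
proof -
  have "(\<lambda>x i. x (f i)) \<in> measurable (bern p) (\<Pi>\<^sub>M i\<in>(UNIV::int set). count_space UNIV)"
    by (rule measurable_PiM_single') (auto intro: measurable_coord)
  thus ?thesis using measurable_cong_sets[OF refl sets_bern] by blast
qed

text \<open>Shifts in both directions and time reversal are all injective reindexings, so this
  covers every symmetry of the measure in use.\<close>

lemma distr_bern_reindex:
  assumes "inj f" shows "distr (bern p) (bern p) (\<lambda>x i. x (f i)) = bern p"
  using distr_PiM_reindex[of UNIV "\<lambda>_. measure_pmf p" f "UNIV::int set"] assms
  by (simp add: bern_def prob_space_measure_pmf restrict_def)

lemma integral_bern_reindex:
  fixes g :: "(int \<Rightarrow> 'a) \<Rightarrow> real"
  assumes "inj f" "g \<in> borel_measurable (bern p)"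
  shows "(\<integral>x. g (\<lambda>i. x (f i)) \<partial>bern p) = (\<integral>x. g x \<partial>bern p)"
  using integral_distr[OF measurable_bern_reindex[of f p], of g] assms distr_bern_reindex[OF assms(1), of p] by simp

lemma AE_bern_reindex:
  assumes "inj f" "AE x in bern p. P x" shows "AE x in bern p. P (\<lambda>i. x (f i))"
  using AE_distrD[OF measurable_bern_reindex[of f p], of P] assms(2)
  unfolding distr_bern_reindex[OF assms(1)] by blast

text \<open>The letter j is placed at time 0 and everything else moves one place to the right; the
  old letter at time -1 is lost. On the times from 0 on, \<open>shift\<close> undoes it.\<close>

definition bcons :: "'a \<Rightarrow> (int \<Rightarrow> 'a) \<Rightarrow> (int \<Rightarrow> 'a)" where
  "bcons j x = (\<lambda>i. if i = 0 then j else x (i - 1))"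

lemma measurable_bcons: "bcons j \<in> measurable (bern p) (bern p)"
proof -
  have "bcons j \<in> measurable (bern p) (\<Pi>\<^sub>M i\<in>(UNIV::int set). count_space UNIV)"
  proof (rule measurable_PiM_single')
    fix i :: int show "(\<lambda>x. bcons j x i) \<in> measurable (bern p) (count_space UNIV)"
      by (cases "i = 0") (auto simp: bcons_def intro: measurable_coord)
  qed auto
  thus ?thesis using measurable_cong_sets[OF refl sets_bern] by blast
qed

text \<open>The letter at time 0 is resampled independently of the others; a translation by one
  place, which preserves the measure, then replaces \<open>x(0 := j)\<close> by
  \<open>bcons j x\<close>. Inductions on words over the bi-infinite space proceed through this
  formula.\<close>

lemma integral_bcons:
  fixes g :: "(int \<Rightarrow> 'a::finite) \<Rightarrow> real"
  assumes [measurable]: "g \<in> borel_measurable (bern p)" and b: "\<And>x. \<bar>g x\<bar> \<le> C"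
  shows "(\<integral>x. g x \<partial>bern p) = (\<Sum>j\<in>UNIV. pmf p j * (\<integral>x. g (bcons j x) \<partial>bern p))"
proof -
  interpret B: prob_space "bern p" by (rule prob_space_bern)
  interpret P: pair_prob_space "measure_pmf p" "bern p" ..
  let ?f = "\<lambda>(j::'a, X). X((0::int) := j)"
  have d: "distr (measure_pmf p \<Otimes>\<^sub>M bern p) (bern p) ?f = bern p"
    using distr_pair_PiM_eq_PiM[of "UNIV::int set" "\<lambda>_. measure_pmf p" 0]
    by (simp add: bern_def prob_space_measure_pmf)
  have m: "?f \<in> measurable (measure_pmf p \<Otimes>\<^sub>M bern p) (bern p)"
  proof -
    have "?f \<in> measurable (measure_pmf p \<Otimes>\<^sub>M bern p) (\<Pi>\<^sub>M i\<in>(UNIV::int set). count_space UNIV)"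
    proof (rule measurable_PiM_single')
      fix i :: int
      have "(\<lambda>z. if i = 0 then fst z else snd z i) \<in> measurable (measure_pmf p \<Otimes>\<^sub>M bern p) (count_space UNIV)"
      proof (cases "i = 0")
        case True
        have "(\<lambda>z. fst z) \<in> measurable (measure_pmf p \<Otimes>\<^sub>M bern p) (count_space UNIV)"
          by (rule measurable_compose[OF measurable_fst]) simp
        thus ?thesis using True by simp
      qed (auto intro!: measurable_compose[OF measurable_snd measurable_coord])
      thus "(\<lambda>z. ?f z i) \<in> measurable (measure_pmf p \<Otimes>\<^sub>M bern p) (count_space UNIV)"
        by (simp add: split_beta' fun_upd_def)
    qed auto
    thus ?thesis using measurable_cong_sets[OF refl sets_bern] by blast
  qed
  have "(\<integral>x. g x \<partial>bern p) = (\<integral>z. g (?f z) \<partial>(measure_pmf p \<Otimes>\<^sub>M bern p))"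
    using integral_distr[OF m, of g] d by simp
  also have "\<dots> = (\<integral>j. (\<integral>x. g (x(0 := j)) \<partial>bern p) \<partial>measure_pmf p)"
  proof -
    have "integrable (measure_pmf p \<Otimes>\<^sub>M bern p) (\<lambda>z. g (?f z))"
      using m b by (intro P.P.integrable_const_bound[of _ C]) auto
    from P.integral_fst'[OF this] show ?thesis by simp
  qed
  also have "\<dots> = (\<Sum>j\<in>UNIV. pmf p j * (\<integral>x. g (x(0 := j)) \<partial>bern p))"
    by (subst integral_measure_pmf[of UNIV]) auto
  also have "(\<lambda>j. \<integral>x. g (x(0 := j)) \<partial>bern p) = (\<lambda>j. \<integral>x. g (bcons j x) \<partial>bern p)"
  proof
    fix j
    have "(\<lambda>x. x(0::int := j)) \<in> measurable (bern p) (\<Pi>\<^sub>M i\<in>(UNIV::int set). count_space UNIV)"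
    proof (rule measurable_PiM_single')
      fix i :: int show "(\<lambda>x. (x(0 := j)) i) \<in> measurable (bern p) (count_space UNIV)"
        by (cases "i = 0") (auto intro: measurable_coord)
    qed auto
    hence "(\<lambda>x. x(0::int := j)) \<in> measurable (bern p) (bern p)"
      using measurable_cong_sets[OF refl sets_bern] by blast
    hence "(\<integral>x. g ((\<lambda>i. x (i - 1))(0 := j)) \<partial>bern p) = (\<integral>x. g (x(0 := j)) \<partial>bern p)"
      by (intro integral_bern_reindex[of "\<lambda>i. i - 1" "\<lambda>x. g (x(0:=j))" p]) (auto simp: inj_def)
    thus "(\<integral>x. g (x(0 := j)) \<partial>bern p) = (\<integral>x. g (bcons j x) \<partial>bern p)"
      by (simp add: bcons_def fun_upd_def)
  qed
  finally show ?thesis .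
qed

section \<open>Initial words of a sequence, and integrals of functions of them\<close>

definition word :: "nat \<Rightarrow> (int \<Rightarrow> 'a) \<Rightarrow> 'a list" where
  "word n x = map (\<lambda>i. x (int i)) [0..<n]"

lemma length_word [simp]: "length (word n x) = n" by (simp add: word_def)

lemma word_0 [simp]: "word 0 x = []" by (simp add: word_def)

lemma word_Suc: "word (Suc n) x = word n x @ [x (int n)]" by (simp add: word_def)

lemma word_bcons: "word (Suc n) (bcons j x) = j # word n x"
  by (rule nth_equalityI) (auto simp: word_def nth_Cons' bcons_def of_nat_diff simp del: upt_Suc)

lemma word_add: "word (n + m) x = word n x @ word m (\<lambda>i. x (i + int n))"
  by (induction m) (auto simp: word_Suc add.commute)

lemma measurable_word: "word n \<in> measurable (bern p) (count_space (UNIV :: 'a::finite list set))"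
proof (induction n)
  case (Suc n)
  have "(\<lambda>x. (\<lambda>j x. word n x @ [j]) (x (int n)) x) \<in> measurable (bern p) (count_space (UNIV :: 'a list set))"
    by (rule measurable_compose_countable[OF measurable_compose[OF Suc] measurable_coord]) auto
  thus ?case by (simp add: word_Suc[abs_def])
qed simp

lemma measurable_word_fun: "(\<lambda>x. F (word n x)) \<in> measurable (bern p) N" if "range F \<subseteq> space N" for F :: "'a::finite list \<Rightarrow> 'b"
  by (rule measurable_compose[OF measurable_word]) (use that in auto)

lemma borel_measurable_word: "(\<lambda>x. F (word n x)) \<in> borel_measurable (bern p)"
  for F :: "'a::finite list \<Rightarrow> 'b::topological_space"
  by (rule measurable_word_fun) auto

lemma word_fun_bounded: "\<exists>C. \<forall>x. \<bar>F (word n x)\<bar> \<le> C" for F :: "'a::finite list \<Rightarrow> real"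
proof -
  have "finite {w :: 'a list. length w = n}" using finite_lists_length_eq[of "UNIV::'a set" n] by simp
  hence f: "finite ((\<lambda>w. \<bar>F w\<bar>) ` {w. length w = n})" by simp
  show ?thesis by (intro exI[of _ "Max ((\<lambda>w. \<bar>F w\<bar>) ` {w. length w = n})"] allI Max_ge f) auto
qed

lemma integral_word: "(\<integral>x. F (word n x) \<partial>bern p) = EW p n F"
proof (induction n arbitrary: F)
  case 0
  interpret prob_space "bern p" by (rule prob_space_bern)
  show ?case using prob_space by simp
next
  case (Suc n)
  obtain C where "\<And>x. \<bar>F (word (Suc n) x)\<bar> \<le> C" using word_fun_bounded by metis
  hence "(\<integral>x. F (word (Suc n) x) \<partial>bern p) = (\<Sum>j\<in>UNIV. pmf p j * (\<integral>x. F (word (Suc n) (bcons j x)) \<partial>bern p))"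
    by (intro integral_bcons borel_measurable_word) auto
  thus ?case using Suc.IH[of "\<lambda>w. F (_ # w)"] by (simp add: word_bcons)
qed

lemma integrable_bounded_bern:
  "g \<in> borel_measurable (bern p) \<Longrightarrow> (\<And>x. norm (g x) \<le> C) \<Longrightarrow> integrable (bern p) (g :: _ \<Rightarrow> real)"
proof -
  interpret prob_space "bern p" by (rule prob_space_bern)
  show "g \<in> borel_measurable (bern p) \<Longrightarrow> (\<And>x. norm (g x) \<le> C) \<Longrightarrow> integrable (bern p) g"
    by (rule integrable_const_bound[of _ C]) auto
qed

lemma integrable_word: "integrable (bern p) (\<lambda>x. F (word n x))" for F :: "'a::finite list \<Rightarrow> real"
  using word_fun_bounded[of F n] by (auto intro!: integrable_bounded_bern borel_measurable_word)

text \<open>A Borel-Cantelli argument: the expectations are summable, so the random series has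
  finite expectation and converges almost surely.\<close>

lemma AE_word_tendsto_0:
  assumes nn: "\<And>w. 0 \<le> F w" and le: "\<And>n. EW p n F \<le> C * \<kappa> ^ n" and k: "0 \<le> \<kappa>" "\<kappa> < 1"
  shows "AE x in bern p. (\<lambda>n. F (word n x)) \<longlonglongrightarrow> 0"
proof -
  have m[measurable]: "(\<lambda>x. ennreal (F (word n x))) \<in> borel_measurable (bern p)" for n
    by (intro measurable_compose[OF borel_measurable_word measurable_ennreal])
  have "(\<integral>\<^sup>+x. (\<Sum>n. ennreal (F (word n x))) \<partial>bern p) = (\<Sum>n. \<integral>\<^sup>+x. ennreal (F (word n x)) \<partial>bern p)"
    by (intro nn_integral_suminf m)
  also have "\<dots> = (\<Sum>n. ennreal (EW p n F))"
    by (subst nn_integral_eq_integral) (auto intro: integrable_word simp: nn integral_word)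
  also have "\<dots> \<le> (\<Sum>n. ennreal (C * \<kappa> ^ n))"
    by (intro suminf_le ennreal_leI le) auto
  also have "\<dots> < \<infinity>"
  proof -
    have C: "0 \<le> C" using le[of 0] nn[of "[]"] by simp
    have "summable (\<lambda>n. C * \<kappa> ^ n)" using k by (intro summable_mult summable_geometric) auto
    thus ?thesis using C k by (subst suminf_ennreal2) auto
  qed
  finally have "AE x in bern p. (\<Sum>n. ennreal (F (word n x))) \<noteq> \<infinity>"
    by (intro nn_integral_PInf_AE) auto
  thus ?thesis
  proof eventually_elim
    case (elim x)
    have "summable (\<lambda>n. F (word n x))"
      using elim nn by (intro summable_suminf_not_top) auto
    thus ?case by (rule summable_LIMSEQ_zero)
  qed
qed

lemma bounded_convergence_bern:
  fixes f :: "nat \<Rightarrow> (int \<Rightarrow> 'a) \<Rightarrow> real"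
  assumes [measurable]: "\<And>n. f n \<in> borel_measurable (bern p)" "g \<in> borel_measurable (bern p)"
    and b: "\<And>n x. \<bar>f n x\<bar> \<le> C" and l: "AE x in bern p. (\<lambda>n. f n x) \<longlonglongrightarrow> g x"
  shows "(\<lambda>n. \<integral>x. f n x \<partial>bern p) \<longlonglongrightarrow> (\<integral>x. g x \<partial>bern p)"
proof -
  interpret prob_space "bern p" by (rule prob_space_bern)
  show ?thesis by (rule integral_dominated_convergence[where w="\<lambda>_. C"]) (use l b in auto)
qed

section \<open>Lyapunov exponents\<close>

lemma exp_le_quadratic:
  fixes y :: real assumes "\<bar>y\<bar> \<le> 1" shows "exp y \<le> 1 + y + y\<^sup>2"
proof (cases "0 \<le> y")
  case True thus ?thesis using assms by (intro exp_bound) auto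
next
  case False
  define z where "z = - y"
  have z: "0 < z" "z \<le> 1" using False assms by (auto simp: z_def)
  \<comment> \<open>The product equals 1 + z^3.\<close>
  have "1 \<le> (1 + z) * (1 - z + z\<^sup>2)" using z by (simp add: algebra_simps power2_eq_square)
  also have "\<dots> \<le> exp z * (1 - z + z\<^sup>2)"
    using z by (intro mult_right_mono exp_ge_add_one_self) (auto simp: add_nonneg_nonneg)
  finally have "exp (- z) \<le> 1 - z + z\<^sup>2" by (simp add: exp_minus field_simps)
  thus ?thesis by (simp add: z_def)
qed

lemma list_fun_bounded: "\<exists>C>0. \<forall>w. length w = n \<longrightarrow> \<bar>F w\<bar> \<le> C" for F :: "'a::finite list \<Rightarrow> real"
proof -
  have "finite {w :: 'a list. length w = n}" using finite_lists_length_eq[of "UNIV::'a set" n] by simp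
  hence f: "finite (insert 0 ((\<lambda>w. \<bar>F w\<bar>) ` {w. length w = n}))" by simp
  let ?M = "Max (insert 0 ((\<lambda>w. \<bar>F w\<bar>) ` {w. length w = n}))"
  have "?M \<ge> 0" by (intro Max_ge f) auto
  moreover have "\<bar>F w\<bar> \<le> ?M" if "length w = n" for w by (intro Max_ge f) (use that in auto)
  ultimately show ?thesis by (intro exI[of _ "?M + 1"]) force
qed

text \<open>Second-order expansion: the mean contributes a linear gain t \<mu>, and for t up to
  \<open>t0\<close> the quadratic error t^2 C^2 is at most half of it.\<close>

lemma EW_exp_less_1:
  assumes "EW p n Z < 0"
  shows "\<exists>t0>0. \<forall>t. 0 < t \<and> t \<le> t0 \<longrightarrow> EW p n (\<lambda>w. exp (t * Z w)) < 1"
proof -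
  obtain C where C: "C > 0" "\<And>w. length w = n \<Longrightarrow> \<bar>Z w\<bar> \<le> C" using list_fun_bounded[of n Z] by blast
  define \<mu> where "\<mu> = - EW p n Z"
  have \<mu>: "\<mu> > 0" using assms by (simp add: \<mu>_def)
  define t0 where "t0 = min (1 / C) (\<mu> / (2 * C\<^sup>2))"
  have t0: "t0 > 0" using C \<mu> by (simp add: t0_def)
  moreover have "EW p n (\<lambda>w. exp (t * Z w)) < 1" if t: "0 < t" "t \<le> t0" for t
  proof -
    have tC: "t * C \<le> 1" "t * C\<^sup>2 \<le> \<mu> / 2"
      using t C by (auto simp: t0_def field_simps)
    have "EW p n (\<lambda>w. exp (t * Z w)) \<le> EW p n (\<lambda>w. 1 + t * Z w + t\<^sup>2 * C\<^sup>2)"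
    proof (rule EW_mono)
      fix w :: "'a list" assume "length w = n"
      hence z: "\<bar>Z w\<bar> \<le> C" by (rule C)
      have "\<bar>t * Z w\<bar> \<le> t * C" using z t by (simp add: abs_mult)
      hence "exp (t * Z w) \<le> 1 + t * Z w + (t * Z w)\<^sup>2" using tC by (intro exp_le_quadratic) auto
      also have "(t * Z w)\<^sup>2 \<le> (t * C)\<^sup>2" using \<open>\<bar>t * Z w\<bar> \<le> t * C\<close> by (metis abs_ge_zero power2_abs power_mono)
      finally show "exp (t * Z w) \<le> 1 + t * Z w + t\<^sup>2 * C\<^sup>2" by (simp add: power_mult_distrib)
    qed
    also have "\<dots> = 1 + t * (- \<mu>) + t * (t * C\<^sup>2)"
      by (simp add: EW_add EW_cmult \<mu>_def power2_eq_square mult_ac)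
    also have "\<dots> \<le> 1 + t * (-\<mu>) + t * (\<mu> / 2)" using t tC by (intro add_left_mono mult_left_mono) auto
    also have "\<dots> = 1 - t * \<mu> / 2" by simp
    also have "\<dots> < 1" using t \<mu> by simp
    finally show ?thesis .
  qed
  ultimately show ?thesis by blast
qed

lemma geometric_decay:
  fixes S :: "nat \<Rightarrow> real"
  assumes step: "\<And>n. S (m + n) \<le> \<kappa> * S n" and k: "\<kappa> < 1" and m: "m \<ge> 1" and nn: "\<And>n. 0 \<le> S n"
  shows "\<exists>C \<kappa>'. 0 < \<kappa>' \<and> \<kappa>' < 1 \<and> (\<forall>n. S n \<le> C * \<kappa>' ^ n)"
proof -
  \<comment> \<open>The maximum with 1/2 makes the rate positive, which the root and the division in
    \<open>C\<close> require.\<close>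
  define k0 where "k0 = max \<kappa> (1/2)"
  define k' where "k' = root m k0"
  have k0: "0 < k0" "k0 < 1" "\<kappa> \<le> k0" using k by (auto simp: k0_def)
  have k': "0 < k'" "k' < 1" "k' ^ m = k0" using k0 m by (auto simp: k'_def)
  define C where "C = (\<Sum>i<m. S i) / k0"
  have C: "C \<ge> 0" using nn k0 by (auto simp: C_def intro!: divide_nonneg_pos sum_nonneg)
  have "S n \<le> C * k' ^ n" for n
  proof (induction n rule: less_induct)
    case (less n)
    show ?case
    proof (cases "n < m")
      case True
      have "S n \<le> (\<Sum>i<m. S i)" using True nn by (intro member_le_sum) auto
      also have "\<dots> = C * k' ^ m" using k0 by (simp add: C_def k')
      also have "\<dots> \<le> C * k' ^ n" using True k' C by (intro mult_left_mono power_decreasing) auto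
      finally show ?thesis .
    next
      case False
      then obtain l where l: "n = m + l" using le_Suc_ex not_less by blast
      have "S n \<le> \<kappa> * S l" using step l by simp
      also have "\<dots> \<le> k0 * S l" using k0 nn by (intro mult_right_mono) auto
      also have "\<dots> \<le> k0 * (C * k' ^ l)" using k0 less.IH[of l] l m by (intro mult_left_mono) auto
      also have "\<dots> = C * k' ^ n" by (simp add: l power_add k')
      finally show ?thesis .
    qed
  qed
  thus ?thesis using k' by blast
qed

text \<open>An exponential Chebyshev bound: for small t the variable exp (t (F - c m)) has mean
  below 1 on blocks of length m. Subadditivity and independence of blocks make it submultiplicative
  in the mean, hence geometrically decaying.\<close>

lemma subadd_upper:
  fixes F :: "'a::finite list \<Rightarrow> real"
  assumes sub: "\<And>u v. F (u @ v) \<le> F u + F v" and m: "m \<ge> 1" and c: "EW p m F < c * real m"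
  shows "AE x in bern p. eventually (\<lambda>n. F (word n x) < c * real n) sequentially"
proof -
  have "EW p m (\<lambda>w. F w - c * real m) < 0" using c by (simp add: EW_diff)
  from EW_exp_less_1[OF this] obtain t where t: "t > 0" "EW p m (\<lambda>w. exp (t * (F w - c * real m))) < 1" by blast
  define H where "H w = exp (t * (F w - c * real (length w)))" for w
  have H: "H (u @ v) \<le> H u * H v" for u v
  proof -
    have "t * (F (u @ v) - c * real (length (u @ v))) \<le> t * (F u - c * real (length u)) + t * (F v - c * real (length v))"
      using sub[of u v] t by (simp add: algebra_simps)
        (metis add.commute distrib_left mult_le_cancel_left_pos)
    thus ?thesis by (simp add: H_def mult_exp_exp)
  qed
  have step: "EW p (m + n) H \<le> EW p m H * EW p n H" for n
  proof -
    have "EW p (m + n) H \<le> EW p m (\<lambda>u. EW p n (\<lambda>v. H u * H v))"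
      unfolding EW_append by (intro EW_mono H)
    also have "\<dots> = EW p m H * EW p n H" by (simp only: EW_cmult mult.commute[of _ "EW p n H"])
    finally show ?thesis .
  qed
  have "EW p m H = EW p m (\<lambda>w. exp (t * (F w - c * real m)))" by (rule EW_cong) (simp add: H_def)
  hence "EW p m H < 1" using t by simp
  then obtain C k where k: "0 < k" "k < 1" "\<And>n. EW p n H \<le> C * k ^ n"
    using geometric_decay[of "\<lambda>n. EW p n H" m "EW p m H", OF step] m by (force intro: EW_nonneg simp: H_def)
  have "AE x in bern p. (\<lambda>n. H (word n x)) \<longlonglongrightarrow> 0"
    by (rule AE_word_tendsto_0[of H p C k]) (use k in \<open>auto simp: H_def\<close>)
  thus ?thesis
  proof eventually_elim
    case (elim x)
    have "eventually (\<lambda>n. H (word n x) < 1) sequentially"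
      using order_tendstoD(2)[OF elim, of 1] by simp
    thus ?case by eventually_elim (use t in \<open>auto simp: H_def mult_less_0_iff\<close>)
  qed
qed

lemma word_Suc_shift: "word (Suc n) x = x 0 # word n (shift x)"
  by (rule nth_equalityI) (auto simp: word_def nth_Cons' shift_def of_nat_diff simp del: upt_Suc)

lemma sets_bern_Collect: "{x. P x} \<in> sets (bern p) \<longleftrightarrow> Measurable.pred (bern p) P"
  by (simp add: pred_def)

text \<open>After Katznelson and Weiss: \<open>D\<close> is the shift-invariant event that the lower growth rate is at most c. The
  orbit of a point of \<open>D\<close> is cut greedily into blocks of length at most K of rate almost c, except at the
  visits to \<open>B K\<close>, a set of small measure; integrating contradicts the mean growth rate unless \<open>D\<close> is null.\<close>
lemma subadd_lower:
  fixes F :: "'a::finite list \<Rightarrow> real" and p :: "'a pmf"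
  assumes sub: "\<And>u v. F (u @ v) \<le> F u + F v" and lip: "\<And>j w. \<bar>F (j # w) - F w\<bar> \<le> C" and F0: "F [] = 0"
    and g: "\<And>n. n \<ge> 1 \<Longrightarrow> g * real n \<le> EW p n F"
    and upper: "\<And>e. e > 0 \<Longrightarrow> AE x in bern p. eventually (\<lambda>n. F (word n x) < (g + e) * real n) sequentially"
    and c: "c < g"
  shows "AE x in bern p. eventually (\<lambda>n. F (word n x) > c * real n) sequentially"
proof -
  interpret prob_space "bern p" by (rule prob_space_bern)
  have C: "0 \<le> C" using lip[of undefined "[]"] by linarith
  have Fb: "\<bar>F w\<bar> \<le> C * real (length w)" for w
  proof (induction w)
    case (Cons j w) thus ?case using lip[of j w] by (simp add: algebra_simps)
  qed (simp add: F0)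
  define f where "f n x = F (word n x)" for n x
  have fm [measurable]: "f n \<in> borel_measurable (bern p)" for n
    unfolding f_def[abs_def] by (rule borel_measurable_word)
  have fb: "\<bar>f n x\<bar> \<le> C * real n" for n x using Fb[of "word n x"] by (simp add: f_def)
  \<comment> \<open>Lower growth rate at most c, spelled out with countably many quantifiers for the
    sake of measurability.\<close>
  define D where "D = {x. \<forall>k::nat. \<forall>N. \<exists>n\<ge>N. f n x \<le> (c + 1 / real (Suc k)) * real n}"
  have Dm [measurable]: "D \<in> sets (bern p)" unfolding D_def sets_bern_Collect by measurable
  have D_shift: "shift x \<in> D" if x: "x \<in> D" for x
    unfolding D_def
  proof (intro CollectI allI)
    fix k N
    \<comment> \<open>Dropping the first letter changes F by at most C. The difference of two
      consecutive slacks, multiplied by a large length, absorbs this, which gives shift invariance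
      of \<open>D\<close>.\<close>
    define d where "d = 1 / real (Suc k) - 1 / real (Suc (Suc k))"
    have d: "d > 0" by (simp add: d_def frac_less2)
    obtain M where M: "real M * d \<ge> C + \<bar>c\<bar> + 1" using d by (metis reals_Archimedean3 less_imp_le)
    obtain n where n: "n \<ge> Suc (max N M)" "f n x \<le> (c + 1 / real (Suc (Suc k))) * real n"
      using x unfolding D_def by blast
    obtain l where l: "n = Suc l" "l \<ge> N" "l \<ge> M" using n by (cases n) auto
    have "f l (shift x) \<le> f n x + C" using lip[of "x 0" "word l (shift x)"] by (simp add: f_def l word_Suc_shift)
    also have "\<dots> \<le> (c + 1 / real (Suc (Suc k))) * real (Suc l) + C" using n l by simp
    also have "\<dots> = (c + 1 / real (Suc k)) * real l - real l * d + c + 1 / real (Suc (Suc k)) + C"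
      unfolding d_def by (simp add: algebra_simps add_divide_distrib)
    also have "\<dots> \<le> (c + 1 / real (Suc k)) * real l - real M * d + c + 1 + C"
    proof -
      have "real M * d \<le> real l * d" using d l by (intro mult_right_mono) auto
      moreover have "1 / real (Suc (Suc k)) \<le> 1" by simp
      ultimately show ?thesis by linarith
    qed
    also have "\<dots> \<le> (c + 1 / real (Suc k)) * real l" using M by linarith
    finally show "\<exists>n\<ge>N. f n (shift x) \<le> (c + 1 / real (Suc k)) * real n" using l by blast
  qed
  have D_shiftn: "(\<lambda>i. x (i + int m)) \<in> D" if "x \<in> D" for x m
  proof (induction m)
    case (Suc m)
    show ?case using D_shift[OF Suc] by (simp add: shift_def add_ac)
  qed (use that in simp)
  have key: "(g - c) * prob D \<le> e" if e: "e > 0" for e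
  proof -
    obtain k where k: "1 / real (Suc k) < e / 4" using e nat_approx_posE[of "e/4"] by auto
    define a where "a = c + 1 / real (Suc k)"
    define B where "B K = {x. x \<in> D \<and> (\<forall>n\<in>{1..K}. f n x > a * real n)}" for K
    have Bm [measurable]: "B K \<in> sets (bern p)" for K unfolding B_def sets_bern_Collect by measurable
    \<comment> \<open>A point in every \<open>B K\<close> would have no initial block of rate at
      most \<open>a\<close>, against its membership in \<open>D\<close>; the intersection is empty
      and the measures tend to 0.\<close>
    have "(\<lambda>K. prob (B K)) \<longlonglongrightarrow> prob (\<Inter>K. B K)"
      by (intro finite_Lim_measure_decseq) (auto simp: decseq_def B_def)
    moreover have "(\<Inter>K. B K) = {}"
    proof -
      have False if x: "x \<in> (\<Inter>K. B K)" for x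
      proof -
        have "x \<in> D" using x by (auto simp: B_def)
        then obtain n where n: "n \<ge> 1" "f n x \<le> a * real n" unfolding D_def a_def by blast
        have "\<forall>m\<in>{1..n}. f m x > a * real m" using x unfolding B_def by blast
        hence "f n x > a * real n" by (rule bspec) (use n in simp)
        thus False using n by simp
      qed
      thus ?thesis by auto
    qed
    ultimately have lim: "(\<lambda>K. prob (B K)) \<longlonglongrightarrow> 0" by simp
    \<comment> \<open>One \<open>C'\<close> pays for the single letter read at a visit to
      \<open>B K\<close>, and \<open>K\<close> times that amount pays for the last block, of length
      at most \<open>K\<close>.\<close>
    define C' where "C' = C + \<bar>a\<bar> + 1"
    have C': "C' > 0" "C \<le> a + C'" using C by (auto simp: C'_def)
    have "eventually (\<lambda>K. prob (B K) < e / (4 * C')) sequentially"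
      using order_tendstoD(2)[OF lim, of "e / (4 * C')"] e C' by simp
    then obtain K where K: "prob (B K) < e / (4 * C')" by (auto simp: eventually_sequentially)
    have cover: "f n x \<le> a * real n + C' * (\<Sum>i<n. indicator (B K) (\<lambda>j. x (j + int i))) + C' * real K" if "x \<in> D" for n x
      using that
    proof (induction n arbitrary: x rule: less_induct)
      case (less n)
      show ?case
      proof (cases "n \<le> K")
        case True
        have "f n x - a * real n \<le> C' * real n" using fb[of n x] by (simp add: C'_def algebra_simps) (smt (verit) mult_minus_left mult_right_mono of_nat_0_le_iff)
        also have "\<dots> \<le> C' * real K" using True C' by (intro mult_left_mono) auto
        moreover have "0 \<le> C' * (\<Sum>i<n. indicator (B K) (\<lambda>j. x (j + int i)))"
          using C' by (intro mult_nonneg_nonneg sum_nonneg) auto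
        ultimately show ?thesis by linarith
      next
        case False
        have one: "\<exists>m\<in>{1..n}. f m x \<le> a * real m + C' * (\<Sum>i<m. indicator (B K) (\<lambda>j. x (j + int i)))"
        proof (cases "x \<in> B K")
          case True
          have "f 1 x \<le> a + C'" using fb[of 1 x] C' by auto
          thus ?thesis using True False by (intro bexI[of _ 1]) auto
        next
          case nB: False
          then obtain m where m: "m \<in> {1..K}" "f m x \<le> a * real m" using less.prems by (auto simp: B_def not_less)
          moreover have "0 \<le> C' * (\<Sum>i<m. indicator (B K) (\<lambda>j. x (j + int i)))"
            using C' by (intro mult_nonneg_nonneg sum_nonneg) auto
          ultimately show ?thesis using False by (intro bexI[of _ m]) auto
        qed
        then obtain m where m: "1 \<le> m" "m \<le> n"
          "f m x \<le> a * real m + C' * (\<Sum>i<m. indicator (B K) (\<lambda>j. x (j + int i)))" by auto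
        define l where "l = n - m"
        have n: "n = m + l" using m by (simp add: l_def)
        have "f n x \<le> f m x + f l (\<lambda>i. x (i + int m))"
          using sub by (simp add: f_def n word_add)
        also have "f l (\<lambda>i. x (i + int m)) \<le> a * real l + C' * (\<Sum>i<l. indicator (B K) (\<lambda>j. x (j + int i + int m))) + C' * real K"
          by (rule less.IH) (use n m less.prems D_shiftn in auto)
        finally have "f n x \<le> a * real n + C' * ((\<Sum>i<m. indicator (B K) (\<lambda>j. x (j + int i))) + (\<Sum>i<l. indicator (B K) (\<lambda>j. x (j + int i + int m)))) + C' * real K"
          using m(3) by (simp add: n algebra_simps)
        also have "(\<Sum>i<m. indicator (B K) (\<lambda>j. x (j + int i))) + (\<Sum>i<l. indicator (B K) (\<lambda>j. x (j + int i + int m))) = (\<Sum>i<n. indicator (B K) (\<lambda>j. x (j + int i)) :: real)"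
          unfolding n by (induction l) (auto simp: add_ac)
        finally show ?thesis .
      qed
    qed
    have dm [measurable]: "(\<lambda>x. indicator (B K) (\<lambda>j. x (j + int i)) :: real) \<in> borel_measurable (bern p)" for i
    proof -
      have "(indicator (B K) :: _ \<Rightarrow> real) \<in> borel_measurable (bern p)" by measurable
      from measurable_compose[OF measurable_bern_reindex[of "\<lambda>j. j + int i"] this] show ?thesis .
    qed
    \<comment> \<open>The cover is integrated on \<open>D\<close>; off \<open>D\<close> the function
      is bounded by g n plus a positive part. After division by n this leaves (g - a) prob D below
      C' prob (B K) and terms that vanish for large n.\<close>
    have est: "g * real n \<le> (a * real n) * prob D + C' * (real n * prob (B K)) + C' * real K + g * real n * (1 - prob D) + real n * (\<integral>x. max 0 (f n x / real n - g) \<partial>bern p)" if n: "n \<ge> 1" for n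
    proof -
      let ?r = "\<lambda>x. (a * real n) * indicator D x + (C' * (\<Sum>i<n. indicator (B K) (\<lambda>j. x (j + int i))) + C' * real K) + g * real n * (1 - indicator D x) + real n * max 0 (f n x / real n - g)"
      have i1: "integrable (bern p) (\<lambda>x. max 0 (f n x / real n - g))"
      proof (rule integrable_bounded_bern[of _ _ "C + \<bar>g\<bar>"])
        fix x
        have "f n x / real n \<le> C" using fb[of n x] n by (auto simp: field_simps)
        thus "norm (max 0 (f n x / real n - g)) \<le> C + \<bar>g\<bar>" using C by (auto simp: max_def)
      qed measurable
      have i2: "integrable (bern p) (indicator D :: _ \<Rightarrow> real)" by (intro integrable_bounded_bern[of _ _ 1]) auto
      have i3: "integrable (bern p) (\<lambda>x. indicator (B K) (\<lambda>j. x (j + int i)) :: real)" for i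
        by (rule integrable_bounded_bern[of _ _ 1, OF dm]) (simp add: indicator_def)
      have i3': "(\<integral>x. indicator (B K) (\<lambda>j. x (j + int i)) \<partial>bern p) = prob (B K)" for i
        using integral_bern_reindex[of "\<lambda>j. j + int i" "indicator (B K)" p] by (simp add: inj_def)
      have "g * real n \<le> EW p n F" using g n by blast
      also have "\<dots> = (\<integral>x. f n x \<partial>bern p)" by (simp add: f_def integral_word)
      also have "\<dots> \<le> (\<integral>x. ?r x \<partial>bern p)"
      proof (rule integral_mono)
        show "integrable (bern p) (f n)" by (rule integrable_bounded_bern[OF fm]) (use fb in auto)
        show "integrable (bern p) ?r" using i1 i2 i3 by auto
        fix x
        have nn: "0 \<le> C' * (\<Sum>i<n. indicator (B K) (\<lambda>j. x (j + int i))) + C' * real K"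
          using C' by (intro add_nonneg_nonneg mult_nonneg_nonneg sum_nonneg) auto
        have mx: "f n x / real n - g \<le> max 0 (f n x / real n - g)" by simp
        have q1: "f n x \<le> g * real n + real n * max 0 (f n x / real n - g)"
          using mult_left_mono[OF mx, of "real n"] n by (simp add: right_diff_distrib mult.commute)
        have q2: "0 \<le> real n * max 0 (f n x / real n - g)" by simp
        show "f n x \<le> ?r x"
        proof (cases "x \<in> D")
          case True
          have i: "indicator D x = (1::real)" using True by simp
          show ?thesis unfolding i mult_1_right diff_self mult_zero_right using cover[OF True, of n] q2 by linarith
        next
          case False
          have i: "indicator D x = (0::real)" using False by simp
          show ?thesis unfolding i mult_1_right diff_zero mult_zero_right using q1 nn by linarith
        qed
      qed
      also have "\<dots> = (a * real n) * prob D + (C' * (\<Sum>i<n. prob (B K)) + C' * real K) + g * real n * (1 - prob D) + real n * (\<integral>x. max 0 (f n x / real n - g) \<partial>bern p)"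
        using i1 i2 i3 i3' by (simp add: Bochner_Integration.integral_sum prob_space)
      finally show ?thesis by simp
    qed
    \<comment> \<open>The upper bound on the growth rate makes the positive part vanish almost
      surely, hence in the mean.\<close>
    have l0: "(\<lambda>n. \<integral>x. max 0 (f n x / real n - g) \<partial>bern p) \<longlonglongrightarrow> (\<integral>x. 0 \<partial>bern p)"
    proof (rule bounded_convergence_bern[where C="C + \<bar>g\<bar>"])
      fix n x show "\<bar>max 0 (f n x / real n - g)\<bar> \<le> C + \<bar>g\<bar>"
      proof (cases "n = 0")
        case False
        have "f n x / real n \<le> C" using fb[of n x] False by (auto simp: field_simps)
        thus ?thesis using C by (auto simp: max_def)
      qed (use C in \<open>auto simp: max_def\<close>)
    next
      have "AE x in bern p. \<forall>k. eventually (\<lambda>n. f n x < (g + 1 / real (Suc k)) * real n) sequentially"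
        unfolding AE_all_countable f_def by (intro allI upper) auto
      thus "AE x in bern p. (\<lambda>n. max 0 (f n x / real n - g)) \<longlonglongrightarrow> 0"
      proof eventually_elim
        case (elim x)
        show ?case
        proof (rule order_tendstoI)
          fix y :: real assume "y < 0" thus "eventually (\<lambda>n. y < max 0 (f n x / real n - g)) sequentially"
            by (intro always_eventually allI) (simp add: less_max_iff_disj)
        next
          fix y :: real assume y: "y > 0"
          obtain k where k: "1 / real (Suc k) < y" using y nat_approx_posE[of y] by auto
          have "eventually (\<lambda>n. f n x < (g + 1 / real (Suc k)) * real n) sequentially" using elim by blast
          thus "eventually (\<lambda>n. max 0 (f n x / real n - g) < y) sequentially"
            using eventually_gt_at_top[of 0]
          proof eventually_elim
            case (elim n)
            hence "f n x / real n < g + 1 / real (Suc k)" by (simp add: pos_divide_less_eq)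
            thus ?case using k y by linarith
          qed
        qed
      qed
    qed measurable
    have ev: "eventually (\<lambda>n. (\<integral>x. max 0 (f n x / real n - g) \<partial>bern p) < e / 4) sequentially"
      using order_tendstoD(2)[OF l0, of "e/4"] e by simp
    obtain n0 where n0: "real n0 * e \<ge> 4 * C' * real K" using e by (metis reals_Archimedean3 less_imp_le)
    have "\<exists>n. (\<integral>x. max 0 (f n x / real n - g) \<partial>bern p) < e / 4 \<and> n \<ge> 1 \<and> n \<ge> n0"
      by (rule eventually_happens'[OF sequentially_bot eventually_conj[OF ev eventually_conj[OF eventually_ge_at_top eventually_ge_at_top]]])
    then obtain n where n: "n \<ge> 1" "n \<ge> n0" "(\<integral>x. max 0 (f n x / real n - g) \<partial>bern p) < e / 4" by blast
    have "real n * ((g - a) * prob D) \<le> real n * (C' * prob (B K)) + C' * real K + real n * (\<integral>x. max 0 (f n x / real n - g) \<partial>bern p)"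
      using est[OF n(1)] by (simp add: algebra_simps)
    also have "\<dots> \<le> real n * (e / 4) + real n * (e / 4) + real n * (e / 4)"
    proof (intro add_mono mult_left_mono)
      show "C' * prob (B K) \<le> e / 4" using K C' by (simp add: field_simps)
      have "real n0 * e \<le> real n * e" using n e by (intro mult_right_mono) auto
      thus "C' * real K \<le> real n * (e / 4)" using n0 by simp
    qed (use n in auto)
    also have "\<dots> = real n * (3 * e / 4)" by simp
    finally have "(g - a) * prob D \<le> 3 * e / 4" using n by simp
    moreover have "(a - c) * prob D \<le> (e / 4) * 1" using k e by (intro mult_mono) (auto simp: a_def)
    ultimately show ?thesis by (simp add: algebra_simps)
  qed
  have "(g - c) * prob D \<le> 0" by (rule field_le_epsilon) (use key in auto)
  hence "prob D = 0" using c measure_nonneg[of "bern p" D] by (auto simp: mult_le_0_iff)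
  hence "AE x in bern p. x \<notin> D" by (simp add: prob_eq_0)
  thus ?thesis
  proof eventually_elim
    case (elim x)
    then obtain k N where "\<And>n. n \<ge> N \<Longrightarrow> \<not> f n x \<le> (c + 1 / real (Suc k)) * real n"
      unfolding D_def by blast
    hence k: "\<And>n. n \<ge> N \<Longrightarrow> f n x > (c + 1 / real (Suc k)) * real n" by (simp only: not_le)
    show ?case unfolding eventually_sequentially
    proof (intro exI allI impI)
      fix n assume "n \<ge> N"
      have "c * real n \<le> (c + 1 / real (Suc k)) * real n" by (intro mult_right_mono) auto
      thus "F (word n x) > c * real n" using k[OF \<open>n \<ge> N\<close>] by (simp add: f_def)
    qed
  qed
qed

text \<open>Kingman's theorem for functions of independent letters. The infimum runs over
  \<open>Suc n\<close> to avoid division by zero. The last two conclusions present the limit as an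
  infimum of finite averages, which is what semicontinuity and the passage to the inverse cocycle
  use.\<close>

theorem subadditive_ergodic:
  fixes F :: "'a::finite list \<Rightarrow> real" and p :: "'a pmf"
  assumes sub: "\<And>u v. F (u @ v) \<le> F u + F v" and lip: "\<And>j w. \<bar>F (j # w) - F w\<bar> \<le> C" and F0: "F [] = 0"
  shows "AE x in bern p. (\<lambda>n. F (word n x) / real n) \<longlonglongrightarrow> (INF n. EW p (Suc n) F / real (Suc n))"
    and "n \<ge> 1 \<Longrightarrow> (INF n. EW p (Suc n) F / real (Suc n)) * real n \<le> EW p n F"
    and "(INF n. EW p (Suc n) F / real (Suc n)) < c \<Longrightarrow> \<exists>n\<ge>1. EW p n F < c * real n"
proof -
  define g where "g = (INF n. EW p (Suc n) F / real (Suc n))"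
  have Fb: "\<bar>F w\<bar> \<le> C * real (length w)" for w
  proof (induction w)
    case (Cons j w) thus ?case using lip[of j w] by (simp add: algebra_simps)
  qed (simp add: F0)
  have "EW p (Suc n) F / real (Suc n) \<ge> - C" for n
  proof -
    have "EW p (Suc n) F \<ge> EW p (Suc n) (\<lambda>_. - C * real (Suc n))"
      by (rule EW_mono) (metis Fb abs_le_iff minus_le_iff mult_minus_left)
    thus ?thesis by (simp add: field_simps del: EW.simps)
  qed
  hence bdd: "bdd_below (range (\<lambda>n. EW p (Suc n) F / real (Suc n)))" by (intro bdd_belowI[of _ "-C"]) auto
  have g1: "g * real n \<le> EW p n F" if "n \<ge> 1" for n
  proof -
    have "g \<le> EW p (Suc (n - 1)) F / real (Suc (n - 1))" unfolding g_def by (rule cINF_lower[OF bdd]) auto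
    thus ?thesis using that by (simp add: field_simps del: EW.simps)
  qed
  thus "n \<ge> 1 \<Longrightarrow> (INF n. EW p (Suc n) F / real (Suc n)) * real n \<le> EW p n F" by (simp add: g_def)
  have g2: "\<exists>n\<ge>1. EW p n F < c * real n" if "g < c" for c
  proof -
    from that obtain n where "EW p (Suc n) F / real (Suc n) < c"
      unfolding g_def using cINF_less_iff[OF _ bdd, of c] by auto
    thus ?thesis by (intro exI[of _ "Suc n"]) (simp add: field_simps del: EW.simps)
  qed
  thus "(INF n. EW p (Suc n) F / real (Suc n)) < c \<Longrightarrow> \<exists>n\<ge>1. EW p n F < c * real n" by (simp add: g_def)
  have up: "AE x in bern p. eventually (\<lambda>n. F (word n x) < c * real n) sequentially" if "g < c" for c
    using g2[OF that] subadd_upper[of F _ p c, OF sub] by blast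
  have lo: "AE x in bern p. eventually (\<lambda>n. F (word n x) > c * real n) sequentially" if "c < g" for c
    by (rule subadd_lower[of F C g p, OF sub lip F0 g1 up that]) auto
  have "AE x in bern p. (\<forall>k. eventually (\<lambda>n. F (word n x) < (g + 1 / real (Suc k)) * real n) sequentially)
      \<and> (\<forall>k. eventually (\<lambda>n. F (word n x) > (g - 1 / real (Suc k)) * real n) sequentially)"
    unfolding AE_conj_iff AE_all_countable by (auto intro!: up lo)
  thus "AE x in bern p. (\<lambda>n. F (word n x) / real n) \<longlonglongrightarrow> (INF n. EW p (Suc n) F / real (Suc n))"
    unfolding g_def[symmetric]
  proof eventually_elim
    case (elim x)
    show ?case
    proof (rule tendstoI)
      fix e :: real assume "e > 0"
      then obtain k where k: "1 / real (Suc k) < e" using nat_approx_posE[of e] by auto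
      have "eventually (\<lambda>n. F (word n x) < (g + 1 / real (Suc k)) * real n) sequentially"
        "eventually (\<lambda>n. F (word n x) > (g - 1 / real (Suc k)) * real n) sequentially" using elim by blast+
      thus "eventually (\<lambda>n. dist (F (word n x) / real n) g < e) sequentially"
        using eventually_gt_at_top[of 0]
      proof eventually_elim
        case (elim n)
        hence "F (word n x) / real n < g + 1 / real (Suc k)" "F (word n x) / real n > g - 1 / real (Suc k)"
          by (simp_all add: pos_divide_less_eq pos_less_divide_eq)
        thus ?case using k by (simp add: dist_real_def abs_less_iff)
      qed
    qed
  qed
qed

section \<open>Matrix products along words and the Lyapunov exponents\<close>

primrec wprod :: "'a cocycle \<Rightarrow> 'a list \<Rightarrow> real^2^2" where
  "wprod A [] = mat 1"
| "wprod A (j # w) = wprod A w ** A j"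

text \<open>Letters stand in the order of time, whereas matrices of later times multiply on the
  left; hence the exchange of factors.\<close>

lemma wprod_append: "wprod A (u @ v) = wprod A v ** wprod A u"
  by (induction u) (auto simp: matrix_mul_assoc matrix_mul_rid)

lemma citer_wprod: "citer A n x = wprod A (word n x)"
  by (induction n) (auto simp: word_Suc wprod_append matrix_mul_lid)

lemma GLk_det: "A \<in> GLk \<longleftrightarrow> (\<forall>j. det (A j) \<noteq> 0)"
  by (simp add: GLk_def invertible_det_nz)

lemma GLkD: "A \<in> GLk \<Longrightarrow> invertible (A j)"
  by (simp add: GLk_def)

lemma invertible_wprod: "A \<in> GLk \<Longrightarrow> invertible (wprod A w)"
  by (induction w) (auto simp: invertible_det_nz det_mul det_I GLk_det)

lemma ln_det_wprod: "A \<in> GLk \<Longrightarrow> ln \<bar>det (wprod A w)\<bar> = sum_list (map (\<lambda>j. ln \<bar>det (A j)\<bar>) w)"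
proof (induction w)
  case (Cons j w)
  have "ln \<bar>det (wprod A (j # w))\<bar> = ln (\<bar>det (wprod A w)\<bar> * \<bar>det (A j)\<bar>)"
    by (simp add: det_mul abs_mult)
  also have "\<dots> = ln \<bar>det (wprod A w)\<bar> + ln \<bar>det (A j)\<bar>"
    using invertible_wprod[OF Cons.prems, of w] GLkD[OF Cons.prems, of j]
    by (intro ln_mult_pos) (auto simp: invertible_det_nz)
  finally show ?case using Cons by simp
qed (simp add: det_I)

lemma EW_sum_list: "EW p n (\<lambda>w. sum_list (map f w)) = real n * (\<Sum>j\<in>UNIV. pmf p j * f j)"
proof (induction n)
  case (Suc n)
  define c where "c = real n * (\<Sum>j\<in>UNIV. pmf p j * f j)"
  have "EW p (Suc n) (\<lambda>w. sum_list (map f w)) = (\<Sum>j\<in>UNIV. pmf p j * (f j + c))"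
    by (simp add: EW_add Suc c_def)
  also have "\<dots> = (\<Sum>j\<in>UNIV. pmf p j * f j) + (\<Sum>j\<in>UNIV. pmf p j) * c"
    by (simp add: distrib_left sum.distrib sum_distrib_right)
  finally show ?case by (simp add: sum_pmf_UNIV c_def algebra_simps)
qed simp

lemma AE_sum_list:
  "AE x in bern p. (\<lambda>n. sum_list (map f (word n x)) / real n) \<longlonglongrightarrow> (\<Sum>j\<in>UNIV. pmf p j * f j)"
  for p :: "'a::finite pmf" and f :: "'a \<Rightarrow> real"
proof -
  have "\<bar>f j\<bar> \<le> (\<Sum>j\<in>UNIV. \<bar>f j\<bar>)" for j by (rule member_le_sum) auto
  hence "AE x in bern p. (\<lambda>n. sum_list (map f (word n x)) / real n) \<longlonglongrightarrow>
      (INF n. EW p (Suc n) (\<lambda>w. sum_list (map f w)) / real (Suc n))"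
    by (intro subadditive_ergodic[where C="\<Sum>j\<in>UNIV. \<bar>f j\<bar>"]) auto
  thus ?thesis by (simp add: EW_sum_list del: EW.simps of_nat_Suc)
qed

definition ldet :: "'a::finite pmf \<Rightarrow> 'a cocycle \<Rightarrow> real" where
  "ldet p A = (\<Sum>j\<in>UNIV. pmf p j * ln \<bar>det (A j)\<bar>)"

definition lnorm :: "'a cocycle \<Rightarrow> 'a list \<Rightarrow> real" where
  "lnorm A w = ln (mnorm (wprod A w))"

text \<open>The hypotheses of \<open>subadditive_ergodic\<close>. The Lipschitz bound holds because
  right multiplication by \<open>A j\<close> or by its inverse changes the norm by a bounded
  factor.\<close>

lemma lnorm_props:
  fixes A :: "'a::finite cocycle"
  assumes A: "A \<in> GLk"
  shows "lnorm A (u @ v) \<le> lnorm A u + lnorm A v"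
    and "\<bar>lnorm A (j # w) - lnorm A w\<bar> \<le> (\<Sum>j\<in>UNIV. \<bar>ln (mnorm (A j))\<bar> + \<bar>ln (mnorm (matrix_inv (A j)))\<bar>)"
    and "lnorm A [] = 0"
proof -
  have pos: "mnorm (wprod A w) > 0" for w using mnorm_pos invertible_wprod[OF A] by blast
  have posj: "mnorm (A j) > 0" "mnorm (matrix_inv (A j)) > 0" for j
    using mnorm_pos GLkD[OF A] matrix_inv_cancel(3) by blast+
  show "lnorm A (u @ v) \<le> lnorm A u + lnorm A v"
  proof -
    have "ln (mnorm (wprod A (u @ v))) \<le> ln (mnorm (wprod A v) * mnorm (wprod A u))"
      by (rule ln_mono[OF _ pos]) (simp add: wprod_append mnorm_mult)
    thus ?thesis using pos by (simp add: lnorm_def ln_mult_pos)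
  qed
  show "lnorm A [] = 0" by (simp add: lnorm_def)
  have "ln (mnorm (wprod A (j # w))) \<le> ln (mnorm (wprod A w) * mnorm (A j))"
    by (rule ln_mono[OF _ pos]) (simp add: mnorm_mult)
  hence 1: "lnorm A (j # w) \<le> lnorm A w + ln (mnorm (A j))" using pos posj by (simp add: lnorm_def ln_mult_pos)
  have "wprod A w = wprod A (j # w) ** matrix_inv (A j)"
    using matrix_inv_cancel(1)[OF GLkD[OF A, of j]] by (simp add: matrix_mul_assoc[symmetric] matrix_mul_rid)
  hence "mnorm (wprod A w) \<le> mnorm (wprod A (j # w)) * mnorm (matrix_inv (A j))"
    by (metis mnorm_mult)
  hence "ln (mnorm (wprod A w)) \<le> ln (mnorm (wprod A (j # w)) * mnorm (matrix_inv (A j)))"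
    by (rule ln_mono[OF _ pos])
  hence 2: "lnorm A w \<le> lnorm A (j # w) + ln (mnorm (matrix_inv (A j)))"
    using pos[of "j # w"] posj[of j] unfolding lnorm_def by (subst (asm) ln_mult_pos) auto
  have "\<bar>ln (mnorm (A j))\<bar> + \<bar>ln (mnorm (matrix_inv (A j)))\<bar> \<le> (\<Sum>j\<in>UNIV. \<bar>ln (mnorm (A j))\<bar> + \<bar>ln (mnorm (matrix_inv (A j)))\<bar>)"
    by (rule member_le_sum) auto
  thus "\<bar>lnorm A (j # w) - lnorm A w\<bar> \<le> (\<Sum>j\<in>UNIV. \<bar>ln (mnorm (A j))\<bar> + \<bar>ln (mnorm (matrix_inv (A j)))\<bar>)"
    using 1 2 by linarith
qed

lemma AE_bern_const: "AE x in bern p. P \<Longrightarrow> P"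
proof -
  interpret prob_space "bern p" by (rule prob_space_bern)
  show "AE x in bern p. P \<Longrightarrow> P" by simp
qed

lemma THE_AE_limit:
  assumes "AE x in bern p. (\<lambda>n. f n x) \<longlonglongrightarrow> (c::real)"
  shows "(THE c. AE x in bern p. (\<lambda>n. f n x) \<longlonglongrightarrow> c) = c"
proof (rule the_equality)
  show "AE x in bern p. (\<lambda>n. f n x) \<longlonglongrightarrow> c" by fact
  fix d assume "AE x in bern p. (\<lambda>n. f n x) \<longlonglongrightarrow> d"
  with assms have "AE x in bern p. d = c"
    by eventually_elim (rule LIMSEQ_unique)
  thus "d = c" by (rule AE_bern_const)
qed

lemma Lplus_conv:
  fixes A :: "'a::finite cocycle"
  assumes A: "A \<in> GLk"
  shows "AE x in bern p. (\<lambda>n. ln (mnorm (citer A n x)) / real n) \<longlonglongrightarrow> Lplus p A"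
    and "n \<ge> 1 \<Longrightarrow> Lplus p A * real n \<le> EW p n (lnorm A)"
    and "Lplus p A < c \<Longrightarrow> \<exists>n\<ge>1. EW p n (lnorm A) < c * real n"
proof -
  let ?L = "INF n. EW p (Suc n) (lnorm A) / real (Suc n)"
  have *: "AE x in bern p. (\<lambda>n. ln (mnorm (citer A n x)) / real n) \<longlonglongrightarrow> ?L"
    using subadditive_ergodic(1)[OF lnorm_props[OF A], of p] by (simp add: lnorm_def citer_wprod)
  have L: "Lplus p A = ?L" unfolding Lplus_def by (rule THE_AE_limit[OF *])
  show "AE x in bern p. (\<lambda>n. ln (mnorm (citer A n x)) / real n) \<longlonglongrightarrow> Lplus p A" using * L by simp
  show "n \<ge> 1 \<Longrightarrow> Lplus p A * real n \<le> EW p n (lnorm A)"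
    unfolding L by (rule subadditive_ergodic(2)[OF lnorm_props[OF A]])
  show "Lplus p A < c \<Longrightarrow> \<exists>n\<ge>1. EW p n (lnorm A) < c * real n"
    unfolding L by (rule subadditive_ergodic(3)[OF lnorm_props[OF A]])
qed

lemma AE_ldet:
  fixes A :: "'a::finite cocycle"
  assumes A: "A \<in> GLk"
  shows "AE x in bern p. (\<lambda>n. ln \<bar>det (citer A n x)\<bar> / real n) \<longlonglongrightarrow> ldet p A"
  using AE_sum_list[of "\<lambda>j. ln \<bar>det (A j)\<bar>" p] by (simp add: citer_wprod ln_det_wprod[OF A] ldet_def)

lemma invertible_citer: "A \<in> GLk \<Longrightarrow> invertible (citer A n x)"
  by (simp add: citer_wprod invertible_wprod)

text \<open>The norm of the inverse is the norm divided by |det|, and ln |det| is additive along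
  words; so the lower exponent follows from the upper one and the law of large numbers for
  determinants.\<close>

lemma Lminus_eq:
  fixes A :: "'a::finite cocycle"
  assumes A: "A \<in> GLk"
  shows "Lminus p A = ldet p A - Lplus p A"
proof -
  have e: "ln (inverse (mnorm (matrix_inv (citer A n x)))) = ln \<bar>det (citer A n x)\<bar> - ln (mnorm (citer A n x))" for n x
    using invertible_citer[OF A, of n x] mnorm_pos[OF invertible_citer[OF A, of n x]]
    by (simp add: mnorm_matrix_inv ln_div invertible_det_nz)
  have "AE x in bern p. (\<lambda>n. ln (inverse (mnorm (matrix_inv (citer A n x)))) / real n) \<longlonglongrightarrow> ldet p A - Lplus p A"
    using AE_ldet[OF A, of p] Lplus_conv(1)[OF A, of p]
    by eventually_elim (simp add: e diff_divide_distrib tendsto_diff)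
  thus ?thesis unfolding Lminus_def by (rule THE_AE_limit)
qed

lemma Lplus_ge:
  fixes A :: "'a::finite cocycle"
  assumes A: "A \<in> GLk"
  shows "ldet p A \<le> 2 * Lplus p A" "Lminus p A \<le> Lplus p A"
proof -
  have "AE x in bern p. ldet p A \<le> 2 * Lplus p A"
    using AE_ldet[OF A, of p] Lplus_conv(1)[OF A, of p]
  proof eventually_elim
    case (elim x)
    show ?case
    proof (rule tendsto_le[OF sequentially_bot tendsto_mult_left[OF elim(2), of 2] elim(1)], intro always_eventually allI)
      fix n
      have "ln \<bar>det (citer A n x)\<bar> \<le> ln ((mnorm (citer A n x))\<^sup>2)"
        using invertible_citer[OF A, of n x] by (intro ln_mono det_le_mnorm_sq) (auto simp: invertible_det_nz)
      also have "\<dots> = 2 * ln (mnorm (citer A n x))"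
        using mnorm_pos[OF invertible_citer[OF A, of n x]] by (simp add: ln_realpow)
      finally show "ln \<bar>det (citer A n x)\<bar> / real n \<le> 2 * (ln (mnorm (citer A n x)) / real n)"
        by (simp add: divide_right_mono)
    qed
  qed
  thus 1: "ldet p A \<le> 2 * Lplus p A" by (rule AE_bern_const)
  thus "Lminus p A \<le> Lplus p A" by (simp add: Lminus_eq[OF A])
qed

section \<open>Perturbations of a cocycle\<close>

text \<open>The neighbourhood filter of A for \<open>cdist\<close>: with it, perturbation statements
  can be proved by calculus of limits and read back as \<epsilon>-\<delta> statements through
  \<open>eventually_nbh\<close>.\<close>

definition nbh :: "'a::finite cocycle \<Rightarrow> 'a cocycle filter" where
  "nbh A = (INF d\<in>{0<..}. principal {B. cdist A B < d})"

lemma cdist_ge: "mnorm (A j - B j) \<le> cdist A B"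
  unfolding cdist_def by (rule Max_ge) auto

lemma cdist_nonneg: "0 \<le> cdist A B"
  using cdist_ge[of A undefined B] mnorm_nonneg[of "A undefined - B undefined"] by linarith

lemma cdist_commute: "cdist A B = cdist B A"
  unfolding cdist_def by (simp add: mnorm_minus_commute)

lemma cdist_le: "(\<And>j. mnorm (A j - B j) \<le> c) \<Longrightarrow> cdist A B \<le> c"
  unfolding cdist_def by (subst Max_le_iff) auto

lemma cdist_triangle: "cdist A C \<le> cdist A B + cdist B C"
proof (rule cdist_le)
  fix j
  have "mnorm (A j - C j) \<le> mnorm (A j - B j) + mnorm (B j - C j)"
    using mnorm_triangle[of "A j - B j" "B j - C j"] by simp
  thus "mnorm (A j - C j) \<le> cdist A B + cdist B C" using cdist_ge[of A j B] cdist_ge[of B j C] by linarith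
qed

lemma eventually_nbh: "eventually P (nbh A) \<longleftrightarrow> (\<exists>d>0. \<forall>B. cdist A B < d \<longrightarrow> P B)"
  unfolding nbh_def
proof (subst eventually_INF_base)
  fix a b :: real assume "a \<in> {0<..}" "b \<in> {0<..}"
  thus "\<exists>x\<in>{0<..}. principal {B. cdist A B < x} \<le> inf (principal {B. cdist A B < a}) (principal {B. cdist A B < b})"
    by (intro bexI[of _ "min a b"]) auto
qed (auto simp: eventually_principal)

lemma tendsto_nbh: "((\<lambda>B. B j) \<longlongrightarrow> A j) (nbh A)"
proof (rule tendstoI)
  fix e :: real assume e: "e > 0"
  show "eventually (\<lambda>B. dist (B j) (A j) < e) (nbh A)"
    unfolding eventually_nbh
  proof (intro exI conjI allI impI)
    show "e / 4 > 0" using e by simp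
    fix B assume "cdist A B < e / 4"
    hence "mnorm (B j - A j) < e / 4" using cdist_ge[of A j B] by (simp add: mnorm_minus_commute)
    thus "dist (B j) (A j) < e" using norm_le_mnorm[of "B j - A j"] by (simp add: dist_norm)
  qed
qed

lemma tendsto_matrix_mult:
  fixes f g :: "'b \<Rightarrow> real^2^2"
  assumes "(f \<longlongrightarrow> M) F" "(g \<longlongrightarrow> N) F" shows "((\<lambda>x. f x ** g x) \<longlongrightarrow> M ** N) F"
  unfolding matrix_matrix_mult_def
  by (intro tendsto_vec_lambda tendsto_sum tendsto_mult tendsto_vec_nth assms)

lemma tendsto_matvec:
  fixes f :: "'b \<Rightarrow> real^2^2"
  assumes "(f \<longlongrightarrow> M) F" "(g \<longlongrightarrow> v) F" shows "((\<lambda>x. f x *v g x) \<longlongrightarrow> M *v v) F"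
  unfolding matrix_vector_mult_def
  by (intro tendsto_vec_lambda tendsto_sum tendsto_mult tendsto_vec_nth assms)

lemma tendsto_mnorm:
  fixes f :: "'b \<Rightarrow> real^2^2"
  assumes "(f \<longlongrightarrow> M) F" shows "((\<lambda>x. mnorm (f x)) \<longlongrightarrow> mnorm M) F"
proof (rule tendstoI)
  fix e :: real assume "e > 0"
  with assms have "eventually (\<lambda>x. dist (f x) M < e) F" by (rule tendstoD)
  thus "eventually (\<lambda>x. dist (mnorm (f x)) (mnorm M) < e) F"
  proof eventually_elim
    case (elim x)
    thus ?case using mnorm_diff_abs[of "f x" M] mnorm_le_norm[of "f x - M"] by (simp add: dist_norm dist_real_def)
  qed
qed

lemma tendsto_det:
  fixes f :: "'b \<Rightarrow> real^2^2"
  assumes "(f \<longlongrightarrow> M) F" shows "((\<lambda>x. det (f x)) \<longlongrightarrow> det M) F"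
  unfolding det_2 by (intro tendsto_intros assms)

lemma tendsto_cr:
  assumes "(f \<longlongrightarrow> u) F" "(g \<longlongrightarrow> v) F" shows "((\<lambda>x. cr (f x) (g x)) \<longlongrightarrow> cr u v) F"
  unfolding cr_def by (intro tendsto_intros assms)

lemma tendsto_wprod: "(\<And>j. ((\<lambda>x. f x j) \<longlongrightarrow> A j) F) \<Longrightarrow> ((\<lambda>x. wprod (f x) w) \<longlongrightarrow> wprod A w) F"
  by (induction w) (auto intro!: tendsto_matrix_mult)

lemma tendsto_EW: "(\<And>w. length w = n \<Longrightarrow> ((\<lambda>x. f x w) \<longlongrightarrow> G w) F) \<Longrightarrow> ((\<lambda>x. EW p n (f x)) \<longlongrightarrow> EW p n G) F"
  by (induction n arbitrary: f G) (auto intro!: tendsto_sum tendsto_mult)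

lemma tendsto_ldet:
  fixes A :: "'a::finite cocycle"
  assumes "A \<in> GLk" shows "(ldet p \<longlongrightarrow> ldet p A) (nbh A)"
  unfolding ldet_def[abs_def] using assms
  by (intro tendsto_intros tendsto_det tendsto_nbh) (auto simp: GLk_det)

text \<open>The exponent is an infimum over n of averages over words of length n, each of them
  continuous in the matrices; one n with an average below c is enough for all nearby B.\<close>

lemma Lplus_usc:
  fixes A :: "'a::finite cocycle"
  assumes A: "A \<in> GLk" and c: "Lplus p A < c"
  shows "eventually (\<lambda>B. B \<in> GLk \<longrightarrow> Lplus p B < c) (nbh A)"
proof -
  obtain n where n: "n \<ge> 1" "EW p n (lnorm A) < c * real n" using Lplus_conv(3)[OF A c] by blast
  have "((\<lambda>B. EW p n (lnorm B)) \<longlongrightarrow> EW p n (lnorm A)) (nbh A)"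
  proof (rule tendsto_EW)
    fix w :: "'a list"
    have "mnorm (wprod A w) > 0" by (intro mnorm_pos invertible_wprod A)
    thus "((\<lambda>B. lnorm B w) \<longlongrightarrow> lnorm A w) (nbh A)" unfolding lnorm_def
      by (intro tendsto_ln tendsto_mnorm tendsto_wprod tendsto_nbh) auto
  qed
  from order_tendstoD(2)[OF this n(2)] show ?thesis
  proof eventually_elim
    case (elim B)
    show ?case
    proof
      assume "B \<in> GLk"
      hence "Lplus p B * real n < c * real n" using Lplus_conv(2)[of B n p] n elim by linarith
      thus "Lplus p B < c" using n by simp
    qed
  qed
qed

text \<open>\<open>Lminus\<close> is the continuous function \<open>ldet\<close> minus
  \<open>Lplus\<close>.\<close>

lemma Lminus_lsc:
  fixes A :: "'a::finite cocycle"
  assumes A: "A \<in> GLk" and c: "c < Lminus p A"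
  shows "eventually (\<lambda>B. B \<in> GLk \<longrightarrow> c < Lminus p B) (nbh A)"
proof -
  define e where "e = (Lminus p A - c) / 2"
  have e: "e > 0" using c by (simp add: e_def)
  have 1: "eventually (\<lambda>B. B \<in> GLk \<longrightarrow> Lplus p B < Lplus p A + e) (nbh A)" using e by (intro Lplus_usc A) auto
  have 2: "eventually (\<lambda>B. ldet p A - e < ldet p B) (nbh A)" using e by (intro order_tendstoD(1)[OF tendsto_ldet[OF A]]) auto
  from 1 2 show ?thesis
    by eventually_elim (use Lminus_eq[OF A, of p] in \<open>auto simp: Lminus_eq e_def field_simps\<close>)
qed

lemma eventually_GLk:
  fixes A :: "'a::finite cocycle"
  assumes "A \<in> GLk" shows "eventually (\<lambda>B. B \<in> GLk) (nbh A)"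
proof -
  have "eventually (\<lambda>B. \<forall>j\<in>UNIV. det (B j) \<noteq> 0) (nbh A)"
    using assms by (intro eventually_ball_finite ballI tendsto_imp_eventually_ne[OF tendsto_det[OF tendsto_nbh]]) (auto simp: GLk_det)
  thus ?thesis by (simp add: GLk_det)
qed

section \<open>The contracted direction\<close>

text \<open>The sign condition picks representatives at an angle of at most ninety degrees, where 1
  - cos is bounded by the squared sine.\<close>

lemma norm_diff_le_cr:
  assumes "norm u = 1" "norm v = 1" "0 \<le> u \<bullet> v"
  shows "norm (u - v) \<le> 2 * \<bar>cr u v\<bar>"
proof -
  have l: "(cr u v)\<^sup>2 + (u \<bullet> v)\<^sup>2 = 1" using cr_lagrange[of u v] assms by simp
  have c1: "u \<bullet> v \<le> 1" using norm_cauchy_schwarz[of u v] assms by simp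
  have "(u \<bullet> v)\<^sup>2 \<le> u \<bullet> v" using c1 assms(3) by (simp add: power2_eq_square mult_left_le)
  hence "2 - 2 * (u \<bullet> v) \<le> 4 * (cr u v)\<^sup>2" using l c1 by simp
  moreover have "(norm (u - v))\<^sup>2 = 2 - 2 * (u \<bullet> v)"
    using assms(1,2) by (simp add: power2_norm_eq_inner[of "u - v"] inner_diff_left inner_diff_right inner_commute norm_eq_1)
  ultimately have "(norm (u - v))\<^sup>2 \<le> (2 * \<bar>cr u v\<bar>)\<^sup>2" by (simp add: power_mult_distrib)
  thus ?thesis by (rule power2_le_imp_le) simp
qed

text \<open>A direction contracted by the product N M is contracted by M too, up to the condition
  number of N, which is \<open>1 / rat N\<close>. Two directions contracted by M are close by
  \<open>cr_mnorm_le\<close>.\<close>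

lemma cr_contracted_step:
  assumes M: "invertible (M::real^2^2)" and N: "invertible (N::real^2^2)" and u: "norm u = 1" "norm (M *v u) = \<bar>det M\<bar> / mnorm M"
    and w: "norm w = 1" "norm ((N ** M) *v w) = \<bar>det (N ** M)\<bar> / mnorm (N ** M)"
  shows "\<bar>cr u w\<bar> \<le> (1 + 1 / rat N) * rat M"
proof -
  note Mp = mnorm_pos[OF M] and Np = mnorm_pos[OF N]
  have dN: "det N \<noteq> 0" using N by (simp add: invertible_det_nz)
  have inv: "invertible (N ** M)" using M N by (simp add: invertible_mult)
  have "M *v w = matrix_inv N *v ((N ** M) *v w)"
    by (simp add: matrix_inv_cancel(6)[OF N] flip: matrix_vector_mul_assoc)
  hence 1: "norm (M *v w) \<le> mnorm (matrix_inv N) * (\<bar>det (N ** M)\<bar> / mnorm (N ** M))"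
    using mnorm_bound[of "matrix_inv N" "(N ** M) *v w"] w by simp
  have "M = matrix_inv N ** (N ** M)" by (simp add: matrix_mul_assoc matrix_inv_cancel(2)[OF N] matrix_mul_lid)
  hence 2: "mnorm M \<le> mnorm (matrix_inv N) * mnorm (N ** M)" by (metis mnorm_mult)
  have ip: "mnorm (matrix_inv N) > 0" by (intro mnorm_pos matrix_inv_cancel(3) N)
  have "\<bar>det (N ** M)\<bar> / mnorm (N ** M) \<le> \<bar>det (N ** M)\<bar> * mnorm (matrix_inv N) / mnorm M"
  proof -
    have "1 / mnorm (N ** M) \<le> mnorm (matrix_inv N) / mnorm M"
      using 2 Mp mnorm_pos[OF inv] by (simp add: field_simps)
    from mult_left_mono[OF this, of "\<bar>det (N ** M)\<bar>"] show ?thesis by simp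
  qed
  hence "norm (M *v w) \<le> mnorm (matrix_inv N) * (\<bar>det (N ** M)\<bar> * mnorm (matrix_inv N) / mnorm M)"
    using 1 ip by (meson less_imp_le mult_left_mono order_trans)
  also have "\<dots> = (1 / rat N) * (\<bar>det M\<bar> / mnorm M)"
    using dN Np Mp by (simp add: mnorm_matrix_inv[OF N] rat_def det_mul abs_mult field_simps power2_eq_square)
  finally have "\<bar>cr u w\<bar> * mnorm M \<le> (1 / rat N) * (\<bar>det M\<bar> / mnorm M) + \<bar>det M\<bar> / mnorm M"
    using cr_mnorm_le[of u w M] u w by simp
  hence "\<bar>cr u w\<bar> \<le> ((1 / rat N) * (\<bar>det M\<bar> / mnorm M) + \<bar>det M\<bar> / mnorm M) / mnorm M"
    using Mp by (simp add: field_simps)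
  also have "\<dots> = (1 + 1 / rat N) * rat M"
    using Mp by (simp add: rat_def field_simps power2_eq_square)
  finally show ?thesis .
qed

definition contr :: "real^2^2 \<Rightarrow> real^2" where
  "contr M = (SOME u. norm u = 1 \<and> norm (M *v u) = \<bar>det M\<bar> / mnorm M)"

lemma contr: "invertible M \<Longrightarrow> norm (contr M) = 1 \<and> norm (M *v contr M) = \<bar>det M\<bar> / mnorm M"
  unfolding contr_def by (rule someI_ex[OF contracted_exists])

text \<open>Signs are fixed recursively so that consecutive vectors make an angle of at most ninety
  degrees; convergence of the lines then becomes convergence of unit vectors.\<close>

primrec cdir :: "'a cocycle \<Rightarrow> nat \<Rightarrow> (int \<Rightarrow> 'a) \<Rightarrow> real^2" where
  "cdir A 0 x = contr (mat 1)"
| "cdir A (Suc n) x = (let u = contr (citer A (Suc n) x) in if 0 \<le> u \<bullet> cdir A n x then u else - u)"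

lemma matvec_minus: "(M::real^2^2) *v (- v) = - (M *v v)"
  by (simp add: vec2_eq_iff matvec2)

lemma cdir:
  fixes A :: "'a::finite cocycle"
  assumes A: "A \<in> GLk"
  shows "norm (cdir A n x) = 1" "norm (citer A n x *v cdir A n x) = \<bar>det (citer A n x)\<bar> / mnorm (citer A n x)"
    "0 \<le> cdir A (Suc n) x \<bullet> cdir A n x"
proof -
  have i: "invertible (citer A n x)" for n by (rule invertible_citer[OF A])
  show "norm (cdir A n x) = 1"
    using contr[OF i[of n]] by (cases n) (auto simp: Let_def)
  show "norm (citer A n x *v cdir A n x) = \<bar>det (citer A n x)\<bar> / mnorm (citer A n x)"
    using contr[OF i[of n]] by (cases n) (auto simp: Let_def matvec_minus)
  show "0 \<le> cdir A (Suc n) x \<bullet> cdir A n x" by (auto simp: Let_def)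
qed

lemma cdir_measurable: "cdir A n \<in> borel_measurable (bern p)" for A :: "'a::finite cocycle"
proof (induction n)
  case (Suc n)
  note [measurable] = Suc
  have [measurable]: "(\<lambda>x. contr (citer A (Suc n) x)) \<in> borel_measurable (bern p)"
    unfolding citer_wprod by (rule borel_measurable_word)
  show ?case unfolding cdir.simps Let_def by measurable
qed simp

definition rmax :: "'a::finite cocycle \<Rightarrow> real" where
  "rmax A = 1 + (\<Sum>j\<in>UNIV. 1 / rat (A j))"

lemma rmax: "1 + 1 / rat (A j) \<le> rmax A" "1 \<le> rmax A"
  unfolding rmax_def by (auto intro!: member_le_sum sum_nonneg simp: rat_nonneg)

lemma cr_cdir_step:
  fixes A :: "'a::finite cocycle"
  assumes A: "A \<in> GLk"
  shows "\<bar>cr (cdir A n x) (cdir A (Suc n) x)\<bar> \<le> rmax A * rat (citer A n x)"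
proof -
  have "\<bar>cr (cdir A n x) (cdir A (Suc n) x)\<bar> \<le> (1 + 1 / rat (A (x (int n)))) * rat (citer A n x)"
    using cdir(1,2)[OF A, of n x] cdir(1,2)[OF A, of "Suc n" x] unfolding citer.simps(2)
    by (intro cr_contracted_step invertible_citer GLkD A)
  also have "\<dots> \<le> rmax A * rat (citer A n x)" by (intro mult_right_mono rmax rat_nonneg)
  finally show ?thesis .
qed

section \<open>Convergence of the contracted directions at typical points\<close>

lemma geometric_cauchy_limit:
  fixes u :: "nat \<Rightarrow> 'a::banach"
  assumes step: "\<And>n. n \<ge> N \<Longrightarrow> norm (u (Suc n) - u n) \<le> K * q ^ n" and q: "0 < q" "q < 1" and K: "0 \<le> K"
  shows "convergent u" "n \<ge> N \<Longrightarrow> norm (lim u - u n) \<le> K / (1 - q) * q ^ n"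
proof -
  have b: "norm (u (n + m) - u n) \<le> K / (1 - q) * q ^ n" if n: "n \<ge> N" for n m
  proof -
    have "norm (u (n + m) - u n) \<le> K * q ^ n * (\<Sum>i<m. q ^ i)"
    proof (induction m)
      case (Suc m)
      have "norm (u (n + Suc m) - u n) \<le> norm (u (Suc (n + m)) - u (n + m)) + norm (u (n + m) - u n)"
        using norm_triangle_ineq[of "u (Suc (n + m)) - u (n + m)" "u (n + m) - u n"] by simp
      also have "\<dots> \<le> K * q ^ (n + m) + K * q ^ n * (\<Sum>i<m. q ^ i)" using Suc step[of "n + m"] n by auto
      finally show ?case by (simp add: algebra_simps power_add)
    qed simp
    also have "\<dots> = K * q ^ n * ((1 - q ^ m) / (1 - q))" using q by (simp add: sum_gp_strict)
    also have "\<dots> \<le> K * q ^ n * (1 / (1 - q))" using q K by (intro mult_left_mono divide_right_mono) auto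
    finally show ?thesis by simp
  qed
  have l0: "(\<lambda>n. K / (1 - q) * q ^ n) \<longlonglongrightarrow> 0"
    using q by (intro tendsto_mult_right_zero LIMSEQ_power_zero) auto
  have "Cauchy u"
  proof (rule CauchyI)
    fix e :: real assume "0 < e"
    hence "eventually (\<lambda>n. K / (1 - q) * q ^ n < e / 2) sequentially" using order_tendstoD(2)[OF l0, of "e/2"] by simp
    then obtain M where M: "\<And>n. n \<ge> M \<Longrightarrow> K / (1 - q) * q ^ n < e / 2" by (auto simp: eventually_sequentially)
    define n0 where "n0 = max M N"
    have c: "norm (u m - u n0) < e / 2" if "m \<ge> n0" for m
      using order_le_less_trans[OF b[of n0 "m - n0"] M[of n0]] that by (simp add: n0_def)
    have "norm (u m - u n) < e" if "m \<ge> n0" "n \<ge> n0" for m n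
      using c[OF that(1)] c[OF that(2)] norm_triangle_ineq4[of "u m - u n0" "u n - u n0"] by simp
    thus "\<exists>M. \<forall>m\<ge>M. \<forall>n\<ge>M. norm (u m - u n) < e" by blast
  qed
  thus conv: "convergent u" by (simp add: Cauchy_convergent_iff)
  assume n: "n \<ge> N"
  have "(\<lambda>m. norm (u (m + n) - u n)) \<longlonglongrightarrow> norm (lim u - u n)"
    using conv by (intro tendsto_norm tendsto_diff tendsto_const LIMSEQ_ignore_initial_segment) (simp add: convergent_LIMSEQ_iff)
  thus "norm (lim u - u n) \<le> K / (1 - q) * q ^ n"
    by (rule tendsto_upperbound) (use b[OF n] in \<open>auto simp: add.commute\<close>)
qed

text \<open>These two limits are all that is asked of a point: \<open>good_edir\<close> derives the
  slow line and all growth rates from them without a further exceptional set.\<close>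

definition good :: "'a pmf \<Rightarrow> 'a cocycle \<Rightarrow> (int \<Rightarrow> 'a) \<Rightarrow> bool" where
  "good p A x \<longleftrightarrow> (\<lambda>n. ln (mnorm (citer A n x)) / real n) \<longlonglongrightarrow> Lplus p A \<and>
     (\<lambda>n. ln \<bar>det (citer A n x)\<bar> / real n) \<longlonglongrightarrow> Lplus p A + Lminus p A"

lemma AE_good: "A \<in> GLk \<Longrightarrow> AE x in bern p. good p A x" for A :: "'a::finite cocycle"
  using Lplus_conv(1)[of A p] AE_ldet[of A p] by (auto simp: good_def Lminus_eq)

text \<open>A line field needs a nonzero vector at every point, so the first axis serves as default
  where \<open>lim\<close> is 0.\<close>

definition edir :: "'a cocycle \<Rightarrow> (int \<Rightarrow> 'a) \<Rightarrow> real^2" where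
  "edir A x = (let l = lim (\<lambda>n. cdir A n x) in if l = 0 then axis 1 1 else l)"

lemma edir_nz [simp]: "edir A x \<noteq> 0" by (auto simp: edir_def Let_def axis_eq_0_iff)

lemma edir_measurable: "edir A \<in> borel_measurable (bern p)" for A :: "'a::finite cocycle"
proof -
  have [measurable]: "(\<lambda>x. lim (\<lambda>n. cdir A n x)) \<in> borel_measurable (bern p)"
    by (rule borel_measurable_lim_metric[OF cdir_measurable])
  show ?thesis unfolding edir_def[abs_def] Let_def by measurable
qed

lemma tendsto_ln_div_exp:
  fixes a :: "nat \<Rightarrow> real"
  assumes pos: "\<And>n. 0 < a n" and l: "(\<lambda>n. ln (a n) / real n) \<longlonglongrightarrow> l"
  shows "c > l \<Longrightarrow> eventually (\<lambda>n. a n < exp (c * real n)) sequentially"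
    and "c < l \<Longrightarrow> eventually (\<lambda>n. a n > exp (c * real n)) sequentially"
proof -
  assume "c > l"
  from order_tendstoD(2)[OF l this] eventually_gt_at_top[of 0] show "eventually (\<lambda>n. a n < exp (c * real n)) sequentially"
  proof eventually_elim
    case (elim n)
    hence "ln (a n) < c * real n" by (simp add: field_simps)
    thus ?case using pos[of n] by (metis exp_less_cancel_iff exp_ln)
  qed
next
  assume "c < l"
  from order_tendstoD(1)[OF l this] eventually_gt_at_top[of 0] show "eventually (\<lambda>n. a n > exp (c * real n)) sequentially"
  proof eventually_elim
    case (elim n)
    hence "ln (a n) > c * real n" by (simp add: field_simps)
    thus ?case using pos[of n] by (metis exp_less_cancel_iff exp_ln)
  qed
qed

lemma ln_less_exp: "0 < a \<Longrightarrow> a < exp c \<Longrightarrow> ln a < (c::real)"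
  by (metis exp_less_cancel_iff exp_ln)

lemma exp_linear_to_0: "c < 0 \<Longrightarrow> (\<lambda>n. exp (c * real n)) \<longlonglongrightarrow> 0"
  using LIMSEQ_power_zero[of "exp c"] by (simp add: exp_of_nat2_mult)

lemma const_le_exp_linear: "c > 0 \<Longrightarrow> eventually (\<lambda>n. K < exp (c * real n)) sequentially"
proof -
  assume c: "c > 0"
  have "(\<lambda>n. (\<bar>K\<bar> + 1) * exp (- c * real n)) \<longlonglongrightarrow> 0"
    using c by (intro tendsto_mult_right_zero exp_linear_to_0) auto
  from order_tendstoD(2)[OF this, of 1] have "eventually (\<lambda>n. (\<bar>K\<bar> + 1) * exp (- c * real n) < 1) sequentially" by simp
  thus ?thesis
  proof eventually_elim
    case (elim n)
    have "(\<bar>K\<bar> + 1) * exp (- c * real n) * exp (c * real n) < 1 * exp (c * real n)"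
      by (rule mult_strict_right_mono[OF elim]) simp
    thus ?case by (simp add: mult.assoc mult_exp_exp)
  qed
qed

lemma ln_div_n_sandwich:
  fixes a b :: "nat \<Rightarrow> real"
  assumes l: "(\<lambda>n. ln (a n) / real n) \<longlonglongrightarrow> l" and pos: "\<And>n. 0 < a n" and c: "c > 0" "d > 0"
    and ab: "eventually (\<lambda>n. c * a n \<le> b n \<and> b n \<le> d * a n) sequentially"
  shows "(\<lambda>n. ln (b n) / real n) \<longlonglongrightarrow> l"
proof -
  have t: "(\<lambda>n. ln k / real n + ln (a n) / real n) \<longlonglongrightarrow> 0 + l" for k :: real
    by (intro tendsto_add l lim_const_over_n)
  have e: "ln k / real n + ln (a n) / real n = ln (k * a n) / real n" if "k > 0" for k n
    using that pos[of n] by (simp add: ln_mult_pos add_divide_distrib)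
  show ?thesis
  proof (rule tendsto_sandwich)
    show "eventually (\<lambda>n. ln c / real n + ln (a n) / real n \<le> ln (b n) / real n) sequentially"
      using ab
    proof eventually_elim
      case (elim n)
      have "ln (c * a n) \<le> ln (b n)" using elim c pos[of n] by (intro ln_mono) auto
      thus ?case using e[OF c(1), of n] by (simp add: divide_right_mono)
    qed
    show "eventually (\<lambda>n. ln (b n) / real n \<le> ln d / real n + ln (a n) / real n) sequentially"
      using ab
    proof eventually_elim
      case (elim n)
      have "0 < b n" using elim c pos[of n] by (meson less_le_trans mult_pos_pos)
      hence "ln (b n) \<le> ln (d * a n)" using elim by (intro ln_mono) auto
      thus ?case using e[OF c(2), of n] by (simp add: divide_right_mono)
    qed
  qed (use t[of c] t[of d] in auto)
qed

text \<open>Let \<rho> be the gap. Consecutive contracted directions differ by a multiple of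
  \<open>rat\<close>, about exp (-\<rho> n), so they approach a limit e at that rate. Then |M e| is
  at most |M| (rat M + |e - cdir|), which has exponent L+ - \<rho> = L-; the determinant bound gives
  the other inequality. A vector off the line of e grows like |M| by
  \<open>cr_mnorm_le\<close>.\<close>

lemma good_edir:
  fixes A :: "'a::finite cocycle"
  assumes A: "A \<in> GLk" and gap: "Lminus p A < Lplus p A" and g: "good p A x"
  shows "norm (edir A x) = 1" "(\<lambda>n. cdir A n x) \<longlonglongrightarrow> edir A x"
    and "v \<in> span {edir A x} \<Longrightarrow> v \<noteq> 0 \<Longrightarrow> (\<lambda>n. ln (norm (citer A n x *v v)) / real n) \<longlonglongrightarrow> Lminus p A"
    and "v \<notin> span {edir A x} \<Longrightarrow> (\<lambda>n. ln (norm (citer A n x *v v)) / real n) \<longlonglongrightarrow> Lplus p A"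
proof -
  define M where "M n = citer A n x" for n
  define \<rho> where "\<rho> = Lplus p A - Lminus p A"
  have \<rho>: "\<rho> > 0" using gap by (simp add: \<rho>_def)
  have inv: "invertible (M n)" for n unfolding M_def by (rule invertible_citer[OF A])
  have Mp: "mnorm (M n) > 0" for n by (rule mnorm_pos[OF inv])
  have dp: "\<bar>det (M n)\<bar> > 0" for n using inv[of n] by (simp add: invertible_det_nz)
  have l1: "(\<lambda>n. ln (mnorm (M n)) / real n) \<longlonglongrightarrow> Lplus p A"
    and l2: "(\<lambda>n. ln \<bar>det (M n)\<bar> / real n) \<longlonglongrightarrow> Lplus p A + Lminus p A"
    using g by (simp_all add: good_def M_def)
  have "(\<lambda>n. ln \<bar>det (M n)\<bar> / real n - 2 * (ln (mnorm (M n)) / real n)) \<longlonglongrightarrow> (Lplus p A + Lminus p A) - 2 * Lplus p A"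
    by (intro tendsto_intros l1 l2)
  also have "(\<lambda>n. ln \<bar>det (M n)\<bar> / real n - 2 * (ln (mnorm (M n)) / real n)) = (\<lambda>n. ln (rat (M n)) / real n)"
    using Mp[THEN less_imp_neq] Mp dp by (simp add: rat_def ln_div ln_realpow diff_divide_distrib fun_eq_iff)
  finally have l3: "(\<lambda>n. ln (rat (M n)) / real n) \<longlonglongrightarrow> - \<rho>" by (simp add: \<rho>_def)
  have rp: "rat (M n) > 0" for n by (rule rat_pos[OF inv])
  have lim: "convergent (\<lambda>n. cdir A n x)" and rate: "r < \<rho> \<Longrightarrow> 0 < r \<Longrightarrow> \<exists>K>0. eventually (\<lambda>n. norm (lim (\<lambda>n. cdir A n x) - cdir A n x) \<le> K * exp (- r * real n)) sequentially" for r
  proof -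
    have *: "convergent (\<lambda>n. cdir A n x) \<and> (\<exists>K>0. eventually (\<lambda>n. norm (lim (\<lambda>n. cdir A n x) - cdir A n x) \<le> K * exp (- r * real n)) sequentially)"
      if r: "r < \<rho>" "0 < r" for r
    proof -
      have "eventually (\<lambda>n. rat (M n) < exp ((- r) * real n)) sequentially"
        by (rule tendsto_ln_div_exp(1)[OF rp l3]) (use r in simp)
      then obtain N where N: "\<And>n. n \<ge> N \<Longrightarrow> rat (M n) < exp (- r * real n)" by (auto simp: eventually_sequentially)
      define q where "q = exp (- r)"
      have q: "0 < q" "q < 1" using r by (auto simp: q_def)
      have qn: "q ^ n = exp (- r * real n)" for n by (simp only: q_def exp_of_nat2_mult)
      have step: "norm (cdir A (Suc n) x - cdir A n x) \<le> 2 * rmax A * q ^ n" if n: "n \<ge> N" for n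
      proof -
        have "norm (cdir A (Suc n) x - cdir A n x) \<le> 2 * \<bar>cr (cdir A (Suc n) x) (cdir A n x)\<bar>"
          by (intro norm_diff_le_cr cdir A)
        also have "\<dots> \<le> 2 * (rmax A * rat (M n))" using cr_cdir_step[OF A, of n x] by (simp add: M_def cr_abs_commute)
        also have "\<dots> \<le> 2 * (rmax A * q ^ n)" using N[OF n] rmax(2)[of A] by (simp add: qn mult_left_mono)
        finally show ?thesis by simp
      qed
      have r0: "0 \<le> 2 * rmax A" using rmax(2)[of A] by simp
      note gl = geometric_cauchy_limit[of N "\<lambda>n. cdir A n x", OF step q r0]
      have "eventually (\<lambda>n. norm (lim (\<lambda>n. cdir A n x) - cdir A n x) \<le> 2 * rmax A / (1 - q) * exp (- r * real n)) sequentially"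
        unfolding eventually_sequentially using gl(2) by (auto simp: qn)
      moreover have "2 * rmax A / (1 - q) > 0" using q rmax(2)[of A] by simp
      ultimately show ?thesis using gl(1) by blast
    qed
    show "convergent (\<lambda>n. cdir A n x)" using *[of "\<rho> / 2"] \<rho> by simp
    show "r < \<rho> \<Longrightarrow> 0 < r \<Longrightarrow> \<exists>K>0. eventually (\<lambda>n. norm (lim (\<lambda>n. cdir A n x) - cdir A n x) \<le> K * exp (- r * real n)) sequentially"
      using *[of r] by blast
  qed
  define e where "e = lim (\<lambda>n. cdir A n x)"
  have te: "(\<lambda>n. cdir A n x) \<longlonglongrightarrow> e" using lim by (simp add: e_def convergent_LIMSEQ_iff)
  have "(\<lambda>n. norm (cdir A n x)) \<longlonglongrightarrow> norm e" by (intro tendsto_norm te)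
  hence ne: "norm e = 1" by (simp add: cdir(1)[OF A] LIMSEQ_const_iff)
  hence eedir: "edir A x = e" by (auto simp: edir_def Let_def e_def)
  show "norm (edir A x) = 1" "(\<lambda>n. cdir A n x) \<longlonglongrightarrow> edir A x" using ne te eedir by simp_all
  have posv: "norm (M n *v v) > 0" if "v \<noteq> 0" for n v using matvec_pos[OF inv that] .
  have e0: "e \<noteq> 0" using ne by auto
  have Le: "(\<lambda>n. ln (norm (M n *v e)) / real n) \<longlonglongrightarrow> Lminus p A"
  proof (rule order_tendstoI)
    fix a assume a: "a < Lminus p A"
    have "(\<lambda>n. ln \<bar>det (M n)\<bar> / real n - ln (mnorm (M n)) / real n) \<longlonglongrightarrow> (Lplus p A + Lminus p A) - Lplus p A"
      by (intro tendsto_intros l1 l2)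
    hence "eventually (\<lambda>n. ln \<bar>det (M n)\<bar> / real n - ln (mnorm (M n)) / real n > a) sequentially"
      using a by (intro order_tendstoD(1)) auto
    thus "eventually (\<lambda>n. a < ln (norm (M n *v e)) / real n) sequentially"
    proof eventually_elim
      case (elim n)
      have "\<bar>det (M n)\<bar> / mnorm (M n) \<le> norm (M n *v e)" using det_le_norm_mnorm[of "M n" e] ne Mp[of n] by (simp add: field_simps)
      hence "ln (\<bar>det (M n)\<bar> / mnorm (M n)) \<le> ln (norm (M n *v e))" using Mp[of n] dp[of n] by (intro ln_mono) auto
      hence "(ln \<bar>det (M n)\<bar> - ln (mnorm (M n))) / real n \<le> ln (norm (M n *v e)) / real n"
        using Mp[of n] dp[of n] by (intro divide_right_mono) (auto simp: ln_div)
      thus ?case using elim by (simp add: diff_divide_distrib)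
    qed
  next
    fix b assume b: "Lminus p A < b"
    \<comment> \<open>Of the four \<epsilon> below b - L- one is spent on the norm, one on the ratio
      and one on the constant 1 + K; the last gives strictness.\<close>
    define \<epsilon> where "\<epsilon> = min ((b - Lminus p A) / 4) (\<rho> / 2)"
    have \<epsilon>: "\<epsilon> > 0" "4 * \<epsilon> \<le> b - Lminus p A" "\<epsilon> < \<rho>" using b \<rho> unfolding \<epsilon>_def min_def by auto
    obtain K where K: "K > 0" "eventually (\<lambda>n. norm (e - cdir A n x) \<le> K * exp (- (\<rho> - \<epsilon>) * real n)) sequentially"
      using rate[of "\<rho> - \<epsilon>"] \<epsilon> unfolding e_def by auto
    have 1: "eventually (\<lambda>n. mnorm (M n) < exp ((Lplus p A + \<epsilon>) * real n)) sequentially"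
      by (rule tendsto_ln_div_exp(1)[OF Mp l1]) (use \<epsilon> in simp)
    have 2: "eventually (\<lambda>n. rat (M n) < exp ((- \<rho> + \<epsilon>) * real n)) sequentially"
      by (rule tendsto_ln_div_exp(1)[OF rp l3]) (use \<epsilon> in simp)
    have 3: "eventually (\<lambda>n. 1 + K < exp (\<epsilon> * real n)) sequentially" by (rule const_le_exp_linear[OF \<epsilon>(1)])
    from 1 2 3 K(2) eventually_gt_at_top[of 0]
    show "eventually (\<lambda>n. ln (norm (M n *v e)) / real n < b) sequentially"
    proof eventually_elim
      case (elim n)
      have "norm (M n *v e) \<le> norm (M n *v cdir A n x) + norm (M n *v (e - cdir A n x))"
        using norm_triangle_ineq[of "M n *v cdir A n x" "M n *v (e - cdir A n x)"]
        by (simp add: matrix_vector_mult_diff_distrib)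
      moreover have "norm (M n *v cdir A n x) = rat (M n) * mnorm (M n)"
        using cdir(2)[OF A, of n x] Mp[of n] by (simp add: M_def rat_def power2_eq_square)
      ultimately have "norm (M n *v e) \<le> rat (M n) * mnorm (M n) + mnorm (M n) * norm (e - cdir A n x)"
        using mnorm_bound[of "M n" "e - cdir A n x"] by linarith
      also have "rat (M n) * mnorm (M n) + mnorm (M n) * norm (e - cdir A n x)
          = mnorm (M n) * (rat (M n) + norm (e - cdir A n x))" by (simp add: algebra_simps)
      also have "\<dots> \<le> exp ((Lplus p A + \<epsilon>) * real n) * (exp ((- \<rho> + \<epsilon>) * real n) + K * exp (- (\<rho> - \<epsilon>) * real n))"
        using elim rat_nonneg[of "M n"] by (intro mult_mono add_mono) auto
      also have "\<dots> = exp ((Lplus p A + \<epsilon>) * real n) * exp ((- \<rho> + \<epsilon>) * real n) * (1 + K)" by (simp add: algebra_simps)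
      also have "\<dots> = exp ((Lminus p A + 2 * \<epsilon>) * real n) * (1 + K)"
        unfolding mult_exp_exp by (simp add: \<rho>_def algebra_simps)
      also have "\<dots> < exp ((Lminus p A + 2 * \<epsilon>) * real n) * exp (\<epsilon> * real n)" using elim by simp
      also have "\<dots> = exp ((Lminus p A + 3 * \<epsilon>) * real n)" unfolding mult_exp_exp by (simp add: algebra_simps)
      also have "\<dots> < exp (b * real n)" using \<epsilon> elim by simp
      finally have "ln (norm (M n *v e)) < b * real n" using posv[OF e0, of n] by (intro ln_less_exp)
      thus ?case using elim by (simp add: field_simps)
    qed
  qed
  show "(\<lambda>n. ln (norm (citer A n x *v v)) / real n) \<longlonglongrightarrow> Lminus p A" if v: "v \<in> span {edir A x}" "v \<noteq> 0"
  proof -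
    obtain c where c: "v = c *\<^sub>R e" using v eedir by (auto simp: span_singleton)
    hence "c \<noteq> 0" using v by auto
    thus ?thesis unfolding M_def[symmetric]
      by (intro ln_div_n_sandwich[OF Le posv[OF e0], of "\<bar>c\<bar>" "\<bar>c\<bar>"]) (auto simp: c matrix_vector_mult_scaleR)
  qed
  show "(\<lambda>n. ln (norm (citer A n x *v v)) / real n) \<longlonglongrightarrow> Lplus p A" if v: "v \<notin> span {edir A x}"
  proof -
    have c: "cr e v \<noteq> 0" using v span_eq_iff_cr[OF e0, of v] eedir by simp
    have v0: "v \<noteq> 0" using v by (auto simp: span_zero)
    have "(\<lambda>n. ln (norm (M n *v e)) / real n - ln (mnorm (M n)) / real n) \<longlonglongrightarrow> Lminus p A - Lplus p A"
      by (intro tendsto_intros Le l1)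
    also have "(\<lambda>n. ln (norm (M n *v e)) / real n - ln (mnorm (M n)) / real n) = (\<lambda>n. ln (norm (M n *v e) / mnorm (M n)) / real n)"
      using posv[OF e0] Mp Mp[THEN less_imp_neq] by (simp add: ln_div diff_divide_distrib fun_eq_iff e0)
    finally have lq: "(\<lambda>n. ln (norm (M n *v e) / mnorm (M n)) / real n) \<longlonglongrightarrow> Lminus p A - Lplus p A" .
    have gap_half: "Lminus p A - Lplus p A < - (\<rho> / 2)"
    proof -
      have "Lminus p A - Lplus p A = - \<rho>" by (simp add: \<rho>_def)
      thus ?thesis using \<rho> by simp
    qed
    have "eventually (\<lambda>n. norm (M n *v e) / mnorm (M n) < exp (- (\<rho> / 2) * real n)) sequentially"
      by (rule tendsto_ln_div_exp(1)[OF _ lq gap_half]) (use posv[OF e0] Mp in auto)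
    moreover have "(\<lambda>n. exp (- (\<rho> / 2) * real n)) \<longlonglongrightarrow> 0" using \<rho> by (intro exp_linear_to_0) auto
    hence "eventually (\<lambda>n. exp (- (\<rho> / 2) * real n) < \<bar>cr e v\<bar> / (2 * norm v)) sequentially"
      using c v0 by (intro order_tendstoD(2)) auto
    ultimately have "eventually (\<lambda>n. \<bar>cr e v\<bar> / 2 * mnorm (M n) \<le> norm (M n *v v) \<and> norm (M n *v v) \<le> norm v * mnorm (M n)) sequentially"
    proof eventually_elim
      case (elim n)
      have "norm (M n *v e) / mnorm (M n) \<le> \<bar>cr e v\<bar> / (2 * norm v)" using elim by linarith
      hence "norm v * norm (M n *v e) \<le> \<bar>cr e v\<bar> / 2 * mnorm (M n)" using Mp[of n] v0 by (simp add: field_simps)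
      hence "\<bar>cr e v\<bar> / 2 * mnorm (M n) \<le> norm (M n *v v)" using cr_mnorm_le[of e v "M n"] ne by simp
      thus ?case using mnorm_bound[of "M n" v] by (simp add: mult.commute)
    qed
    with c v0 show ?thesis unfolding M_def[symmetric]
      by (intro ln_div_n_sandwich[OF l1 Mp, where c="\<bar>cr e v\<bar> / 2" and d="norm v"]) auto
  qed
qed

text \<open>Membership in the slow line is read off from a growth rate. Invariance and uniqueness of
  the splitting thereby reduce to uniqueness of limits.\<close>

lemma good_span_iff:
  fixes A :: "'a::finite cocycle"
  assumes A: "A \<in> GLk" and gap: "Lminus p A < Lplus p A" and g: "good p A x" and v: "v \<noteq> 0"
  shows "v \<in> span {edir A x} \<longleftrightarrow> (\<lambda>n. ln (norm (citer A n x *v v)) / real n) \<longlonglongrightarrow> Lminus p A"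
proof
  assume "(\<lambda>n. ln (norm (citer A n x *v v)) / real n) \<longlonglongrightarrow> Lminus p A"
  thus "v \<in> span {edir A x}" using good_edir(4)[OF A gap g, of v] gap LIMSEQ_unique by fastforce
qed (use good_edir(3)[OF A gap g] v in blast)

section \<open>The Oseledets splitting\<close>

definition icoc :: "'a cocycle \<Rightarrow> 'a cocycle" where
  "icoc A = (\<lambda>j. matrix_inv (A j))"

text \<open>The index is -1 - i, not -i: going backwards, the first matrix to be inverted is the one
  at time -1.\<close>

definition xrev :: "(int \<Rightarrow> 'a) \<Rightarrow> (int \<Rightarrow> 'a)" where
  "xrev x = (\<lambda>i. x (- 1 - i))"

lemma icoc_GLk: "A \<in> GLk \<Longrightarrow> icoc A \<in> GLk"
  by (auto simp: GLk_def icoc_def intro: matrix_inv_cancel(3))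

lemma icoc_icoc: "A \<in> GLk \<Longrightarrow> icoc (icoc A) = A"
  by (auto simp: GLk_def icoc_def fun_eq_iff intro: matrix_inv_cancel(4))

lemma matrix_inv_mult:
  assumes "invertible (M::real^2^2)" "invertible (N::real^2^2)"
  shows "matrix_inv (M ** N) = matrix_inv N ** matrix_inv M"
proof (rule matrix_inv_eqI)
  have "M ** N ** (matrix_inv N ** matrix_inv M) = M ** (N ** matrix_inv N) ** matrix_inv M"
    by (simp add: matrix_mul_assoc)
  thus "M ** N ** (matrix_inv N ** matrix_inv M) = mat 1"
    by (simp add: matrix_inv_cancel(1) assms matrix_mul_rid)
  have "matrix_inv N ** matrix_inv M ** (M ** N) = matrix_inv N ** (matrix_inv M ** M) ** N"
    by (simp add: matrix_mul_assoc)
  thus "matrix_inv N ** matrix_inv M ** (M ** N) = mat 1"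
    by (simp add: matrix_inv_cancel(2) assms matrix_mul_rid)
qed

lemma wprod_icoc:
  assumes A: "A \<in> GLk" shows "wprod (icoc A) w = matrix_inv (wprod A (rev w))"
proof (induction w)
  case Nil show ?case using matrix_inv_eqI[of "mat 1" "mat 1"] by (simp add: matrix_mul_lid eq_commute)
next
  case (Cons j w)
  thus ?case using matrix_inv_mult[OF GLkD[OF A, of j] invertible_wprod[OF A, of "rev w"]]
    by (simp add: wprod_append matrix_mul_lid icoc_def)
qed

lemma word_xrev: "word n (\<lambda>i. x (i - int n)) = rev (word n (xrev x))"
  by (rule nth_equalityI) (auto simp: word_def xrev_def rev_nth of_nat_diff algebra_simps simp del: upt_Suc)

text \<open>Every statement about the past of A becomes one about the future of
  \<open>icoc A\<close>, so the construction of the slow line also yields the fast line.\<close>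

lemma citer_past:
  assumes A: "A \<in> GLk"
  shows "matrix_inv (citer A n (\<lambda>i. x (i - int n))) = citer (icoc A) n (xrev x)"
  by (simp add: citer_wprod word_xrev wprod_icoc[OF A])

lemma ldet_icoc: "A \<in> GLk \<Longrightarrow> ldet p (icoc A) = - ldet p A"
  by (simp add: ldet_def icoc_def matrix_inv_cancel(7)[OF GLkD] abs_inverse ln_inverse GLk_det sum_negf)

lemma lnorm_icoc:
  assumes A: "A \<in> GLk"
  shows "lnorm (icoc A) w = lnorm A (rev w) - ln \<bar>det (wprod A (rev w))\<bar>"
  using invertible_wprod[OF A, of "rev w"] mnorm_pos[OF invertible_wprod[OF A, of "rev w"]]
  by (simp add: lnorm_def wprod_icoc[OF A] mnorm_matrix_inv ln_div invertible_det_nz)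

lemma EW_lnorm_icoc:
  fixes A :: "'a::finite cocycle"
  assumes A: "A \<in> GLk"
  shows "EW p n (lnorm (icoc A)) = EW p n (lnorm A) - real n * ldet p A"
proof -
  have "EW p n (lnorm (icoc A)) = EW p n (\<lambda>w. lnorm A (rev w) - ln \<bar>det (wprod A (rev w))\<bar>)"
    using lnorm_icoc[OF A] by (intro EW_cong) auto
  also have "\<dots> = EW p n (\<lambda>w. lnorm A w - ln \<bar>det (wprod A w)\<bar>)"
    by (rule EW_rev[of p n "\<lambda>w. lnorm A w - ln \<bar>det (wprod A w)\<bar>"])
  also have "\<dots> = EW p n (lnorm A) - real n * ldet p A"
    by (simp add: EW_diff ln_det_wprod[OF A] EW_sum_list ldet_def)
  finally show ?thesis .
qed

text \<open>Averages of the log norm over words of length n differ for A and \<open>icoc A\<close>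
  by n \<open>ldet p A\<close> only, and the exponent is an infimum of such averages. This gives one
  inequality for every cocycle; applied to \<open>icoc A\<close> it becomes the other.\<close>

lemma Lplus_icoc:
  fixes A :: "'a::finite cocycle"
  assumes A: "A \<in> GLk"
  shows "Lplus p (icoc A) = - Lminus p A" "Lminus p (icoc A) = - Lplus p A"
proof -
  have le: "Lplus p (icoc A) \<le> Lplus p A - ldet p A" if A: "A \<in> GLk" for A :: "'a cocycle"
  proof (rule dense_ge)
    fix c assume "Lplus p A - ldet p A < c"
    then obtain n where n: "n \<ge> 1" "EW p n (lnorm A) < (c + ldet p A) * real n"
      using Lplus_conv(3)[OF A, of p "c + ldet p A"] by auto
    have "Lplus p (icoc A) * real n \<le> EW p n (lnorm A) - real n * ldet p A"
      using Lplus_conv(2)[OF icoc_GLk[OF A] n(1)] by (simp add: EW_lnorm_icoc[OF A])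
    also have "\<dots> < c * real n" using n by (simp add: algebra_simps)
    finally show "Lplus p (icoc A) \<le> c" using n by simp
  qed
  have "Lplus p A \<le> Lplus p (icoc A) + ldet p A"
    using le[OF icoc_GLk[OF A]] by (simp add: icoc_icoc[OF A] ldet_icoc[OF A])
  thus 1: "Lplus p (icoc A) = - Lminus p A" using le[OF A] by (simp add: Lminus_eq[OF A])
  thus "Lminus p (icoc A) = - Lplus p A"
    by (simp add: Lminus_eq[OF icoc_GLk[OF A]] Lminus_eq[OF A] ldet_icoc[OF A])
qed

lemma AE_shift: "AE x in bern p. P x \<Longrightarrow> AE x in bern p. P (\<lambda>i. x (i + k))"
  by (rule AE_bern_reindex) (auto simp: inj_def)

lemma AE_xrev: "AE x in bern p. P x \<Longrightarrow> AE x in bern p. P (xrev x)"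
  unfolding xrev_def by (rule AE_bern_reindex) (auto simp: inj_def)

lemma edir_xrev_measurable: "(\<lambda>x. edir A (xrev x)) \<in> borel_measurable (bern p)" for A :: "'a::finite cocycle"
  unfolding xrev_def by (rule measurable_compose[OF measurable_bern_reindex edir_measurable])

lemma citer_Suc_shift: "citer A (Suc n) x = citer A n (shift x) ** A (x 0)"
  by (simp only: citer_wprod word_Suc_shift wprod.simps)

lemma citer_icoc_shift:
  assumes A: "A \<in> GLk"
  shows "citer (icoc A) (Suc n) (xrev (shift x)) *v (A (x 0) *v v) = citer (icoc A) n (xrev x) *v v"
proof -
  have "shift (xrev (shift x)) = xrev x" by (auto simp: shift_def xrev_def fun_eq_iff intro!: arg_cong[of _ _ x])
  moreover have "xrev (shift x) 0 = x 0" by (simp add: shift_def xrev_def)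
  ultimately have "citer (icoc A) (Suc n) (xrev (shift x)) = citer (icoc A) n (xrev x) ** matrix_inv (A (x 0))"
    by (simp only: citer_Suc_shift icoc_def)
  thus ?thesis by (simp add: matrix_inv_cancel(6)[OF GLkD[OF A]] flip: matrix_vector_mul_assoc)
qed

lemma tendsto_over_Suc_iff:
  fixes f :: "nat \<Rightarrow> real"
  shows "(\<lambda>n. f n / real n) \<longlonglongrightarrow> l \<Longrightarrow> (\<lambda>n. f (Suc n) / real n) \<longlonglongrightarrow> l"
    and "(\<lambda>n. f n / real n) \<longlonglongrightarrow> l \<Longrightarrow> (\<lambda>n. f n / real (Suc n)) \<longlonglongrightarrow> l"
proof -
  have t: "(\<lambda>n. 1 + 1 / real n) \<longlonglongrightarrow> 1 + 0" by (intro tendsto_intros lim_const_over_n)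
  have t2: "(\<lambda>n. real n / real (Suc n)) \<longlonglongrightarrow> 1" by (rule LIMSEQ_n_over_Suc_n)
  { assume a: "(\<lambda>n. f n / real n) \<longlonglongrightarrow> l"
    have "(\<lambda>n. f (Suc n) / real (Suc n) * (1 + 1 / real n)) \<longlonglongrightarrow> l * (1 + 0)"
      by (intro tendsto_mult t LIMSEQ_Suc[OF a])
    moreover have "eventually (\<lambda>n. f (Suc n) / real (Suc n) * (1 + 1 / real n) = f (Suc n) / real n) sequentially"
      using eventually_gt_at_top[of 0]
    proof eventually_elim
      case (elim n)
      have "1 + 1 / real n = real (Suc n) / real n" using elim by (simp add: field_simps)
      thus ?case by simp
    qed
    ultimately show "(\<lambda>n. f (Suc n) / real n) \<longlonglongrightarrow> l" using Lim_transform_eventually by fastforce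
  next
    assume a: "(\<lambda>n. f n / real n) \<longlonglongrightarrow> l"
    have "(\<lambda>n. f n / real n * (real n / real (Suc n))) \<longlonglongrightarrow> l * 1" by (intro tendsto_mult t2 a)
    moreover have "eventually (\<lambda>n. f n / real n * (real n / real (Suc n)) = f n / real (Suc n)) sequentially"
      using eventually_gt_at_top[of 0] by eventually_elim simp
    ultimately show "(\<lambda>n. f n / real (Suc n)) \<longlonglongrightarrow> l" using Lim_transform_eventually by fastforce }
qed

lemma line_image:
  assumes "invertible (M::real^2^2)" "u \<noteq> 0" "M *v u \<in> span {w}"
  shows "(\<lambda>v. M *v v) ` span {u} = span {w}"
proof -
  obtain c where c: "M *v u = c *\<^sub>R w" using assms(3) by (auto simp: span_singleton)
  have "M *v u \<noteq> 0" using matvec_pos[OF assms(1,2)] by auto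
  hence c0: "c \<noteq> 0" using c by auto
  show ?thesis
  proof safe
    fix v assume "v \<in> span {u}"
    then obtain k where "v = k *\<^sub>R u" by (auto simp: span_singleton)
    thus "M *v v \<in> span {w}" by (auto simp: matrix_vector_mult_scaleR c span_singleton)
  next
    fix v assume "v \<in> span {w}"
    then obtain k where "v = k *\<^sub>R w" by (auto simp: span_singleton)
    hence "v = M *v ((k / c) *\<^sub>R u)" using c c0 by (simp add: matrix_vector_mult_scaleR)
    thus "v \<in> (\<lambda>v. M *v v) ` span {u}" by (auto simp: span_singleton)
  qed
qed

lemma span_line_eq:
  assumes "u \<noteq> (0::real^2)" "u \<in> span {w}" shows "span {u} = span {w}"
proof -
  obtain c where c: "u = c *\<^sub>R w" using assms(2) by (auto simp: span_singleton)
  hence "c \<noteq> 0" using assms(1) by auto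
  thus ?thesis unfolding span_singleton c
    by (auto simp: image_iff) (metis nonzero_mult_div_cancel_right times_divide_eq_left)
qed

text \<open>Discarding one step does not alter a growth rate, so the image vector still has rate L-
  and \<open>good_span_iff\<close> places it on the slow line of the shifted point.\<close>

lemma edir_equivariant:
  fixes A :: "'a::finite cocycle"
  assumes A: "A \<in> GLk" and gap: "Lminus p A < Lplus p A" and g: "good p A x" "good p A (shift x)"
  shows "A (x 0) *v edir A x \<in> span {edir A (shift x)}"
proof -
  have "A (x 0) *v edir A x \<noteq> 0" using matvec_pos[OF GLkD[OF A]] by (metis edir_nz norm_zero less_irrefl)
  moreover have "(\<lambda>n. ln (norm (citer A n x *v edir A x)) / real n) \<longlonglongrightarrow> Lminus p A"
    by (intro good_edir(3)[OF A gap g(1)] span_base) auto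
  from tendsto_over_Suc_iff(1)[OF this]
  have "(\<lambda>n. ln (norm (citer A n (shift x) *v (A (x 0) *v edir A x))) / real n) \<longlonglongrightarrow> Lminus p A"
    by (simp only: citer_Suc_shift matrix_vector_mul_assoc)
  ultimately show ?thesis using good_span_iff[OF A gap g(2)] by blast
qed

text \<open>The same argument for the past, where passing to \<open>shift x\<close> adds a letter
  instead of removing one.\<close>

lemma edir_past_equivariant:
  fixes A :: "'a::finite cocycle"
  assumes A: "A \<in> GLk" and gap: "Lminus p A < Lplus p A" and g: "good p (icoc A) (xrev x)" "good p (icoc A) (xrev (shift x))"
  shows "A (x 0) *v edir (icoc A) (xrev x) \<in> span {edir (icoc A) (xrev (shift x))}"
proof -
  note iA = icoc_GLk[OF A]
  have igap: "Lminus p (icoc A) < Lplus p (icoc A)" using gap by (simp add: Lplus_icoc[OF A])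
  let ?e = "edir (icoc A) (xrev x)"
  have "A (x 0) *v ?e \<noteq> 0" using matvec_pos[OF GLkD[OF A]] by (metis edir_nz norm_zero less_irrefl)
  moreover have "(\<lambda>n. ln (norm (citer (icoc A) n (xrev x) *v ?e)) / real n) \<longlonglongrightarrow> Lminus p (icoc A)"
    by (intro good_edir(3)[OF iA igap g(1)] span_base) auto
  from tendsto_over_Suc_iff(2)[OF this]
  have "(\<lambda>n. ln (norm (citer (icoc A) (Suc n) (xrev (shift x)) *v (A (x 0) *v ?e))) / real (Suc n)) \<longlonglongrightarrow> Lminus p (icoc A)"
    by (simp only: citer_icoc_shift[OF A])
  hence "(\<lambda>n. ln (norm (citer (icoc A) n (xrev (shift x)) *v (A (x 0) *v ?e))) / real n) \<longlonglongrightarrow> Lminus p (icoc A)"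
    by (rule LIMSEQ_imp_Suc)
  ultimately show ?thesis using good_span_iff[OF iA igap g(2)] by blast
qed

lemma measurable_vec_nth: "g \<in> borel_measurable N \<Longrightarrow> (\<lambda>x. g x $ i) \<in> borel_measurable N"
  for g :: "_ \<Rightarrow> 'b::topological_space ^ 'n"
  by (erule measurable_compose) (intro borel_measurable_continuous_onI continuous_intros)

lemma measurable_cr:
  "f \<in> borel_measurable N \<Longrightarrow> g \<in> borel_measurable N \<Longrightarrow> (\<lambda>x. cr (f x) (g x)) \<in> borel_measurable N"
  unfolding cr_def by (intro borel_measurable_diff borel_measurable_times measurable_vec_nth)

lemma measurable_matvec:
  fixes M :: "_ \<Rightarrow> real^2^2"
  assumes "M \<in> borel_measurable N" "v \<in> borel_measurable N"
  shows "(\<lambda>x. M x *v v x) \<in> borel_measurable N"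
proof -
  have "(\<lambda>x. (M x *v v x) \<bullet> b) \<in> borel_measurable N" if b: "b \<in> Basis" for b
  proof -
    obtain i where "b = axis i 1" using b unfolding Basis_vec_def by auto
    hence "(\<lambda>x. (M x *v v x) \<bullet> b) = (\<lambda>x. M x $ i $ 1 * v x $ 1 + M x $ i $ 2 * v x $ 2)"
      by (simp add: inner_axis matvec2)
    thus ?thesis
      by (auto intro!: borel_measurable_add borel_measurable_times measurable_vec_nth assms)
  qed
  thus ?thesis using borel_measurable_euclidean_space by blast
qed

definition lbd :: "'a::finite cocycle \<Rightarrow> real" where
  "lbd A = (\<Sum>j\<in>UNIV. \<bar>ln (mnorm (A j))\<bar> + \<bar>ln (mnorm (matrix_inv (A j)))\<bar>)"

lemma ln_matvec_bound:
  fixes A :: "'a::finite cocycle"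
  assumes A: "A \<in> GLk" and v: "v \<noteq> 0"
  shows "\<bar>ln (norm (wprod A w *v v)) - ln (norm v)\<bar> \<le> lbd A * real (length w)"
  using v
proof (induction w arbitrary: v)
  case (Cons j w)
  have p: "norm (A j *v v) > 0" using matvec_pos[OF GLkD[OF A] Cons.prems] .
  hence nz: "A j *v v \<noteq> 0" by auto
  have posj: "mnorm (A j) > 0" "mnorm (matrix_inv (A j)) > 0"
    using mnorm_pos GLkD[OF A] matrix_inv_cancel(3) by blast+
  have "ln (norm (A j *v v)) \<le> ln (mnorm (A j) * norm v)" by (rule ln_mono[OF mnorm_bound p])
  also have "\<dots> = ln (mnorm (A j)) + ln (norm v)" using posj Cons.prems by (intro ln_mult_pos) auto
  finally have 1: "ln (norm (A j *v v)) - ln (norm v) \<le> ln (mnorm (A j))" by simp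
  have "norm v \<le> mnorm (matrix_inv (A j)) * norm (A j *v v)"
    using mnorm_bound[of "matrix_inv (A j)" "A j *v v"] matrix_inv_cancel(6)[OF GLkD[OF A]] by simp
  hence "ln (norm v) \<le> ln (mnorm (matrix_inv (A j)) * norm (A j *v v))" using Cons.prems by (intro ln_mono) auto
  also have "\<dots> = ln (mnorm (matrix_inv (A j))) + ln (norm (A j *v v))" using posj p by (intro ln_mult_pos) auto
  finally have 2: "- ln (mnorm (matrix_inv (A j))) \<le> ln (norm (A j *v v)) - ln (norm v)" by simp
  have "\<bar>ln (mnorm (A j))\<bar> + \<bar>ln (mnorm (matrix_inv (A j)))\<bar> \<le> lbd A"
    unfolding lbd_def by (rule member_le_sum) auto
  hence "\<bar>ln (norm (A j *v v)) - ln (norm v)\<bar> \<le> lbd A" using 1 2 by linarith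
  moreover have "\<bar>ln (norm (wprod A w *v (A j *v v))) - ln (norm (A j *v v))\<bar> \<le> lbd A * real (length w)"
    by (rule Cons.IH[OF nz])
  moreover have "wprod A (j # w) *v v = wprod A w *v (A j *v v)" by (simp add: matrix_vector_mul_assoc)
  ultimately show ?case by (simp only: length_Cons of_nat_Suc) (simp add: algebra_simps)
qed simp

lemma lbd_nonneg: "0 \<le> lbd A" unfolding lbd_def by (intro sum_nonneg) auto

text \<open>The part of the splitting where the two lines coincide is invariant; along it the exponent of the
  common line, computed forwards and (by invariance of the measure) backwards, would be both L- and L+.\<close>
lemma AE_transversal:
  fixes A :: "'a::finite cocycle"
  assumes A: "A \<in> GLk" and gap: "Lminus p A < Lplus p A"
  shows "AE x in bern p. edir (icoc A) (xrev x) \<notin> span {edir A x}"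
proof -
  interpret prob_space "bern p" by (rule prob_space_bern)
  note iA = icoc_GLk[OF A]
  have igap: "Lminus p (icoc A) < Lplus p (icoc A)" using gap by (simp add: Lplus_icoc[OF A])
  define f where "f x = edir (icoc A) (xrev x)" for x
  define D where "D = {x. cr (edir A x) (f x) = 0}"
  have [measurable]: "edir A \<in> borel_measurable (bern p)" by (rule edir_measurable)
  have [measurable]: "f \<in> borel_measurable (bern p)" unfolding f_def[abs_def] by (rule edir_xrev_measurable)
  have [measurable]: "(\<lambda>x. cr (edir A x) (f x)) \<in> borel_measurable (bern p)"
    by (intro measurable_cr) measurable
  have [measurable]: "D \<in> sets (bern p)" unfolding D_def sets_bern_Collect by measurable
  have fnz: "f x \<noteq> 0" for x by (simp add: f_def)
  have Dspan: "x \<in> D \<longleftrightarrow> f x \<in> span {edir A x}" for x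
    by (simp add: D_def span_eq_iff_cr)
  \<comment> \<open>The subtracted logarithm is 0 at good points; with it the bound
    \<open>hb\<close> holds at every x, as bounded convergence demands.\<close>
  define h where "h n x = indicator D x * ((ln (norm (citer A n x *v edir A x)) - ln (norm (edir A x))) / real n)" for n x
  have cm: "(\<lambda>x. citer A n x) \<in> borel_measurable (bern p)" for n unfolding citer_wprod by (rule borel_measurable_word)
  have [measurable]: "(\<lambda>x. citer A n x *v edir A x) \<in> borel_measurable (bern p)" for n
    by (intro measurable_matvec cm edir_measurable)
  have hm [measurable]: "h n \<in> borel_measurable (bern p)" for n unfolding h_def[abs_def] by measurable
  have hb: "\<bar>h n x\<bar> \<le> lbd A" for n x
  proof (cases "n = 0")
    case False
    have "\<bar>ln (norm (citer A n x *v edir A x)) - ln (norm (edir A x))\<bar> \<le> lbd A * real n"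
      using ln_matvec_bound[OF A, of "edir A x" "word n x"] by (simp add: citer_wprod)
    thus ?thesis using False lbd_nonneg[of A] by (simp add: h_def indicator_def field_simps)
  qed (simp add: h_def lbd_nonneg)
  have "(\<lambda>n. \<integral>x. h n x \<partial>bern p) \<longlonglongrightarrow> (\<integral>x. indicator D x * Lminus p A \<partial>bern p)"
  proof (rule bounded_convergence_bern[OF _ _ hb])
    show "AE x in bern p. (\<lambda>n. h n x) \<longlonglongrightarrow> indicator D x * Lminus p A"
      using AE_good[OF A, of p]
    proof eventually_elim
      case (elim x)
      have "(\<lambda>n. ln (norm (citer A n x *v edir A x)) / real n) \<longlonglongrightarrow> Lminus p A"
        by (intro good_edir(3)[OF A gap elim] span_base) auto
      thus ?case unfolding h_def using good_edir(1)[OF A gap elim] by (intro tendsto_mult tendsto_const) simp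
    qed
  qed measurable
  hence l1: "(\<lambda>n. \<integral>x. h n x \<partial>bern p) \<longlonglongrightarrow> Lminus p A * prob D" by (simp add: mult.commute)
  \<comment> \<open>The orbit piece now ends at x instead of starting there. On \<open>D\<close>
    this turns the quantity into minus a backward exponent, while the integral stays that of
    \<open>h n\<close>.\<close>
  define h' where "h' n x = h n (\<lambda>i. x (i - int n))" for n x
  have eq: "(\<integral>x. h' n x \<partial>bern p) = (\<integral>x. h n x \<partial>bern p)" for n
    unfolding h'_def by (rule integral_bern_reindex[of "\<lambda>i. i - int n" "h n" p]) (auto simp: inj_def)
  have gs: "AE x in bern p. \<forall>k::int. good p A (\<lambda>i. x (i + k)) \<and> good p (icoc A) (xrev (\<lambda>i. x (i + k)))"
    unfolding AE_all_countable AE_conj_iff using AE_shift[OF AE_good[OF A]] AE_shift[OF AE_xrev[OF AE_good[OF iA]]] by blast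
  have "(\<lambda>n. \<integral>x. h' n x \<partial>bern p) \<longlonglongrightarrow> (\<integral>x. indicator D x * Lplus p A \<partial>bern p)"
  proof (rule bounded_convergence_bern[where C="lbd A"])
    show "h' n \<in> borel_measurable (bern p)" for n
      unfolding h'_def by (rule measurable_compose[OF measurable_bern_reindex hm])
    show "\<bar>h' n x\<bar> \<le> lbd A" for n x unfolding h'_def by (rule hb)
    show "AE x in bern p. (\<lambda>n. h' n x) \<longlonglongrightarrow> indicator D x * Lplus p A"
      using gs
    proof eventually_elim
      case (elim x)
      define y where "y k = (\<lambda>i. x (i - int k))" for k
      have y0: "y 0 = x" by (simp add: y_def)
      have sy: "shift (y (Suc k)) = y k" for k by (simp add: y_def shift_def algebra_simps)
      have gy: "good p A (y k)" "good p (icoc A) (xrev (y k))" for k using elim[rule_format, of "- int k"] by (simp_all add: y_def)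
      have inv: "citer A k (y k) *v edir A (y k) \<in> span {edir A x}" "citer A k (y k) *v f (y k) \<in> span {f x}" for k
      proof (induction k)
        case 0
        { case 1 show ?case by (simp add: y0 span_base) }
        { case 2 show ?case by (simp add: y0 span_base) }
      next
        case (Suc k)
        have st: "citer A (Suc k) (y (Suc k)) *v v = citer A k (y k) *v (A (y (Suc k) 0) *v v)" for v
          by (simp only: citer_Suc_shift sy matrix_vector_mul_assoc)
        { case 1
          obtain c where c: "A (y (Suc k) 0) *v edir A (y (Suc k)) = c *\<^sub>R edir A (y k)"
            using edir_equivariant[OF A gap, of "y (Suc k)"] gy by (auto simp: sy span_singleton)
          show ?case unfolding st c using Suc(1) by (simp add: matrix_vector_mult_scaleR span_scale) }
        { case 2
          obtain c where c: "A (y (Suc k) 0) *v f (y (Suc k)) = c *\<^sub>R f (y k)"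
            using edir_past_equivariant[OF A gap, of "y (Suc k)"] gy by (auto simp: sy span_singleton f_def)
          show ?case unfolding st c using Suc(2) by (simp add: matrix_vector_mult_scaleR span_scale) }
      qed
      \<comment> \<open>Both lines are carried along the orbit by the same invertible matrix, which
        multiplies their cross product by a nonzero factor.\<close>
      have Dy: "y k \<in> D \<longleftrightarrow> x \<in> D" for k
      proof -
        obtain a b where ab: "citer A k (y k) *v edir A (y k) = a *\<^sub>R edir A x" "citer A k (y k) *v f (y k) = b *\<^sub>R f x"
          using inv[of k] by (auto simp: span_singleton)
        have i: "invertible (citer A k (y k))" by (rule invertible_citer[OF A])
        have "a \<noteq> 0" "b \<noteq> 0" using ab matvec_pos[OF i edir_nz] matvec_pos[OF i fnz] by (metis norm_zero scale_zero_left less_irrefl)+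
        moreover have "det (citer A k (y k)) * cr (edir A (y k)) (f (y k)) = a * b * cr (edir A x) (f x)"
          unfolding cr_matvec[symmetric] ab by simp
        ultimately show ?thesis using i by (auto simp: D_def invertible_det_nz)
      qed
      show ?case
      proof (cases "x \<in> D")
        case False
        hence "h' n x = 0" for n using Dy[of n] by (simp add: h'_def h_def y_def)
        thus ?thesis using False by simp
      next
        case True
        hence "cr (f x) (edir A x) = 0" using cr_commute[of "f x" "edir A x"] by (simp add: D_def)
        hence "edir A x \<in> span {f x}" using span_eq_iff_cr[OF fnz] by blast
        hence "(\<lambda>n. ln (norm (citer (icoc A) n (xrev x) *v edir A x)) / real n) \<longlonglongrightarrow> Lminus p (icoc A)"
          using gy(2)[of 0] by (intro good_edir(3)[OF iA igap]) (auto simp: f_def y0)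
        hence "(\<lambda>n. - (ln (norm (citer (icoc A) n (xrev x) *v edir A x)) / real n)) \<longlonglongrightarrow> - Lminus p (icoc A)"
          by (rule tendsto_minus)
        moreover have "- (ln (norm (citer (icoc A) n (xrev x) *v edir A x)) / real n) = h' n x" for n
        proof -
          let ?M = "citer A n (y n)"
          have i: "invertible ?M" by (rule invertible_citer[OF A])
          obtain a where a: "?M *v edir A (y n) = a *\<^sub>R edir A x" using inv(1)[of n] by (auto simp: span_singleton)
          have a0: "a \<noteq> 0" using a matvec_pos[OF i edir_nz] by (metis norm_zero scale_zero_left less_irrefl)
          have c: "citer (icoc A) n (xrev x) = matrix_inv ?M" unfolding y_def by (rule citer_past[OF A, symmetric])
          have "matrix_inv ?M *v (a *\<^sub>R edir A x) = edir A (y n)" unfolding a[symmetric] by (rule matrix_inv_cancel(6)[OF i])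
          hence "citer (icoc A) n (xrev x) *v edir A x = (1 / a) *\<^sub>R edir A (y n)"
          proof -
            assume "matrix_inv ?M *v (a *\<^sub>R edir A x) = edir A (y n)"
            hence "(1 / a) *\<^sub>R edir A (y n) = (1 / a) *\<^sub>R (a *\<^sub>R (matrix_inv ?M *v edir A x))"
              by (simp only: matrix_vector_mult_scaleR)
            thus ?thesis using a0 by (simp add: c)
          qed
          moreover have "norm (edir A x) = 1" using good_edir(1)[OF A gap] gy(1)[of 0] by (simp add: y0)
          moreover have "norm (edir A (y n)) = 1" using good_edir(1)[OF A gap gy(1)] .
          ultimately show ?thesis using True Dy[of n] a0
            by (simp add: h'_def h_def y_def[symmetric] a ln_div)
        qed
        ultimately show ?thesis using True by (simp add: Lplus_icoc[OF A])
      qed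
    qed
  qed measurable
  hence "(\<lambda>n. \<integral>x. h n x \<partial>bern p) \<longlonglongrightarrow> Lplus p A * prob D" unfolding eq by (simp add: mult.commute)
  from LIMSEQ_unique[OF this l1] have "prob D = 0" using gap by auto
  hence "AE x in bern p. x \<notin> D" by (simp add: prob_eq_0)
  thus ?thesis by (simp add: Dspan f_def)
qed

section \<open>Two-sided exponents and the existence of the splitting\<close>

lemma tendsto_int_iff_at_top:
  fixes f :: "int \<Rightarrow> real"
  shows "(f \<longlongrightarrow> L) at_top \<longleftrightarrow> (\<lambda>n. f (int n)) \<longlonglongrightarrow> L"
proof
  assume "(f \<longlongrightarrow> L) at_top"
  thus "(\<lambda>n. f (int n)) \<longlonglongrightarrow> L" by (rule filterlim_compose[OF _ filterlim_int_sequentially])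
next
  assume "(\<lambda>n. f (int n)) \<longlonglongrightarrow> L"
  thus "(f \<longlongrightarrow> L) at_top" by (rule filterlim_int_of_nat_at_topD)
qed

lemma tendsto_int_iff_at_bot:
  fixes f :: "int \<Rightarrow> real"
  shows "(f \<longlongrightarrow> L) at_bot \<longleftrightarrow> (\<lambda>n. f (- int n)) \<longlonglongrightarrow> L"
proof -
  have "(f \<longlongrightarrow> L) at_bot \<longleftrightarrow> ((\<lambda>n. f (- n)) \<longlongrightarrow> L) at_top"
    unfolding at_bot_mirror filterlim_filtermap ..
  thus ?thesis by (simp add: tendsto_int_iff_at_top)
qed

lemma ziter_nonneg: "ziter A (int n) x = citer A n x"
  by (simp add: ziter_def)

lemma ziter_neg: "A \<in> GLk \<Longrightarrow> ziter A (- int n) x = citer (icoc A) n (xrev x)"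
  using matrix_inv_eqI[of "mat 1 :: real^2^2" "mat 1"] by (cases "n = 0") (auto simp: ziter_def citer_past)

lemma forward_exponent_iff:
  "((\<lambda>n::int. ln (norm (ziter A n x *v v)) / real_of_int n) \<longlongrightarrow> L) at_top \<longleftrightarrow>
   (\<lambda>n. ln (norm (citer A n x *v v)) / real n) \<longlonglongrightarrow> L"
  by (simp add: tendsto_int_iff_at_top ziter_nonneg)

lemma backward_exponent_iff:
  assumes "A \<in> GLk"
  shows "((\<lambda>n::int. ln (norm (ziter A n x *v v)) / real_of_int n) \<longlongrightarrow> L) at_bot \<longleftrightarrow>
   (\<lambda>n. ln (norm (citer (icoc A) n (xrev x) *v v)) / real n) \<longlonglongrightarrow> - L"
  using tendsto_minus_cancel_left[of "\<lambda>n. ln (norm (citer (icoc A) n (xrev x) *v v)) / real n" L sequentially]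
  by (simp add: tendsto_int_iff_at_bot ziter_neg[OF assms])

definition fdir :: "'a cocycle \<Rightarrow> (int \<Rightarrow> 'a) \<Rightarrow> real^2" where
  "fdir A x = edir (icoc A) (xrev x)"

lemma fdir_nz [simp]: "fdir A x \<noteq> 0" by (simp add: fdir_def)

lemma fdir_measurable: "fdir A \<in> borel_measurable (bern p)" for A :: "'a::finite cocycle"
  unfolding fdir_def[abs_def] by (rule edir_xrev_measurable)

lemma oseledets_edir:
  fixes A :: "'a::finite cocycle"
  assumes A: "A \<in> GLk" and gap: "Lminus p A < Lplus p A"
  shows "oseledets p A (\<lambda>x. span {fdir A x}) (\<lambda>x. span {edir A x})"
  unfolding oseledets_def
proof (intro conjI)
  show "borel_line_field p (\<lambda>x. span {edir A x})"
    unfolding borel_line_field_def by (intro exI[of _ "edir A"]) (simp add: edir_measurable)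
  show "borel_line_field p (\<lambda>x. span {fdir A x})"
    unfolding borel_line_field_def by (intro exI[of _ "fdir A"]) (simp add: fdir_measurable)
  note iA = icoc_GLk[OF A]
  have igap: "Lminus p (icoc A) < Lplus p (icoc A)" using gap by (simp add: Lplus_icoc[OF A])
  have s: "AE x in bern p. P x \<Longrightarrow> AE x in bern p. P (shift x)" for P
    using AE_shift[where k=1 and P=P] by (simp add: shift_def[abs_def])
  show "AE x in bern p. span {fdir A x} \<inter> span {edir A x} = {0} \<and>
        (\<lambda>v. A (x 0) *v v) ` span {fdir A x} = span {fdir A (shift x)} \<and>
        (\<lambda>v. A (x 0) *v v) ` span {edir A x} = span {edir A (shift x)} \<and>
        (\<forall>v\<in>span {fdir A x}. v \<noteq> 0 \<longrightarrow>
           ((\<lambda>n::int. ln (norm (ziter A n x *v v)) / real_of_int n) \<longlongrightarrow> Lplus p A) at_top \<and>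
           ((\<lambda>n::int. ln (norm (ziter A n x *v v)) / real_of_int n) \<longlongrightarrow> Lplus p A) at_bot) \<and>
        (\<forall>v\<in>span {edir A x}. v \<noteq> 0 \<longrightarrow>
           ((\<lambda>n::int. ln (norm (ziter A n x *v v)) / real_of_int n) \<longlongrightarrow> Lminus p A) at_top \<and>
           ((\<lambda>n::int. ln (norm (ziter A n x *v v)) / real_of_int n) \<longlongrightarrow> Lminus p A) at_bot)"
    using AE_good[OF A, of p] s[OF AE_good[OF A, of p]] AE_xrev[OF AE_good[OF iA, of p]] s[OF AE_xrev[OF AE_good[OF iA, of p]]]
      AE_transversal[OF A gap]
  proof eventually_elim
    case (elim x)
    note g = elim(1-4)
    have tr: "fdir A x \<notin> span {edir A x}" using elim(5) by (simp add: fdir_def)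
    have disj: "v \<notin> span {edir A x}" if v: "v \<in> span {fdir A x}" "v \<noteq> 0" for v
    proof
      assume "v \<in> span {edir A x}"
      hence "span {fdir A x} = span {edir A x}" using span_line_eq[OF v(2)] v(1) by metis
      thus False using tr by (metis span_base singletonI)
    qed
    have 1: "span {fdir A x} \<inter> span {edir A x} = {0}" using disj by (auto simp: span_zero)
    have 2: "(\<lambda>v. A (x 0) *v v) ` span {fdir A x} = span {fdir A (shift x)}"
      unfolding fdir_def by (intro line_image GLkD A edir_nz edir_past_equivariant[OF A gap g(3,4)])
    have 3: "(\<lambda>v. A (x 0) *v v) ` span {edir A x} = span {edir A (shift x)}"
      by (intro line_image GLkD A edir_nz edir_equivariant[OF A gap g(1,2)])
    have 4: "(\<lambda>n. ln (norm (citer A n x *v v)) / real n) \<longlonglongrightarrow> Lplus p A"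
      "(\<lambda>n. ln (norm (citer (icoc A) n (xrev x) *v v)) / real n) \<longlonglongrightarrow> - Lplus p A"
      if v: "v \<in> span {fdir A x}" "v \<noteq> 0" for v
      using good_edir(4)[OF A gap g(1) disj[OF v]] good_edir(3)[OF iA igap g(3), of v] v
      by (simp_all add: fdir_def Lplus_icoc[OF A])
    have 5: "(\<lambda>n. ln (norm (citer A n x *v v)) / real n) \<longlonglongrightarrow> Lminus p A"
      "(\<lambda>n. ln (norm (citer (icoc A) n (xrev x) *v v)) / real n) \<longlonglongrightarrow> - Lminus p A"
      if v: "v \<in> span {edir A x}" "v \<noteq> 0" for v
    proof -
      have "v \<notin> span {edir (icoc A) (xrev x)}" using disj v unfolding fdir_def by blast
      thus "(\<lambda>n. ln (norm (citer (icoc A) n (xrev x) *v v)) / real n) \<longlonglongrightarrow> - Lminus p A"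
        using good_edir(4)[OF iA igap g(3), of v] by (simp add: Lplus_icoc[OF A])
      show "(\<lambda>n. ln (norm (citer A n x *v v)) / real n) \<longlonglongrightarrow> Lminus p A"
        by (rule good_edir(3)[OF A gap g(1) v])
    qed
    show ?case unfolding forward_exponent_iff backward_exponent_iff[OF A] by (intro conjI ballI impI 1 2 3 4 5; assumption)
  qed
qed

text \<open>Vectors of the fast line are recognised by their backward exponent, those of the slow
  line by the forward one; \<open>good_span_iff\<close> for \<open>icoc A\<close> and for A
  identifies both lines almost surely.\<close>

lemma oseledets_unique:
  fixes A :: "'a::finite cocycle"
  assumes A: "A \<in> GLk" and gap: "Lminus p A < Lplus p A" and os: "oseledets p A Ep Em"
  shows "AE x in bern p. Ep x = span {fdir A x} \<and> Em x = span {edir A x}"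
proof -
  note iA = icoc_GLk[OF A]
  have igap: "Lminus p (icoc A) < Lplus p (icoc A)" using gap by (simp add: Lplus_icoc[OF A])
  obtain e where e: "\<And>x. e x \<noteq> 0" "\<And>x. Ep x = span {e x}"
    using os unfolding oseledets_def borel_line_field_def by blast
  obtain f where f: "\<And>x. f x \<noteq> 0" "\<And>x. Em x = span {f x}"
    using os unfolding oseledets_def borel_line_field_def by blast
  from os[unfolded oseledets_def, THEN conjunct2, THEN conjunct2] AE_good[OF A, of p] AE_xrev[OF AE_good[OF iA, of p]] show ?thesis
  proof eventually_elim
    case (elim x)
    have 1: "\<forall>v\<in>Ep x. v \<noteq> 0 \<longrightarrow> ((\<lambda>n::int. ln (norm (ziter A n x *v v)) / real_of_int n) \<longlongrightarrow> Lplus p A) at_bot"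
      and 2: "\<forall>v\<in>Em x. v \<noteq> 0 \<longrightarrow> ((\<lambda>n::int. ln (norm (ziter A n x *v v)) / real_of_int n) \<longlongrightarrow> Lminus p A) at_top"
      using elim(1) by blast+
    have "e x \<in> Ep x" "f x \<in> Em x" unfolding e f by (simp_all add: span_base)
    hence "e x \<in> span {fdir A x}" "f x \<in> span {edir A x}"
      using 1 2 e(1)[of x] f(1)[of x] good_span_iff[OF A gap elim(2) f(1)] good_span_iff[OF iA igap elim(3) e(1)]
      by (auto simp: forward_exponent_iff backward_exponent_iff[OF A] Lplus_icoc[OF A] fdir_def)
    thus ?case unfolding e f using span_line_eq[OF e(1)] span_line_eq[OF f(1)] by blast
  qed
qed

section \<open>The chosen splitting and its L1 distance in terms of the constructed
  directions\<close>

lemma oseledets_Eplus_Eminus: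
  fixes A :: "'a::finite cocycle"
  assumes A: "A \<in> GLk" and gap: "Lminus p A < Lplus p A"
  shows "oseledets p A (Eplus p A) (Eminus p A)"
proof -
  have "\<exists>E. oseledets p A (fst E) (snd E)" using oseledets_edir[OF A gap] by (metis fst_conv snd_conv)
  thus ?thesis unfolding Eplus_def Eminus_def by (rule someI_ex)
qed

lemma L1dist_eq:
  assumes E: "borel_line_field p E" "AE x in bern p. E x = span {e x}" "\<And>x. e x \<noteq> 0" "AE x in bern p. norm (e x) = 1"
    and F: "borel_line_field p F" "AE x in bern p. F x = span {f x}" "\<And>x. f x \<noteq> 0" "AE x in bern p. norm (f x) = 1"
    and m: "e \<in> borel_measurable (bern p)" "f \<in> borel_measurable (bern p)"
  shows "L1dist p E F = (\<integral>x. \<bar>cr (e x) (f x)\<bar> \<partial>bern p)"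
  unfolding L1dist_def
proof (rule integral_cong_AE)
  show "AE x in bern p. proj_dist (E x) (F x) = \<bar>cr (e x) (f x)\<bar>"
    using E(2,4) F(2,4) by eventually_elim (simp add: proj_dist_span E(3) F(3))
  obtain a where a: "a \<in> borel_measurable (bern p)" "\<And>x. a x \<noteq> 0" "\<And>x. E x = span {a x}"
    using E(1) unfolding borel_line_field_def by blast
  obtain b where b: "b \<in> borel_measurable (bern p)" "\<And>x. b x \<noteq> 0" "\<And>x. F x = span {b x}"
    using F(1) unfolding borel_line_field_def by blast
  note [measurable] = measurable_cr[OF a(1) b(1)] a(1) b(1)
  show "(\<lambda>x. proj_dist (E x) (F x)) \<in> borel_measurable (bern p)"
    unfolding a(3) b(3) proj_dist_span[OF a(2) b(2)] by measurable
  note [measurable] = measurable_cr[OF m]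
  show "(\<lambda>x. \<bar>cr (e x) (f x)\<bar>) \<in> borel_measurable (bern p)" by measurable
qed

text \<open>By uniqueness the choice made by \<open>SOME\<close> changes the lines on a null set
  only. Time reversal preserves the measure, so the distance of fast lines is a distance of slow
  lines of the inverse cocycles, and one modulus of continuity serves both.\<close>

lemma L1dist_Eplus_Eminus:
  fixes A B :: "'a::finite cocycle"
  assumes A: "A \<in> GLk" "Lminus p A < Lplus p A" and B: "B \<in> GLk" "Lminus p B < Lplus p B"
  shows "L1dist p (Eminus p A) (Eminus p B) = (\<integral>x. \<bar>cr (edir A x) (edir B x)\<bar> \<partial>bern p)"
    and "L1dist p (Eplus p A) (Eplus p B) = (\<integral>x. \<bar>cr (edir (icoc A) x) (edir (icoc B) x)\<bar> \<partial>bern p)"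
proof -
  have *: "borel_line_field p (Eplus p A)" "borel_line_field p (Eminus p A)"
    "AE x in bern p. Eplus p A x = span {fdir A x}" "AE x in bern p. Eminus p A x = span {edir A x}"
    "AE x in bern p. norm (edir A x) = 1" "AE x in bern p. norm (fdir A x) = 1"
    if A: "A \<in> GLk" and gap: "Lminus p A < Lplus p A" for A
  proof -
    have o: "oseledets p A (Eplus p A) (Eminus p A)" by (rule oseledets_Eplus_Eminus[OF A gap])
    show "borel_line_field p (Eplus p A)" "borel_line_field p (Eminus p A)" using o by (simp_all add: oseledets_def)
    show "AE x in bern p. Eplus p A x = span {fdir A x}" "AE x in bern p. Eminus p A x = span {edir A x}"
      using oseledets_unique[OF A gap o] by auto
    show "AE x in bern p. norm (edir A x) = 1" using AE_good[OF A, of p] by eventually_elim (rule good_edir(1)[OF A gap])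
    have igap: "Lminus p (icoc A) < Lplus p (icoc A)" using gap by (simp add: Lplus_icoc[OF A])
    show "AE x in bern p. norm (fdir A x) = 1" unfolding fdir_def using AE_xrev[OF AE_good[OF icoc_GLk[OF A], of p]]
      by eventually_elim (rule good_edir(1)[OF icoc_GLk[OF A] igap])
  qed
  show "L1dist p (Eminus p A) (Eminus p B) = (\<integral>x. \<bar>cr (edir A x) (edir B x)\<bar> \<partial>bern p)"
    by (rule L1dist_eq) (use *[OF A] *[OF B] edir_measurable in auto)
  have "L1dist p (Eplus p A) (Eplus p B) = (\<integral>x. \<bar>cr (fdir A x) (fdir B x)\<bar> \<partial>bern p)"
    by (rule L1dist_eq) (use *[OF A] *[OF B] edir_xrev_measurable in \<open>auto simp: fdir_def[abs_def]\<close>)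
  also have "\<dots> = (\<integral>x. \<bar>cr (edir (icoc A) x) (edir (icoc B) x)\<bar> \<partial>bern p)"
  proof -
    note [measurable] = measurable_cr[OF edir_measurable[of "icoc A" p] edir_measurable[of "icoc B" p]]
    have "(\<lambda>x. \<bar>cr (edir (icoc A) x) (edir (icoc B) x)\<bar>) \<in> borel_measurable (bern p)" by measurable
    from integral_bern_reindex[OF _ this, of "\<lambda>i. - 1 - i"] show ?thesis
      by (simp add: inj_def fdir_def xrev_def)
  qed
  finally show "L1dist p (Eplus p A) (Eplus p B) = (\<integral>x. \<bar>cr (edir (icoc A) x) (edir (icoc B) x)\<bar> \<partial>bern p)" .
qed

section \<open>Deterministic vectors in the slow direction\<close>

text \<open>Prescribing the letter at time 0 amounts to conditioning on an event of positive
  probability, by full support, so null sets remain null.\<close>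

lemma AE_bcons:
  fixes p :: "'a::finite pmf"
  assumes sup: "set_pmf p = UNIV" and P: "AE x in bern p. P x"
  shows "AE x in bern p. P (bcons j x)"
proof -
  interpret prob_space "bern p" by (rule prob_space_bern)
  obtain N where N: "{x. \<not> P x} \<subseteq> N" "N \<in> sets (bern p)" "emeasure (bern p) N = 0"
    using AE_E[OF P] by auto
  note [measurable] = N(2)
  have "(\<integral>x. indicator N x \<partial>bern p) = (\<Sum>j\<in>UNIV. pmf p j * (\<integral>x. indicator N (bcons j x) \<partial>bern p))"
    by (rule integral_bcons[of _ _ 1]) (auto simp: indicator_def)
  moreover have "(\<integral>x. indicator N x \<partial>bern p) = (0::real)" using N by (simp add: measure_def)
  ultimately have "(\<Sum>j\<in>UNIV. pmf p j * (\<integral>x. indicator N (bcons j x) \<partial>bern p)) = 0" by simp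
  hence "\<forall>j\<in>UNIV. pmf p j * (\<integral>x. indicator N (bcons j x) \<partial>bern p) = 0"
    by (subst (asm) sum_nonneg_eq_0_iff) (auto intro!: mult_nonneg_nonneg Bochner_Integration.integral_nonneg)
  moreover have "pmf p j > 0" using sup by (simp add: pmf_positive)
  ultimately have "(\<integral>x. indicator N (bcons j x) \<partial>bern p) = (0::real)" by (metis UNIV_I less_irrefl mult_eq_0_iff)
  moreover have m: "(\<lambda>x. indicator N (bcons j x) :: real) \<in> borel_measurable (bern p)"
    by (rule measurable_compose[OF measurable_bcons]) measurable
  hence "integrable (bern p) (\<lambda>x. indicator N (bcons j x) :: real)"
    by (rule integrable_bounded_bern[of _ _ 1]) (auto simp: indicator_def)
  ultimately have "AE x in bern p. indicator N (bcons j x) = (0::real)"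
    by (subst (asm) integral_nonneg_eq_0_iff_AE) auto
  thus ?thesis by eventually_elim (use N(1) in \<open>auto simp: indicator_def split: if_splits\<close>)
qed

lemma word_shift_bcons: "word n (shift (bcons j x)) = word n x"
  by (simp add: word_def shift_def bcons_def)

lemma cdir_word_cong: "(\<And>n. word n x = word n y) \<Longrightarrow> cdir A n x = cdir A n y"
  by (induction n) (auto simp: citer_wprod simp del: citer.simps)

lemma edir_word_cong: "(\<And>n. word n x = word n y) \<Longrightarrow> edir A x = edir A y"
  using cdir_word_cong[of x y A] by (simp add: edir_def)

lemma cdir_word: "\<exists>F. \<forall>x. cdir A n x = F (word n x)"
proof (induction n)
  case (Suc n)
  then obtain F where F: "\<And>x. cdir A n x = F (word n x)" by blast
  show ?case
    by (intro exI[of _ "\<lambda>w. let u = contr (wprod A w) in if 0 \<le> u \<bullet> F (butlast w) then u else - u"])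
       (simp add: F citer_wprod word_Suc del: citer.simps)
qed auto

definition slow :: "'a::finite pmf \<Rightarrow> 'a cocycle \<Rightarrow> real^2 \<Rightarrow> real" where
  "slow p A v = measure (bern p) {x. cr (edir A x) v = 0}"

lemma slow_set: "{x. cr (edir A x) v = 0} \<in> sets (bern p)" for A :: "'a::finite cocycle"
proof -
  have [measurable]: "(\<lambda>x. cr (edir A x) v) \<in> borel_measurable (bern p)"
    by (intro measurable_cr edir_measurable borel_measurable_const)
  show ?thesis unfolding sets_bern_Collect by measurable
qed

text \<open>By equivariance v lies on the slow line iff its image after n steps lies on the slow
  line of the shifted point, which depends on later letters only. Conditioning on the first n
  letters thus replaces the indicator by \<open>slow\<close> at the image of v.\<close>

lemma slow_word:
  fixes A :: "'a::finite cocycle"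
  assumes A: "A \<in> GLk" and gap: "Lminus p A < Lplus p A" and sup: "set_pmf p = UNIV"
  shows "(\<integral>x. indicator {x. cr (edir A x) v = 0} x * G (word n x) \<partial>bern p) = EW p n (\<lambda>w. G w * slow p A (wprod A w *v v))"
proof (induction n arbitrary: G v)
  case 0
  show ?case by (simp add: slow_def)
next
  case (Suc n)
  let ?S = "\<lambda>v. {x. cr (edir A x) v = 0}"
  note [measurable] = slow_set
  have gm [measurable]: "(\<lambda>x. G (word m x)) \<in> borel_measurable (bern p)" for m by (rule borel_measurable_word)
  obtain C where C: "C > 0" "\<And>w. length w = Suc n \<Longrightarrow> \<bar>G w\<bar> \<le> C" using list_fun_bounded[of "Suc n" G] by blast
  have mm: "(\<lambda>x. indicator (?S v) x * G (word (Suc n) x)) \<in> borel_measurable (bern p)" by measurable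
  have "(\<integral>x. indicator (?S v) x * G (word (Suc n) x) \<partial>bern p) =
      (\<Sum>j\<in>UNIV. pmf p j * (\<integral>x. indicator (?S v) (bcons j x) * G (word (Suc n) (bcons j x)) \<partial>bern p))"
    by (rule integral_bcons[OF mm, of C]) (use C in \<open>auto simp: indicator_def\<close>)
  also have "\<dots> = (\<Sum>j\<in>UNIV. pmf p j * (\<integral>x. indicator (?S (A j *v v)) x * G (j # word n x) \<partial>bern p))"
  proof (intro sum.cong refl arg_cong2[where f="(*)"] integral_cong_AE)
    fix j
    show "(\<lambda>x. indicator (?S v) (bcons j x) * G (word (Suc n) (bcons j x))) \<in> borel_measurable (bern p)"
      by (rule measurable_compose[OF measurable_bcons mm])
    have [measurable]: "(\<lambda>x. G (j # word n x)) \<in> borel_measurable (bern p)" by (rule borel_measurable_word)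
    show "(\<lambda>x. indicator (?S (A j *v v)) x * G (j # word n x)) \<in> borel_measurable (bern p)" by measurable
    have s: "AE x in bern p. P x \<Longrightarrow> AE x in bern p. P (shift x)" for P
      using AE_shift[where k=1 and P=P] by (simp add: shift_def[abs_def])
    show "AE x in bern p. indicator (?S v) (bcons j x) * G (word (Suc n) (bcons j x)) = indicator (?S (A j *v v)) x * G (j # word n x)"
      using AE_bcons[OF sup AE_good[OF A], of j] AE_bcons[OF sup s[OF AE_good[OF A]], of j]
    proof eventually_elim
      case (elim x)
      have "bcons j x 0 = j" by (simp add: bcons_def)
      moreover have "edir A (shift (bcons j x)) = edir A x" by (rule edir_word_cong[OF word_shift_bcons])
      ultimately have "A j *v edir A (bcons j x) \<in> span {edir A x}" using edir_equivariant[OF A gap elim] by simp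
      then obtain c where c: "A j *v edir A (bcons j x) = c *\<^sub>R edir A x" by (auto simp: span_singleton)
      have "c \<noteq> 0" using c matvec_pos[OF GLkD[OF A, of j] edir_nz, of A "bcons j x"] by auto
      moreover have "det (A j) * cr (edir A (bcons j x)) v = c * cr (edir A x) (A j *v v)"
        unfolding cr_matvec[symmetric] c by simp
      ultimately have "cr (edir A (bcons j x)) v = 0 \<longleftrightarrow> cr (edir A x) (A j *v v) = 0"
        using A by (auto simp: GLk_det)
      thus ?case by (simp add: word_bcons indicator_def)
    qed
  qed
  also have "\<dots> = (\<Sum>j\<in>UNIV. pmf p j * EW p n (\<lambda>w. G (j # w) * slow p A (wprod A w *v (A j *v v))))"
    by (intro sum.cong refl arg_cong2[where f="(*)"] Suc.IH)
  also have "\<dots> = EW p (Suc n) (\<lambda>w. G w * slow p A (wprod A w *v v))"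
    by (simp add: matrix_vector_mul_assoc)
  finally show ?case .
qed

text \<open>Different lines give disjoint events, so a strictly increasing sequence of values
  starting at a positive level would exhaust the total mass.\<close>

lemma slow_max_exists:
  fixes A :: "'a::finite cocycle"
  assumes v0: "v0 \<noteq> 0" "slow p A v0 > 0"
  shows "\<exists>v. v \<noteq> 0 \<and> slow p A v > 0 \<and> (\<forall>w. w \<noteq> 0 \<longrightarrow> slow p A w \<le> slow p A v)"
proof (rule ccontr)
  interpret prob_space "bern p" by (rule prob_space_bern)
  assume neg: "\<not> ?thesis"
  define P where "P v \<longleftrightarrow> v \<noteq> 0 \<and> slow p A v \<ge> slow p A v0" for v
  have "\<exists>w. P w \<and> slow p A v < slow p A w" if "P v" for v
  proof -
    have "v \<noteq> 0 \<and> slow p A v > 0" using that v0 by (auto simp: P_def)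
    then obtain w where "w \<noteq> 0" "slow p A v < slow p A w" using neg by (auto simp: not_le)
    thus ?thesis using that by (auto simp: P_def intro!: exI[of _ w])
  qed
  moreover have "P v0" using v0 by (simp add: P_def)
  ultimately obtain V where V: "\<And>n. P (V n)" "\<And>n. slow p A (V n) < slow p A (V (Suc n))"
    using dependent_nat_choice[of "\<lambda>_. P" "\<lambda>_ v w. slow p A v < slow p A w"] by metis
  have inc: "slow p A (V m) < slow p A (V n)" if "m < n" for m n
    using lift_Suc_mono_less[of "\<lambda>n. slow p A (V n)"] V(2) that by blast
  define S where "S n = {x. cr (edir A x) (V n) = 0}" for n
  have "disjoint_family S"
    unfolding disjoint_family_on_def
  proof (intro ballI impI)
    fix m n :: nat assume "m \<noteq> n"
    show "S m \<inter> S n = {}"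
    proof (rule ccontr)
      assume "S m \<inter> S n \<noteq> {}"
      then obtain x where x: "cr (edir A x) (V m) = 0" "cr (edir A x) (V n) = 0" by (auto simp: S_def)
      obtain a b where ab: "V m = a *\<^sub>R edir A x" "V n = b *\<^sub>R edir A x"
        using x by (auto simp: span_eq_iff_cr[OF edir_nz, symmetric] span_singleton)
      have "a \<noteq> 0" "b \<noteq> 0" using ab V(1)[of m] V(1)[of n] by (auto simp: P_def)
      hence "slow p A (V m) = slow p A (V n)" by (simp add: slow_def ab)
      thus False using inc[of m n] inc[of n m] \<open>m \<noteq> n\<close> by (metis less_irrefl nat_neq_iff)
    qed
  qed
  moreover have "range S \<subseteq> sets (bern p)" by (auto simp: S_def slow_set)
  ultimately have "(\<lambda>n. prob (S n)) sums prob (\<Union>n. S n)" by (intro finite_measure_UNION)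
  hence "(\<lambda>n. prob (S n)) \<longlonglongrightarrow> 0" by (intro summable_LIMSEQ_zero sums_summable)
  hence "eventually (\<lambda>n. prob (S n) < slow p A v0) sequentially" using v0 by (intro order_tendstoD) auto
  then obtain n where "prob (S n) < slow p A v0" by (auto simp: eventually_sequentially)
  thus False using V(1)[of n] by (simp add: P_def S_def slow_def)
qed

text \<open>For v maximising the probability q of lying in the slow line, that event is independent of every
  finite prefix, hence of the approximating directions and of the slow line itself; so q = 1.\<close>
lemma slow_dichotomy:
  fixes A :: "'a::finite cocycle"
  assumes A: "A \<in> GLk" and gap: "Lminus p A < Lplus p A" and sup: "set_pmf p = UNIV"
  obtains (never) "\<And>v. v \<noteq> 0 \<Longrightarrow> AE x in bern p. v \<notin> span {edir A x}"
  | (always) v where "v \<noteq> 0" "\<And>j. A j *v v \<in> span {v}" "AE x in bern p. v \<in> span {edir A x}"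
proof (cases "\<forall>v. v \<noteq> 0 \<longrightarrow> slow p A v = 0")
  case True
  interpret prob_space "bern p" by (rule prob_space_bern)
  have "AE x in bern p. v \<notin> span {edir A x}" if "v \<noteq> 0" for v
    using True[rule_format, OF that] slow_set[of A v p] unfolding slow_def
    by (subst (asm) prob_eq_0) (auto simp: span_eq_iff_cr)
  thus ?thesis by (rule never)
next
  case False
  interpret prob_space "bern p" by (rule prob_space_bern)
  note [measurable] = slow_set
  obtain v0 where "v0 \<noteq> 0" "slow p A v0 > 0" using False by (auto simp: slow_def zero_less_measure_iff)
  from slow_max_exists[OF this] obtain v where v: "v \<noteq> 0" "slow p A v > 0" "\<And>w. w \<noteq> 0 \<Longrightarrow> slow p A w \<le> slow p A v" by blast
  have nz: "wprod A w *v v \<noteq> 0" if "v \<noteq> 0" for w v using matvec_pos[OF invertible_wprod[OF A] that] by auto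
  have nzj: "A j *v v \<noteq> 0" if "v \<noteq> 0" for j v using matvec_pos[OF GLkD[OF A] that] by auto
  \<comment> \<open>Maximum principle: the value at u is an average, with positive weights, of the
    values at its images, and none of these exceeds the maximum.\<close>
  have step: "slow p A (A j *v u) = slow p A v" if u: "u \<noteq> 0" "slow p A u = slow p A v" for j u
  proof -
    have "slow p A u = (\<Sum>j\<in>UNIV. pmf p j * slow p A (A j *v u))"
      using slow_word[OF A gap sup, of u "\<lambda>_. 1" 1] by (simp add: slow_def matrix_mul_lid)
    hence "(\<Sum>j\<in>UNIV. pmf p j * (slow p A v - slow p A (A j *v u))) = 0"
      using u by (simp add: right_diff_distrib sum_subtractf sum_pmf_UNIV flip: sum_distrib_right)
    hence "\<forall>j\<in>UNIV. pmf p j * (slow p A v - slow p A (A j *v u)) = 0"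
      using v(3) nzj[OF u(1)] by (subst (asm) sum_nonneg_eq_0_iff) auto
    moreover have "pmf p j > 0" using sup by (simp add: pmf_positive)
    ultimately show ?thesis by (metis UNIV_I eq_iff_diff_eq_0 less_irrefl mult_eq_0_iff)
  qed
  have words: "slow p A (wprod A w *v u) = slow p A v" if "u \<noteq> 0" "slow p A u = slow p A v" for w u
    using that
  proof (induction w arbitrary: u)
    case (Cons j w)
    have "slow p A (wprod A w *v (A j *v u)) = slow p A v" using Cons.prems by (intro Cons.IH nzj step)
    thus ?case by (simp add: matrix_vector_mul_assoc)
  qed simp
  let ?S = "{x. cr (edir A x) v = 0}"
  have crm: "(\<lambda>x. cr (cdir A n x) v) \<in> borel_measurable (bern p)" for n
    by (intro measurable_cr cdir_measurable borel_measurable_const)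
  have crm': "(\<lambda>x. cr (edir A x) v) \<in> borel_measurable (bern p)"
    by (intro measurable_cr edir_measurable borel_measurable_const)
  note [measurable] = crm crm'
  have bd: "\<bar>cr (cdir A n x) v\<bar> \<le> norm v" for n x using cr_le_norm[of "cdir A n x" v] cdir(1)[OF A, of n x] by simp
  \<comment> \<open>All images of v have the same probability, which makes the event independent of
    the first n letters and so of \<open>cdir A n\<close>.\<close>
  have eq: "(\<integral>x. indicator ?S x * \<bar>cr (cdir A n x) v\<bar> \<partial>bern p) = slow p A v * (\<integral>x. \<bar>cr (cdir A n x) v\<bar> \<partial>bern p)" for n
  proof -
    obtain F where F: "\<And>x. cdir A n x = F (word n x)" using cdir_word by blast
    have "(\<integral>x. indicator ?S x * \<bar>cr (cdir A n x) v\<bar> \<partial>bern p) = EW p n (\<lambda>w. \<bar>cr (F w) v\<bar> * slow p A (wprod A w *v v))"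
      unfolding F by (rule slow_word[OF A gap sup])
    also have "\<dots> = slow p A v * EW p n (\<lambda>w. \<bar>cr (F w) v\<bar>)"
      by (simp add: words[OF v(1)] mult.commute[of _ "slow p A v"] EW_cmult)
    also have "EW p n (\<lambda>w. \<bar>cr (F w) v\<bar>) = (\<integral>x. \<bar>cr (cdir A n x) v\<bar> \<partial>bern p)"
      unfolding F by (rule integral_word[symmetric])
    finally show ?thesis .
  qed
  have lim: "AE x in bern p. (\<lambda>n. \<bar>cr (cdir A n x) v\<bar>) \<longlonglongrightarrow> \<bar>cr (edir A x) v\<bar>"
    using AE_good[OF A, of p] by eventually_elim (intro tendsto_rabs tendsto_cr good_edir(2)[OF A gap] tendsto_const)
  have l1: "(\<lambda>n. \<integral>x. \<bar>cr (cdir A n x) v\<bar> \<partial>bern p) \<longlonglongrightarrow> (\<integral>x. \<bar>cr (edir A x) v\<bar> \<partial>bern p)"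
    by (rule bounded_convergence_bern[of _ _ _ "norm v"]) (use bd lim in auto)
  have l2: "(\<lambda>n. \<integral>x. indicator ?S x * \<bar>cr (cdir A n x) v\<bar> \<partial>bern p) \<longlonglongrightarrow> (\<integral>x. indicator ?S x * \<bar>cr (edir A x) v\<bar> \<partial>bern p)"
  proof (rule bounded_convergence_bern[of _ _ _ "norm v"])
    show "AE x in bern p. (\<lambda>n. indicator ?S x * \<bar>cr (cdir A n x) v\<bar>) \<longlonglongrightarrow> indicator ?S x * \<bar>cr (edir A x) v\<bar>"
      using lim by eventually_elim (intro tendsto_mult tendsto_const)
    show "\<bar>indicator ?S x * \<bar>cr (cdir A n x) v\<bar>\<bar> \<le> norm v" for n x using bd[of n x] by (simp add: indicator_def)
  qed measurable
  \<comment> \<open>On the event the slow direction is parallel to v, so the left side of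
    \<open>eq\<close> vanishes in the limit; the right side tends to q times the mean of |cr (edir A
    x) v|.\<close>
  have "(\<lambda>x. indicator ?S x * \<bar>cr (edir A x) v\<bar>) = (\<lambda>x. 0::real)" by (auto simp: indicator_def)
  hence "slow p A v * (\<integral>x. \<bar>cr (edir A x) v\<bar> \<partial>bern p) = 0"
    using LIMSEQ_unique[OF l2[unfolded eq] tendsto_mult[OF tendsto_const l1]] by simp
  hence i0: "(\<integral>x. \<bar>cr (edir A x) v\<bar> \<partial>bern p) = 0" using v(2) by simp
  have "integrable (bern p) (\<lambda>x. \<bar>cr (edir A x) v\<bar>)"
  proof -
    have "AE x in bern p. norm \<bar>cr (edir A x) v\<bar> \<le> norm v"
      using AE_good[OF A, of p]
    proof eventually_elim
      case (elim x)
      show ?case using cr_le_norm[of "edir A x" v] good_edir(1)[OF A gap elim] by simp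
    qed
    thus ?thesis by (rule integrable_const_bound) measurable
  qed
  hence alw: "AE x in bern p. cr (edir A x) v = 0" using i0
    by (subst (asm) integral_nonneg_eq_0_iff_AE) auto
  hence q1: "slow p A v = 1" unfolding slow_def by (subst prob_eq_1) auto
  have "A j *v v \<in> span {v}" for j
  proof -
    have "slow p A (A j *v v) = 1" using step[OF v(1) refl] q1 by simp
    hence "AE x in bern p. cr (edir A x) (A j *v v) = 0" unfolding slow_def by (subst (asm) prob_eq_1) auto
    with alw have "AE x in bern p. cr v (A j *v v) = 0"
    proof eventually_elim
      case (elim x)
      thus ?case by (auto simp: span_eq_iff_cr[OF edir_nz, symmetric] span_singleton)
    qed
    hence "cr v (A j *v v) = 0" by (rule AE_bern_const)
    thus ?thesis using v(1) by (simp add: span_eq_iff_cr)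
  qed
  moreover have "AE x in bern p. v \<in> span {edir A x}" using alw by eventually_elim (simp add: span_eq_iff_cr)
  ultimately show ?thesis using v(1) by (intro always[of v]) auto
qed

section \<open>Contraction along words\<close>

text \<open>The product of the factors g along the trajectory of v. When each factor is, up to a
  determinant, the quotient of one function at the image and at the point, the product telescopes;
  see \<open>cw_lrat\<close> and \<open>cw_gg\<close>.\<close>

primrec cw :: "('a \<Rightarrow> 'v \<Rightarrow> real) \<Rightarrow> ('a \<Rightarrow> 'v \<Rightarrow> 'v) \<Rightarrow> 'a list \<Rightarrow> 'v \<Rightarrow> real" where
  "cw g act [] v = 1"
| "cw g act (j # w) v = g j v * cw g act w (act j v)"

lemma cw_append: "cw g act (u @ w) v = cw g act u v * cw g act w (fold act u v)"
  by (induction u arbitrary: v) auto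

text \<open>The trajectory is restarted after each contracting block. The length i of a block
  depends on the current vector but is at most N, so the factor \<kappa> is at most the i-th power
  of its N-th root; \<open>K ^ N\<close> pays for a last incomplete block.\<close>

lemma variable_step_contraction:
  assumes inv: "\<And>j v. v \<in> V \<Longrightarrow> act j v \<in> V" and g0: "\<And>j v. v \<in> V \<Longrightarrow> 0 \<le> g j v"
    and gK: "\<And>j v. v \<in> V \<Longrightarrow> g j v \<le> K" and K: "1 \<le> K" and k: "0 < \<kappa>" "\<kappa> < 1" and N: "1 \<le> N"
    and step: "\<And>v. v \<in> V \<Longrightarrow> \<exists>i\<in>{1..N}. EW p i (\<lambda>w. cw g act w v) \<le> \<kappa>"
    and v: "v \<in> V"
  shows "EW p n (\<lambda>w. cw g act w v) \<le> K ^ N / \<kappa> * root N \<kappa> ^ n"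
proof -
  have fV: "fold act w v \<in> V" if "v \<in> V" for w v
    using that by (induction w arbitrary: v) (auto intro: inv)
  have c0: "0 \<le> cw g act w v" if "v \<in> V" for w v
    using that by (induction w arbitrary: v) (auto intro!: mult_nonneg_nonneg g0 inv)
  have cK: "cw g act w v \<le> K ^ length w" if "v \<in> V" for w v
    using that
  proof (induction w arbitrary: v)
    case (Cons j w)
    show ?case using Cons K by (auto intro!: mult_mono gK c0 inv)
  qed simp
  define k' where "k' = root N \<kappa>"
  have k': "0 < k'" "k' < 1" "k' ^ N = \<kappa>" using k N by (auto simp: k'_def)
  define C where "C = K ^ N / \<kappa>"
  have C: "C \<ge> 0" using K k by (simp add: C_def)
  have "EW p n (\<lambda>w. cw g act w v) \<le> C * k' ^ n"
    using v
  proof (induction n arbitrary: v rule: less_induct)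
    case (less n)
    obtain i where i: "1 \<le> i" "i \<le> N" "EW p i (\<lambda>w. cw g act w v) \<le> \<kappa>" using step[OF less.prems] by auto
    show ?case
    proof (cases "n < i")
      case True
      have "EW p n (\<lambda>w. cw g act w v) \<le> EW p n (\<lambda>w. K ^ n)"
        by (rule EW_mono) (use cK[OF less.prems] in auto)
      also have "\<dots> \<le> K ^ N" using True i K by (auto intro: power_increasing)
      also have "\<dots> = C * k' ^ N" using k by (simp add: C_def k')
      also have "\<dots> \<le> C * k' ^ n" using True i k' C by (intro mult_left_mono power_decreasing) auto
      finally show ?thesis .
    next
      case False
      then obtain l where l: "n = i + l" using le_Suc_ex not_less by blast
      have "EW p n (\<lambda>w. cw g act w v) = EW p i (\<lambda>u. cw g act u v * EW p l (\<lambda>w. cw g act w (fold act u v)))"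
        by (simp add: l EW_append cw_append EW_cmult)
      also have "\<dots> \<le> EW p i (\<lambda>u. cw g act u v * (C * k' ^ l))"
        by (intro EW_mono mult_left_mono less.IH c0 less.prems fV) (use i l in auto)
      also have "\<dots> = EW p i (\<lambda>u. cw g act u v) * (C * k' ^ l)"
        by (simp only: mult.commute[of _ "C * k' ^ l"] EW_cmult)
      also have "\<dots> \<le> k' ^ i * (C * k' ^ l)"
      proof (rule mult_right_mono)
        have "\<kappa> \<le> k' ^ i" using k' i power_decreasing[of i N k'] by simp
        thus "EW p i (\<lambda>u. cw g act u v) \<le> k' ^ i" using i by simp
      qed (use C k' in auto)
      also have "\<dots> = C * k' ^ n" by (simp add: l power_add)
      finally show ?thesis .
    qed
  qed
  thus ?thesis by (simp add: C_def k'_def)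
qed

text \<open>The logarithm of the derivative, at the direction of v, of the projective map of the
  word. A negative mean says that the direction v expands relative to the area.\<close>

definition lrat :: "'a cocycle \<Rightarrow> real^2 \<Rightarrow> 'a list \<Rightarrow> real" where
  "lrat B v w = ln \<bar>det (wprod B w)\<bar> + 2 * ln (norm v) - 2 * ln (norm (wprod B w *v v))"

definition lbd2 :: "'a::finite cocycle \<Rightarrow> real" where
  "lbd2 A = 2 * lbd A + (\<Sum>j\<in>UNIV. \<bar>ln \<bar>det (A j)\<bar>\<bar>)"

lemma lrat_bound:
  fixes B :: "'a::finite cocycle"
  assumes B: "B \<in> GLk" and v: "v \<noteq> 0"
  shows "\<bar>lrat B v w\<bar> \<le> lbd2 B * real (length w)"
proof -
  have "\<bar>ln \<bar>det (B j)\<bar>\<bar> \<le> (\<Sum>j\<in>UNIV. \<bar>ln \<bar>det (B j)\<bar>\<bar>)" for j by (rule member_le_sum) auto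
  hence "\<bar>sum_list (map (\<lambda>j. ln \<bar>det (B j)\<bar>) w)\<bar> \<le> (\<Sum>j\<in>UNIV. \<bar>ln \<bar>det (B j)\<bar>\<bar>) * real (length w)"
    by (induction w) (auto simp: algebra_simps intro!: order_trans[OF abs_triangle_ineq] add_mono)
  thus ?thesis using ln_matvec_bound[OF B v, of w] unfolding lrat_def ln_det_wprod[OF B] lbd2_def
    by (simp add: algebra_simps)
qed

lemma tendsto_matrix_inv:
  assumes A: "A \<in> GLk" shows "((\<lambda>B. matrix_inv (B j)) \<longlongrightarrow> matrix_inv (A j)) (nbh (A :: 'a::finite cocycle))"
proof -
  define adj :: "real^2^2 \<Rightarrow> real^2^2" where "adj M = (\<chi> i k. if i = 1 then (if k = 1 then M$2$2 else - M$1$2) else (if k = 1 then - M$2$1 else M$1$1))" for M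
  have inv: "matrix_inv M = (1 / det M) *\<^sub>R adj M" if "invertible M" for M :: "real^2^2"
  proof (rule matrix_inv_eqI)
    have d: "det M \<noteq> 0" using that by (simp add: invertible_det_nz)
    have 1: "M ** adj M = det M *\<^sub>R mat 1" "adj M ** M = det M *\<^sub>R mat 1"
      by (simp_all add: vec_eq_iff forall_2 matrix_matrix_mult_def sum_2 adj_def det_2 mat_def algebra_simps)
    have s: "M ** (c *\<^sub>R N) = c *\<^sub>R (M ** N)" "(c *\<^sub>R N) ** M = c *\<^sub>R (N ** M)" for c and N :: "real^2^2"
      by (simp_all add: vec_eq_iff matrix_matrix_mult_def sum_2 algebra_simps)
    show "M ** ((1 / det M) *\<^sub>R adj M) = mat 1" "((1 / det M) *\<^sub>R adj M) ** M = mat 1"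
      using d by (simp_all add: s 1)
  qed
  have "((\<lambda>B. (1 / det (B j)) *\<^sub>R adj (B j)) \<longlongrightarrow> (1 / det (A j)) *\<^sub>R adj (A j)) (nbh A)"
  proof (intro tendsto_scaleR tendsto_divide tendsto_const tendsto_det tendsto_nbh)
    show "det (A j) \<noteq> 0" using A by (simp add: GLk_det)
    show "((\<lambda>B. adj (B j)) \<longlongrightarrow> adj (A j)) (nbh A)"
      unfolding adj_def by (intro tendsto_vec_lambda) (auto intro!: tendsto_intros tendsto_nbh)
  qed
  thus ?thesis unfolding inv[OF GLkD[OF A], symmetric]
    by (rule Lim_transform_eventually) (use eventually_GLk[OF A] in \<open>eventually_elim, simp add: inv GLkD\<close>)
qed

lemma tendsto_lbd2:
  assumes A: "A \<in> GLk" shows "(lbd2 \<longlongrightarrow> lbd2 A) (nbh (A :: 'a::finite cocycle))"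
proof -
  have p: "mnorm (A j) \<noteq> 0" "mnorm (matrix_inv (A j)) \<noteq> 0" "\<bar>det (A j)\<bar> \<noteq> 0" for j
    using mnorm_pos[OF GLkD[OF A, of j]] mnorm_pos[OF matrix_inv_cancel(3)[OF GLkD[OF A, of j]]] A by (auto simp: GLk_det)
  show ?thesis unfolding lbd2_def[abs_def] lbd_def
    by (intro tendsto_intros tendsto_ln tendsto_mnorm tendsto_det tendsto_nbh tendsto_matrix_inv A p)
qed

lemma rat_le_lrat:
  fixes B :: "'a::finite cocycle"
  assumes B: "B \<in> GLk" and v: "v \<noteq> 0" and a: "0 \<le> a"
  shows "rat (wprod B w) powr a \<le> exp (a * lrat B v w)"
proof -
  note inv = invertible_wprod[OF B, of w]
  have p: "norm (wprod B w *v v) > 0" by (rule matvec_pos[OF inv v])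
  have "ln (norm (wprod B w *v v)) \<le> ln (mnorm (wprod B w) * norm v)" by (rule ln_mono[OF mnorm_bound p])
  also have "\<dots> = ln (mnorm (wprod B w)) + ln (norm v)" using mnorm_pos[OF inv] v by (intro ln_mult_pos) auto
  finally have "ln (rat (wprod B w)) \<le> lrat B v w"
    using mnorm_pos[OF inv] inv by (simp add: rat_def ln_div ln_realpow lrat_def invertible_det_nz)
  thus ?thesis using a rat_pos[OF inv] by (simp add: powr_def mult_left_mono)
qed

lemma cw_lrat:
  fixes B :: "'a::finite cocycle"
  assumes B: "B \<in> GLk" and v: "v \<noteq> 0"
  shows "cw (\<lambda>j v. exp (a * lrat B v [j])) (\<lambda>j v. B j *v v) w v = exp (a * lrat B v w)"
  using v
proof (induction w arbitrary: v)
  case (Cons j w)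
  have nz: "B j *v v \<noteq> 0" using matvec_pos[OF GLkD[OF B] Cons.prems] by auto
  have "ln \<bar>det (wprod B (j # w))\<bar> = ln \<bar>det (B j)\<bar> + ln \<bar>det (wprod B w)\<bar>"
    by (simp only: ln_det_wprod[OF B] list.map sum_list.Cons)
  hence "lrat B v (j # w) = lrat B v [j] + lrat B (B j *v v) w"
    by (simp add: lrat_def matrix_mul_lid matrix_vector_mul_assoc)
  thus ?case using Cons.IH[OF nz] by (simp add: mult_exp_exp distrib_left)
qed (simp add: lrat_def det_I)

lemma lrat_scale:
  assumes B: "B \<in> GLk" and v: "v \<noteq> 0" and c: "c > 0"
  shows "lrat B (c *\<^sub>R v) w = lrat B v w"
  using matvec_pos[OF invertible_wprod[OF B] v, of w] v c
  by (simp add: lrat_def matrix_vector_mult_scaleR ln_mult_pos)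

text \<open>Every direction expands on average after some number of steps; that number is bounded by
  compactness of the circle, hence stable under perturbation.\<close>
lemma estimate_if_never_slow:
  fixes A :: "'a::finite cocycle"
  assumes A: "A \<in> GLk" and gap: "Lminus p A < Lplus p A"
    and never: "\<And>v. v \<noteq> 0 \<Longrightarrow> AE x in bern p. v \<notin> span {edir A x}"
  shows "\<exists>a C \<kappa>. 0 < a \<and> a \<le> 1 \<and> 0 < \<kappa> \<and> \<kappa> < 1 \<and>
    eventually (\<lambda>B. B \<in> GLk \<longrightarrow> (\<forall>n. EW p n (\<lambda>w. rat (wprod B w) powr a) \<le> C * \<kappa> ^ n)) (nbh A)"
proof -
  \<comment> \<open>As v is almost surely off the slow line, \<open>lrat\<close> divided by n tends
    to L- - L+ < 0, also in the mean because the quotients are bounded.\<close>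
  have ex: "\<exists>n\<ge>1. EW p n (lrat A v) < 0" if v: "norm v = 1" for v
  proof -
    have v0: "v \<noteq> 0" using v by auto
    have meas: "(\<lambda>x. lrat A v (word n x) / real n) \<in> borel_measurable (bern p)" for n by (rule borel_measurable_word)
    have "(\<lambda>n. \<integral>x. lrat A v (word n x) / real n \<partial>bern p) \<longlonglongrightarrow> (\<integral>x. Lminus p A - Lplus p A \<partial>bern p)"
    proof (rule bounded_convergence_bern[OF meas, where C="lbd2 A"])
      show "AE x in bern p. (\<lambda>n. lrat A v (word n x) / real n) \<longlonglongrightarrow> Lminus p A - Lplus p A"
        using AE_good[OF A, of p] never[OF v0]
      proof eventually_elim
        case (elim x)
        have "(\<lambda>n. ln \<bar>det (citer A n x)\<bar> / real n - 2 * (ln (norm (citer A n x *v v)) / real n)) \<longlonglongrightarrow> (Lplus p A + Lminus p A) - 2 * Lplus p A"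
          using elim(1) by (intro tendsto_intros good_edir(4)[OF A gap elim]) (simp add: good_def)
        thus ?case by (simp add: lrat_def v citer_wprod diff_divide_distrib)
      qed
      fix n x
      show "\<bar>lrat A v (word n x) / real n\<bar> \<le> lbd2 A"
      proof (cases "n = 0")
        case True
        have "lbd2 A \<ge> 0" using lbd_nonneg[of A] by (auto simp: lbd2_def intro!: add_nonneg_nonneg sum_nonneg)
        thus ?thesis using True by simp
      qed (use lrat_bound[OF A v0, of "word n x"] in \<open>simp add: field_simps\<close>)
    qed simp
    moreover have "(\<integral>x. lrat A v (word n x) / real n \<partial>bern p) = EW p n (\<lambda>w. lrat A v w / real n)" for n
      by (rule integral_word[where F="\<lambda>w. lrat A v w / real n"])
    ultimately have "(\<lambda>n. EW p n (\<lambda>w. lrat A v w / real n)) \<longlonglongrightarrow> Lminus p A - Lplus p A" by simp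
    hence "eventually (\<lambda>n. EW p n (\<lambda>w. lrat A v w / real n) < 0) sequentially" using gap by (intro order_tendstoD) auto
    hence "\<exists>n. EW p n (\<lambda>w. lrat A v w / real n) < 0 \<and> n \<ge> 1"
      by (intro eventually_happens'[OF sequentially_bot eventually_conj] eventually_ge_at_top)
    then obtain n where n: "EW p n (\<lambda>w. lrat A v w / real n) < 0" "n \<ge> 1" by blast
    have "EW p n (\<lambda>w. lrat A v w / real n) = EW p n (lrat A v) / real n"
      using EW_cmult[of p n "1 / real n" "lrat A v"] by simp
    thus ?thesis using n by (auto simp: divide_less_0_iff)
  qed
  have loc: "\<exists>n\<ge>1. \<exists>c>0. \<exists>U. open U \<and> v \<in> U \<and> eventually (\<lambda>B. \<forall>u\<in>U. EW p n (lrat B u) < - c) (nbh A)" if v: "norm v = 1" for v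
  proof -
    obtain n where n: "n \<ge> 1" "EW p n (lrat A v) < 0" using ex[OF v] by blast
    define c where "c = - EW p n (lrat A v) / 2"
    have c: "c > 0" "EW p n (lrat A v) < - c" using n by (auto simp: c_def)
    have v0: "v \<noteq> 0" using v by auto
    have tf: "((\<lambda>z. fst z j) \<longlongrightarrow> A j) (nbh A \<times>\<^sub>F nhds v)" for j
      by (rule filterlim_compose[OF tendsto_nbh filterlim_fst])
    have ts: "(snd \<longlongrightarrow> v) (nbh A \<times>\<^sub>F nhds v)" by (rule filterlim_snd)
    have "((\<lambda>z. EW p n (lrat (fst z) (snd z))) \<longlongrightarrow> EW p n (lrat A v)) (nbh A \<times>\<^sub>F nhds v)"
    proof (rule tendsto_EW)
      fix w :: "'a list"
      have "det (wprod A w) \<noteq> 0" "norm (wprod A w *v v) \<noteq> 0" "norm v \<noteq> 0"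
        using invertible_wprod[OF A, of w] matvec_pos[OF invertible_wprod[OF A] v0, of w] v0 by (auto simp: invertible_det_nz)
      thus "((\<lambda>z. lrat (fst z) (snd z) w) \<longlongrightarrow> lrat A v w) (nbh A \<times>\<^sub>F nhds v)"
        unfolding lrat_def
        by (intro tendsto_intros tendsto_ln tendsto_det tendsto_wprod tf tendsto_norm tendsto_matvec ts) auto
    qed
    from order_tendstoD(2)[OF this c(2)] obtain Pf Pg where P: "eventually Pf (nbh A)" "eventually Pg (nhds v)"
      "\<And>B u. Pf B \<Longrightarrow> Pg u \<Longrightarrow> EW p n (lrat B u) < - c"
      unfolding eventually_prod_filter by auto
    obtain U where U: "open U" "v \<in> U" "\<And>u. u \<in> U \<Longrightarrow> Pg u" using P(2) by (auto simp: eventually_nhds)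
    have "eventually (\<lambda>B. \<forall>u\<in>U. EW p n (lrat B u) < - c) (nbh A)"
      using P(1) by eventually_elim (use P(3) U(3) in blast)
    thus ?thesis using n(1) c(1) U(1,2) by blast
  qed
  \<comment> \<open>The length, the gain and the neighbourhood are packed into one tuple, so that a
    single choice function provides them all.\<close>
  define R where "R v z \<longleftrightarrow> fst z \<ge> 1 \<and> fst (snd z) > 0 \<and> open (snd (snd z)) \<and> v \<in> snd (snd z) \<and>
      eventually (\<lambda>B. \<forall>u\<in>snd (snd z). EW p (fst z) (lrat B u) < - fst (snd z)) (nbh A)" for v and z :: "nat \<times> real \<times> (real^2) set"
  have "\<exists>z. R v z" if v: "v \<in> sphere 0 1" for v
  proof -
    obtain n c U where "n \<ge> 1" "c > 0" "open U" "v \<in> U" "eventually (\<lambda>B. \<forall>u\<in>U. EW p n (lrat B u) < - c) (nbh A)"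
      using loc[of v] v by auto
    thus ?thesis by (intro exI[of _ "(n, c, U)"]) (simp add: R_def)
  qed
  then obtain f where f: "\<And>v. v \<in> sphere 0 1 \<Longrightarrow> R v (f v)" using bchoice[of "sphere 0 1" R] by blast
  define nn where "nn v = fst (f v)" for v
  define cc where "cc v = fst (snd (f v))" for v
  define U where "U v = snd (snd (f v))" for v
  have L: "nn v \<ge> 1 \<and> cc v > 0 \<and> open (U v) \<and> v \<in> U v \<and>
      eventually (\<lambda>B. \<forall>u\<in>U v. EW p (nn v) (lrat B u) < - cc v) (nbh A)" if "norm v = 1" for v
    using f[of v] that by (simp add: R_def nn_def cc_def U_def)
  obtain T where T: "T \<subseteq> sphere (0::real^2) 1" "finite T" "sphere (0::real^2) 1 \<subseteq> (\<Union>v\<in>T. U v)"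
  proof (rule compactE_image[OF compact_sphere, of "sphere (0::real^2) 1" U])
    show "\<And>v. v \<in> sphere 0 1 \<Longrightarrow> open (U v)" using L by simp
    show "sphere (0::real^2) 1 \<subseteq> (\<Union>v\<in>sphere 0 1. U v)" using L by fastforce
  qed blast
  have Tne: "T \<noteq> {}" using T(3) norm_axis_1[of 1] by (metis UN_empty empty_iff mem_sphere_0 subset_empty)
  define N where "N = (\<Sum>v\<in>T. nn v)"
  define c where "c = Min (cc ` T)"
  have c: "c > 0" using T Tne L by (auto simp: c_def)
  have N: "nn v \<le> N" if "v \<in> T" for v unfolding N_def by (rule member_le_sum) (use T that in auto)
  have N1: "N \<ge> 1" using Tne N L T(1) by (metis ex_in_conv le_trans mem_sphere_0 subsetD)
  \<comment> \<open>\<open>Cb\<close> bounds \<open>lrat\<close> on words of length at most N for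
    every B near A. The exponent \<open>a\<close> keeps the quadratic term of the exponential below
    half of the linear gain a c, which leaves 1 - a c / 2.\<close>
  define Cb where "Cb = (\<bar>lbd2 A\<bar> + 1) * real N"
  have Cb: "Cb > 0" using N1 by (simp add: Cb_def)
  define a where "a = min (1 / Cb) (c / (2 * Cb\<^sup>2))"
  have a: "a > 0" "a * Cb \<le> 1" "a * Cb\<^sup>2 \<le> c / 2" using Cb c by (auto simp: a_def field_simps min_def)
  define \<kappa> where "\<kappa> = max (1/2) (1 - a * c / 2)"
  have k: "0 < \<kappa>" "\<kappa> < 1" "1 - a * c / 2 \<le> \<kappa>" using a c by (auto simp: \<kappa>_def)
  have "eventually (\<lambda>B. \<forall>v\<in>T. \<forall>u\<in>U v. EW p (nn v) (lrat B u) < - cc v) (nbh A)"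
    using T L by (intro eventually_ball_finite) auto
  moreover have "eventually (\<lambda>B. lbd2 B < \<bar>lbd2 A\<bar> + 1) (nbh A)"
    by (rule order_tendstoD(2)[OF tendsto_lbd2[OF A]]) linarith
  ultimately have "eventually (\<lambda>B. B \<in> GLk \<longrightarrow> (\<forall>n. EW p n (\<lambda>w. rat (wprod B w) powr a) \<le> exp 1 ^ N / \<kappa> * root N \<kappa> ^ n)) (nbh A)"
  proof eventually_elim
    case (elim B)
    show ?case
    proof (intro impI allI)
      fix n assume B: "B \<in> GLk"
      have bd: "\<bar>lrat B v w\<bar> \<le> Cb" if "v \<noteq> 0" "length w \<le> N" for v w
      proof -
        have "\<bar>lrat B v w\<bar> \<le> lbd2 B * real (length w)" by (rule lrat_bound[OF B that(1)])
        also have "\<dots> \<le> (\<bar>lbd2 A\<bar> + 1) * real N" using that elim(2) by (intro mult_mono) auto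
        finally show ?thesis by (simp add: Cb_def)
      qed
      have st: "\<exists>i\<in>{1..N}. EW p i (\<lambda>w. cw (\<lambda>j v. exp (a * lrat B v [j])) (\<lambda>j v. B j *v v) w v) \<le> \<kappa>" if v: "v \<noteq> 0" for v
      proof -
        define u where "u = (1 / norm v) *\<^sub>R v"
        have u: "norm u = 1" "u \<noteq> 0" using v by (auto simp: u_def)
        have lu: "lrat B u w = lrat B v w" for w unfolding u_def by (rule lrat_scale[OF B v]) (use v in auto)
        obtain t where t: "t \<in> T" "u \<in> U t" using T(3) u(1) by auto
        have i: "nn t \<in> {1..N}" using N[OF t(1)] L t(1) T(1) by auto
        have "c \<le> cc t" unfolding c_def using T t by auto
        hence m: "EW p (nn t) (lrat B u) < - c" using elim(1) t by fastforce
        have "EW p (nn t) (\<lambda>w. exp (a * lrat B u w)) \<le> EW p (nn t) (\<lambda>w. 1 + a * lrat B u w + a * (c / 2))"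
        proof (rule EW_mono)
          fix w :: "'a list" assume w: "length w = nn t"
          have b: "\<bar>lrat B u w\<bar> \<le> Cb" using bd[OF u(2)] w i by auto
          have b2: "\<bar>a * lrat B u w\<bar> \<le> a * Cb" using b a by (simp add: abs_mult)
          hence "exp (a * lrat B u w) \<le> 1 + a * lrat B u w + (a * lrat B u w)\<^sup>2" using a by (intro exp_le_quadratic) linarith
          also have "(a * lrat B u w)\<^sup>2 \<le> (a * Cb)\<^sup>2" using b2 by (metis abs_ge_zero power2_abs power_mono)
          also have "(a * Cb)\<^sup>2 = a * (a * Cb\<^sup>2)" by (simp add: power2_eq_square)
          also have "\<dots> \<le> a * (c / 2)" using a by (intro mult_left_mono) auto
          finally show "exp (a * lrat B u w) \<le> 1 + a * lrat B u w + a * (c / 2)" by simp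
        qed
        also have "\<dots> = 1 + a * EW p (nn t) (lrat B u) + a * (c / 2)" by (simp add: EW_add EW_cmult)
        also have "\<dots> \<le> 1 + a * (- c) + a * (c / 2)" using m a by (intro add_mono mult_left_mono) auto
        also have "\<dots> \<le> \<kappa>" using k by simp
        finally show ?thesis using i by (intro bexI[of _ "nn t"]) (simp_all add: cw_lrat[OF B v] lu)
      qed
      have "EW p n (\<lambda>w. rat (wprod B w) powr a) \<le> EW p n (\<lambda>w. exp (a * lrat B (axis 1 1) w))"
        using a by (intro EW_mono rat_le_lrat[OF B]) (auto simp: axis_eq_0_iff)
      also have "\<dots> = EW p n (\<lambda>w. cw (\<lambda>j v. exp (a * lrat B v [j])) (\<lambda>j v. B j *v v) w (axis 1 1))"
        by (simp add: cw_lrat[OF B] axis_eq_0_iff)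
      also have "\<dots> \<le> exp 1 ^ N / \<kappa> * root N \<kappa> ^ n"
      proof (rule variable_step_contraction[where V="{v. v \<noteq> 0}"])
        fix j v assume v: "v \<in> {v::real^2. v \<noteq> 0}"
        show "B j *v v \<in> {v. v \<noteq> 0}" using matvec_pos[OF GLkD[OF B], of v j] v by auto
        have "a * lrat B v [j] \<le> a * Cb" using bd[of v "[j]"] v N1 a by (intro mult_left_mono) auto
        hence "a * lrat B v [j] \<le> 1" using a(2) by linarith
        thus "exp (a * lrat B v [j]) \<le> exp 1" by simp
      qed (use st k N1 in \<open>auto simp: axis_eq_0_iff\<close>)
      finally show "EW p n (\<lambda>w. rat (wprod B w) powr a) \<le> exp 1 ^ N / \<kappa> * root N \<kappa> ^ n" .
    qed
  qed
  moreover have "0 < root N \<kappa>" "root N \<kappa> < 1" using k N1 by auto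
  moreover have "a \<le> 1"
  proof -
    have "1 * 1 \<le> (\<bar>lbd2 A\<bar> + 1) * real N" using N1 by (intro mult_mono) auto
    hence "1 / Cb \<le> 1" by (simp add: Cb_def)
    thus ?thesis unfolding a_def by (rule min.coboundedI1)
  qed
  ultimately show ?thesis using a(1) by blast
qed

section \<open>An invariant slow line: the capped function and its contraction\<close>

lemma powr_add_le:
  fixes x y :: real
  assumes "0 \<le> x" "0 \<le> y" "0 < t" "t \<le> 1"
  shows "(x + y) powr t \<le> x powr t + y powr t"
proof (cases "x + y = 0")
  case False
  define s where "s = x + y"
  have s: "s > 0" using False assms by (simp add: s_def)
  have *: "z / s \<le> (z / s) powr t" if "0 \<le> z" "z \<le> s" for z
  proof (cases "z = 0")
    case False
    have "(z / s) powr 1 \<le> (z / s) powr t" using that False s assms by (intro powr_mono') auto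
    thus ?thesis using that False s by simp
  qed simp
  have "1 = x / s + y / s" using s by (simp add: s_def add_divide_distrib[symmetric])
  also have "\<dots> \<le> (x / s) powr t + (y / s) powr t" using assms by (intro add_mono *) (auto simp: s_def)
  finally have "s powr t * 1 \<le> s powr t * ((x / s) powr t + (y / s) powr t)" by (intro mult_left_mono) auto
  thus ?thesis using assms s by (simp add: distrib_left powr_divide s_def)
next
  case True
  hence "x = 0" "y = 0" using assms by auto
  thus ?thesis by simp
qed

definition mat_act :: "('a \<Rightarrow> real) \<Rightarrow> ('a \<Rightarrow> real) \<Rightarrow> ('a \<Rightarrow> real) \<Rightarrow> ('a \<Rightarrow> real) \<Rightarrow> 'a \<Rightarrow> real \<times> real \<Rightarrow> real \<times> real" where
  "mat_act a b g d j v = (a j * fst v + b j * snd v, g j * fst v + d j * snd v)"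

text \<open>Perturbations of a lower triangular cocycle whose invariant line (the second axis) is the slow one.
  The function \<open>ph\<close> is homogeneous and large near the slow axis, but capped at the scale \<open>\<eta>\<close> of the
  upper right entries, the scale at which the perturbation pushes vectors away from that axis.
  Outside the cap it contracts in one step; inside the cap a word of length \<open>Suc r\<close> which leaves the
  cap contracts it, since there the exponent \<open>\<alpha>\<close> is much smaller than \<open>\<theta>\<close>.\<close>
locale escape =
  fixes p :: "'a::finite pmf" and a b g d lo up DD :: "'a \<Rightarrow> real"
    and K c C \<Gamma> \<eta> \<alpha> \<theta> e \<kappa> \<zeta> G \<pi> :: real and r :: nat and j0 j1 :: 'a
  assumes \<eta>: "0 \<le> \<eta>" "\<And>j. \<bar>b j\<bar> \<le> \<eta>" and \<Gamma>: "0 \<le> \<Gamma>" "\<And>j. \<bar>g j\<bar> \<le> \<Gamma>"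
    and C: "1 \<le> C" "\<And>j. \<bar>a j\<bar> \<le> C" "\<And>j. \<bar>d j\<bar> \<le> C"
    and lo: "\<And>j. 0 < lo j" "\<And>j. lo j + \<zeta> \<le> \<bar>a j\<bar>" and up: "\<And>j. 0 < up j" "\<And>j. \<bar>d j\<bar> \<le> up j"
    and \<zeta>: "0 < \<zeta>" and K: "1 \<le> K" "K * \<zeta> = 1" "K * \<eta> \<le> 1"
    and DD: "\<And>j. \<bar>a j * d j - b j * g j\<bar> \<le> DD j"
    and c: "0 < c" "c \<le> 1" "\<And>j. c * (C + 1 + \<Gamma>) \<le> \<bar>a j * d j - b j * g j\<bar>"
    and \<alpha>: "0 < \<alpha>" and \<theta>: "0 < \<theta>" "\<theta> \<le> 1" and e: "0 < e"
    and k1: "(\<Sum>j\<in>UNIV. pmf p j * (DD j powr (\<alpha>/2) * lo j powr (-\<alpha>) * (1 + e * (\<Gamma> / lo j) powr \<theta>))) \<le> \<kappa>"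
    and k2: "(\<Sum>j\<in>UNIV. pmf p j * (DD j powr (\<alpha>/2) * lo j powr (-\<alpha>) * (up j / lo j) powr \<theta>)) \<le> \<kappa>"
    and \<kappa>: "0 < \<kappa>" "\<kappa> < 1"
    and b0: "b j0 = 0" and j1: "\<bar>b j1\<bar> = \<eta>"
    and G: "1 < G" "G * (up j0 + 2 * K * \<Gamma> * \<eta>) \<le> lo j0" "2 * K \<le> 1 / (2 * (C + \<Gamma>)) * G ^ r"
    and \<pi>: "0 < \<pi>" "\<And>j. \<pi> \<le> pmf p j"
    and k3: "\<And>j. ((DD j powr (1/2) + 1) / c) powr (\<alpha> * real (Suc r)) * (1 - \<pi> ^ Suc r * (1 - 2 powr (-\<theta>)) / 2) \<le> \<kappa>"
    and cap: "0 < \<eta> \<Longrightarrow> 1 \<le> e * (K * \<eta>) powr (-\<theta>)"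
begin

abbreviation act :: "'a \<Rightarrow> real \<times> real \<Rightarrow> real \<times> real" where
  "act \<equiv> mat_act a b g d"

text \<open>The first coordinate, cut off from below at the level K \<eta> |y|. For \<eta> = 0 it is
  |x|, and \<open>0 < mm v\<close> then excludes the second axis.\<close>

definition mm :: "real \<times> real \<Rightarrow> real" where "mm v = max \<bar>fst v\<bar> (K * \<eta> * \<bar>snd v\<bar>)"

text \<open>The first factor, of degree -\<alpha>, combines with the weight D^(\<alpha>/2) of
  \<open>gg\<close> into a bound for powers of \<open>rat\<close>. The second factor, of degree 0,
  grows towards the second axis; for \<eta> > 0 the cut-off in \<open>mm\<close> keeps it
  bounded.\<close>

definition ph :: "real \<times> real \<Rightarrow> real" where
  "ph v = mm v powr (-\<alpha>) * (1 + e * (\<bar>snd v\<bar> / mm v) powr \<theta>)"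

definition D :: "'a \<Rightarrow> real" where "D j = \<bar>a j * d j - b j * g j\<bar>"

definition gg :: "'a \<Rightarrow> real \<times> real \<Rightarrow> real" where
  "gg j v = D j powr (\<alpha>/2) * ph (act j v) / ph v"

lemma K_pos: "0 < K" using K by linarith

lemma mm_nonneg: "0 \<le> mm v" by (simp add: mm_def le_max_iff_disj)

text \<open>Cramer's rule expresses the determinant times the old coordinates through the new ones,
  with coefficients below C + 1 + \<Gamma> because K \<eta> is at most 1; c is bounded by the
  determinant over this constant.\<close>

lemma mm_act: "c * mm v \<le> mm (act j v)"
proof -
  obtain x y where v: "v = (x, y)" by (cases v)
  define x' where "x' = a j * x + b j * y"
  define y' where "y' = g j * x + d j * y"
  define m where "m = mm (act j v)"
  have m: "\<bar>x'\<bar> \<le> m" "K * \<eta> * \<bar>y'\<bar> \<le> m" by (auto simp: m_def mm_def mat_act_def v x'_def y'_def)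
  have \<eta>y: "\<eta> * \<bar>y'\<bar> \<le> m"
  proof -
    have "\<eta> * \<bar>y'\<bar> \<le> K * (\<eta> * \<bar>y'\<bar>)" using K \<eta> mult_right_mono[of 1 K "\<eta> * \<bar>y'\<bar>"] by simp
    thus ?thesis using m(2) by (simp add: mult.assoc)
  qed
  have m0: "0 \<le> m" using mm_nonneg by (simp add: m_def)
  have Dp: "0 \<le> D j" by (simp add: D_def)
  have x: "D j * \<bar>x\<bar> \<le> (C + 1 + \<Gamma>) * m"
  proof -
    have "(a j * d j - b j * g j) * x = d j * x' - b j * y'" by (simp add: x'_def y'_def algebra_simps)
    hence "D j * \<bar>x\<bar> = \<bar>d j * x' - b j * y'\<bar>" by (simp add: D_def flip: abs_mult)
    also have "\<dots> \<le> \<bar>d j\<bar> * \<bar>x'\<bar> + \<bar>b j\<bar> * \<bar>y'\<bar>" by (metis abs_mult abs_triangle_ineq4)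
    also have "\<dots> \<le> C * m + \<eta> * \<bar>y'\<bar>" using C \<eta> m by (intro add_mono mult_mono) auto
    also have "\<dots> \<le> (C + 1 + \<Gamma>) * m" using \<eta>y mult_nonneg_nonneg[OF \<Gamma>(1) m0] by (simp add: algebra_simps)
    finally show ?thesis .
  qed
  have y: "D j * (K * \<eta> * \<bar>y\<bar>) \<le> (C + 1 + \<Gamma>) * m"
  proof -
    have "(a j * d j - b j * g j) * y = a j * y' - g j * x'" by (simp add: x'_def y'_def algebra_simps)
    hence "D j * \<bar>y\<bar> = \<bar>a j * y' - g j * x'\<bar>" by (simp add: D_def flip: abs_mult)
    also have "\<dots> \<le> \<bar>a j\<bar> * \<bar>y'\<bar> + \<bar>g j\<bar> * \<bar>x'\<bar>" by (metis abs_mult abs_triangle_ineq4)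
    also have "\<dots> \<le> C * \<bar>y'\<bar> + \<Gamma> * m" using C \<Gamma> m by (intro add_mono mult_mono) auto
    finally have "K * \<eta> * (D j * \<bar>y\<bar>) \<le> K * \<eta> * (C * \<bar>y'\<bar> + \<Gamma> * m)" using K_pos \<eta> by (intro mult_left_mono) auto
    also have "\<dots> = C * (K * \<eta> * \<bar>y'\<bar>) + K * \<eta> * (\<Gamma> * m)" by (simp add: algebra_simps)
    also have "\<dots> \<le> C * m + 1 * (\<Gamma> * m)" using C K \<Gamma> m m0 by (intro add_mono mult_left_mono mult_right_mono) auto
    also have "\<dots> \<le> (C + 1 + \<Gamma>) * m" using m0 by (simp add: algebra_simps)
    finally show ?thesis by (simp add: mult_ac)
  qed
  have "D j * mm v \<le> (C + 1 + \<Gamma>) * m" using x y by (simp add: mm_def v max_def)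
  moreover have "c * (C + 1 + \<Gamma>) * mm v \<le> D j * mm v" using c(3)[of j] mm_nonneg by (intro mult_right_mono) (auto simp: D_def)
  ultimately have "(C + 1 + \<Gamma>) * (c * mm v) \<le> (C + 1 + \<Gamma>) * m" by (simp add: mult_ac)
  thus ?thesis using C \<Gamma> by (simp add: m_def)
qed

lemma mm_act_pos: "0 < mm v \<Longrightarrow> 0 < mm (act j v)"
  using mm_act[of v j] c(1) by (metis less_le_trans mult_pos_pos)

lemma ph_pos: "0 < mm v \<Longrightarrow> 0 < ph v"
  using e by (auto simp: ph_def intro!: mult_pos_pos add_pos_nonneg)

lemma ph_ge: "mm v powr (-\<alpha>) \<le> ph v"
  using e by (simp add: ph_def mult_le_cancel_left1)

lemma D_pos: "0 < D j"
proof -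
  have "0 < c * (C + 1 + \<Gamma>)" using c(1) C(1) \<Gamma>(1) by (intro mult_pos_pos) auto
  thus ?thesis using c(3)[of j] by (simp add: D_def)
qed

lemma prod_list_D_pos: "0 < prod_list (map D w)"
  by (induction w) (auto intro!: mult_pos_pos D_pos)

lemma powr_antimono: "0 < x \<Longrightarrow> x \<le> y \<Longrightarrow> y powr (-\<alpha>) \<le> x powr (-\<alpha>)"
  using \<alpha> by (intro powr_mono2') auto

lemma cw_gg:
  assumes "0 < mm v"
  shows "cw gg act w v = prod_list (map D w) powr (\<alpha>/2) * ph (fold act w v) / ph v"
  using assms
proof (induction w arbitrary: v)
  case (Cons j w)
  have pl: "0 < prod_list (map D w)" by (rule prod_list_D_pos)
  have "cw gg act (j # w) v = (D j powr (\<alpha>/2) * ph (act j v) / ph v) * (prod_list (map D w) powr (\<alpha>/2) * ph (fold act w (act j v)) / ph (act j v))"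
    by (simp only: cw.simps Cons.IH[OF mm_act_pos[OF Cons.prems]] gg_def[of j v])
  also have "\<dots> = D j powr (\<alpha>/2) * prod_list (map D w) powr (\<alpha>/2) * ph (fold act w (act j v)) / ph v"
    using ph_pos[OF mm_act_pos[OF Cons.prems, of j]] by simp
  also have "D j powr (\<alpha>/2) * prod_list (map D w) powr (\<alpha>/2) = prod_list (map D (j # w)) powr (\<alpha>/2)"
    using pl D_pos[of j] by (simp add: powr_mult)
  finally show ?case by simp
qed (use ph_pos in \<open>auto simp: less_imp_neq[symmetric]\<close>)

text \<open>Outside the cap \<open>mm v\<close> is |x|, and with t = |y| / |x| the function equals
  |x|^(-\<alpha>) (1 + e t^\<theta>). Its average image is bounded by |x|^(-\<alpha>) times an
  affine function of t^\<theta>: \<open>k1\<close> contracts the constant part, with the feedback of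
  \<Gamma> included, and \<open>k2\<close> the coefficient of t^\<theta>.\<close>

lemma one_step_outside:
  assumes m: "0 < mm v" and out: "K * \<eta> * \<bar>snd v\<bar> \<le> \<bar>fst v\<bar>"
  shows "EW p 1 (\<lambda>w. cw gg act w v) \<le> \<kappa>"
proof -
  obtain x y where v: "v = (x, y)" by (cases v)
  have mx: "mm v = \<bar>x\<bar>" using out by (simp add: mm_def v)
  have x0: "0 < \<bar>x\<bar>" using m mx by simp
  define t where "t = \<bar>y\<bar> / \<bar>x\<bar>"
  have phv: "ph v = \<bar>x\<bar> powr (-\<alpha>) * (1 + e * t powr \<theta>)" by (simp add: ph_def mx t_def) (simp add: v)
  \<comment> \<open>Because K \<zeta> = 1, the entry b costs at most the margin \<zeta> that
    separates \<open>lo j\<close> from |a j|.\<close>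
  have ey: "\<eta> * \<bar>y\<bar> \<le> \<zeta> * \<bar>x\<bar>"
  proof -
    have "\<zeta> * (K * \<eta> * \<bar>y\<bar>) \<le> \<zeta> * \<bar>x\<bar>" using out \<zeta> by (intro mult_left_mono) (auto simp: v)
    moreover have "\<zeta> * (K * \<eta> * \<bar>y\<bar>) = (K * \<zeta>) * (\<eta> * \<bar>y\<bar>)" by (simp only: mult_ac)
    ultimately show ?thesis using K(2) by simp
  qed
  define u where "u j = DD j powr (\<alpha>/2) * lo j powr (-\<alpha>)" for j
  have one: "D j powr (\<alpha>/2) * ph (act j v) \<le> \<bar>x\<bar> powr (-\<alpha>) * (u j * (1 + e * (\<Gamma> / lo j) powr \<theta>) + e * t powr \<theta> * (u j * (up j / lo j) powr \<theta>))" for j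
  proof -
    define x' where "x' = a j * x + b j * y"
    define y' where "y' = g j * x + d j * y"
    have av: "act j v = (x', y')" by (simp add: mat_act_def v x'_def y'_def)
    have lx: "lo j * \<bar>x\<bar> \<le> \<bar>x'\<bar>"
    proof -
      have "\<bar>b j * y\<bar> \<le> \<zeta> * \<bar>x\<bar>" using ey \<eta>(2)[of j] by (simp add: abs_mult) (meson abs_ge_zero mult_right_mono order_trans)
      moreover have "(lo j + \<zeta>) * \<bar>x\<bar> \<le> \<bar>a j * x\<bar>" using lo(2)[of j] by (simp add: abs_mult mult_right_mono)
      ultimately show ?thesis unfolding x'_def by (simp add: algebra_simps)
    qed
    have lx0: "0 < lo j * \<bar>x\<bar>" using lo x0 by simp
    have mx': "lo j * \<bar>x\<bar> \<le> mm (act j v)" using lx by (simp add: mm_def av)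
    have y': "\<bar>y'\<bar> \<le> up j * \<bar>y\<bar> + \<Gamma> * \<bar>x\<bar>"
    proof -
      have "\<bar>y'\<bar> \<le> \<bar>g j\<bar> * \<bar>x\<bar> + \<bar>d j\<bar> * \<bar>y\<bar>" unfolding y'_def by (metis abs_mult abs_triangle_ineq)
      also have "\<dots> \<le> \<Gamma> * \<bar>x\<bar> + up j * \<bar>y\<bar>" using \<Gamma> up(2)[of j] by (intro add_mono mult_right_mono) auto
      finally show ?thesis by simp
    qed
    have q: "\<bar>y'\<bar> / mm (act j v) \<le> up j / lo j * t + \<Gamma> / lo j"
    proof -
      have "\<bar>y'\<bar> / mm (act j v) \<le> (up j * \<bar>y\<bar> + \<Gamma> * \<bar>x\<bar>) / (lo j * \<bar>x\<bar>)" using y' mx' lx0 by (intro frac_le) auto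
      also have "\<dots> = up j / lo j * t + \<Gamma> / lo j" using x0 lo(1)[of j] by (simp add: t_def add_divide_distrib)
      finally show ?thesis .
    qed
    have t0: "0 \<le> t" by (simp add: t_def)
    have "(\<bar>y'\<bar> / mm (act j v)) powr \<theta> \<le> (up j / lo j * t + \<Gamma> / lo j) powr \<theta>"
      using q \<theta> mm_nonneg by (intro powr_mono2) auto
    \<comment> \<open>For \<theta> at most 1 the power is subadditive, which separates the old ratio
      t from the feedback of \<Gamma>.\<close>
    also have "\<dots> \<le> (up j / lo j * t) powr \<theta> + (\<Gamma> / lo j) powr \<theta>"
      using t0 up(1)[of j] lo(1)[of j] \<Gamma>(1) \<theta> by (intro powr_add_le) auto
    also have "(up j / lo j * t) powr \<theta> = (up j / lo j) powr \<theta> * t powr \<theta>"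
      using t0 up(1)[of j] lo(1)[of j] by (intro powr_mult)
    finally have q2: "(\<bar>y'\<bar> / mm (act j v)) powr \<theta> \<le> (up j / lo j) powr \<theta> * t powr \<theta> + (\<Gamma> / lo j) powr \<theta>" by simp
    have "ph (act j v) \<le> (lo j * \<bar>x\<bar>) powr (-\<alpha>) * (1 + e * ((up j / lo j) powr \<theta> * t powr \<theta> + (\<Gamma> / lo j) powr \<theta>))"
      unfolding ph_def using q2 e by (intro mult_mono powr_antimono lx0 mx' add_left_mono mult_left_mono) (auto simp: av)
    moreover have "D j powr (\<alpha>/2) \<le> DD j powr (\<alpha>/2)" using DD[of j] \<alpha> by (intro powr_mono2) (auto simp: D_def)
    moreover have "0 \<le> ph (act j v)" using e by (simp add: ph_def)
    ultimately have "D j powr (\<alpha>/2) * ph (act j v) \<le> DD j powr (\<alpha>/2) * ((lo j * \<bar>x\<bar>) powr (-\<alpha>) * (1 + e * ((up j / lo j) powr \<theta> * t powr \<theta> + (\<Gamma> / lo j) powr \<theta>)))"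
      by (intro mult_mono) auto
    also have "(lo j * \<bar>x\<bar>) powr (-\<alpha>) = lo j powr (-\<alpha>) * \<bar>x\<bar> powr (-\<alpha>)" using lo(1)[of j] by (intro powr_mult)
    finally show ?thesis by (simp add: u_def algebra_simps)
  qed
  have "EW p 1 (\<lambda>w. cw gg act w v) * ph v = (\<Sum>j\<in>UNIV. pmf p j * (D j powr (\<alpha>/2) * ph (act j v)))"
    using ph_pos[OF m] by (simp add: gg_def sum_distrib_right)
  also have "\<dots> \<le> (\<Sum>j\<in>UNIV. pmf p j * (\<bar>x\<bar> powr (-\<alpha>) * (u j * (1 + e * (\<Gamma> / lo j) powr \<theta>) + e * t powr \<theta> * (u j * (up j / lo j) powr \<theta>))))"
    by (intro sum_mono mult_left_mono one) auto
  also have "\<dots> = \<bar>x\<bar> powr (-\<alpha>) * ((\<Sum>j\<in>UNIV. pmf p j * (u j * (1 + e * (\<Gamma> / lo j) powr \<theta>))) + e * t powr \<theta> * (\<Sum>j\<in>UNIV. pmf p j * (u j * (up j / lo j) powr \<theta>)))"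
    by (simp add: sum.distrib sum_distrib_left algebra_simps)
  also have "\<dots> \<le> \<bar>x\<bar> powr (-\<alpha>) * (\<kappa> + e * t powr \<theta> * \<kappa>)"
    using k1 k2 e by (intro mult_left_mono add_mono) (auto simp: u_def)
  also have "\<dots> = \<kappa> * ph v" by (simp add: phv algebra_simps)
  finally show ?thesis using ph_pos[OF m] by simp
qed

text \<open>With b j0 = 0 the first coordinate grows by at least \<open>lo j0\<close>; the second
  grows by at most \<open>up j0\<close>, apart from a feedback \<Gamma> |x| that the bound X \<le> 2
  K makes small on the scale \<eta>. So |x| / |y| improves by the factor G.\<close>

lemma expanding_step:
  assumes X: "0 < X" "X \<le> 2 * K" and v: "X * \<eta> * \<bar>snd v\<bar> \<le> \<bar>fst v\<bar>"
  shows "(G * X) * \<eta> * \<bar>snd (act j0 v)\<bar> \<le> \<bar>fst (act j0 v)\<bar>"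
proof -
  obtain x y where xy: "v = (x, y)" by (cases v)
  have f: "lo j0 * \<bar>x\<bar> \<le> \<bar>fst (act j0 v)\<bar>"
  proof -
    have "lo j0 * \<bar>x\<bar> \<le> \<bar>a j0\<bar> * \<bar>x\<bar>" using lo(2)[of j0] \<zeta> by (intro mult_right_mono) auto
    thus ?thesis by (simp add: mat_act_def b0 xy abs_mult)
  qed
  have "\<bar>snd (act j0 v)\<bar> \<le> \<bar>g j0\<bar> * \<bar>x\<bar> + \<bar>d j0\<bar> * \<bar>y\<bar>" by (simp add: mat_act_def xy) (metis abs_mult abs_triangle_ineq)
  also have "\<dots> \<le> \<Gamma> * \<bar>x\<bar> + up j0 * \<bar>y\<bar>" using \<Gamma> up(2)[of j0] by (intro add_mono mult_right_mono) auto
  finally have "X * \<eta> * \<bar>snd (act j0 v)\<bar> \<le> X * \<eta> * (\<Gamma> * \<bar>x\<bar> + up j0 * \<bar>y\<bar>)"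
    using X \<eta> by (intro mult_left_mono) auto
  also have "\<dots> = X * (\<Gamma> * \<eta> * \<bar>x\<bar>) + up j0 * (X * \<eta> * \<bar>y\<bar>)" by (simp add: algebra_simps)
  also have "\<dots> \<le> (2 * K) * (\<Gamma> * \<eta> * \<bar>x\<bar>) + up j0 * \<bar>x\<bar>"
    using X v \<Gamma>(1) \<eta>(1) up(1)[of j0] by (intro add_mono mult_right_mono mult_left_mono) (auto simp: xy)
  also have "\<dots> = (up j0 + 2 * K * \<Gamma> * \<eta>) * \<bar>x\<bar>" by (simp add: algebra_simps)
  finally have "G * (X * \<eta> * \<bar>snd (act j0 v)\<bar>) \<le> G * ((up j0 + 2 * K * \<Gamma> * \<eta>) * \<bar>x\<bar>)"
    using G(1) by (intro mult_left_mono) auto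
  also have "\<dots> = (G * (up j0 + 2 * K * \<Gamma> * \<eta>)) * \<bar>x\<bar>" by simp
  also have "\<dots> \<le> lo j0 * \<bar>x\<bar>" using G(2) by (intro mult_right_mono) auto
  finally show ?thesis using f by (simp add: mult_ac)
qed

lemma expanding_steps:
  assumes X: "0 < X" "X \<le> 2 * K" and v: "X * \<eta> * \<bar>snd v\<bar> \<le> \<bar>fst v\<bar>"
  shows "min (2 * K) (X * G ^ n) * \<eta> * \<bar>snd (fold act (replicate n j0) v)\<bar> \<le> \<bar>fst (fold act (replicate n j0) v)\<bar>"
  using X v
proof (induction n arbitrary: X v)
  case (Suc n)
  define X' where "X' = min (2 * K) (G * X)"
  have X': "0 < X'" "X' \<le> 2 * K" using Suc.prems G(1) K_pos by (auto simp: X'_def)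
  have "X' * (\<eta> * \<bar>snd (act j0 v)\<bar>) \<le> (G * X) * (\<eta> * \<bar>snd (act j0 v)\<bar>)"
    using \<eta> by (intro mult_right_mono) (auto simp: X'_def)
  hence "X' * \<eta> * \<bar>snd (act j0 v)\<bar> \<le> \<bar>fst (act j0 v)\<bar>"
    using expanding_step[OF Suc.prems] by (simp add: mult.assoc)
  from Suc.IH[OF X' this] have IH: "min (2 * K) (X' * G ^ n) * \<eta> * \<bar>snd (fold act (replicate (Suc n) j0) v)\<bar> \<le> \<bar>fst (fold act (replicate (Suc n) j0) v)\<bar>"
    by simp
  have "min (2 * K) (X * G ^ Suc n) \<le> min (2 * K) (X' * G ^ n)"
  proof -
    have "1 \<le> G ^ n" using G(1) by (intro one_le_power) auto
    hence "2 * K \<le> 2 * K * G ^ n" using K_pos by simp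
    thus ?thesis by (auto simp: X'_def min_def mult_ac)
  qed
  hence "min (2 * K) (X * G ^ Suc n) * (\<eta> * \<bar>snd (fold act (replicate (Suc n) j0) v)\<bar>) \<le> min (2 * K) (X' * G ^ n) * (\<eta> * \<bar>snd (fold act (replicate (Suc n) j0) v)\<bar>)"
    using \<eta> by (intro mult_right_mono) auto
  thus ?case using IH by (simp only: mult.assoc)
qed (auto simp: min_def)

text \<open>If v is closer to the axis than order \<eta>, the letter \<open>j1\<close> with the
  largest upper right entry throws it to a distance of order \<eta>; otherwise \<open>j0\<close>
  does no harm. Then r repetitions of \<open>j0\<close> raise the distance to twice the cap
  level.\<close>

lemma escape_word:
  assumes \<eta>0: "0 < \<eta>"
  shows "\<exists>w. length w = Suc r \<and> 2 * K * \<eta> * \<bar>snd (fold act w v)\<bar> \<le> \<bar>fst (fold act w v)\<bar>"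
proof -
  \<comment> \<open>Small enough that a x stays below half of the kick \<eta> |y| and that the new
    second coordinate fits the other half. The choice of r reads 2 K \<le> c0 G^r.\<close>
  define c0 where "c0 = 1 / (2 * (C + \<Gamma>))"
  have c0: "0 < c0" "c0 * C \<le> 1/2" "c0 * (C + \<Gamma>) = 1/2" "c0 \<le> 1"
    using C(1) \<Gamma>(1) by (auto simp: c0_def field_simps)
  have c0K: "c0 \<le> 2 * K" using c0 K by linarith
  have "\<exists>j. c0 * \<eta> * \<bar>snd (act j v)\<bar> \<le> \<bar>fst (act j v)\<bar>"
  proof (cases "c0 * \<eta> * \<bar>snd v\<bar> \<le> \<bar>fst v\<bar>")
    case True
    have "c0 * (\<eta> * \<bar>snd (act j0 v)\<bar>) \<le> (G * c0) * (\<eta> * \<bar>snd (act j0 v)\<bar>)"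
      using G(1) c0(1) \<eta>0 by (intro mult_right_mono) auto
    thus ?thesis using expanding_step[OF c0(1) c0K True] by (intro exI[of _ j0]) (simp add: mult.assoc)
  next
    case False
    obtain x y where xy: "v = (x, y)" by (cases v)
    have xl: "\<bar>x\<bar> < c0 * \<eta> * \<bar>y\<bar>" using False by (simp add: xy)
    have "\<bar>a j1 * x\<bar> \<le> C * (c0 * \<eta> * \<bar>y\<bar>)" using C(2)[of j1] xl C(1) by (auto simp: abs_mult intro!: mult_mono)
    also have "\<dots> = (c0 * C) * (\<eta> * \<bar>y\<bar>)" by simp
    also have "\<dots> \<le> (1/2) * (\<eta> * \<bar>y\<bar>)" using c0 \<eta>0 by (intro mult_right_mono) auto
    finally have ax: "\<bar>a j1 * x\<bar> \<le> \<eta> * \<bar>y\<bar> / 2" by simp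
    have "\<bar>b j1 * y\<bar> = \<eta> * \<bar>y\<bar>" using j1 by (simp add: abs_mult)
    moreover have "\<bar>b j1 * y\<bar> \<le> \<bar>a j1 * x + b j1 * y\<bar> + \<bar>a j1 * x\<bar>" by linarith
    ultimately have "\<eta> * \<bar>y\<bar> / 2 \<le> \<bar>a j1 * x + b j1 * y\<bar>" using ax by linarith
    hence f: "\<eta> * \<bar>y\<bar> / 2 \<le> \<bar>fst (act j1 v)\<bar>" by (simp add: mat_act_def xy)
    have "c0 * \<eta> \<le> 1"
    proof -
      have "1 * \<eta> \<le> K * \<eta>" using K(1) \<eta>0 by (intro mult_right_mono) auto
      hence "\<eta> \<le> 1" using K(3) by simp
      thus ?thesis using c0(1,4) \<eta>0 by (simp add: mult_le_one)
    qed
    hence "c0 * \<eta> * \<bar>y\<bar> \<le> 1 * \<bar>y\<bar>" by (intro mult_right_mono) auto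
    hence xy': "\<bar>x\<bar> \<le> \<bar>y\<bar>" using xl by simp
    have "\<bar>snd (act j1 v)\<bar> \<le> \<bar>g j1\<bar> * \<bar>x\<bar> + \<bar>d j1\<bar> * \<bar>y\<bar>" by (simp add: mat_act_def xy) (metis abs_mult abs_triangle_ineq)
    also have "\<dots> \<le> \<Gamma> * \<bar>y\<bar> + C * \<bar>y\<bar>" using \<Gamma> C xy' by (intro add_mono mult_mono) auto
    finally have "c0 * \<eta> * \<bar>snd (act j1 v)\<bar> \<le> c0 * \<eta> * ((C + \<Gamma>) * \<bar>y\<bar>)"
      using c0 \<eta>0 by (intro mult_left_mono) (auto simp: algebra_simps)
    also have "\<dots> = (c0 * (C + \<Gamma>)) * (\<eta> * \<bar>y\<bar>)" by simp
    also have "\<dots> = \<eta> * \<bar>y\<bar> / 2" unfolding c0(3) by simp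
    finally show ?thesis using f by (intro exI[of _ j1]) linarith
  qed
  then obtain j where j: "c0 * \<eta> * \<bar>snd (act j v)\<bar> \<le> \<bar>fst (act j v)\<bar>" by blast
  have "min (2 * K) (c0 * G ^ r) = 2 * K" using G(3) by (simp add: c0_def min_def)
  hence "2 * K * \<eta> * \<bar>snd (fold act (replicate r j0) (act j v))\<bar> \<le> \<bar>fst (fold act (replicate r j0) (act j v))\<bar>"
    using expanding_steps[OF c0(1) c0K j, of r] by simp
  thus ?thesis by (intro exI[of _ "j # replicate r j0"]) simp
qed

text \<open>Inside the cap the second factor has its largest possible value 1 + e H, so no word can
  increase it, and the escaping word multiplies H by at most 2^(-\<theta>). The factor
  \<open>mm\<close> with its determinants changes by at most Q^(\<alpha> (r + 1)), which
  \<open>k3\<close> keeps below the gain.\<close>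

lemma steps_inside:
  assumes m: "0 < mm v" and ins: "\<bar>fst v\<bar> < K * \<eta> * \<bar>snd v\<bar>"
  shows "EW p (Suc r) (\<lambda>w. cw gg act w v) \<le> \<kappa>"
proof -
  have \<eta>0: "0 < \<eta>" using ins \<eta>(1) by (cases "\<eta> = 0") auto
  have Ke: "0 < K * \<eta>" using \<eta>0 K_pos by simp
  have mv: "mm v = K * \<eta> * \<bar>snd v\<bar>" using ins by (simp add: mm_def)
  define H where "H = (K * \<eta>) powr (-\<theta>)"
  have s0: "0 < \<bar>snd v\<bar>" using m mv Ke by (simp add: zero_less_mult_iff)
  have q: "(\<bar>snd u\<bar> / mm u) powr \<theta> \<le> H" if "0 < mm u" for u
  proof -
    have "K * \<eta> * \<bar>snd u\<bar> \<le> mm u" by (simp add: mm_def)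
    hence "\<bar>snd u\<bar> / mm u \<le> 1 / (K * \<eta>)" using that Ke by (simp add: field_simps)
    hence "(\<bar>snd u\<bar> / mm u) powr \<theta> \<le> (1 / (K * \<eta>)) powr \<theta>" using that \<theta> by (intro powr_mono2) auto
    thus ?thesis using Ke by (simp add: H_def powr_minus_divide powr_divide)
  qed
  have phv: "ph v = mm v powr (-\<alpha>) * (1 + e * H)"
  proof -
    have "\<bar>snd v\<bar> / mm v = 1 / (K * \<eta>)" using s0 Ke by (simp add: mv)
    thus ?thesis using Ke by (simp add: ph_def H_def powr_minus_divide powr_divide)
  qed
  \<comment> \<open>The maximum is attained at a letter \<open>jm\<close>, to which the letterwise
    hypothesis \<open>k3\<close> is applied at the end.\<close>
  define Dm where "Dm = Max (range (\<lambda>j. DD j powr (1/2)))"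
  have "Dm \<in> range (\<lambda>j. DD j powr (1/2))" unfolding Dm_def by (intro Max_in) auto
  then obtain jm where jm: "Dm = DD jm powr (1/2)" by blast
  define Q where "Q = (Dm + 1) / c"
  have Q: "0 < Q" using c(1) jm by (auto simp: Q_def intro!: divide_pos_pos add_nonneg_pos)
  have QD: "D j powr (\<alpha>/2) * c powr (-\<alpha>) \<le> Q powr \<alpha>" for j
  proof -
    have "DD j powr (1/2) \<le> Dm" unfolding Dm_def by (intro Max_ge) auto
    moreover have "D j powr (1/2) \<le> DD j powr (1/2)" using DD[of j] by (intro powr_mono2) (auto simp: D_def)
    ultimately have "D j powr (1/2) / c \<le> Q" using c(1) unfolding Q_def by (intro divide_right_mono) auto
    hence "(D j powr (1/2) / c) powr \<alpha> \<le> Q powr \<alpha>" using \<alpha> c(1) by (intro powr_mono2) auto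
    thus ?thesis using c(1) by (simp add: powr_divide powr_powr powr_minus_divide)
  qed
  have mfold: "0 < mm (fold act w u) \<and> prod_list (map D w) powr (\<alpha>/2) * mm (fold act w u) powr (-\<alpha>) \<le> Q powr (\<alpha> * real (length w)) * mm u powr (-\<alpha>)" if "0 < mm u" for w u
    using that
  proof (induction w arbitrary: u)
    case (Cons j w)
    have mp: "0 < mm (act j u)" by (rule mm_act_pos[OF Cons.prems])
    have pl: "0 < prod_list (map D w)" by (rule prod_list_D_pos)
    have "mm (act j u) powr (-\<alpha>) \<le> (c * mm u) powr (-\<alpha>)" using mm_act[of u j] c(1) Cons.prems by (intro powr_antimono) auto
    also have "\<dots> = c powr (-\<alpha>) * mm u powr (-\<alpha>)" using c(1) mm_nonneg by (intro powr_mult)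
    finally have "D j powr (\<alpha>/2) * mm (act j u) powr (-\<alpha>) \<le> D j powr (\<alpha>/2) * (c powr (-\<alpha>) * mm u powr (-\<alpha>))"
      by (intro mult_left_mono) auto
    also have "\<dots> \<le> Q powr \<alpha> * mm u powr (-\<alpha>)" using mult_right_mono[OF QD[of j], of "mm u powr (-\<alpha>)"] by (simp add: mult.assoc)
    finally have 1: "D j powr (\<alpha>/2) * mm (act j u) powr (-\<alpha>) \<le> Q powr \<alpha> * mm u powr (-\<alpha>)" .
    have "prod_list (map D (j # w)) powr (\<alpha>/2) * mm (fold act (j # w) u) powr (-\<alpha>)
        = D j powr (\<alpha>/2) * (prod_list (map D w) powr (\<alpha>/2) * mm (fold act w (act j u)) powr (-\<alpha>))"
      using pl D_pos[of j] by (simp add: powr_mult)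
    also have "\<dots> \<le> D j powr (\<alpha>/2) * (Q powr (\<alpha> * real (length w)) * mm (act j u) powr (-\<alpha>))"
      using Cons.IH[OF mp] by (intro mult_left_mono) auto
    also have "\<dots> = Q powr (\<alpha> * real (length w)) * (D j powr (\<alpha>/2) * mm (act j u) powr (-\<alpha>))" by simp
    also have "\<dots> \<le> Q powr (\<alpha> * real (length w)) * (Q powr \<alpha> * mm u powr (-\<alpha>))" by (intro mult_left_mono 1) auto
    also have "\<dots> = Q powr (\<alpha> * real (length (j # w))) * mm u powr (-\<alpha>)" using Q by (simp add: distrib_left powr_add)
    finally show ?case using Cons.IH[OF mp] by simp
  qed (use Q in simp)
  define Z where "Z = Q powr (\<alpha> * real (Suc r)) * mm v powr (-\<alpha>)"
  have Z: "0 \<le> Z" by (simp add: Z_def)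
  have cwz: "cw gg act w v * ph v \<le> Z * (1 + e * (\<bar>snd (fold act w v)\<bar> / mm (fold act w v)) powr \<theta>)" if "length w = Suc r" for w
  proof -
    have "cw gg act w v * ph v = (prod_list (map D w) powr (\<alpha>/2) * mm (fold act w v) powr (-\<alpha>)) * (1 + e * (\<bar>snd (fold act w v)\<bar> / mm (fold act w v)) powr \<theta>)"
      using ph_pos[OF m] by (simp add: cw_gg[OF m] ph_def[of "fold act w v"])
    also have "\<dots> \<le> Z * (1 + e * (\<bar>snd (fold act w v)\<bar> / mm (fold act w v)) powr \<theta>)"
      using mfold[OF m, of w] that e by (intro mult_right_mono) (auto simp: Z_def intro!: add_nonneg_nonneg)
    finally show ?thesis .
  qed
  obtain w0 where w0: "length w0 = Suc r" "2 * K * \<eta> * \<bar>snd (fold act w0 v)\<bar> \<le> \<bar>fst (fold act w0 v)\<bar>"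
    using escape_word[OF \<eta>0] by blast
  have up1: "cw gg act w v * ph v \<le> Z * (1 + e * H)" if "length w = Suc r" for w
  proof -
    have "Z * (1 + e * (\<bar>snd (fold act w v)\<bar> / mm (fold act w v)) powr \<theta>) \<le> Z * (1 + e * H)"
      using Z e q[of "fold act w v"] mfold[OF m, of w] by (intro mult_left_mono add_left_mono) auto
    thus ?thesis using cwz[OF that] by linarith
  qed
  have up2: "cw gg act w0 v * ph v \<le> Z * (1 + e * (2 powr (-\<theta>) * H))"
  proof -
    let ?u = "fold act w0 v"
    have mu: "0 < mm ?u" using mfold[OF m, of w0] by blast
    have "2 * K * \<eta> * \<bar>snd ?u\<bar> \<le> mm ?u" using w0(2) by (simp add: mm_def)
    hence "\<bar>snd ?u\<bar> / mm ?u \<le> 1 / (2 * (K * \<eta>))" using mu Ke by (simp add: field_simps)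
    hence "(\<bar>snd ?u\<bar> / mm ?u) powr \<theta> \<le> (1 / (2 * (K * \<eta>))) powr \<theta>" using mu \<theta> by (intro powr_mono2) auto
    also have "\<dots> = 2 powr (-\<theta>) * H" using Ke by (simp add: H_def powr_minus_divide powr_divide powr_mult)
    finally have "Z * (1 + e * (\<bar>snd ?u\<bar> / mm ?u) powr \<theta>) \<le> Z * (1 + e * (2 powr (-\<theta>) * H))"
      using Z e by (intro mult_left_mono add_left_mono) auto
    thus ?thesis using cwz[OF w0(1)] by linarith
  qed
  have H0: "0 \<le> H" by (simp add: H_def)
  have t2: "2 powr (-\<theta>) \<le> (1::real)" using \<theta> powr_mono[of "-\<theta>" 0 "2::real"] by simp
  have "EW p (Suc r) (\<lambda>w. cw gg act w v * ph v) \<le> Z * (1 + e * H) - \<pi> ^ Suc r * (Z * (1 + e * H) - Z * (1 + e * (2 powr (-\<theta>) * H)))"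
  proof (rule EW_le_special[where ?w0.0 = w0 and n = "Suc r" and F = "\<lambda>w. cw gg act w v * ph v"])
    have "2 powr (-\<theta>) * H \<le> 1 * H" using t2 H0 by (intro mult_right_mono) auto
    thus "Z * (1 + e * (2 powr (-\<theta>) * H)) \<le> Z * (1 + e * H)" using Z e by (intro mult_left_mono add_left_mono) auto
  qed (use \<pi> up1 up2 w0(1) in auto)
  also have "\<dots> = Z * (1 + e * H - \<pi> ^ Suc r * (1 - 2 powr (-\<theta>)) * (e * H))" by (simp add: algebra_simps)
  also have "\<dots> \<le> Z * ((1 + e * H) * (1 - \<pi> ^ Suc r * (1 - 2 powr (-\<theta>)) / 2))"
  proof (rule mult_left_mono[OF _ Z])
    \<comment> \<open>By \<open>cap\<close> the term e H is at least half of the factor 1 + e H, so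
      reducing H reduces the whole factor by a definite share.\<close>
    have "1 + e * H \<le> 2 * (e * H)" using cap[OF \<eta>0] by (simp add: H_def)
    moreover have "0 \<le> \<pi> ^ Suc r * (1 - 2 powr (-\<theta>))" using \<pi>(1) t2 by simp
    ultimately have "\<pi> ^ Suc r * (1 - 2 powr (-\<theta>)) * (1 + e * H) \<le> \<pi> ^ Suc r * (1 - 2 powr (-\<theta>)) * (2 * (e * H))"
      by (intro mult_left_mono)
    moreover have "q * (1 + h) \<le> q * (2 * h) \<Longrightarrow> 1 + h - q * h \<le> (1 + h) * (1 - q / 2)" for q h :: real
      by (simp add: field_simps)
    ultimately show "1 + e * H - \<pi> ^ Suc r * (1 - 2 powr (-\<theta>)) * (e * H) \<le> (1 + e * H) * (1 - \<pi> ^ Suc r * (1 - 2 powr (-\<theta>)) / 2)"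
      by blast
  qed
  also have "\<dots> = (Q powr (\<alpha> * real (Suc r)) * (1 - \<pi> ^ Suc r * (1 - 2 powr (-\<theta>)) / 2)) * ph v"
    by (simp add: Z_def phv)
  also have "\<dots> \<le> \<kappa> * ph v" using k3[of jm] ph_pos[OF m] unfolding Q_def jm by (intro mult_right_mono) auto
  finally have "ph v * EW p (Suc r) (\<lambda>w. cw gg act w v) \<le> ph v * \<kappa>"
    by (simp only: mult.commute[of _ "ph v"] EW_cmult)
  thus ?thesis using ph_pos[OF m] by simp
qed

text \<open>A crude bound for one step. It does not involve \<eta>, so the constant for incomplete
  blocks is uniform over the perturbations.\<close>

lemma gg_bound: "0 < mm v \<Longrightarrow> gg j v \<le> DD j powr (\<alpha>/2) * c powr (-\<alpha>) * (1 + (C / c) powr \<theta> + e * (\<Gamma> / c) powr \<theta>)"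
proof -
  assume m: "0 < mm v"
  obtain x y where v: "v = (x, y)" by (cases v)
  define y' where "y' = snd (act j v)"
  have xm: "\<bar>x\<bar> \<le> mm v" by (simp add: mm_def v)
  have cm: "0 < c * mm v" using c m by simp
  have "\<bar>y'\<bar> \<le> \<bar>g j\<bar> * \<bar>x\<bar> + \<bar>d j\<bar> * \<bar>y\<bar>" by (simp add: y'_def mat_act_def v) (metis abs_mult abs_triangle_ineq)
  also have "\<dots> \<le> \<Gamma> * mm v + C * \<bar>y\<bar>" using \<Gamma> C xm by (intro add_mono mult_mono) auto
  finally have "\<bar>y'\<bar> / mm (act j v) \<le> (\<Gamma> * mm v + C * \<bar>y\<bar>) / (c * mm v)"
    using mm_act[of v j] cm \<Gamma>(1) m by (intro frac_le) (auto intro!: add_nonneg_nonneg mult_nonneg_nonneg)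
  also have "\<dots> = C / c * (\<bar>y\<bar> / mm v) + \<Gamma> / c" using m by (simp add: add_divide_distrib)
  finally have "(\<bar>y'\<bar> / mm (act j v)) powr \<theta> \<le> (C / c * (\<bar>y\<bar> / mm v) + \<Gamma> / c) powr \<theta>"
    using mm_nonneg \<theta> by (intro powr_mono2) auto
  also have "\<dots> \<le> (C / c * (\<bar>y\<bar> / mm v)) powr \<theta> + (\<Gamma> / c) powr \<theta>"
    using \<theta> C c \<Gamma> m by (intro powr_add_le) auto
  also have "(C / c * (\<bar>y\<bar> / mm v)) powr \<theta> = (C / c) powr \<theta> * (\<bar>y\<bar> / mm v) powr \<theta>" using C(1) c(1) m by (intro powr_mult)
  finally have q: "(\<bar>y'\<bar> / mm (act j v)) powr \<theta> \<le> (C / c) powr \<theta> * (\<bar>y\<bar> / mm v) powr \<theta> + (\<Gamma> / c) powr \<theta>" .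
  let ?t = "(\<bar>y\<bar> / mm v) powr \<theta>"
  have phv: "ph v = mm v powr (-\<alpha>) * (1 + e * ?t)" unfolding ph_def by (simp add: v)
  have "ph (act j v) \<le> (c * mm v) powr (-\<alpha>) * (1 + e * ((C / c) powr \<theta> * ?t + (\<Gamma> / c) powr \<theta>))"
    unfolding ph_def y'_def[symmetric] using q e
    by (intro mult_mono powr_antimono cm mm_act add_left_mono mult_left_mono) auto
  also have "\<dots> \<le> (c * mm v) powr (-\<alpha>) * ((1 + (C / c) powr \<theta> + e * (\<Gamma> / c) powr \<theta>) * (1 + e * ?t))"
  proof (intro mult_left_mono)
    have "0 \<le> (e * ?t) + (C / c) powr \<theta> + e * (\<Gamma> / c) powr \<theta> * (e * ?t)" using e by (intro add_nonneg_nonneg mult_nonneg_nonneg) auto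
    thus "1 + e * ((C / c) powr \<theta> * ?t + (\<Gamma> / c) powr \<theta>) \<le> (1 + (C / c) powr \<theta> + e * (\<Gamma> / c) powr \<theta>) * (1 + e * ?t)"
      by (simp add: algebra_simps)
  qed auto
  also have "(c * mm v) powr (-\<alpha>) = c powr (-\<alpha>) * mm v powr (-\<alpha>)" using c(1) m by (intro powr_mult)
  finally have "ph (act j v) \<le> c powr (-\<alpha>) * (1 + (C / c) powr \<theta> + e * (\<Gamma> / c) powr \<theta>) * ph v"
    by (simp add: phv mult_ac)
  hence "D j powr (\<alpha>/2) * ph (act j v) \<le> DD j powr (\<alpha>/2) * (c powr (-\<alpha>) * (1 + (C / c) powr \<theta> + e * (\<Gamma> / c) powr \<theta>) * ph v)"
    using DD[of j] \<alpha> ph_pos[OF mm_act_pos[OF m, of j]] by (intro mult_mono powr_mono2) (auto simp: D_def)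
  thus ?thesis using ph_pos[OF m] by (simp add: gg_def divide_le_eq mult.assoc)
qed

text \<open>The vector (1, 0) has \<open>mm\<close> and \<open>ph\<close> equal to 1 whatever \<eta>
  is, so the prefactor does not deteriorate as \<eta> tends to 0. Since K \<eta> is at most 1,
  \<open>ph\<close> dominates the power of the maximum norm.\<close>

lemma contraction:
  assumes K2: "1 \<le> K2" "\<And>j. DD j powr (\<alpha>/2) * c powr (-\<alpha>) * (1 + (C / c) powr \<theta> + e * (\<Gamma> / c) powr \<theta>) \<le> K2"
  shows "EW p n (\<lambda>w. prod_list (map D w) powr (\<alpha>/2) * (max \<bar>fst (fold act w (1, 0))\<bar> \<bar>snd (fold act w (1, 0))\<bar>) powr (-\<alpha>))
    \<le> K2 ^ Suc r / \<kappa> * root (Suc r) \<kappa> ^ n"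
proof -
  have m1: "mm (1, 0) = 1" by (simp add: mm_def)
  have "EW p n (\<lambda>w. prod_list (map D w) powr (\<alpha>/2) * (max \<bar>fst (fold act w (1, 0))\<bar> \<bar>snd (fold act w (1, 0))\<bar>) powr (-\<alpha>))
    \<le> EW p n (\<lambda>w. cw gg act w (1, 0))"
  proof (rule EW_mono)
    fix w :: "'a list"
    have mf: "0 < mm (fold act w u)" if "0 < mm u" for u
      using that
    proof (induction w arbitrary: u)
      case (Cons j w)
      show ?case using Cons.IH[OF mm_act_pos[OF Cons.prems]] by simp
    qed simp
    let ?u = "fold act w (1, 0)"
    have "mm ?u \<le> max \<bar>fst ?u\<bar> \<bar>snd ?u\<bar>"
    proof -
      have "K * \<eta> * \<bar>snd ?u\<bar> \<le> 1 * \<bar>snd ?u\<bar>" using K(3) by (intro mult_right_mono) auto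
      thus ?thesis unfolding mm_def by (intro max.mono) auto
    qed
    hence "(max \<bar>fst ?u\<bar> \<bar>snd ?u\<bar>) powr (-\<alpha>) \<le> mm ?u powr (-\<alpha>)" using mf m1 by (intro powr_antimono) auto
    also have "\<dots> \<le> ph ?u" by (rule ph_ge)
    finally have "prod_list (map D w) powr (\<alpha>/2) * (max \<bar>fst ?u\<bar> \<bar>snd ?u\<bar>) powr (-\<alpha>) \<le> prod_list (map D w) powr (\<alpha>/2) * ph ?u"
      by (intro mult_left_mono) auto
    also have "\<dots> = cw gg act w (1, 0)" by (subst cw_gg) (auto simp: m1 ph_def[of "(1,0)"])
    finally show "prod_list (map D w) powr (\<alpha>/2) * (max \<bar>fst ?u\<bar> \<bar>snd ?u\<bar>) powr (-\<alpha>) \<le> cw gg act w (1, 0)" .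
  qed
  also have "\<dots> \<le> K2 ^ Suc r / \<kappa> * root (Suc r) \<kappa> ^ n"
  proof (rule variable_step_contraction[where V="{v. 0 < mm v}" and g=gg and act=act])
    fix v j assume v: "v \<in> {v. 0 < mm v}"
    show "act j v \<in> {v. 0 < mm v}" using mm_act_pos v by blast
    show "0 \<le> gg j v" using ph_pos[of v] ph_pos[OF mm_act_pos, of v j] v by (auto simp: gg_def intro!: divide_nonneg_pos mult_nonneg_nonneg less_imp_le)
    show "gg j v \<le> K2" using gg_bound[of v j] K2(2)[of j] v by auto
  next
    fix v assume v: "v \<in> {v. 0 < mm v}"
    show "\<exists>i\<in>{1..Suc r}. EW p i (\<lambda>w. cw gg act w v) \<le> \<kappa>"
    proof (cases "K * \<eta> * \<bar>snd v\<bar> \<le> \<bar>fst v\<bar>")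
      case True
      thus ?thesis using one_step_outside[of v] v by (intro bexI[of _ 1]) (auto simp del: EW.simps)
    next
      case False
      thus ?thesis using steps_inside[of v] v by (intro bexI[of _ "Suc r"]) (auto simp del: EW.simps)
    qed
  qed (use K2 \<kappa> m1 in auto)
  finally show ?thesis .
qed

end

section \<open>Choice of the constants, and coordinates adapted to a perturbed cocycle\<close>

lemma sum_exp_less_1:
  fixes p :: "'a::finite pmf" and f :: "'a \<Rightarrow> real"
  assumes "(\<Sum>j\<in>UNIV. pmf p j * f j) < 0"
  shows "\<exists>t0>0. \<forall>t. 0 < t \<and> t \<le> t0 \<longrightarrow> (\<Sum>j\<in>UNIV. pmf p j * exp (t * f j)) < 1"
  using EW_exp_less_1[of p 1 "\<lambda>w. f (hd w)"] assms by simp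

text \<open>The order of the choices matters: the margin \<zeta> comes from the gap; \<theta>, G and
  the word length r come from \<zeta>; \<alpha> is small depending on r; e depends on \<alpha>; the
  size \<epsilon> of the perturbation is last. The lower left entries are only bounded by \<Gamma>,
  not small.\<close>

lemma escape_contraction_exists:
  fixes p :: "'a::finite pmf" and a0 d0 :: "'a \<Rightarrow> real"
  assumes sup: "set_pmf p = UNIV" and nz: "\<And>j. a0 j \<noteq> 0" "\<And>j. d0 j \<noteq> 0" and \<Gamma>: "0 \<le> \<Gamma>"
    and gap: "(\<Sum>j\<in>UNIV. pmf p j * ln \<bar>d0 j\<bar>) < (\<Sum>j\<in>UNIV. pmf p j * ln \<bar>a0 j\<bar>)"
  shows "\<exists>j0 \<alpha> \<epsilon> M q. \<bar>d0 j0\<bar> < \<bar>a0 j0\<bar> \<and> 0 < \<alpha> \<and> \<alpha> \<le> 2 \<and> 0 < \<epsilon> \<and> 0 < q \<and> q < 1 \<and>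
    (\<forall>a b g d. (\<forall>j. \<bar>a j - a0 j\<bar> \<le> \<epsilon> \<and> \<bar>d j - d0 j\<bar> \<le> \<epsilon> \<and> \<bar>b j\<bar> \<le> \<epsilon> \<and> \<bar>g j\<bar> \<le> \<Gamma>) \<longrightarrow> b j0 = 0 \<longrightarrow>
      (\<forall>n. EW p n (\<lambda>w. prod_list (map (\<lambda>j. \<bar>a j * d j - b j * g j\<bar>) w) powr (\<alpha>/2) *
         (max \<bar>fst (fold (mat_act a b g d) w (1, 0))\<bar> \<bar>snd (fold (mat_act a b g d) w (1, 0))\<bar>) powr (-\<alpha>)) \<le> M * q ^ n))"
proof -
  have ppos: "0 < pmf p j" for j using sup by (simp add: pmf_positive)
  obtain j0 where j0: "\<bar>d0 j0\<bar> < \<bar>a0 j0\<bar>"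
  proof (rule ccontr)
    assume "\<not> thesis"
    hence "\<bar>a0 j\<bar> \<le> \<bar>d0 j\<bar>" for j using that by (meson not_le)
    hence "(\<Sum>j\<in>UNIV. pmf p j * ln \<bar>a0 j\<bar>) \<le> (\<Sum>j\<in>UNIV. pmf p j * ln \<bar>d0 j\<bar>)"
      using nz by (intro sum_mono mult_left_mono ln_mono) auto
    thus False using gap by simp
  qed
  have id0: "((\<lambda>z::real. z) \<longlongrightarrow> 0) (at_right 0)" by (rule tendsto_ident_at)
  \<comment> \<open>Each of the conditions F1 to F6 is strict at margin 0, so a small positive
    margin satisfies them all. For F2 the value at 0 is half of the difference of the two
    means.\<close>
  have F1: "eventually (\<lambda>z. (\<Sum>j\<in>UNIV. pmf p j * (ln (\<bar>d0 j\<bar> + z) - ln (\<bar>a0 j\<bar> - 2 * z))) < 0) (at_right 0)"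
  proof (rule order_tendstoD(2))
    show "((\<lambda>z. (\<Sum>j\<in>UNIV. pmf p j * (ln (\<bar>d0 j\<bar> + z) - ln (\<bar>a0 j\<bar> - 2 * z)))) \<longlongrightarrow>
        (\<Sum>j\<in>UNIV. pmf p j * (ln (\<bar>d0 j\<bar> + 0) - ln (\<bar>a0 j\<bar> - 2 * 0)))) (at_right 0)"
      using nz by (intro tendsto_intros id0) auto
    show "(\<Sum>j\<in>UNIV. pmf p j * (ln (\<bar>d0 j\<bar> + 0) - ln (\<bar>a0 j\<bar> - 2 * 0))) < 0"
      using gap by (simp add: right_diff_distrib sum_subtractf)
  qed
  have F2: "eventually (\<lambda>z. (\<Sum>j\<in>UNIV. pmf p j * (ln ((\<bar>a0 j\<bar> + z) * (\<bar>d0 j\<bar> + z) + z) / 2 - ln (\<bar>a0 j\<bar> - 2 * z))) < 0) (at_right 0)"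
  proof (rule order_tendstoD(2))
    show "((\<lambda>z. (\<Sum>j\<in>UNIV. pmf p j * (ln ((\<bar>a0 j\<bar> + z) * (\<bar>d0 j\<bar> + z) + z) / 2 - ln (\<bar>a0 j\<bar> - 2 * z)))) \<longlongrightarrow>
        (\<Sum>j\<in>UNIV. pmf p j * (ln ((\<bar>a0 j\<bar> + 0) * (\<bar>d0 j\<bar> + 0) + 0) / 2 - ln (\<bar>a0 j\<bar> - 2 * 0)))) (at_right 0)"
      using nz by (intro tendsto_intros id0) auto
    have "(\<Sum>j\<in>UNIV. pmf p j * (ln ((\<bar>a0 j\<bar> + 0) * (\<bar>d0 j\<bar> + 0) + 0) / 2 - ln (\<bar>a0 j\<bar> - 2 * 0)))
      = ((\<Sum>j\<in>UNIV. pmf p j * ln \<bar>d0 j\<bar>) - (\<Sum>j\<in>UNIV. pmf p j * ln \<bar>a0 j\<bar>)) / 2"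
      using nz by (simp add: ln_mult_pos sum_subtractf[symmetric] sum_divide_distrib) (intro sum.cong refl, simp add: field_simps)
    thus "(\<Sum>j\<in>UNIV. pmf p j * (ln ((\<bar>a0 j\<bar> + 0) * (\<bar>d0 j\<bar> + 0) + 0) / 2 - ln (\<bar>a0 j\<bar> - 2 * 0))) < 0"
      using gap by simp
  qed
  have F3: "eventually (\<lambda>z. \<forall>j\<in>UNIV. 0 < \<bar>a0 j\<bar> - 2 * z) (at_right 0)"
  proof (intro eventually_ball_finite ballI)
    fix j
    have "((\<lambda>z. \<bar>a0 j\<bar> - 2 * z) \<longlongrightarrow> \<bar>a0 j\<bar> - 2 * 0) (at_right 0)" by (intro tendsto_intros id0)
    thus "eventually (\<lambda>z. 0 < \<bar>a0 j\<bar> - 2 * z) (at_right 0)" using nz by (intro order_tendstoD) auto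
  qed simp
  have F4: "eventually (\<lambda>z. 0 < (\<bar>a0 j0\<bar> - 2 * z) - (\<bar>d0 j0\<bar> + z)) (at_right 0)"
  proof (rule order_tendstoD(1))
    show "((\<lambda>z. (\<bar>a0 j0\<bar> - 2 * z) - (\<bar>d0 j0\<bar> + z)) \<longlongrightarrow> (\<bar>a0 j0\<bar> - 2 * 0) - (\<bar>d0 j0\<bar> + 0)) (at_right 0)" by (intro tendsto_intros id0)
  qed (use j0 in simp)
  have F5: "eventually (\<lambda>z. \<forall>j\<in>UNIV. 0 < (\<bar>a0 j\<bar> - z) * (\<bar>d0 j\<bar> - z) - z) (at_right 0)"
  proof (intro eventually_ball_finite ballI)
    fix j
    have "((\<lambda>z. (\<bar>a0 j\<bar> - z) * (\<bar>d0 j\<bar> - z) - z) \<longlongrightarrow> (\<bar>a0 j\<bar> - 0) * (\<bar>d0 j\<bar> - 0) - 0) (at_right 0)" by (intro tendsto_intros id0)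
    thus "eventually (\<lambda>z. 0 < (\<bar>a0 j\<bar> - z) * (\<bar>d0 j\<bar> - z) - z) (at_right 0)" using nz by (intro order_tendstoD) auto
  qed simp
  have F6: "eventually (\<lambda>z. \<forall>j\<in>UNIV. 0 < \<bar>d0 j\<bar> - z) (at_right 0)"
  proof (intro eventually_ball_finite ballI)
    fix j
    have "((\<lambda>z. \<bar>d0 j\<bar> - z) \<longlongrightarrow> \<bar>d0 j\<bar> - 0) (at_right 0)" by (intro tendsto_intros id0)
    thus "eventually (\<lambda>z. 0 < \<bar>d0 j\<bar> - z) (at_right 0)" using nz by (intro order_tendstoD) auto
  qed simp
  have F7: "eventually (\<lambda>z::real. 0 < z \<and> z < 1) (at_right 0)"
    using eventually_at_right_real[of 0 1] by simp
  from eventually_happens'[OF trivial_limit_at_right_real eventually_conj[OF F1 eventually_conj[OF F2 eventually_conj[OF F3 eventually_conj[OF F4 eventually_conj[OF F5 eventually_conj[OF F6 F7]]]]]]]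
  obtain \<zeta> where \<zeta>1: "(\<Sum>j\<in>UNIV. pmf p j * (ln (\<bar>d0 j\<bar> + \<zeta>) - ln (\<bar>a0 j\<bar> - 2 * \<zeta>))) < 0"
    and \<zeta>2: "(\<Sum>j\<in>UNIV. pmf p j * (ln ((\<bar>a0 j\<bar> + \<zeta>) * (\<bar>d0 j\<bar> + \<zeta>) + \<zeta>) / 2 - ln (\<bar>a0 j\<bar> - 2 * \<zeta>))) < 0"
    and \<zeta>3: "\<And>j. 0 < \<bar>a0 j\<bar> - 2 * \<zeta>" and \<zeta>4: "0 < (\<bar>a0 j0\<bar> - 2 * \<zeta>) - (\<bar>d0 j0\<bar> + \<zeta>)"
    and \<zeta>5: "\<And>j. 0 < (\<bar>a0 j\<bar> - \<zeta>) * (\<bar>d0 j\<bar> - \<zeta>) - \<zeta>" and \<zeta>6: "\<And>j. 0 < \<bar>d0 j\<bar> - \<zeta>" and \<zeta>: "0 < \<zeta>" "\<zeta> < 1"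
    by blast
  define lo where "lo j = \<bar>a0 j\<bar> - 2 * \<zeta>" for j
  define up where "up j = \<bar>d0 j\<bar> + \<zeta>" for j
  define DD where "DD j = (\<bar>a0 j\<bar> + \<zeta>) * (\<bar>d0 j\<bar> + \<zeta>) + \<zeta>" for j
  define dd where "dd j = (\<bar>a0 j\<bar> - \<zeta>) * (\<bar>d0 j\<bar> - \<zeta>) - \<zeta>" for j
  define K where "K = 1 / \<zeta>"
  define C where "C = 2 + (\<Sum>j\<in>UNIV. \<bar>a0 j\<bar> + \<bar>d0 j\<bar>)"
  define c where "c = min 1 (Min (range dd) / (C + 1 + \<Gamma>))"
  have lo: "0 < lo j" for j using \<zeta>3 by (simp add: lo_def)
  have up: "0 < up j" for j using \<zeta> by (simp add: up_def add_nonneg_pos)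
  have DDp: "0 < DD j" for j using \<zeta> by (auto simp: DD_def intro!: add_nonneg_pos mult_nonneg_nonneg)
  have K: "1 \<le> K" "K * \<zeta> = 1" "0 < K" using \<zeta> by (auto simp: K_def)
  have Cj: "\<bar>a0 j\<bar> + \<bar>d0 j\<bar> + 2 \<le> C" for j unfolding C_def using member_le_sum[of j UNIV "\<lambda>j. \<bar>a0 j\<bar> + \<bar>d0 j\<bar>"] by simp
  have C1: "1 \<le> C" using Cj[of j0] by linarith
  have ddm: "0 < Min (range dd)" using \<zeta>5 by (subst Min_gr_iff) (auto simp: dd_def)
  have c: "0 < c" "c \<le> 1" "c * (C + 1 + \<Gamma>) \<le> dd j" for j
  proof -
    have pos: "0 < C + 1 + \<Gamma>" using C1 \<Gamma> by linarith
    show "0 < c" "c \<le> 1" using ddm pos by (auto simp: c_def)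
    have "c * (C + 1 + \<Gamma>) \<le> Min (range dd) / (C + 1 + \<Gamma>) * (C + 1 + \<Gamma>)" using pos by (intro mult_right_mono) (auto simp: c_def)
    also have "\<dots> = Min (range dd)" using pos by simp
    also have "\<dots> \<le> dd j" by (intro Min_le) auto
    finally show "c * (C + 1 + \<Gamma>) \<le> dd j" .
  qed
  have "(\<Sum>j\<in>UNIV. pmf p j * (ln (up j) - ln (lo j))) < 0" using \<zeta>1 by (simp add: up_def lo_def)
  from sum_exp_less_1[OF this] obtain t1 where t1: "0 < t1" "\<And>t. 0 < t \<Longrightarrow> t \<le> t1 \<Longrightarrow> (\<Sum>j\<in>UNIV. pmf p j * exp (t * (ln (up j) - ln (lo j)))) < 1" by blast
  define \<theta> where "\<theta> = min 1 t1"
  have \<theta>: "0 < \<theta>" "\<theta> \<le> 1" using t1 by (auto simp: \<theta>_def)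
  have "(up j / lo j) powr \<theta> = exp (\<theta> * (ln (up j) - ln (lo j)))" for j
    using up[of j] lo[of j] by (simp add: powr_def ln_div)
  hence th: "(\<Sum>j\<in>UNIV. pmf p j * (up j / lo j) powr \<theta>) < 1" using t1(2)[of \<theta>] \<theta> by (simp add: \<theta>_def)
  define G where "G = (lo j0 / up j0 + 1) / 2"
  have lu: "up j0 < lo j0" using \<zeta>4 by (simp add: lo_def up_def)
  have G: "1 < G" "G * up j0 = (lo j0 + up j0) / 2" using lu up[of j0] by (auto simp: G_def field_simps)
  obtain r where "2 * K * (2 * (C + \<Gamma>)) < G ^ r" using real_arch_pow[OF G(1)] by blast
  hence r: "2 * K \<le> 1 / (2 * (C + \<Gamma>)) * G ^ r" using C1 \<Gamma> by (simp add: field_simps)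
  define \<pi> where "\<pi> = Min (range (pmf p))"
  have \<pi>: "0 < \<pi>" "\<pi> \<le> pmf p j" for j using ppos by (auto simp: \<pi>_def)
  define qq where "qq = \<pi> ^ Suc r * (1 - 2 powr (-\<theta>))"
  have "2 powr (-\<theta>) < (1::real)" using \<theta> powr_less_mono[of "-\<theta>" 0 "2::real"] by simp
  hence qq: "0 < qq" using \<pi>(1) by (simp add: qq_def)
  have "(\<Sum>j\<in>UNIV. pmf p j * (ln (DD j) / 2 - ln (lo j))) < 0" using \<zeta>2 by (simp add: DD_def lo_def)
  from sum_exp_less_1[OF this] obtain t2 where t2: "0 < t2" "\<And>t. 0 < t \<Longrightarrow> t \<le> t2 \<Longrightarrow> (\<Sum>j\<in>UNIV. pmf p j * exp (t * (ln (DD j) / 2 - ln (lo j)))) < 1" by blast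
  \<comment> \<open>Three demands on \<alpha>: at most \<open>t2\<close> for the contraction of the
    constant part, close to 0 so that the \<theta>-contraction survives the extra factors, and so
    small that the loss over r + 1 letters is beaten by the gain \<open>qq / 2\<close>. The bound 2
    makes the final exponent \<alpha>/2 at most 1.\<close>
  have E1: "eventually (\<lambda>t. 0 < t \<and> t < min t2 2) (at_right 0)" using eventually_at_right_real[of 0 "min t2 2"] t2(1) by simp
  have E2: "eventually (\<lambda>t. (\<Sum>j\<in>UNIV. pmf p j * (DD j powr (t/2) * lo j powr (-t) * (up j / lo j) powr \<theta>)) < 1) (at_right 0)"
  proof (rule order_tendstoD(2))
    show "((\<lambda>t. (\<Sum>j\<in>UNIV. pmf p j * (DD j powr (t/2) * lo j powr (-t) * (up j / lo j) powr \<theta>))) \<longlongrightarrow>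
       (\<Sum>j\<in>UNIV. pmf p j * (DD j powr (0/2) * lo j powr (-0) * (up j / lo j) powr \<theta>))) (at_right 0)"
      using DDp lo by (intro tendsto_intros tendsto_powr id0) (auto simp: less_imp_neq[symmetric])
  qed (use th DDp lo in \<open>simp add: less_imp_neq[symmetric]\<close>)
  have E3: "eventually (\<lambda>t. \<forall>j\<in>UNIV. ((DD j powr (1/2) + 1) / c) powr (t * real (Suc r)) * (1 - qq / 2) < 1) (at_right 0)"
  proof (intro eventually_ball_finite ballI order_tendstoD(2))
    fix j
    have b: "0 < (DD j powr (1/2) + 1) / c" using c(1) by (intro divide_pos_pos add_nonneg_pos) auto
    show "((\<lambda>t. ((DD j powr (1/2) + 1) / c) powr (t * real (Suc r)) * (1 - qq / 2)) \<longlongrightarrow> ((DD j powr (1/2) + 1) / c) powr (0 * real (Suc r)) * (1 - qq / 2)) (at_right 0)"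
      using b by (intro tendsto_mult tendsto_powr tendsto_const id0) auto
    show "((DD j powr (1/2) + 1) / c) powr (0 * real (Suc r)) * (1 - qq / 2) < 1" using b qq by (simp add: less_imp_neq[symmetric])
  qed simp
  from eventually_happens'[OF trivial_limit_at_right_real eventually_conj[OF E1 eventually_conj[OF E2 E3]]]
  obtain \<alpha> where \<alpha>': "0 < \<alpha>" "\<alpha> < min t2 2"
    and a2: "(\<Sum>j\<in>UNIV. pmf p j * (DD j powr (\<alpha>/2) * lo j powr (-\<alpha>) * (up j / lo j) powr \<theta>)) < 1"
    and a3: "\<And>j. ((DD j powr (1/2) + 1) / c) powr (\<alpha> * real (Suc r)) * (1 - qq / 2) < 1" by blast
  have \<alpha>: "0 < \<alpha>" "\<alpha> < t2" "\<alpha> \<le> 2" using \<alpha>' by auto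
  define u where "u j = DD j powr (\<alpha>/2) * lo j powr (-\<alpha>)" for j
  have "u j = exp (\<alpha> * (ln (DD j) / 2 - ln (lo j)))" for j
    using DDp[of j] lo[of j] by (simp add: u_def powr_def mult_exp_exp algebra_simps)
  hence a1: "(\<Sum>j\<in>UNIV. pmf p j * u j) < 1" using t2(2)[of \<alpha>] \<alpha> by simp
  define \<kappa>1 where "\<kappa>1 = (\<Sum>j\<in>UNIV. pmf p j * u j)"
  define G1 where "G1 = (\<Sum>j\<in>UNIV. pmf p j * (u j * (\<Gamma> / lo j) powr \<theta>))"
  have G1: "0 \<le> G1" by (auto simp: G1_def u_def intro!: sum_nonneg)
  \<comment> \<open>Half of the room left by \<kappa>1 is spent on the feedback; the 1 added to
    \<open>G1\<close> avoids a zero denominator.\<close>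
  define e where "e = (1 - \<kappa>1) / (2 * (G1 + 1))"
  have e: "0 < e" using a1 G1 by (auto simp: e_def \<kappa>1_def)
  have k1: "\<kappa>1 + e * G1 < 1"
  proof -
    have "e * G1 \<le> e * (G1 + 1)" using e by (intro mult_left_mono) auto
    also have "\<dots> = (1 - \<kappa>1) / 2"
    proof -
      have gen: "y \<noteq> 0 \<Longrightarrow> x / (2 * y) * y = x / 2" for x y :: real by simp
      show ?thesis unfolding e_def by (rule gen) (use G1 in simp)
    qed
    finally show ?thesis using a1 by (simp add: \<kappa>1_def)
  qed
  define \<kappa> where "\<kappa> = Max ({1/2, \<kappa>1 + e * G1, (\<Sum>j\<in>UNIV. pmf p j * (DD j powr (\<alpha>/2) * lo j powr (-\<alpha>) * (up j / lo j) powr \<theta>))}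
     \<union> range (\<lambda>j. ((DD j powr (1/2) + 1) / c) powr (\<alpha> * real (Suc r)) * (1 - qq / 2)))" (is "_ = Max ?S")
  have fS: "finite ?S" by simp
  have \<kappa>1: "\<kappa> < 1" unfolding \<kappa>_def using k1 a2 a3 by (subst Max_less_iff[OF fS]) auto
  have \<kappa>ge: "z \<in> ?S \<Longrightarrow> z \<le> \<kappa>" for z unfolding \<kappa>_def by (rule Max_ge[OF fS])
  have \<kappa>0: "0 < \<kappa>" using \<kappa>ge[of "1/2"] by simp
  \<comment> \<open>In this order: the diagonal entries stay within the margins, b g stays below
    \<zeta>, the capped term dominates 1 as \<open>cap\<close> requires, and the feedback spares the
    expansion by G.\<close>
  define \<epsilon> where "\<epsilon> = Min {\<zeta>, \<zeta> / (\<Gamma> + 1), \<zeta> * e powr (1/\<theta>), (lo j0 - up j0) / (2 * (2 * K * \<Gamma> * G + 1))}"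
  have den: "0 < 2 * (2 * K * \<Gamma> * G + 1)" using K \<Gamma> G(1) by (auto intro!: add_nonneg_pos mult_nonneg_nonneg)
  have \<epsilon>: "0 < \<epsilon>" unfolding \<epsilon>_def using \<zeta> \<Gamma> e lu den by (subst Min_gr_iff) (auto intro!: divide_pos_pos)
  have \<epsilon>le: "\<epsilon> \<le> \<zeta>" "\<epsilon> \<le> \<zeta> / (\<Gamma> + 1)" "\<epsilon> \<le> \<zeta> * e powr (1/\<theta>)" "\<epsilon> \<le> (lo j0 - up j0) / (2 * (2 * K * \<Gamma> * G + 1))"
    unfolding \<epsilon>_def by (auto intro!: Min_le)
  define K2 where "K2 = 1 + (\<Sum>j\<in>UNIV. DD j powr (\<alpha>/2) * c powr (-\<alpha>) * (1 + (C / c) powr \<theta> + e * (\<Gamma> / c) powr \<theta>))"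
  have K2j0: "0 \<le> DD j powr (\<alpha>/2) * c powr (-\<alpha>) * (1 + (C / c) powr \<theta> + e * (\<Gamma> / c) powr \<theta>)" for j
    using e by (intro mult_nonneg_nonneg add_nonneg_nonneg) auto
  have K2: "1 \<le> K2" "DD j powr (\<alpha>/2) * c powr (-\<alpha>) * (1 + (C / c) powr \<theta> + e * (\<Gamma> / c) powr \<theta>) \<le> K2" for j
  proof -
    show "1 \<le> K2" unfolding K2_def using K2j0 by (simp add: sum_nonneg)
    have "DD j powr (\<alpha>/2) * c powr (-\<alpha>) * (1 + (C / c) powr \<theta> + e * (\<Gamma> / c) powr \<theta>) \<le> K2 - 1"
      unfolding K2_def using member_le_sum[of j UNIV "\<lambda>j. DD j powr (\<alpha>/2) * c powr (-\<alpha>) * (1 + (C / c) powr \<theta> + e * (\<Gamma> / c) powr \<theta>)"] K2j0 by simp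
    thus "DD j powr (\<alpha>/2) * c powr (-\<alpha>) * (1 + (C / c) powr \<theta> + e * (\<Gamma> / c) powr \<theta>) \<le> K2" by simp
  qed
  have main: "EW p n (\<lambda>w. prod_list (map (\<lambda>j. \<bar>a j * d j - b j * g j\<bar>) w) powr (\<alpha>/2) *
         (max \<bar>fst (fold (mat_act a b g d) w (1, 0))\<bar> \<bar>snd (fold (mat_act a b g d) w (1, 0))\<bar>) powr (-\<alpha>))
      \<le> K2 ^ Suc r / \<kappa> * root (Suc r) \<kappa> ^ n"
    if A: "\<forall>j. \<bar>a j - a0 j\<bar> \<le> \<epsilon> \<and> \<bar>d j - d0 j\<bar> \<le> \<epsilon> \<and> \<bar>b j\<bar> \<le> \<epsilon> \<and> \<bar>g j\<bar> \<le> \<Gamma>" and b0: "b j0 = 0" for a b g d n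
  proof -
    define \<eta> where "\<eta> = Max (range (\<lambda>j. \<bar>b j\<bar>))"
    have "\<eta> \<in> range (\<lambda>j. \<bar>b j\<bar>)" unfolding \<eta>_def by (intro Max_in) auto
    then obtain j1 where j1: "\<bar>b j1\<bar> = \<eta>" by auto
    have \<eta>: "0 \<le> \<eta>" "\<eta> \<le> \<epsilon>" "\<bar>b j\<bar> \<le> \<eta>" for j using j1 A[rule_format, of j1] by (auto simp: \<eta>_def)
    have \<eta>\<zeta>: "\<eta> \<le> \<zeta>" using \<eta> \<epsilon>le by linarith
    have aj: "\<bar>a0 j\<bar> - \<zeta> \<le> \<bar>a j\<bar>" "\<bar>a j\<bar> \<le> \<bar>a0 j\<bar> + \<zeta>" "\<bar>d0 j\<bar> - \<zeta> \<le> \<bar>d j\<bar>" "\<bar>d j\<bar> \<le> \<bar>d0 j\<bar> + \<zeta>" for j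
      using A[rule_format, of j] \<epsilon>le(1) by linarith+
    have bg: "\<bar>b j * g j\<bar> \<le> \<zeta>" for j
    proof -
      have "\<bar>b j * g j\<bar> \<le> \<epsilon> * (\<Gamma> + 1)" using A[rule_format, of j] \<epsilon> unfolding abs_mult by (intro mult_mono) auto
      also have "\<dots> \<le> \<zeta> / (\<Gamma> + 1) * (\<Gamma> + 1)" using \<epsilon>le(2) \<Gamma> by (intro mult_right_mono) auto
      also have "\<dots> = \<zeta>" using \<Gamma> by simp
      finally show ?thesis .
    qed
    have Dle: "\<bar>a j * d j - b j * g j\<bar> \<le> DD j" for j
    proof -
      have "\<bar>a j * d j\<bar> \<le> (\<bar>a0 j\<bar> + \<zeta>) * (\<bar>d0 j\<bar> + \<zeta>)" unfolding abs_mult using aj[of j] \<zeta> by (intro mult_mono) auto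
      thus ?thesis using bg[of j] unfolding DD_def by linarith
    qed
    have Dge: "dd j \<le> \<bar>a j * d j - b j * g j\<bar>" for j
    proof -
      have "(\<bar>a0 j\<bar> - \<zeta>) * (\<bar>d0 j\<bar> - \<zeta>) \<le> \<bar>a j * d j\<bar>" unfolding abs_mult using aj[of j] \<zeta>6[of j] by (intro mult_mono) auto
      thus ?thesis using bg[of j] unfolding dd_def by linarith
    qed
    interpret escape p a b g d lo up DD K c C \<Gamma> \<eta> \<alpha> \<theta> e \<kappa> \<zeta> G \<pi> r j0 j1
    proof
      show "\<bar>a j\<bar> \<le> C" "\<bar>d j\<bar> \<le> C" for j using aj[of j] Cj[of j] \<zeta> abs_ge_zero[of "a0 j"] abs_ge_zero[of "d0 j"] by linarith+
      show "lo j + \<zeta> \<le> \<bar>a j\<bar>" for j using aj[of j] by (simp add: lo_def)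
      show "\<bar>d j\<bar> \<le> up j" for j using aj[of j] by (simp add: up_def)
      have "K * \<eta> \<le> K * \<zeta>" using K \<eta>\<zeta> by (intro mult_left_mono) auto
      thus "K * \<eta> \<le> 1" using K(2) by simp
      show "c * (C + 1 + \<Gamma>) \<le> \<bar>a j * d j - b j * g j\<bar>" for j using c(3)[of j] Dge[of j] by linarith
      have "(\<Sum>j\<in>UNIV. pmf p j * (DD j powr (\<alpha>/2) * lo j powr (-\<alpha>) * (1 + e * (\<Gamma> / lo j) powr \<theta>))) = \<kappa>1 + e * G1"
        by (simp add: \<kappa>1_def G1_def u_def sum.distrib sum_distrib_left algebra_simps)
      thus "(\<Sum>j\<in>UNIV. pmf p j * (DD j powr (\<alpha>/2) * lo j powr (-\<alpha>) * (1 + e * (\<Gamma> / lo j) powr \<theta>))) \<le> \<kappa>"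
        using \<kappa>ge[of "\<kappa>1 + e * G1"] by simp
      show "(\<Sum>j\<in>UNIV. pmf p j * (DD j powr (\<alpha>/2) * lo j powr (-\<alpha>) * (up j / lo j) powr \<theta>)) \<le> \<kappa>"
        by (rule \<kappa>ge) simp
      show "G * (up j0 + 2 * K * \<Gamma> * \<eta>) \<le> lo j0"
      proof -
        have "(2 * K * \<Gamma> * G) * \<eta> \<le> (2 * K * \<Gamma> * G + 1) * \<epsilon>" using \<eta> K \<Gamma> G(1) by (intro mult_mono) auto
        also have "\<dots> \<le> (2 * K * \<Gamma> * G + 1) * ((lo j0 - up j0) / (2 * (2 * K * \<Gamma> * G + 1)))"
          using \<epsilon>le(4) den by (intro mult_left_mono) auto
        also have "\<dots> = (lo j0 - up j0) / 2"
        proof -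
          have gen: "y \<noteq> 0 \<Longrightarrow> y * (x / (2 * y)) = x / 2" for x y :: real by simp
          show ?thesis by (rule gen) (use den in simp)
        qed
        finally show ?thesis using G(2) by (simp add: distrib_left mult_ac)
      qed
      show "((DD j powr (1/2) + 1) / c) powr (\<alpha> * real (Suc r)) * (1 - \<pi> ^ Suc r * (1 - 2 powr (-\<theta>)) / 2) \<le> \<kappa>" for j
        unfolding qq_def[symmetric] by (rule \<kappa>ge) blast
      show "1 \<le> e * (K * \<eta>) powr (-\<theta>)" if "0 < \<eta>"
      proof -
        have "K * \<eta> \<le> K * (\<zeta> * e powr (1/\<theta>))" using \<eta> \<epsilon>le(3) K by (intro mult_left_mono) auto
        also have "\<dots> = e powr (1/\<theta>)" using K(2) by (metis mult.assoc mult_1)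
        finally have "(K * \<eta>) powr \<theta> \<le> (e powr (1/\<theta>)) powr \<theta>" using K that \<theta> by (intro powr_mono2) auto
        also have "\<dots> = e" using e \<theta> by (simp add: powr_powr)
        finally have "(K * \<eta>) powr \<theta> \<le> e" .
        moreover have "0 < (K * \<eta>) powr \<theta>" using K that by simp
        ultimately show ?thesis by (simp add: powr_minus field_simps)
      qed
    qed (use \<eta> \<Gamma> A C1 lo up \<zeta> K Dle c \<alpha> \<theta> e \<kappa>0 \<kappa>1 b0 j1 G r \<pi> in auto)
    show ?thesis using contraction[OF K2, of n] unfolding D_def[abs_def] .
  qed
  have "0 < root (Suc r) \<kappa>" "root (Suc r) \<kappa> < 1" using \<kappa>0 \<kappa>1 by auto
  thus ?thesis using j0 \<alpha>(1,3) \<epsilon> main by blast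
qed

text \<open>The basis consists of \<open>f1\<close>, orthogonal to the invariant line, and a tilted
  vector \<open>f2 s\<close> spanning a line close to it. For every B near A the tilt s is chosen so
  that \<open>f2 s\<close> is an eigenvector of \<open>B j0\<close>; the matrices then satisfy the
  hypotheses of \<open>escape_contraction_exists\<close>, and the trajectory of \<open>f1\<close>
  bounds the norm of the product from below.\<close>

lemma estimate_if_invariant_slow:
  fixes A :: "'a::finite cocycle"
  assumes A: "A \<in> GLk" and gap: "Lminus p A < Lplus p A" and sup: "set_pmf p = UNIV"
    and v0: "v0 \<noteq> 0" and inv: "\<And>j. A j *v v0 \<in> span {v0}" and slow: "AE x in bern p. v0 \<in> span {edir A x}"
  shows "\<exists>a C \<kappa>. 0 < a \<and> a \<le> 1 \<and> 0 < \<kappa> \<and> \<kappa> < 1 \<and>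
    eventually (\<lambda>B. B \<in> GLk \<longrightarrow> (\<forall>n. EW p n (\<lambda>w. rat (wprod B w) powr a) \<le> C * \<kappa> ^ n)) (nbh A)"
proof -
  define u0 where "u0 = (1 / norm v0) *\<^sub>R v0"
  have u0: "norm u0 = 1" "u0 \<noteq> 0" using v0 by (auto simp: u0_def)
  \<comment> \<open>This sign gives cr f1 u0 = 1, so that coordinates in the basis are cross
    products without denominators.\<close>
  define f1 where "f1 = - perp u0"
  have f1: "norm f1 = 1" "f1 \<noteq> 0" using u0(1) perp_simps(3)[of u0] by (auto simp: f1_def simp del: perp_simps)
  have cf: "cr f1 u0 = 1" using cr_perp[of u0] cr_commute[of "perp u0" u0] u0(1) by (simp add: f1_def)
  have "\<exists>k. A j *v u0 = k *\<^sub>R u0" for j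
  proof -
    obtain k where "A j *v v0 = k *\<^sub>R v0" using inv[of j] by (auto simp: span_singleton)
    hence "A j *v u0 = k *\<^sub>R u0" by (simp add: u0_def matrix_vector_mult_scaleR)
    thus ?thesis by blast
  qed
  then obtain d0 where d0: "\<And>j. A j *v u0 = d0 j *\<^sub>R u0" by metis
  have d0nz: "d0 j \<noteq> 0" for j using d0[of j] matvec_pos[OF GLkD[OF A] u0(2), of j] by auto
  define a0 where "a0 j = cr (A j *v f1) u0" for j
  have ad: "det (A j) = a0 j * d0 j" for j
    using cr_matvec[of "A j" f1 u0] by (simp add: cf d0 a0_def mult.commute)
  have a0nz: "a0 j \<noteq> 0" for j using ad[of j] A by (auto simp: GLk_det)
  \<comment> \<open>On the invariant line the product is scalar multiplication by the product of the
    d0, so the law of large numbers gives its growth rate; as the line is slow, this rate is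
    L-.\<close>
  have sd: "(\<Sum>j\<in>UNIV. pmf p j * ln \<bar>d0 j\<bar>) = Lminus p A"
  proof -
    have nw: "ln (norm (wprod A w *v u0)) = sum_list (map (\<lambda>j. ln \<bar>d0 j\<bar>) w)" for w
    proof -
      have "norm (wprod A w *v u0) > 0 \<and> (\<exists>k. wprod A w *v u0 = k *\<^sub>R u0 \<and> k \<noteq> 0 \<and> ln \<bar>k\<bar> = sum_list (map (\<lambda>j. ln \<bar>d0 j\<bar>) w))"
      proof (induction w)
        case (Cons j w)
        then obtain k where k: "wprod A w *v u0 = k *\<^sub>R u0" "k \<noteq> 0" "ln \<bar>k\<bar> = sum_list (map (\<lambda>j. ln \<bar>d0 j\<bar>) w)" by blast
        have e: "wprod A (j # w) *v u0 = (d0 j * k) *\<^sub>R u0"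
          by (simp add: d0 k matrix_vector_mult_scaleR flip: matrix_vector_mul_assoc)
        have "ln \<bar>d0 j * k\<bar> = ln \<bar>d0 j\<bar> + ln \<bar>k\<bar>" unfolding abs_mult using d0nz k by (intro ln_mult_pos) auto
        thus ?case using e k d0nz u0 by (auto intro!: exI[of _ "d0 j * k"])
      qed (use u0 in \<open>auto intro!: exI[of _ 1]\<close>)
      thus ?thesis using u0 by auto
    qed
    have "AE x in bern p. (\<Sum>j\<in>UNIV. pmf p j * ln \<bar>d0 j\<bar>) = Lminus p A"
      using AE_sum_list[of "\<lambda>j. ln \<bar>d0 j\<bar>" p] AE_good[OF A, of p] slow
    proof eventually_elim
      case (elim x)
      have "u0 \<in> span {edir A x}" unfolding u0_def by (intro span_scale elim(3))
      from good_edir(3)[OF A gap elim(2) this u0(2)]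
      have "(\<lambda>n. sum_list (map (\<lambda>j. ln \<bar>d0 j\<bar>) (word n x)) / real n) \<longlonglongrightarrow> Lminus p A"
        by (simp add: citer_wprod nw)
      thus ?case using elim(1) LIMSEQ_unique by blast
    qed
    thus ?thesis by (rule AE_bern_const)
  qed
  have "ldet p A = (\<Sum>j\<in>UNIV. pmf p j * ln \<bar>a0 j\<bar>) + (\<Sum>j\<in>UNIV. pmf p j * ln \<bar>d0 j\<bar>)"
    unfolding ldet_def sum.distrib[symmetric] ad abs_mult using a0nz d0nz
    by (intro sum.cong refl) (simp add: ln_mult_pos distrib_left)
  hence sa: "(\<Sum>j\<in>UNIV. pmf p j * ln \<bar>a0 j\<bar>) = Lplus p A" using sd by (simp add: Lminus_eq[OF A])
  define \<Gamma> where "\<Gamma> = 1 + (\<Sum>j\<in>UNIV. \<bar>cr f1 (A j *v f1)\<bar>)"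
  have \<Gamma>: "0 \<le> \<Gamma>" "\<bar>cr f1 (A j *v f1)\<bar> < \<Gamma>" for j
    using member_le_sum[of j UNIV "\<lambda>j. \<bar>cr f1 (A j *v f1)\<bar>"] by (auto simp: \<Gamma>_def intro!: add_nonneg_nonneg sum_nonneg)
  have gap': "(\<Sum>j\<in>UNIV. pmf p j * ln \<bar>d0 j\<bar>) < (\<Sum>j\<in>UNIV. pmf p j * ln \<bar>a0 j\<bar>)" using gap sd sa by simp
  obtain j0 \<alpha> \<epsilon> M q where j0: "\<bar>d0 j0\<bar> < \<bar>a0 j0\<bar>" and \<alpha>: "0 < \<alpha>" "\<alpha> \<le> 2" and \<epsilon>: "0 < \<epsilon>" and q: "0 < q" "q < 1"
    and est: "\<And>a b g d n. (\<forall>j. \<bar>a j - a0 j\<bar> \<le> \<epsilon> \<and> \<bar>d j - d0 j\<bar> \<le> \<epsilon> \<and> \<bar>b j\<bar> \<le> \<epsilon> \<and> \<bar>g j\<bar> \<le> \<Gamma>) \<Longrightarrow> b j0 = 0 \<Longrightarrow>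
      EW p n (\<lambda>w. prod_list (map (\<lambda>j. \<bar>a j * d j - b j * g j\<bar>) w) powr (\<alpha>/2) *
         (max \<bar>fst (fold (mat_act a b g d) w (1, 0))\<bar> \<bar>snd (fold (mat_act a b g d) w (1, 0))\<bar>) powr (-\<alpha>)) \<le> M * q ^ n"
    using escape_contraction_exists[OF sup a0nz d0nz \<Gamma>(1) gap'] by blast
  \<comment> \<open>\<open>ea\<close>, \<open>eb\<close>, \<open>eg\<close>, \<open>ed\<close> are
    the entries of \<open>B j\<close> in the basis \<open>f1\<close>, \<open>f2 s\<close>. As B
    tends to A and s to 0, \<open>eb\<close> tends to 0, whereas \<open>eg\<close> merely stays
    bounded.\<close>
  define f2 where "f2 s = u0 + s *\<^sub>R f1" for s
  define ea where "ea B s j = cr (B j *v f1) (f2 s)" for B :: "'a cocycle" and s j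
  define eb where "eb B s j = cr (B j *v f2 s) (f2 s)" for B :: "'a cocycle" and s j
  define eg where "eg B j = cr f1 (B j *v f1)" for B :: "'a cocycle" and j
  define ed where "ed B s j = cr f1 (B j *v f2 s)" for B :: "'a cocycle" and s j
  have c12: "cr f1 (f2 s) = 1" for s by (simp add: f2_def cr_add cf)
  let ?F = "nbh A \<times>\<^sub>F nhds (0::real)"
  have tf: "((\<lambda>z. fst z j) \<longlongrightarrow> A j) ?F" for j by (rule filterlim_compose[OF tendsto_nbh filterlim_fst])
  have ts: "(snd \<longlongrightarrow> 0) ?F" by (rule filterlim_snd)
  have tf2: "((\<lambda>z. f2 (snd z)) \<longlongrightarrow> u0) ?F"
  proof -
    have "((\<lambda>z. u0 + snd z *\<^sub>R f1) \<longlongrightarrow> u0 + 0 *\<^sub>R f1) ?F" by (intro tendsto_intros ts)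
    thus ?thesis by (simp add: f2_def)
  qed
  have ta: "((\<lambda>z. ea (fst z) (snd z) j) \<longlongrightarrow> a0 j) ?F" for j
    unfolding ea_def a0_def by (intro tendsto_cr tendsto_matvec tf tf2 tendsto_const)
  have "((\<lambda>z. eb (fst z) (snd z) j) \<longlongrightarrow> cr (A j *v u0) u0) ?F" for j
    unfolding eb_def by (intro tendsto_cr tendsto_matvec tf tf2 tendsto_const)
  hence tb: "((\<lambda>z. eb (fst z) (snd z) j) \<longlongrightarrow> 0) ?F" for j by (simp add: d0)
  have "((\<lambda>z. ed (fst z) (snd z) j) \<longlongrightarrow> cr f1 (A j *v u0)) ?F" for j
    unfolding ed_def by (intro tendsto_cr tendsto_matvec tf tf2 tendsto_const)
  hence td: "((\<lambda>z. ed (fst z) (snd z) j) \<longlongrightarrow> d0 j) ?F" for j by (simp add: d0 cf)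
  have tg: "((\<lambda>z. eg (fst z) j) \<longlongrightarrow> cr f1 (A j *v f1)) ?F" for j
    unfolding eg_def by (intro tendsto_cr tendsto_matvec tf tendsto_const)
  have "eventually (\<lambda>z. \<forall>j\<in>UNIV. \<bar>ea (fst z) (snd z) j - a0 j\<bar> \<le> \<epsilon> \<and> \<bar>ed (fst z) (snd z) j - d0 j\<bar> \<le> \<epsilon> \<and>
      \<bar>eb (fst z) (snd z) j\<bar> \<le> \<epsilon> \<and> \<bar>eg (fst z) j\<bar> \<le> \<Gamma>) ?F"
  proof (intro eventually_ball_finite ballI)
    fix j
    from tendstoD[OF ta[of j] \<epsilon>] tendstoD[OF td[of j] \<epsilon>] tendstoD[OF tb[of j] \<epsilon>] order_tendstoD(2)[OF tendsto_rabs[OF tg[of j]] \<Gamma>(2)[of j]]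
    show "eventually (\<lambda>z. \<bar>ea (fst z) (snd z) j - a0 j\<bar> \<le> \<epsilon> \<and> \<bar>ed (fst z) (snd z) j - d0 j\<bar> \<le> \<epsilon> \<and>
      \<bar>eb (fst z) (snd z) j\<bar> \<le> \<epsilon> \<and> \<bar>eg (fst z) j\<bar> \<le> \<Gamma>) ?F"
      by eventually_elim (simp add: dist_real_def)
  qed simp
  then obtain Pf Pg where P: "eventually Pf (nbh A)" "eventually Pg (nhds (0::real))"
    "\<And>B s j. Pf B \<Longrightarrow> Pg s \<Longrightarrow> \<bar>ea B s j - a0 j\<bar> \<le> \<epsilon> \<and> \<bar>ed B s j - d0 j\<bar> \<le> \<epsilon> \<and> \<bar>eb B s j\<bar> \<le> \<epsilon> \<and> \<bar>eg B j\<bar> \<le> \<Gamma>"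
    unfolding eventually_prod_filter by auto
  obtain h0 where h0: "h0 > 0" "\<And>s. \<bar>s\<bar> < h0 \<Longrightarrow> Pg s" using P(2) unfolding eventually_nhds_metric by (auto simp: dist_real_def)
  text \<open>An eigenvector of B j0 close to the invariant line of A, by the intermediate value theorem.\<close>
  define k where "k = cr (A j0 *v f1) f1"
  define \<delta> where "\<delta> = a0 j0 - d0 j0"
  have \<delta>0: "\<delta> \<noteq> 0" using j0 by (auto simp: \<delta>_def)
  \<comment> \<open>At A the function of s has a simple zero at 0, because d0 j0 and a0 j0 differ;
    the resulting change of sign on [-h, h] survives a perturbation.\<close>
  have gA: "eb A s j0 = s * (\<delta> + s * k)" for s
  proof -
    have "cr u0 f1 = -1" using cf cr_commute[of u0 f1] by simp
    thus ?thesis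
      by (simp add: eb_def f2_def matrix_vector_right_distrib matrix_vector_mult_scaleR d0 cr_add k_def \<delta>_def a0_def[symmetric] algebra_simps)
  qed
  define h where "h = min (min 1 (h0 / 2)) (\<bar>\<delta>\<bar> / (2 * (\<bar>k\<bar> + 1)))"
  have h: "0 < h" "h < h0" "h \<le> 1"
  proof -
    have "0 < \<bar>\<delta>\<bar> / (2 * (\<bar>k\<bar> + 1))" using \<delta>0 by (intro divide_pos_pos) auto
    thus "0 < h" using h0(1) by (simp add: h_def)
    show "h \<le> 1" by (simp add: h_def)
    have "h \<le> h0 / 2" unfolding h_def by (meson min.cobounded1 min.cobounded2 order_trans)
    thus "h < h0" using h0(1) by simp
  qed
  have hk: "\<bar>h * k\<bar> < \<bar>\<delta>\<bar>"
  proof -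
    have "\<bar>h * k\<bar> \<le> h * (\<bar>k\<bar> + 1)" using h by (simp add: abs_mult)
    also have "\<dots> \<le> \<bar>\<delta>\<bar> / (2 * (\<bar>k\<bar> + 1)) * (\<bar>k\<bar> + 1)" by (intro mult_right_mono) (auto simp: h_def)
    also have "\<dots> = \<bar>\<delta>\<bar> / 2"
    proof -
      have gen: "y \<noteq> 0 \<Longrightarrow> x / (2 * y) * y = x / 2" for x y :: real by simp
      show ?thesis by (rule gen) linarith
    qed
    finally show ?thesis using \<delta>0 by linarith
  qed
  have sgA: "0 < sgn \<delta> * eb A h j0" "sgn \<delta> * eb A (- h) j0 < 0"
  proof -
    have "0 < sgn \<delta> * (\<delta> + h * k)" "0 < sgn \<delta> * (\<delta> + (- h) * k)" using hk \<delta>0 by (auto simp: sgn_if abs_if split: if_splits)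
    hence "0 < h * (sgn \<delta> * (\<delta> + h * k))" "0 < h * (sgn \<delta> * (\<delta> + (- h) * k))" using h(1) by simp_all
    moreover have "sgn \<delta> * eb A h j0 = h * (sgn \<delta> * (\<delta> + h * k))" "sgn \<delta> * eb A (- h) j0 = - (h * (sgn \<delta> * (\<delta> + (- h) * k)))"
      by (simp_all add: gA algebra_simps)
    ultimately show "0 < sgn \<delta> * eb A h j0" "sgn \<delta> * eb A (- h) j0 < 0" by linarith+
  qed
  have te: "((\<lambda>B. sgn \<delta> * eb B s j0) \<longlongrightarrow> sgn \<delta> * eb A s j0) (nbh A)" for s
    unfolding eb_def by (intro tendsto_mult tendsto_const tendsto_cr tendsto_matvec tendsto_nbh)
  from order_tendstoD(1)[OF te sgA(1)] order_tendstoD(2)[OF te sgA(2)] P(1)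
  have "eventually (\<lambda>B. B \<in> GLk \<longrightarrow> (\<forall>n. EW p n (\<lambda>w. rat (wprod B w) powr (\<alpha>/2)) \<le> 2 powr \<alpha> * M * q ^ n)) (nbh A)"
  proof eventually_elim
    case (elim B)
    show ?case
    proof (intro impI allI)
      fix n assume B: "B \<in> GLk"
      have "\<exists>s. -h \<le> s \<and> s \<le> h \<and> sgn \<delta> * eb B s j0 = 0"
      proof (rule IVT')
        show "continuous_on {-h..h} (\<lambda>s. sgn \<delta> * eb B s j0)"
          unfolding eb_def f2_def cr_def matvec2 by (intro continuous_intros)
      qed (use elim h in auto)
      then obtain s where s': "-h \<le> s" "s \<le> h" "sgn \<delta> * eb B s j0 = 0" by blast
      have s: "\<bar>s\<bar> \<le> h" "eb B s j0 = 0" using s' \<delta>0 by (auto simp: abs_le_iff sgn_if split: if_splits)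
      have E: "\<forall>j. \<bar>ea B s j - a0 j\<bar> \<le> \<epsilon> \<and> \<bar>ed B s j - d0 j\<bar> \<le> \<epsilon> \<and> \<bar>eb B s j\<bar> \<le> \<epsilon> \<and> \<bar>eg B j\<bar> \<le> \<Gamma>"
        using P(3)[OF elim(3) h0(2)[of s]] s h by auto
      let ?act = "mat_act (ea B s) (eb B s) (eg B) (ed B s)"
      have dec: "v = cr v (f2 s) *\<^sub>R f1 + cr f1 v *\<^sub>R f2 s" for v
        using cr_identity[of f1 "f2 s" v] by (simp add: c12)
      have dt: "\<bar>ea B s j * ed B s j - eb B s j * eg B j\<bar> = \<bar>det (B j)\<bar>" for j
      proof -
        have "det (B j) = cr (B j *v f1) (B j *v f2 s)" by (simp add: cr_matvec c12)
        also have "\<dots> = cr (ea B s j *\<^sub>R f1 + eg B j *\<^sub>R f2 s) (eb B s j *\<^sub>R f1 + ed B s j *\<^sub>R f2 s)"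
          using dec[of "B j *v f1"] dec[of "B j *v f2 s"] by (simp add: ea_def eg_def eb_def ed_def)
        also have "\<dots> = ea B s j * ed B s j - eb B s j * eg B j"
          using c12[of s] cr_commute[of "f2 s" f1] by (simp add: cr_add algebra_simps)
        finally show ?thesis by simp
      qed
      have coord: "wprod B w *v (fst z *\<^sub>R f1 + snd z *\<^sub>R f2 s) = fst (fold ?act w z) *\<^sub>R f1 + snd (fold ?act w z) *\<^sub>R f2 s" for w z
      proof (induction w arbitrary: z)
        case (Cons j w)
        have "B j *v (fst z *\<^sub>R f1 + snd z *\<^sub>R f2 s) = fst z *\<^sub>R (B j *v f1) + snd z *\<^sub>R (B j *v f2 s)"
          by (simp add: matrix_vector_right_distrib matrix_vector_mult_scaleR)
        also have "\<dots> = fst z *\<^sub>R (ea B s j *\<^sub>R f1 + eg B j *\<^sub>R f2 s) + snd z *\<^sub>R (eb B s j *\<^sub>R f1 + ed B s j *\<^sub>R f2 s)"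
          using dec[of "B j *v f1"] dec[of "B j *v f2 s"] by (simp add: ea_def eg_def eb_def ed_def)
        also have "\<dots> = fst (?act j z) *\<^sub>R f1 + snd (?act j z) *\<^sub>R f2 s"
          by (simp add: mat_act_def algebra_simps)
        finally show ?case using Cons.IH[of "?act j z"] by (simp flip: matrix_vector_mul_assoc)
      qed simp
      have dw: "\<bar>det (wprod B w)\<bar> = prod_list (map (\<lambda>j. \<bar>ea B s j * ed B s j - eb B s j * eg B j\<bar>) w)" for w
        unfolding dt by (induction w) (simp_all add: det_I det_mul abs_mult mult.commute)
      have "EW p n (\<lambda>w. rat (wprod B w) powr (\<alpha>/2)) \<le> EW p n (\<lambda>w. 2 powr \<alpha> * (prod_list (map (\<lambda>j. \<bar>ea B s j * ed B s j - eb B s j * eg B j\<bar>) w) powr (\<alpha>/2) *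
         (max \<bar>fst (fold ?act w (1, 0))\<bar> \<bar>snd (fold ?act w (1, 0))\<bar>) powr (-\<alpha>)))"
      proof (rule EW_mono)
        fix w :: "'a list"
        let ?m = "max \<bar>fst (fold ?act w (1, 0))\<bar> \<bar>snd (fold ?act w (1, 0))\<bar>"
        let ?M = "wprod B w"
        have Mf: "?M *v f1 = fst (fold ?act w (1, 0)) *\<^sub>R f1 + snd (fold ?act w (1, 0)) *\<^sub>R f2 s"
          using coord[of w "(1, 0)"] by simp
        have x: "fst (fold ?act w (1, 0)) = cr (?M *v f1) (f2 s)" unfolding Mf by (simp add: cr_add c12)
        have y: "snd (fold ?act w (1, 0)) = cr f1 (?M *v f1)" unfolding Mf by (simp add: cr_add c12)
        have n2: "norm (f2 s) \<le> 2"
          using norm_triangle_ineq[of u0 "s *\<^sub>R f1"] u0(1) f1(1) s h by (simp add: f2_def)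
        have nM: "norm (?M *v f1) \<le> mnorm ?M" using mnorm_bound[of ?M f1] f1(1) by simp
        have "\<bar>fst (fold ?act w (1, 0))\<bar> \<le> mnorm ?M * 2"
          unfolding x using cr_le_norm[of "?M *v f1" "f2 s"] mult_mono[OF nM n2] mnorm_nonneg[of ?M] by simp
        moreover have "\<bar>snd (fold ?act w (1, 0))\<bar> \<le> mnorm ?M * 2"
          unfolding y using cr_le_norm[of f1 "?M *v f1"] f1(1) nM mnorm_nonneg[of ?M] by simp
        ultimately have m: "?m \<le> 2 * mnorm ?M" by simp
        have "?M *v f1 \<noteq> 0" using matvec_pos[OF invertible_wprod[OF B] f1(2), of w] by auto
        hence m0: "0 < ?m" unfolding Mf by (auto simp: less_max_iff_disj)
        note Mp = mnorm_pos[OF invertible_wprod[OF B, of w]]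
        have "mnorm ?M powr (-\<alpha>) = 2 powr \<alpha> * (2 * mnorm ?M) powr (-\<alpha>)"
          using Mp by (simp add: powr_mult powr_minus field_simps)
        also have "\<dots> \<le> 2 powr \<alpha> * ?m powr (-\<alpha>)" using m m0 \<alpha> by (intro mult_left_mono powr_mono2') auto
        finally have le: "mnorm ?M powr (-\<alpha>) \<le> 2 powr \<alpha> * ?m powr (-\<alpha>)" .
        have "(mnorm ?M)\<^sup>2 powr (\<alpha>/2) = mnorm ?M powr \<alpha>"
          using Mp by (simp add: powr_powr flip: powr_numeral)
        hence "rat ?M powr (\<alpha>/2) = \<bar>det ?M\<bar> powr (\<alpha>/2) * mnorm ?M powr (-\<alpha>)"
          by (simp add: rat_def powr_divide powr_minus_divide)
        also have "\<dots> \<le> \<bar>det ?M\<bar> powr (\<alpha>/2) * (2 powr \<alpha> * ?m powr (-\<alpha>))" by (intro mult_left_mono le) auto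
        finally show "rat ?M powr (\<alpha>/2) \<le> 2 powr \<alpha> * (prod_list (map (\<lambda>j. \<bar>ea B s j * ed B s j - eb B s j * eg B j\<bar>) w) powr (\<alpha>/2) * ?m powr (-\<alpha>))"
          by (simp add: dw mult_ac)
      qed
      also have "\<dots> \<le> 2 powr \<alpha> * (M * q ^ n)"
        unfolding EW_cmult by (intro mult_left_mono est E s) auto
      finally show "EW p n (\<lambda>w. rat (wprod B w) powr (\<alpha>/2)) \<le> 2 powr \<alpha> * M * q ^ n" by simp
    qed
  qed
  with q \<alpha> show ?thesis by (intro exI[of _ "\<alpha>/2"] exI[of _ "2 powr \<alpha> * M"] exI[of _ q]) auto
qed

theorem uniform_estimate:
  fixes A :: "'a::finite cocycle"
  assumes A: "A \<in> GLk" and gap: "Lminus p A < Lplus p A" and sup: "set_pmf p = UNIV"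
  shows "\<exists>a C \<kappa>. 0 < a \<and> a \<le> 1 \<and> 0 < \<kappa> \<and> \<kappa> < 1 \<and>
    eventually (\<lambda>B. B \<in> GLk \<longrightarrow> (\<forall>n. EW p n (\<lambda>w. rat (wprod B w) powr a) \<le> C * \<kappa> ^ n)) (nbh A)"

proof (cases rule: slow_dichotomy[OF A gap sup])
  case 1
  thus ?thesis by (rule estimate_if_never_slow[OF A gap])
next
  case (2 v)
  thus ?thesis by (rule estimate_if_invariant_slow[OF A gap sup])
qed

section \<open>Moduli of continuity\<close>

text \<open>What is uniform near A, in a form preserved by \<open>icoc\<close>: all later constants
  depend only on R, a, C and \<kappa>.\<close>

definition reg :: "'a::finite pmf \<Rightarrow> real \<Rightarrow> real \<Rightarrow> real \<Rightarrow> real \<Rightarrow> 'a cocycle \<Rightarrow> bool" where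
  "reg p R a C \<kappa> B \<longleftrightarrow> B \<in> GLk \<and> (\<forall>j. mnorm (B j) \<le> R \<and> mnorm (matrix_inv (B j)) \<le> R) \<and> rmax B \<le> R \<and>
     (\<forall>n. EW p n (\<lambda>w. rat (wprod B w) powr a) \<le> C * \<kappa> ^ n)"

text \<open>Inversion preserves the ratio of singular values, and reversal preserves the law of the
  words.\<close>

lemma reg_icoc:
  assumes B: "reg p R a C \<kappa> B" shows "reg p R a C \<kappa> (icoc B)"
proof -
  have G: "B \<in> GLk" using B by (simp add: reg_def)
  have 1: "matrix_inv (icoc B j) = B j" for j by (simp add: icoc_def matrix_inv_cancel(4)[OF GLkD[OF G]])
  have 2: "rmax (icoc B) = rmax B" by (simp add: rmax_def icoc_def rat_matrix_inv[OF GLkD[OF G]])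
  have "EW p n (\<lambda>w. rat (wprod (icoc B) w) powr a) = EW p n (\<lambda>w. rat (wprod B w) powr a)" for n
    using EW_rev[of p n "\<lambda>w. rat (wprod B w) powr a"]
    by (simp add: wprod_icoc[OF G] rat_matrix_inv[OF invertible_wprod[OF G]])
  thus ?thesis using B icoc_GLk[OF G] unfolding reg_def 1 2 by (simp add: icoc_def)
qed

text \<open>The moments decay like \<kappa>^n, so almost surely \<open>rat\<close> to the power a is
  eventually below the n-th power of the square root of \<kappa>; the other square root makes the
  expectations summable. As ln rat over n tends to L- - L+, the gap is positive.\<close>

lemma reg_gap:
  fixes B :: "'a::finite cocycle"
  assumes B: "reg p R a C \<kappa> B" and a: "0 < a" and k: "0 < \<kappa>" "\<kappa> < 1"
  shows "Lminus p B < Lplus p B"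
proof -
  have G: "B \<in> GLk" and est: "\<And>n. EW p n (\<lambda>w. rat (wprod B w) powr a) \<le> C * \<kappa> ^ n" using B by (auto simp: reg_def)
  define k1 where "k1 = sqrt \<kappa>"
  have k1: "0 < k1" "k1 < 1" "k1 * k1 = \<kappa>" using k by (auto simp: k1_def)
  have l1: "ln k1 < 0" using k1 by simp
  define F where "F w = rat (wprod B w) powr a * (1 / k1) ^ length w" for w
  have "AE x in bern p. (\<lambda>n. F (word n x)) \<longlonglongrightarrow> 0"
  proof (rule AE_word_tendsto_0[of F p C k1])
    fix n
    have "EW p n F = (1 / k1) ^ n * EW p n (\<lambda>w. rat (wprod B w) powr a)"
      unfolding EW_cmult[symmetric] by (rule EW_cong) (simp add: F_def)
    also have "\<dots> \<le> (1 / k1) ^ n * (C * \<kappa> ^ n)" using k1 est by (intro mult_left_mono) auto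
    also have "\<dots> = C * ((1 / k1) * \<kappa>) ^ n" by (simp only: power_mult_distrib mult_ac)
    also have "(1 / k1) * \<kappa> = k1" using k1(1) unfolding k1(3)[symmetric] by simp
    finally show "EW p n F \<le> C * k1 ^ n" .
  qed (use k1 in \<open>auto simp: F_def\<close>)
  hence "AE x in bern p. a * (Lminus p B - Lplus p B) \<le> ln k1"
    using AE_good[OF G, of p]
  proof eventually_elim
    case (elim x)
    have inv: "invertible (citer B n x)" for n by (rule invertible_citer[OF G])
    have "(\<lambda>n. a * (ln \<bar>det (citer B n x)\<bar> / real n - 2 * (ln (mnorm (citer B n x)) / real n))) \<longlonglongrightarrow> a * ((Lplus p B + Lminus p B) - 2 * Lplus p B)"
      using elim(2) by (intro tendsto_intros) (auto simp: good_def)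
    hence l: "(\<lambda>n. a * (ln \<bar>det (citer B n x)\<bar> / real n - 2 * (ln (mnorm (citer B n x)) / real n))) \<longlonglongrightarrow> a * (Lminus p B - Lplus p B)" by simp
    have "eventually (\<lambda>n. F (word n x) < 1) sequentially" using order_tendstoD(2)[OF elim(1), of 1] by simp
    hence "eventually (\<lambda>n. a * (ln \<bar>det (citer B n x)\<bar> / real n - 2 * (ln (mnorm (citer B n x)) / real n)) \<le> ln k1) sequentially"
      using eventually_gt_at_top[of 0]
    proof eventually_elim
      case (elim n)
      have rp: "0 < rat (citer B n x)" by (rule rat_pos[OF inv])
      have lr: "ln (rat (citer B n x)) = ln \<bar>det (citer B n x)\<bar> - 2 * ln (mnorm (citer B n x))"
        using mnorm_pos[OF inv[of n]] inv[of n] by (simp add: rat_def ln_div ln_realpow invertible_det_nz)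
      have "F (word n x) = rat (citer B n x) powr a / k1 ^ n" by (simp add: F_def citer_wprod power_divide)
      hence "rat (citer B n x) powr a = F (word n x) * k1 ^ n" using k1 by simp
      also have "\<dots> < 1 * k1 ^ n" using elim(1) k1(1) by (intro mult_strict_right_mono) auto
      finally have "rat (citer B n x) powr a < k1 ^ n" by simp
      hence "ln (rat (citer B n x) powr a) < ln (k1 ^ n)" using rp k1 by (subst ln_less_cancel_iff) auto
      hence "a * ln (rat (citer B n x)) < real n * ln k1" using rp k1 by (simp add: ln_powr ln_realpow)
      thus ?case using elim unfolding lr by (simp add: field_simps)
    qed
    thus ?case by (rule tendsto_upperbound[OF l]) simp
  qed
  hence "a * (Lminus p B - Lplus p B) \<le> ln k1" by (rule AE_bern_const)
  hence "a * (Lminus p B - Lplus p B) < 0" using l1 by linarith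
  thus ?thesis using a by (simp add: mult_less_0_iff)
qed

lemma rat_le_powr: "0 < a \<Longrightarrow> a \<le> 1 \<Longrightarrow> rat M \<le> rat M powr a"
  using powr_mono'[of a 1 "rat M"] rat_nonneg[of M] rat_le_1[of M] by (cases "rat M = 0") auto

text \<open>Each step of the contracted direction is bounded by a multiple of \<open>rat\<close>,
  hence of its power a, since \<open>rat\<close> and a are at most 1. The means are geometric and
  are summed by the triangle inequality for lines.\<close>

lemma integral_cr_cdir_le:
  fixes B :: "'a::finite cocycle"
  assumes B: "reg p R a C \<kappa> B" and a: "0 < a" "a \<le> 1" and k: "0 < \<kappa>" "\<kappa> < 1"
  shows "(\<integral>x. \<bar>cr (cdir B n x) (edir B x)\<bar> \<partial>bern p) \<le> R * C / (1 - \<kappa>) * \<kappa> ^ n"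
proof -
  interpret prob_space "bern p" by (rule prob_space_bern)
  have G: "B \<in> GLk" and est: "\<And>n. EW p n (\<lambda>w. rat (wprod B w) powr a) \<le> C * \<kappa> ^ n" and R: "rmax B \<le> R"
    using B by (auto simp: reg_def)
  have R1: "1 \<le> R" using R rmax(2)[of B] by linarith
  have C0: "0 \<le> C" using est[of 0] by (simp) (metis order_trans powr_ge_zero)
  have [measurable]: "(\<lambda>x. cr (cdir B n x) (cdir B m x)) \<in> borel_measurable (bern p)" for n m
    by (intro measurable_cr cdir_measurable)
  have [measurable]: "(\<lambda>x. cr (cdir B n x) (edir B x)) \<in> borel_measurable (bern p)" for n
    by (intro measurable_cr cdir_measurable edir_measurable)
  have bd: "\<bar>cr (cdir B n x) (cdir B m x)\<bar> \<le> 1" for n m x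
    using cr_le_norm[of "cdir B n x" "cdir B m x"] by (simp add: cdir(1)[OF G])
  have int: "integrable (bern p) (\<lambda>x. \<bar>cr (cdir B n x) (cdir B m x)\<bar>)" for n m
    by (rule integrable_bounded_bern[of _ _ 1]) (use bd in auto)
  have step: "(\<integral>x. \<bar>cr (cdir B m x) (cdir B (Suc m) x)\<bar> \<partial>bern p) \<le> R * (C * \<kappa> ^ m)" for m
  proof -
    have "(\<integral>x. \<bar>cr (cdir B m x) (cdir B (Suc m) x)\<bar> \<partial>bern p) \<le> (\<integral>x. R * rat (wprod B (word m x)) powr a \<partial>bern p)"
    proof (rule integral_mono[OF int])
      show "integrable (bern p) (\<lambda>x. R * rat (wprod B (word m x)) powr a)"
        using integrable_word[of p "\<lambda>w. R * rat (wprod B w) powr a" m] .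
      fix x
      have "\<bar>cr (cdir B m x) (cdir B (Suc m) x)\<bar> \<le> rmax B * rat (citer B m x)" by (rule cr_cdir_step[OF G])
      also have "\<dots> \<le> R * rat (citer B m x) powr a"
        using R R1 rat_le_powr[OF a] rat_nonneg by (intro mult_mono) auto
      finally show "\<bar>cr (cdir B m x) (cdir B (Suc m) x)\<bar> \<le> R * rat (wprod B (word m x)) powr a" by (simp add: citer_wprod)
    qed
    also have "\<dots> = R * EW p m (\<lambda>w. rat (wprod B w) powr a)"
      using integral_word[where F="\<lambda>w. rat (wprod B w) powr a" and p=p and n=m] by simp
    also have "\<dots> \<le> R * (C * \<kappa> ^ m)" using R1 est by (intro mult_left_mono) auto
    finally show ?thesis .
  qed
  have fin: "(\<integral>x. \<bar>cr (cdir B n x) (cdir B (n + m) x)\<bar> \<partial>bern p) \<le> R * C / (1 - \<kappa>) * \<kappa> ^ n" for m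
  proof -
    have "(\<integral>x. \<bar>cr (cdir B n x) (cdir B (n + m) x)\<bar> \<partial>bern p) \<le> R * C * \<kappa> ^ n * (\<Sum>i<m. \<kappa> ^ i)"
    proof (induction m)
      case (Suc m)
      have "(\<integral>x. \<bar>cr (cdir B n x) (cdir B (n + Suc m) x)\<bar> \<partial>bern p) \<le>
        (\<integral>x. \<bar>cr (cdir B (n + m) x) (cdir B (Suc (n + m)) x)\<bar> + \<bar>cr (cdir B n x) (cdir B (n + m) x)\<bar> \<partial>bern p)"
      proof (rule integral_mono)
        show "\<bar>cr (cdir B n x) (cdir B (n + Suc m) x)\<bar> \<le> \<bar>cr (cdir B (n + m) x) (cdir B (Suc (n + m)) x)\<bar> + \<bar>cr (cdir B n x) (cdir B (n + m) x)\<bar>" for x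
          using cr_triangle[OF cdir(1)[OF G, of "n + m" x], of "cdir B n x" "cdir B (Suc (n + m)) x"] cdir(1)[OF G, of n x] cdir(1)[OF G, of "Suc (n + m)" x] by simp
      qed (use int in \<open>auto simp del: cdir.simps\<close>)
      also have "\<dots> \<le> R * (C * \<kappa> ^ (n + m)) + R * C * \<kappa> ^ n * (\<Sum>i<m. \<kappa> ^ i)"
        using int Suc step[of "n + m"] by (simp del: cdir.simps)
      finally show ?case by (simp add: power_add algebra_simps)
    qed simp
    also have "\<dots> = R * C * \<kappa> ^ n * ((1 - \<kappa> ^ m) / (1 - \<kappa>))" using k by (simp add: sum_gp_strict)
    also have "\<dots> \<le> R * C * \<kappa> ^ n * (1 / (1 - \<kappa>))" using k C0 R1 by (intro mult_left_mono divide_right_mono) auto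
    finally show ?thesis by simp
  qed
  note gap = reg_gap[OF B a(1) k]
  have "(\<lambda>m. \<integral>x. \<bar>cr (cdir B n x) (cdir B (n + m) x)\<bar> \<partial>bern p) \<longlonglongrightarrow> (\<integral>x. \<bar>cr (cdir B n x) (edir B x)\<bar> \<partial>bern p)"
  proof (rule bounded_convergence_bern[where C=1])
    show "AE x in bern p. (\<lambda>m. \<bar>cr (cdir B n x) (cdir B (n + m) x)\<bar>) \<longlonglongrightarrow> \<bar>cr (cdir B n x) (edir B x)\<bar>"
      using AE_good[OF G, of p]
    proof eventually_elim
      case (elim x)
      have "(\<lambda>m. cdir B (n + m) x) \<longlonglongrightarrow> edir B x"
        using LIMSEQ_ignore_initial_segment[OF good_edir(2)[OF G gap elim], of n] by (simp add: add.commute)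
      thus ?case by (intro tendsto_rabs tendsto_cr tendsto_const)
    qed
  qed (use bd in auto)
  thus ?thesis by (rule tendsto_upperbound) (use fin in auto)
qed

text \<open>The matrix of larger norm serves as reference: it contracts its own direction, and also
  the direction of the other matrix up to the difference of the two. L is a reciprocal lower bound
  for both norms.\<close>

lemma cr_contracted_compare:
  assumes M: "invertible (M::real^2^2)" "invertible (M'::real^2^2)"
    and u: "norm u = 1" "norm (M *v u) = \<bar>det M\<bar> / mnorm M" and u': "norm u' = 1" "norm (M' *v u') = \<bar>det M'\<bar> / mnorm M'"
    and L: "1 \<le> L * mnorm M" "1 \<le> L * mnorm M'"
  shows "\<bar>cr u u'\<bar> \<le> rat M + rat M' + L * mnorm (M - M')"
proof -
  have *: "\<bar>cr u u'\<bar> \<le> rat M + rat M' + L * mnorm (M - M')"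
    if M: "invertible M" "invertible M'" and u: "norm u = 1" "norm (M *v u) = \<bar>det M\<bar> / mnorm M"
      and u': "norm u' = 1" "norm (M' *v u') = \<bar>det M'\<bar> / mnorm M'" and L: "1 \<le> L * mnorm M" and le: "mnorm M' \<le> mnorm M"
    for M M' :: "real^2^2" and u u'
  proof -
    note p = mnorm_pos[OF M(1)] mnorm_pos[OF M(2)]
    have "norm (M *v u') \<le> norm (M' *v u') + norm ((M - M') *v u')"
      using norm_triangle_ineq[of "M' *v u'" "(M - M') *v u'"] by (simp add: matrix_vector_mult_diff_rdistrib)
    also have "\<dots> \<le> \<bar>det M'\<bar> / mnorm M' + mnorm (M - M')" using mnorm_bound[of "M - M'" u'] u' by simp
    finally have "\<bar>cr u u'\<bar> * mnorm M \<le> \<bar>det M'\<bar> / mnorm M' + mnorm (M - M') + \<bar>det M\<bar> / mnorm M"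
      using cr_mnorm_le[of u u' M] u u' by simp
    hence "\<bar>cr u u'\<bar> \<le> (\<bar>det M'\<bar> / mnorm M' + mnorm (M - M') + \<bar>det M\<bar> / mnorm M) / mnorm M"
      using p by (simp add: field_simps)
    also have "\<dots> = \<bar>det M'\<bar> / mnorm M' / mnorm M + mnorm (M - M') / mnorm M + \<bar>det M\<bar> / mnorm M / mnorm M"
      by (simp add: add_divide_distrib)
    also have "\<dots> \<le> \<bar>det M'\<bar> / mnorm M' / mnorm M' + L * mnorm (M - M') + \<bar>det M\<bar> / mnorm M / mnorm M"
    proof (intro add_mono order_refl)
      show "\<bar>det M'\<bar> / mnorm M' / mnorm M \<le> \<bar>det M'\<bar> / mnorm M' / mnorm M'" using le p by (intro divide_left_mono) auto
      have "mnorm (M - M') * 1 \<le> mnorm (M - M') * (L * mnorm M)" by (intro mult_left_mono L mnorm_nonneg)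
      thus "mnorm (M - M') / mnorm M \<le> L * mnorm (M - M')" using p by (simp add: field_simps)
    qed
    finally show ?thesis by (simp add: rat_def power2_eq_square)
  qed
  show ?thesis
  proof (cases "mnorm M' \<le> mnorm M")
    case True thus ?thesis using * assms by blast
  next
    case False
    hence "\<bar>cr u' u\<bar> \<le> rat M' + rat M + L * mnorm (M' - M)" using assms by (intro *) auto
    thus ?thesis by (simp add: cr_abs_commute mnorm_minus_commute add.commute)
  qed
qed

lemma mnorm_wprod_le:
  assumes "\<And>j. mnorm (B j) \<le> R" "0 \<le> R" shows "mnorm (wprod B w) \<le> R ^ length w"
proof (induction w)
  case (Cons j w)
  have "mnorm (wprod B (j # w)) \<le> mnorm (wprod B w) * mnorm (B j)" by (simp add: mnorm_mult)
  also have "\<dots> \<le> R ^ length w * R" using Cons assms mnorm_nonneg by (intro mult_mono) auto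
  finally show ?case by (simp add: mult.commute)
qed simp

lemma matrix_diff_distrib: "(M - N) ** P = M ** P - N ** P" "P ** (M - N) = P ** M - P ** N" for M N P :: "real^2^2"
  by (simp_all add: vec_eq_iff matrix_matrix_mult_def sum_2 algebra_simps)

text \<open>One letter is exchanged at a time; the factor 2 per letter absorbs the number of
  terms.\<close>

lemma mnorm_wprod_diff_le:
  assumes B: "\<And>j. mnorm (B j) \<le> R" "\<And>j. mnorm (B' j) \<le> R" "1 \<le> R" and d: "\<And>j. mnorm (B j - B' j) \<le> \<delta>" "0 \<le> \<delta>"
  shows "mnorm (wprod B w - wprod B' w) \<le> (2 * R) ^ length w * \<delta>"
proof (induction w)
  case (Cons j w)
  let ?n = "length w"
  have "wprod B (j # w) - wprod B' (j # w) = (wprod B w - wprod B' w) ** B j + wprod B' w ** (B j - B' j)"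
    by (simp add: matrix_diff_distrib)
  hence "mnorm (wprod B (j # w) - wprod B' (j # w)) \<le> mnorm (wprod B w - wprod B' w) * mnorm (B j) + mnorm (wprod B' w) * mnorm (B j - B' j)"
    using mnorm_triangle[of "(wprod B w - wprod B' w) ** B j" "wprod B' w ** (B j - B' j)"]
      mnorm_mult[of "wprod B w - wprod B' w" "B j"] mnorm_mult[of "wprod B' w" "B j - B' j"] by simp
  also have "\<dots> \<le> (2 * R) ^ ?n * \<delta> * R + R ^ ?n * \<delta>"
    using Cons B d mnorm_nonneg mnorm_wprod_le[of B' R w] by (intro add_mono mult_mono) auto
  also have "\<dots> \<le> (2 * R) ^ ?n * \<delta> * R + ((2 * R) ^ ?n * \<delta>) * R"
  proof (intro add_left_mono)
    have "R ^ ?n * \<delta> \<le> (2 * R) ^ ?n * \<delta>" using B(3) d(2) by (intro mult_right_mono power_mono) auto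
    also have "\<dots> \<le> ((2 * R) ^ ?n * \<delta>) * R"
      using mult_left_mono[OF B(3), of "(2 * R) ^ ?n * \<delta>"] B(3) d(2) by simp
    finally show "R ^ ?n * \<delta> \<le> ((2 * R) ^ ?n * \<delta>) * R" .
  qed
  finally show ?case by (simp add: mult_ac)
qed (use d in simp)

text \<open>Each slow line is replaced by its time-n contracted direction at a cost of order
  \<kappa>^n. Products of length n have norm at least R^(-n), so comparing the two directions costs
  R^n (2 R)^n times the distance, apart from the ratios.\<close>

lemma integral_cr_edir_le:
  fixes B B' :: "'a::finite cocycle"
  assumes B: "reg p R a C \<kappa> B" and B': "reg p R a C \<kappa> B'" and a: "0 < a" "a \<le> 1" and k: "0 < \<kappa>" "\<kappa> < 1"
  shows "(\<integral>x. \<bar>cr (edir B x) (edir B' x)\<bar> \<partial>bern p) \<le> (2 * R * C / (1 - \<kappa>) + 2 * C) * \<kappa> ^ n + (2 * R * R) ^ n * cdist B B'"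
proof -
  interpret prob_space "bern p" by (rule prob_space_bern)
  have G: "B \<in> GLk" "B' \<in> GLk" and Rm: "rmax B \<le> R"
    and R: "\<And>j. mnorm (B j) \<le> R" "\<And>j. mnorm (B' j) \<le> R" "\<And>j. mnorm (icoc B j) \<le> R" "\<And>j. mnorm (icoc B' j) \<le> R"
    and est: "\<And>n. EW p n (\<lambda>w. rat (wprod B w) powr a) \<le> C * \<kappa> ^ n" "\<And>n. EW p n (\<lambda>w. rat (wprod B' w) powr a) \<le> C * \<kappa> ^ n"
    using B B' by (auto simp: reg_def icoc_def)
  have R1: "1 \<le> R" using Rm rmax(2)[of B] by linarith
  have low: "1 \<le> R ^ length w * mnorm (wprod D w)" if D: "D \<in> GLk" "\<And>j. mnorm (icoc D j) \<le> R" for D w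
  proof -
    have "mat 1 = wprod (icoc D) (rev w) ** wprod D w"
      using matrix_inv_cancel(2)[OF invertible_wprod[OF D(1), of w]] by (simp add: wprod_icoc[OF D(1)])
    hence "1 \<le> mnorm (wprod (icoc D) (rev w)) * mnorm (wprod D w)" by (metis mnorm_mult mnorm_one)
    also have "\<dots> \<le> R ^ length w * mnorm (wprod D w)"
      using mnorm_wprod_le[of "icoc D" R "rev w"] D(2) R1 by (intro mult_right_mono mnorm_nonneg) auto
    finally show ?thesis .
  qed
  let ?d = "cdist B B'"
  define mid where "mid x = rat (wprod B (word n x)) powr a + rat (wprod B' (word n x)) powr a + (2 * R * R) ^ n * ?d" for x
  have comp: "\<bar>cr (cdir B n x) (cdir B' n x)\<bar> \<le> mid x" for x
  proof -
    let ?w = "word n x"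
    have "\<bar>cr (cdir B n x) (cdir B' n x)\<bar> \<le> rat (wprod B ?w) + rat (wprod B' ?w) + R ^ n * mnorm (wprod B ?w - wprod B' ?w)"
      using cdir(1,2)[OF G(1), of n x] cdir(1,2)[OF G(2), of n x] low[OF G(1) R(3), of ?w] low[OF G(2) R(4), of ?w]
      by (intro cr_contracted_compare invertible_wprod G) (auto simp: citer_wprod)
    also have "\<dots> \<le> rat (wprod B ?w) powr a + rat (wprod B' ?w) powr a + R ^ n * ((2 * R) ^ n * ?d)"
      using mnorm_wprod_diff_le[OF R(1,2) R1 cdist_ge cdist_nonneg, where w="?w"] R1
      by (intro add_mono rat_le_powr a mult_left_mono) auto
    also have "R ^ n * ((2 * R) ^ n * ?d) = (2 * R * R) ^ n * ?d" by (simp add: power_mult_distrib)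
    finally show ?thesis by (simp add: mid_def)
  qed
  have mm: "(\<lambda>x. cr (cdir B n x) (edir B x)) \<in> borel_measurable (bern p)" "(\<lambda>x. cr (cdir B' n x) (edir B' x)) \<in> borel_measurable (bern p)"
    "(\<lambda>x. cr (edir B x) (edir B' x)) \<in> borel_measurable (bern p)"
    by (intro measurable_cr cdir_measurable edir_measurable)+
  note [measurable] = mm
  note gap = reg_gap[OF B a(1) k] reg_gap[OF B' a(1) k]
  have n1: "AE x in bern p. norm (edir B x) = 1 \<and> norm (edir B' x) = 1"
    using AE_good[OF G(1), of p] AE_good[OF G(2), of p]
    by eventually_elim (simp add: good_edir(1)[OF G(1) gap(1)] good_edir(1)[OF G(2) gap(2)])
  have AEint: "integrable (bern p) (\<lambda>x. \<bar>f x\<bar>)" if "f \<in> borel_measurable (bern p)" "AE x in bern p. \<bar>f x\<bar> \<le> 1" for f :: "_ \<Rightarrow> real"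
    by (rule integrable_const_bound[where B=1]) (use that in auto)
  have i1: "integrable (bern p) (\<lambda>x. \<bar>cr (cdir B n x) (edir B x)\<bar>)"
    by (rule AEint[OF mm(1)]) (use n1 in \<open>eventually_elim, metis cdir(1)[OF G(1)] cr_le_norm mult_1\<close>)
  have i2: "integrable (bern p) (\<lambda>x. \<bar>cr (cdir B' n x) (edir B' x)\<bar>)"
    by (rule AEint[OF mm(2)]) (use n1 in \<open>eventually_elim, metis cdir(1)[OF G(2)] cr_le_norm mult_1\<close>)
  have i3: "integrable (bern p) (\<lambda>x. \<bar>cr (edir B x) (edir B' x)\<bar>)"
    by (rule AEint[OF mm(3)]) (use n1 in \<open>eventually_elim, metis cr_le_norm mult_1\<close>)
  have i4: "integrable (bern p) mid"
    unfolding mid_def using integrable_word[of p "\<lambda>w. rat (wprod B w) powr a + rat (wprod B' w) powr a + (2 * R * R) ^ n * ?d" n] .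
  have "(\<integral>x. \<bar>cr (edir B x) (edir B' x)\<bar> \<partial>bern p) \<le> (\<integral>x. (\<bar>cr (cdir B n x) (edir B x)\<bar> + \<bar>cr (cdir B' n x) (edir B' x)\<bar>) + mid x \<partial>bern p)"
  proof (rule integral_mono_AE[OF i3])
    show "integrable (bern p) (\<lambda>x. (\<bar>cr (cdir B n x) (edir B x)\<bar> + \<bar>cr (cdir B' n x) (edir B' x)\<bar>) + mid x)"
      using i1 i2 i4 by simp
    show "AE x in bern p. \<bar>cr (edir B x) (edir B' x)\<bar> \<le> (\<bar>cr (cdir B n x) (edir B x)\<bar> + \<bar>cr (cdir B' n x) (edir B' x)\<bar>) + mid x"
      using n1
    proof eventually_elim
      case (elim x)
      have c: "norm (cdir B n x) = 1" "norm (cdir B' n x) = 1" by (simp_all add: cdir(1) G)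
      show ?case
        using cr_triangle[OF c(1), of "edir B x" "edir B' x"] cr_triangle[OF c(2), of "cdir B n x" "edir B' x"] comp[of x] elim c
          cr_abs_commute[of "edir B x" "cdir B n x"] by simp
    qed
  qed
  also have "\<dots> = (\<integral>x. \<bar>cr (cdir B n x) (edir B x)\<bar> \<partial>bern p) + (\<integral>x. \<bar>cr (cdir B' n x) (edir B' x)\<bar> \<partial>bern p) + (\<integral>x. mid x \<partial>bern p)"
    using i1 i2 i4 by simp
  also have "(\<integral>x. mid x \<partial>bern p) = EW p n (\<lambda>w. rat (wprod B w) powr a) + EW p n (\<lambda>w. rat (wprod B' w) powr a) + (2 * R * R) ^ n * ?d"
    unfolding mid_def using integral_word[where F="\<lambda>w. rat (wprod B w) powr a + rat (wprod B' w) powr a + (2 * R * R) ^ n * ?d" and n=n and p=p]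
    by (simp add: EW_add)
  finally have "(\<integral>x. \<bar>cr (edir B x) (edir B' x)\<bar> \<partial>bern p) \<le> (R * C / (1 - \<kappa>) * \<kappa> ^ n + R * C / (1 - \<kappa>) * \<kappa> ^ n) + (C * \<kappa> ^ n + C * \<kappa> ^ n + (2 * R * R) ^ n * ?d)"
    using integral_cr_cdir_le[OF B a k, of n] integral_cr_cdir_le[OF B' a k, of n] est(1)[of n] est(2)[of n] by linarith
  thus ?thesis by (simp add: algebra_simps)
qed

text \<open>With n about ln (1/\<delta>) / (2 ln D) the second term is at most the square root of
  \<delta>, while \<kappa>^n is at most \<delta>^s / \<kappa>; \<alpha> is the smaller of 1/2 and
  s.\<close>

lemma interpolation:
  assumes k: "0 < \<kappa>" "\<kappa> < (1::real)" and D: "1 < D" and C: "0 \<le> C"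
  shows "\<exists>\<alpha> C'. 0 < \<alpha> \<and> \<alpha> \<le> 1 \<and> 0 \<le> C' \<and> (\<forall>y \<delta>. 0 \<le> \<delta> \<longrightarrow> \<delta> \<le> 1 \<longrightarrow> (\<forall>n. y \<le> C * \<kappa> ^ n + D ^ n * \<delta>) \<longrightarrow> y \<le> C' * \<delta> powr \<alpha>)"
proof -
  define s where "s = ln (1 / \<kappa>) / (2 * ln D)"
  have s: "0 < s" using k D by (simp add: s_def)
  define \<alpha> where "\<alpha> = min (1/2) s"
  have \<alpha>: "0 < \<alpha>" "\<alpha> \<le> 1/2" "\<alpha> \<le> s" using s by (auto simp: \<alpha>_def)
  have "y \<le> (C / \<kappa> + 1) * \<delta> powr \<alpha>" if \<delta>: "0 \<le> \<delta>" "\<delta> \<le> 1" and y: "\<forall>n. y \<le> C * \<kappa> ^ n + D ^ n * \<delta>" for y \<delta>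
  proof (cases "\<delta> = 0")
    case True
    have "(\<lambda>n. C * \<kappa> ^ n) \<longlonglongrightarrow> 0" using k by (intro tendsto_mult_right_zero LIMSEQ_power_zero) auto
    hence "y \<le> 0" by (rule tendsto_lowerbound) (use y True in auto)
    thus ?thesis using True by simp
  next
    case False
    hence d0: "0 < \<delta>" using \<delta> by simp
    define t where "t = ln (1 / \<delta>) / (2 * ln D)"
    have t0: "0 \<le> t" using d0 \<delta> D by (auto simp: t_def intro!: divide_nonneg_pos)
    define n where "n = nat \<lfloor>t\<rfloor>"
    have n: "real n \<le> t" "t - 1 \<le> real n" using t0 by (auto simp: n_def)
    have "D ^ n * \<delta> \<le> \<delta> powr (1/2)"
    proof -
      have "D ^ n = D powr real n" using D by (simp add: powr_realpow)
      also have "\<dots> \<le> D powr t" using D n by (intro powr_mono) auto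
      also have "\<dots> = \<delta> powr (-(1/2))" using D d0 by (simp add: powr_def t_def ln_div)
      finally have "D ^ n * \<delta> \<le> \<delta> powr (-(1/2)) * \<delta> powr 1" using d0 by (intro mult_mono) auto
      thus ?thesis unfolding powr_add[symmetric] by simp
    qed
    also have "\<dots> \<le> \<delta> powr \<alpha>" using \<alpha> \<delta> d0 by (intro powr_mono') auto
    finally have 1: "D ^ n * \<delta> \<le> \<delta> powr \<alpha>" .
    have "\<kappa> ^ n = \<kappa> powr real n" using k by (simp add: powr_realpow)
    also have "\<dots> \<le> \<kappa> powr (t - 1)" using k n by (intro powr_mono') auto
    also have "\<dots> = \<kappa> powr t / \<kappa>" using k by (simp add: powr_diff)
    also have "\<kappa> powr t = \<delta> powr s" using k d0 by (simp add: powr_def t_def s_def ln_div)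
    also have "\<delta> powr s / \<kappa> \<le> \<delta> powr \<alpha> / \<kappa>" using k \<alpha> \<delta> d0 by (intro divide_right_mono powr_mono') auto
    finally have "C * \<kappa> ^ n \<le> C * (\<delta> powr \<alpha> / \<kappa>)" using C by (intro mult_left_mono) auto
    hence "y \<le> C * (\<delta> powr \<alpha> / \<kappa>) + \<delta> powr \<alpha>" using y[rule_format, of n] 1 by linarith
    thus ?thesis by (simp add: algebra_simps)
  qed
  moreover have "0 \<le> C / \<kappa> + 1" using C k by simp
  moreover have "\<alpha> \<le> 1" using \<alpha> by simp
  ultimately show ?thesis using \<alpha>(1) by blast
qed

text \<open>By equivariance the log stretch of the slow direction is additive along orbits, so by
  invariance of the measure its integral over n steps is n times that over one step. Division by n
  and bounded convergence give L-.\<close>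

lemma Lminus_integral:
  fixes B :: "'a::finite cocycle"
  assumes G: "B \<in> GLk" and gap: "Lminus p B < Lplus p B"
  shows "(\<integral>x. ln (norm (B (x 0) *v edir B x)) - ln (norm (edir B x)) \<partial>bern p) = Lminus p B"
    and "integrable (bern p) (\<lambda>x. ln (norm (B (x 0) *v edir B x)) - ln (norm (edir B x)))"
proof -
  define \<phi> where "\<phi> n x = ln (norm (citer B n x *v edir B x)) - ln (norm (edir B x))" for n x
  have e1: "citer B 1 x = B (x 0)" for x by (simp add: matrix_mul_rid)
  have [measurable]: "edir B \<in> borel_measurable (bern p)" by (rule edir_measurable)
  have [measurable]: "(\<lambda>x. citer B n x *v edir B x) \<in> borel_measurable (bern p)" for n
    unfolding citer_wprod by (intro measurable_matvec edir_measurable borel_measurable_word)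
  have \<phi>m: "\<phi> n \<in> borel_measurable (bern p)" for n unfolding \<phi>_def[abs_def] by measurable
  note [measurable] = \<phi>m
  have \<phi>b: "\<bar>\<phi> n x\<bar> \<le> lbd B * real n" for n x
    using ln_matvec_bound[OF G, of "edir B x" "word n x"] by (simp add: \<phi>_def citer_wprod)
  have \<phi>i: "integrable (bern p) (\<phi> n)" for n
    by (rule integrable_bounded_bern[OF \<phi>m]) (use \<phi>b in auto)
  have \<phi>1: "\<phi> 1 = (\<lambda>x. ln (norm (B (x 0) *v edir B x)) - ln (norm (edir B x)))"
    unfolding \<phi>_def[abs_def] e1 ..
  show "integrable (bern p) (\<lambda>x. ln (norm (B (x 0) *v edir B x)) - ln (norm (edir B x)))"
    using \<phi>i[of 1] unfolding \<phi>1 .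
  have sh: "AE x in bern p. good p B (shift x)"
    using AE_shift[where k=1, OF AE_good[OF G, of p]] by (simp add: shift_def[abs_def])
  have step: "(\<integral>x. \<phi> (Suc n) x \<partial>bern p) = (\<integral>x. \<phi> 1 x \<partial>bern p) + (\<integral>x. \<phi> n x \<partial>bern p)" for n
  proof -
    have [measurable]: "(\<lambda>x. \<phi> n (shift x)) \<in> borel_measurable (bern p)"
      using measurable_compose[OF measurable_bern_reindex[of "\<lambda>i. i + 1" p] \<phi>m] by (simp add: shift_def)
    have "(\<integral>x. \<phi> (Suc n) x \<partial>bern p) = (\<integral>x. \<phi> 1 x + \<phi> n (shift x) \<partial>bern p)"
    proof (rule integral_cong_AE)
      show "AE x in bern p. \<phi> (Suc n) x = \<phi> 1 x + \<phi> n (shift x)"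
        using AE_good[OF G, of p] sh
      proof eventually_elim
        case (elim x)
        obtain c where c: "B (x 0) *v edir B x = c *\<^sub>R edir B (shift x)"
          using edir_equivariant[OF G gap elim] by (auto simp: span_singleton)
        have c0: "c \<noteq> 0" using c matvec_pos[OF GLkD[OF G, of "x 0"] edir_nz, of B x] by auto
        have "citer B (Suc n) x *v edir B x = c *\<^sub>R (citer B n (shift x) *v edir B (shift x))"
          by (simp only: citer_Suc_shift matrix_vector_mul_assoc[symmetric] c matrix_vector_mult_scaleR)
        moreover have "norm (citer B n (shift x) *v edir B (shift x)) > 0" by (intro matvec_pos invertible_citer G edir_nz)
        ultimately show ?case unfolding \<phi>_def e1 c using c0 by (simp add: ln_mult_pos)
      qed
    qed measurable
    also have "\<dots> = (\<integral>x. \<phi> 1 x \<partial>bern p) + (\<integral>x. \<phi> n (shift x) \<partial>bern p)"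
    proof (rule Bochner_Integration.integral_add[OF \<phi>i])
      show "integrable (bern p) (\<lambda>x. \<phi> n (shift x))"
        by (rule integrable_bounded_bern[of _ _ "lbd B * real n"]) (use \<phi>b in auto)
    qed
    also have "(\<integral>x. \<phi> n (shift x) \<partial>bern p) = (\<integral>x. \<phi> n x \<partial>bern p)"
      using integral_bern_reindex[of "\<lambda>i. i + 1" "\<phi> n" p] by (simp add: inj_def shift_def \<phi>m)
    finally show ?thesis .
  qed
  have tot: "(\<integral>x. \<phi> n x \<partial>bern p) = real n * (\<integral>x. \<phi> 1 x \<partial>bern p)" for n
  proof (induction n)
    case 0 show ?case by (simp add: \<phi>_def)
  next
    case (Suc n) show ?case unfolding step Suc by (simp add: algebra_simps)
  qed
  have "(\<lambda>n. \<integral>x. \<phi> n x / real n \<partial>bern p) \<longlonglongrightarrow> (\<integral>x. Lminus p B \<partial>bern p)"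
  proof (rule bounded_convergence_bern[where C="lbd B"])
    show "\<bar>\<phi> n x / real n\<bar> \<le> lbd B" for n x
    proof (cases "n = 0")
      case True thus ?thesis by (simp add: lbd_nonneg)
    next
      case False thus ?thesis using \<phi>b[of n x] by (simp add: field_simps)
    qed
    show "AE x in bern p. (\<lambda>n. \<phi> n x / real n) \<longlonglongrightarrow> Lminus p B"
      using AE_good[OF G, of p]
    proof eventually_elim
      case (elim x)
      have "(\<lambda>n. ln (norm (citer B n x *v edir B x)) / real n) \<longlonglongrightarrow> Lminus p B"
        by (intro good_edir(3)[OF G gap elim] span_base) auto
      thus ?case using good_edir(1)[OF G gap elim] by (simp add: \<phi>_def)
    qed
  qed measurable
  hence "(\<lambda>n. (\<integral>x. \<phi> n x \<partial>bern p) / real n) \<longlonglongrightarrow> Lminus p B" by simp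
  moreover have "eventually (\<lambda>n. (\<integral>x. \<phi> n x \<partial>bern p) / real n = (\<integral>x. \<phi> 1 x \<partial>bern p)) sequentially"
    using eventually_gt_at_top[of 0]
  proof eventually_elim
    case (elim n)
    show ?case unfolding tot[of n] using elim by simp
  qed
  ultimately have "(\<lambda>n::nat. \<integral>x. \<phi> 1 x \<partial>bern p) \<longlonglongrightarrow> Lminus p B" by (rule Lim_transform_eventually)
  hence "(\<integral>x. \<phi> 1 x \<partial>bern p) = Lminus p B" by (simp add: LIMSEQ_const_iff)
  thus "(\<integral>x. ln (norm (B (x 0) *v edir B x)) - ln (norm (edir B x)) \<partial>bern p) = Lminus p B" unfolding \<phi>1 .
qed

lemma abs_ln_diff_le:
  fixes x y :: real
  assumes "0 < R" "1 \<le> R * x" "1 \<le> R * y" shows "\<bar>ln x - ln y\<bar> \<le> R * \<bar>x - y\<bar>"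
proof -
  have *: "ln x - ln y \<le> R * \<bar>x - y\<bar>" if "1 \<le> R * x" "1 \<le> R * y" for x y
  proof -
    have p: "0 < x" "0 < y" using that assms(1) by (metis less_le_trans zero_less_mult_pos zero_less_one)+
    have "ln x - ln y = ln (x / y)" using p by (simp add: ln_div)
    also have "\<dots> \<le> x / y - 1" using p by (intro ln_le_minus_one) simp
    also have "\<dots> = (x - y) / y" using p by (simp add: diff_divide_distrib)
    also have "\<dots> \<le> \<bar>x - y\<bar> / y" using p by (intro divide_right_mono) auto
    also have "\<dots> \<le> R * \<bar>x - y\<bar>"
    proof -
      have "\<bar>x - y\<bar> * 1 \<le> \<bar>x - y\<bar> * (R * y)" by (intro mult_left_mono that) auto
      thus ?thesis using p by (simp add: field_simps)
    qed
    finally show ?thesis .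
  qed
  show ?thesis using *[OF assms(2,3)] *[OF assms(3,2)] by (simp add: abs_le_iff abs_minus_commute)
qed

text \<open>The integrand ln |B e| is Lipschitz in B and in e because |B e| is at least 1 / R. The
  sign of the second direction is adjusted first, so that the distance of the unit vectors is
  controlled by their cross product.\<close>

lemma Lminus_diff_le:
  fixes B B' :: "'a::finite cocycle"
  assumes B: "reg p R a C \<kappa> B" and B': "reg p R a C \<kappa> B'" and a: "0 < a" "a \<le> 1" and k: "0 < \<kappa>" "\<kappa> < 1"
  shows "\<bar>Lminus p B - Lminus p B'\<bar> \<le> R * cdist B B' + 2 * R * R * (\<integral>x. \<bar>cr (edir B x) (edir B' x)\<bar> \<partial>bern p)"
proof -
  interpret prob_space "bern p" by (rule prob_space_bern)
  have G: "B \<in> GLk" "B' \<in> GLk" and Rm: "rmax B \<le> R"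
    and R: "\<And>j. mnorm (B j) \<le> R" "\<And>j. mnorm (B' j) \<le> R" "\<And>j. mnorm (matrix_inv (B j)) \<le> R" "\<And>j. mnorm (matrix_inv (B' j)) \<le> R"
    using B B' by (auto simp: reg_def)
  have R1: "1 \<le> R" using Rm rmax(2)[of B] by linarith
  note gap = reg_gap[OF B a(1) k] reg_gap[OF B' a(1) k]
  let ?d = "cdist B B'"
  define f where "f D x = ln (norm (D (x 0) *v edir D x)) - ln (norm (edir D x))" for D :: "'a cocycle" and x
  have low: "1 \<le> R * norm (D j *v u)" if D: "D \<in> GLk" "mnorm (matrix_inv (D j)) \<le> R" "norm u = 1" for D :: "'a cocycle" and j u
  proof -
    have "1 = norm (matrix_inv (D j) *v (D j *v u))" using D(3) by (simp add: matrix_inv_cancel(6)[OF GLkD[OF D(1)]])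
    also have "\<dots> \<le> mnorm (matrix_inv (D j)) * norm (D j *v u)" by (rule mnorm_bound)
    also have "\<dots> \<le> R * norm (D j *v u)" by (intro mult_right_mono D) auto
    finally show ?thesis .
  qed
  have n1: "AE x in bern p. norm (edir B x) = 1 \<and> norm (edir B' x) = 1"
    using AE_good[OF G(1), of p] AE_good[OF G(2), of p]
    by eventually_elim (simp add: good_edir(1)[OF G(1) gap(1)] good_edir(1)[OF G(2) gap(2)])
  have m: "(\<lambda>x. cr (edir B x) (edir B' x)) \<in> borel_measurable (bern p)" by (intro measurable_cr edir_measurable)
  note [measurable] = m
  have i3: "integrable (bern p) (\<lambda>x. \<bar>cr (edir B x) (edir B' x)\<bar>)"
    by (rule integrable_const_bound[where B=1]) (use n1 in \<open>eventually_elim, simp, metis cr_le_norm mult_1\<close>, measurable)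
  note fi = Lminus_integral(2)[OF G(1) gap(1), folded f_def] Lminus_integral(2)[OF G(2) gap(2), folded f_def]
  have pt: "AE x in bern p. \<bar>f B x - f B' x\<bar> \<le> R * ?d + 2 * R * R * \<bar>cr (edir B x) (edir B' x)\<bar>"
    using n1
  proof eventually_elim
    case (elim x)
    define e where "e = edir B x"
    define e' where "e' = (if 0 \<le> edir B x \<bullet> edir B' x then edir B' x else - edir B' x)"
    have e: "norm e = 1" "norm e' = 1" "0 \<le> e \<bullet> e'" using elim by (auto simp: e_def e'_def)
    have cre: "\<bar>cr e e'\<bar> = \<bar>cr (edir B x) (edir B' x)\<bar>" by (auto simp: e_def e'_def)
    have fe: "f B x = ln (norm (B (x 0) *v e))" "f B' x = ln (norm (B' (x 0) *v e'))"
      using elim by (auto simp: f_def e_def e'_def matvec_minus)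
    have "B (x 0) *v e - B' (x 0) *v e' = (B (x 0) - B' (x 0)) *v e + B' (x 0) *v (e - e')"
      by (simp add: matrix_vector_mult_diff_distrib matrix_vector_mult_diff_rdistrib)
    hence "norm (B (x 0) *v e - B' (x 0) *v e') \<le> mnorm (B (x 0) - B' (x 0)) * norm e + mnorm (B' (x 0)) * norm (e - e')"
      using norm_triangle_ineq[of "(B (x 0) - B' (x 0)) *v e" "B' (x 0) *v (e - e')"] mnorm_bound[of "B (x 0) - B' (x 0)" e] mnorm_bound[of "B' (x 0)" "e - e'"] by simp
    also have "\<dots> \<le> ?d * 1 + R * (2 * \<bar>cr e e'\<bar>)"
      using cdist_ge[of B "x 0" B'] R(2) R1 norm_diff_le_cr[OF e] e(1) by (intro add_mono mult_mono) (auto simp: cdist_nonneg)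
    finally have nd: "norm (B (x 0) *v e - B' (x 0) *v e') \<le> ?d + 2 * R * \<bar>cr e e'\<bar>" by simp
    have "\<bar>f B x - f B' x\<bar> \<le> R * \<bar>norm (B (x 0) *v e) - norm (B' (x 0) *v e')\<bar>"
      unfolding fe using R1 by (intro abs_ln_diff_le low G R e) auto
    also have "\<dots> \<le> R * (?d + 2 * R * \<bar>cr e e'\<bar>)"
      using nd R1 norm_triangle_ineq3[of "B (x 0) *v e" "B' (x 0) *v e'"] by (intro mult_left_mono) auto
    finally show ?case unfolding cre by (simp add: algebra_simps)
  qed
  have "\<bar>Lminus p B - Lminus p B'\<bar> = \<bar>\<integral>x. f B x - f B' x \<partial>bern p\<bar>"
    using Lminus_integral(1)[OF G(1) gap(1)] Lminus_integral(1)[OF G(2) gap(2)] fi by (simp add: f_def)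
  also have "\<dots> \<le> (\<integral>x. \<bar>f B x - f B' x\<bar> \<partial>bern p)" by (rule integral_abs_bound)
  also have "\<dots> \<le> (\<integral>x. R * ?d + 2 * R * R * \<bar>cr (edir B x) (edir B' x)\<bar> \<partial>bern p)"
    by (rule integral_mono_AE[OF _ _ pt]) (use fi i3 in auto)
  also have "\<dots> = R * ?d + 2 * R * R * (\<integral>x. \<bar>cr (edir B x) (edir B' x)\<bar> \<partial>bern p)"
    using i3 by simp
  finally show ?thesis .
qed

section \<open>Hoelder bounds for exponents and lines on a neighbourhood of A\<close>

lemma holder_on_reg:
  assumes a: "0 < a" "a \<le> 1" and k: "0 < \<kappa>" "\<kappa> < 1" and R: "1 \<le> R" and C: "0 \<le> C"
  shows "\<exists>\<alpha> C'. 0 < \<alpha> \<and> \<alpha> \<le> 1 \<and> 0 \<le> C' \<and> (\<forall>B B'. reg p R a C \<kappa> B \<longrightarrow> reg p R a C \<kappa> B' \<longrightarrow> cdist B B' \<le> 1 \<longrightarrow>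
     (\<integral>x. \<bar>cr (edir B x) (edir B' x)\<bar> \<partial>bern p) \<le> C' * cdist B B' powr \<alpha> \<and>
     \<bar>Lminus p B - Lminus p B'\<bar> \<le> C' * cdist B B' powr \<alpha>)"
proof -
  have D: "1 < 2 * R * R"
  proof -
    have "1 * 1 \<le> R * R" using R by (intro mult_mono) auto
    thus ?thesis by simp
  qed
  have C1: "0 \<le> 2 * R * C / (1 - \<kappa>) + 2 * C" using R C k by (intro add_nonneg_nonneg divide_nonneg_pos) auto
  obtain \<alpha> C' where \<alpha>: "0 < \<alpha>" "\<alpha> \<le> 1" "0 \<le> C'"
    and int: "\<And>y \<delta>. 0 \<le> \<delta> \<Longrightarrow> \<delta> \<le> 1 \<Longrightarrow> (\<And>n. y \<le> (2 * R * C / (1 - \<kappa>) + 2 * C) * \<kappa> ^ n + (2 * R * R) ^ n * \<delta>) \<Longrightarrow> y \<le> C' * \<delta> powr \<alpha>"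
    using interpolation[OF k D C1] by blast
  define C2 where "C2 = C' + R + 2 * R * R * C'"
  have RC: "0 \<le> 2 * R * R * C'" using R \<alpha> by simp
  have C2: "0 \<le> C2" "C' \<le> C2" "R + 2 * R * R * C' \<le> C2" using \<alpha> R RC by (auto simp: C2_def)
  have "(\<integral>x. \<bar>cr (edir B x) (edir B' x)\<bar> \<partial>bern p) \<le> C2 * cdist B B' powr \<alpha> \<and> \<bar>Lminus p B - Lminus p B'\<bar> \<le> C2 * cdist B B' powr \<alpha>"
    if B: "reg p R a C \<kappa> B" "reg p R a C \<kappa> B'" "cdist B B' \<le> 1" for B B'
  proof -
    let ?d = "cdist B B'"
    let ?I = "\<integral>x. \<bar>cr (edir B x) (edir B' x)\<bar> \<partial>bern p"
    have I: "?I \<le> C' * ?d powr \<alpha>" by (intro int cdist_nonneg B integral_cr_edir_le[OF B(1,2) a k])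
    also have "\<dots> \<le> C2 * ?d powr \<alpha>" using C2 by (intro mult_right_mono) auto
    finally have 1: "?I \<le> C2 * ?d powr \<alpha>" .
    have dd: "?d \<le> ?d powr \<alpha>"
    proof (cases "?d = 0")
      case False
      thus ?thesis using powr_mono'[of \<alpha> 1 ?d] \<alpha> B(3) cdist_nonneg[of B B'] by simp
    qed simp
    have "\<bar>Lminus p B - Lminus p B'\<bar> \<le> R * ?d + 2 * R * R * ?I" by (rule Lminus_diff_le[OF B(1,2) a k])
    also have "\<dots> \<le> R * ?d powr \<alpha> + 2 * R * R * (C' * ?d powr \<alpha>)" using dd I R by (intro add_mono mult_left_mono) auto
    also have "\<dots> = (R + 2 * R * R * C') * ?d powr \<alpha>" by (simp add: algebra_simps)
    also have "\<dots> \<le> C2 * ?d powr \<alpha>" using C2 by (intro mult_right_mono) auto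
    finally show ?thesis using 1 by blast
  qed
  thus ?thesis using \<alpha> C2(1) by blast
qed

text \<open>The resolvent identity: the difference of two inverses is the difference of the
  matrices, with reversed sign, between the two inverses.\<close>

lemma cdist_icoc_le:
  fixes B B' :: "'a::finite cocycle"
  assumes B: "reg p R a C \<kappa> B" and B': "reg p R a C \<kappa> B'"
  shows "cdist (icoc B) (icoc B') \<le> R * R * cdist B B'"
proof (rule cdist_le)
  fix j
  have G: "B \<in> GLk" "B' \<in> GLk" and R: "mnorm (matrix_inv (B j)) \<le> R" "mnorm (matrix_inv (B' j)) \<le> R"
    using B B' by (auto simp: reg_def)
  have "matrix_inv (B j) - matrix_inv (B' j) = matrix_inv (B j) ** ((B' j - B j) ** matrix_inv (B' j))"
    by (simp add: matrix_diff_distrib matrix_mul_assoc matrix_inv_cancel[OF GLkD[OF G(1)]] matrix_inv_cancel[OF GLkD[OF G(2)]] matrix_mul_lid matrix_mul_rid)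
  hence "mnorm (icoc B j - icoc B' j) \<le> mnorm (matrix_inv (B j)) * mnorm ((B' j - B j) ** matrix_inv (B' j))"
    using mnorm_mult by (simp add: icoc_def)
  also have "\<dots> \<le> mnorm (matrix_inv (B j)) * (mnorm (B' j - B j) * mnorm (matrix_inv (B' j)))"
    by (intro mult_left_mono mnorm_mult mnorm_nonneg)
  also have "\<dots> \<le> R * (cdist B B' * R)"
    using R cdist_ge[of B j B'] mnorm_nonneg[of "matrix_inv (B j)"]
    by (intro mult_mono mult_nonneg_nonneg mnorm_nonneg) (auto simp: mnorm_minus_commute cdist_nonneg)
  finally show "mnorm (icoc B j - icoc B' j) \<le> R * R * cdist B B'" by (simp add: mult_ac)
qed

lemma eventually_reg:
  fixes A :: "'a::finite cocycle"
  assumes A: "A \<in> GLk" and gap: "Lminus p A < Lplus p A" and sup: "set_pmf p = UNIV"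
  shows "\<exists>R a C \<kappa>. 1 \<le> R \<and> 0 < a \<and> a \<le> 1 \<and> 0 \<le> C \<and> 0 < \<kappa> \<and> \<kappa> < 1 \<and> eventually (\<lambda>B. B \<in> GLk \<longrightarrow> reg p R a C \<kappa> B) (nbh A)"
proof -
  obtain a C \<kappa> where a: "0 < a" "a \<le> 1" and k: "0 < \<kappa>" "\<kappa> < 1"
    and ev: "eventually (\<lambda>B. B \<in> GLk \<longrightarrow> (\<forall>n. EW p n (\<lambda>w. rat (wprod B w) powr a) \<le> C * \<kappa> ^ n)) (nbh A)"
    using uniform_estimate[OF A gap sup] by blast
  have C: "0 \<le> C"
  proof -
    obtain d where "d > 0" "\<And>B. cdist A B < d \<Longrightarrow> B \<in> GLk \<Longrightarrow> \<forall>n. EW p n (\<lambda>w. rat (wprod B w) powr a) \<le> C * \<kappa> ^ n"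
      using ev by (auto simp: eventually_nbh)
    hence "\<forall>n. EW p n (\<lambda>w. rat (wprod A w) powr a) \<le> C * \<kappa> ^ n" using A by (simp add: cdist_def)
    hence "EW p 0 (\<lambda>w. rat (wprod A w) powr a) \<le> C * \<kappa> ^ 0" by (rule spec)
    hence "rat (mat 1) powr a \<le> C" by simp
    thus ?thesis by (rule order_trans[OF powr_ge_zero])
  qed
  define R where "R = 1 + rmax A + (\<Sum>j\<in>UNIV. mnorm (A j) + mnorm (matrix_inv (A j)))"
  have s: "mnorm (A j) + mnorm (matrix_inv (A j)) \<le> (\<Sum>j\<in>UNIV. mnorm (A j) + mnorm (matrix_inv (A j)))" for j
    by (rule member_le_sum) (auto intro!: add_nonneg_nonneg mnorm_nonneg)
  have s0: "0 \<le> (\<Sum>j\<in>UNIV. mnorm (A j) + mnorm (matrix_inv (A j)))" by (intro sum_nonneg add_nonneg_nonneg mnorm_nonneg)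
  have Rj: "mnorm (A j) < R" "mnorm (matrix_inv (A j)) < R" for j
    using s[of j] mnorm_nonneg[of "A j"] mnorm_nonneg[of "matrix_inv (A j)"] rmax(2)[of A] by (simp_all add: R_def)
  have e1: "eventually (\<lambda>B. \<forall>j\<in>UNIV. mnorm (B j) < R \<and> mnorm (matrix_inv (B j)) < R) (nbh A)"
    by (intro eventually_ball_finite ballI eventually_conj order_tendstoD(2)[OF tendsto_mnorm[OF tendsto_nbh]]
        order_tendstoD(2)[OF tendsto_mnorm[OF tendsto_matrix_inv[OF A]]] Rj) simp
  have "((\<lambda>B. rmax B) \<longlongrightarrow> rmax A) (nbh A)"
  proof -
    have "mnorm (A j) \<noteq> 0" "det (A j) \<noteq> 0" for j using mnorm_pos[OF GLkD[OF A, of j]] A by (auto simp: GLk_det)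
    thus ?thesis unfolding rmax_def rat_def
      by (intro tendsto_intros tendsto_mnorm tendsto_det tendsto_nbh) auto
  qed
  hence e2: "eventually (\<lambda>B. rmax B < R) (nbh A)" using s0 by (intro order_tendstoD) (auto simp: R_def)
  have "eventually (\<lambda>B. B \<in> GLk \<longrightarrow> reg p R a C \<kappa> B) (nbh A)"
    using ev e1 e2 by eventually_elim (auto simp: reg_def less_imp_le)
  moreover have "1 \<le> R" using rmax(2)[of A] s0 by (simp add: R_def)
  ultimately show ?thesis using a k C by blast
qed

text \<open>L+ and the fast line of B are -L- and the reflected slow line of \<open>icoc B\<close>,
  which satisfies \<open>reg\<close> with the same constants. Inversion is Lipschitz with constant R
  R, whence the factor (R R)^\<alpha>.\<close>

theorem holder_near_gap:
  fixes A :: "'a::finite cocycle"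
  assumes A: "A \<in> GLk" and gap: "Lminus p A < Lplus p A" and sup: "set_pmf p = UNIV"
  shows "\<exists>\<epsilon>>0. \<forall>B\<in>GLk. cdist A B < \<epsilon> \<longrightarrow> Lplus p B > Lminus p B \<and> (\<exists>Ep Em. oseledets p B Ep Em)"
    and "loc_holder GLk cdist rdist (Lplus p) A" "loc_holder GLk cdist rdist (Lminus p) A"
    and "loc_holder GLk cdist (L1dist p) (Eplus p) A" "loc_holder GLk cdist (L1dist p) (Eminus p) A"
proof -
  obtain R a C \<kappa> where R: "1 \<le> R" and a: "0 < a" "a \<le> 1" and C: "0 \<le> C" and k: "0 < \<kappa>" "\<kappa> < 1"
    and "eventually (\<lambda>B. B \<in> GLk \<longrightarrow> reg p R a C \<kappa> B) (nbh A)"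
    using eventually_reg[OF A gap sup] by blast
  then obtain d where d: "d > 0" "\<And>B. cdist A B < d \<Longrightarrow> B \<in> GLk \<Longrightarrow> reg p R a C \<kappa> B" by (auto simp: eventually_nbh)
  obtain \<alpha> C' where \<alpha>: "0 < \<alpha>" "0 \<le> C'"
    and H: "\<And>B B'. reg p R a C \<kappa> B \<Longrightarrow> reg p R a C \<kappa> B' \<Longrightarrow> cdist B B' \<le> 1 \<Longrightarrow>
     (\<integral>x. \<bar>cr (edir B x) (edir B' x)\<bar> \<partial>bern p) \<le> C' * cdist B B' powr \<alpha> \<and>
     \<bar>Lminus p B - Lminus p B'\<bar> \<le> C' * cdist B B' powr \<alpha>"
    using holder_on_reg[OF a k R C] by blast
  show "\<exists>\<epsilon>>0. \<forall>B\<in>GLk. cdist A B < \<epsilon> \<longrightarrow> Lplus p B > Lminus p B \<and> (\<exists>Ep Em. oseledets p B Ep Em)"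
    using d reg_gap[OF _ a(1) k] oseledets_edir by blast
  have RR: "1 \<le> R * R" using mult_mono[of 1 R 1 R] R by simp
  \<comment> \<open>The second bound keeps the inverse cocycles of two members of the ball at
    distance at most 1, the range in which the Hoelder bound \<open>H\<close> holds.\<close>
  define \<epsilon> where "\<epsilon> = min d (1 / (2 * (R * R)))"
  have \<epsilon>: "\<epsilon> > 0" using d RR by (simp add: \<epsilon>_def)
  define C2 where "C2 = C' * (R * R) powr \<alpha>"
  have C2: "C' \<le> C2" using \<alpha> RR ge_one_powr_ge_zero[of "R * R" \<alpha>] by (simp add: C2_def mult_le_cancel_left1)
  have K: "rdist (Lplus p B) (Lplus p B') \<le> C2 * cdist B B' powr \<alpha> \<and> rdist (Lminus p B) (Lminus p B') \<le> C2 * cdist B B' powr \<alpha> \<and>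
     L1dist p (Eplus p B) (Eplus p B') \<le> C2 * cdist B B' powr \<alpha> \<and> L1dist p (Eminus p B) (Eminus p B') \<le> C2 * cdist B B' powr \<alpha>"
    if B: "B \<in> GLk" "B' \<in> GLk" "cdist A B < \<epsilon>" "cdist A B' < \<epsilon>" for B B'
  proof -
    have r: "reg p R a C \<kappa> B" "reg p R a C \<kappa> B'" using B d by (auto simp: \<epsilon>_def)
    note ri = reg_icoc[OF r(1)] reg_icoc[OF r(2)]
    let ?d = "cdist B B'"
    have "?d \<le> cdist B A + cdist A B'" by (rule cdist_triangle)
    also have "\<dots> \<le> 1 / (2 * (R * R)) + 1 / (2 * (R * R))" using B by (simp add: \<epsilon>_def cdist_commute[of B A])
    finally have d1: "R * R * ?d \<le> 1" using RR by (simp add: field_simps)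
    have d2: "?d \<le> 1" using d1 RR cdist_nonneg[of B B'] mult_right_mono[of 1 "R * R" ?d] by simp
    have d3: "cdist (icoc B) (icoc B') \<le> R * R * ?d" by (rule cdist_icoc_le[OF r])
    have "C' * cdist (icoc B) (icoc B') powr \<alpha> \<le> C' * (R * R * ?d) powr \<alpha>"
      using \<alpha> d3 cdist_nonneg by (intro mult_left_mono powr_mono2) auto
    also have "\<dots> = C2 * ?d powr \<alpha>" using RR cdist_nonneg[of B B'] by (simp add: C2_def powr_mult)
    finally have i: "C' * cdist (icoc B) (icoc B') powr \<alpha> \<le> C2 * ?d powr \<alpha>" .
    have ii: "C' * ?d powr \<alpha> \<le> C2 * ?d powr \<alpha>" using C2 by (intro mult_right_mono) auto
    note g = reg_gap[OF r(1) a(1) k] reg_gap[OF r(2) a(1) k]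
    have "cdist (icoc B) (icoc B') \<le> 1" using d1 d3 by linarith
    note h = H[OF r d2] H[OF ri this]
    show ?thesis
      unfolding rdist_def L1dist_Eplus_Eminus[OF B(1) g(1) B(2) g(2)]
      using h i ii Lplus_icoc[OF B(1), of p] Lplus_icoc[OF B(2), of p] by (auto simp: abs_minus_commute)
  qed
  thus "loc_holder GLk cdist rdist (Lplus p) A" "loc_holder GLk cdist rdist (Lminus p) A"
    "loc_holder GLk cdist (L1dist p) (Eplus p) A" "loc_holder GLk cdist (L1dist p) (Eminus p) A"
    unfolding loc_holder_def using \<epsilon> \<alpha>(1) by blast+
qed

section \<open>Weak-Hoelder continuity and continuity at every point\<close>

lemma loc_holder_imp_weak:
  assumes "loc_holder S d1 d2 f a" shows "loc_weak_holder S d1 d2 f a"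
proof -
  obtain \<epsilon> C \<alpha> where e: "\<epsilon> > 0" "\<alpha> > 0"
    "\<And>b1 b2. b1 \<in> S \<Longrightarrow> b2 \<in> S \<Longrightarrow> d1 a b1 < \<epsilon> \<Longrightarrow> d1 a b2 < \<epsilon> \<Longrightarrow> d2 (f b1) (f b2) \<le> C * d1 b1 b2 powr \<alpha>"
    using assms unfolding loc_holder_def by blast
  \<comment> \<open>The witness \<sigma> = 1 makes the weak-Hoelder modulus an ordinary
    power.\<close>
  have "d2 (f b1) (f b2) \<le> C * exp (- \<alpha> * (ln (1 / d1 b1 b2)) powr 1)"
    if "b1 \<in> S" "b2 \<in> S" "d1 a b1 < \<epsilon>" "d1 a b2 < \<epsilon>" "0 < d1 b1 b2" "d1 b1 b2 < 1" for b1 b2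
  proof -
    have "exp (- \<alpha> * (ln (1 / d1 b1 b2)) powr 1) = d1 b1 b2 powr \<alpha>"
      using that(5,6) by (simp add: powr_def ln_div)
    thus ?thesis using e(3)[OF that(1-4)] by simp
  qed
  hence "\<forall>b1\<in>S. \<forall>b2\<in>S. d1 a b1 < \<epsilon> \<longrightarrow> d1 a b2 < \<epsilon> \<longrightarrow> 0 < d1 b1 b2 \<longrightarrow> d1 b1 b2 < 1 \<longrightarrow>
      d2 (f b1) (f b2) \<le> C * exp (- \<alpha> * (ln (1 / d1 b1 b2)) powr 1)" by blast
  moreover have "0 < (1::real)" "(1::real) \<le> 1" by simp_all
  ultimately show ?thesis unfolding loc_weak_holder_def using e(1,2) by blast
qed

lemma loc_holder_imp_continuous:
  assumes h: "loc_holder GLk cdist rdist f A" and A: "A \<in> GLk" and e: "e > 0"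
  shows "\<exists>\<delta>>0. \<forall>B\<in>GLk. cdist A B < \<delta> \<longrightarrow> \<bar>f B - f A\<bar> < e"
proof -
  obtain \<epsilon> C \<alpha> where *: "\<epsilon> > 0" "\<alpha> > 0"
    "\<And>b1 b2. b1 \<in> GLk \<Longrightarrow> b2 \<in> GLk \<Longrightarrow> cdist A b1 < \<epsilon> \<Longrightarrow> cdist A b2 < \<epsilon> \<Longrightarrow> rdist (f b1) (f b2) \<le> C * cdist b1 b2 powr \<alpha>"
    using h unfolding loc_holder_def by blast
  define c where "c = \<bar>C\<bar> + 1"
  have c: "0 < c" "C \<le> c" by (auto simp: c_def)
  define \<delta> where "\<delta> = min \<epsilon> ((e / c) powr (1 / \<alpha>))"
  have d: "\<delta> > 0" using * e c by (simp add: \<delta>_def)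
  have "\<bar>f B - f A\<bar> < e" if B: "B \<in> GLk" "cdist A B < \<delta>" for B
  proof -
    have "rdist (f A) (f B) \<le> C * cdist A B powr \<alpha>"
      using B A * by (intro *(3)) (auto simp: \<delta>_def cdist_def[of A A])
    also have "\<dots> \<le> c * cdist A B powr \<alpha>" using c by (intro mult_right_mono) auto
    also have "\<dots> < c * (((e / c) powr (1 / \<alpha>)) powr \<alpha>)"
      using B c *(2) cdist_nonneg[of A B] by (intro mult_strict_left_mono powr_less_mono2) (auto simp: \<delta>_def)
    also have "\<dots> = e" using c e *(2) by (simp add: powr_powr)
    finally show ?thesis by (simp add: rdist_def abs_minus_commute)
  qed
  thus ?thesis using d by blast
qed

lemma Lyapunov_continuous:
  fixes A :: "'a::finite cocycle"
  assumes A: "A \<in> GLk" and sup: "set_pmf p = UNIV" and e: "e > 0"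
  shows "\<exists>\<delta>>0. \<forall>B\<in>GLk. cdist A B < \<delta> \<longrightarrow> \<bar>Lplus p B - Lplus p A\<bar> < e \<and> \<bar>Lminus p B - Lminus p A\<bar> < e"
proof (cases "Lminus p A < Lplus p A")
  case True
  note h = holder_near_gap(2,3)[OF A True sup]
  obtain d1 d2 where "d1 > 0" "\<And>B. B \<in> GLk \<Longrightarrow> cdist A B < d1 \<Longrightarrow> \<bar>Lplus p B - Lplus p A\<bar> < e"
    "d2 > 0" "\<And>B. B \<in> GLk \<Longrightarrow> cdist A B < d2 \<Longrightarrow> \<bar>Lminus p B - Lminus p A\<bar> < e"
    using loc_holder_imp_continuous[OF h(1) A e] loc_holder_imp_continuous[OF h(2) A e] by blast
  thus ?thesis by (intro exI[of _ "min d1 d2"]) auto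
next
  case False
  hence eq: "Lminus p A = Lplus p A" using Lplus_ge(2)[OF A, of p] by simp
  have "eventually (\<lambda>B. B \<in> GLk \<longrightarrow> Lplus p B < Lplus p A + e) (nbh A)" "eventually (\<lambda>B. B \<in> GLk \<longrightarrow> Lminus p A - e < Lminus p B) (nbh A)"
    using e by (auto intro: Lplus_usc[OF A] Lminus_lsc[OF A])
  hence "eventually (\<lambda>B. B \<in> GLk \<longrightarrow> \<bar>Lplus p B - Lplus p A\<bar> < e \<and> \<bar>Lminus p B - Lminus p A\<bar> < e) (nbh A)"
  proof eventually_elim
    case (elim B)
    show ?case
    proof
      assume B: "B \<in> GLk"
      show "\<bar>Lplus p B - Lplus p A\<bar> < e \<and> \<bar>Lminus p B - Lminus p A\<bar> < e"
        using elim B eq Lplus_ge(2)[OF B, of p] by (simp add: abs_less_iff)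
    qed
  qed
  thus ?thesis by (simp add: eventually_nbh) blast
qed

theorem theorem1p7:
  fixes p :: "'a::finite pmf"
  assumes full_support: "set_pmf p = UNIV"
  shows "(\<forall>A\<in>GLk. \<forall>e>0. \<exists>\<delta>>0. \<forall>B\<in>GLk. cdist A B < \<delta> \<longrightarrow>
            \<bar>Lplus p B - Lplus p A\<bar> < e \<and> \<bar>Lminus p B - Lminus p A\<bar> < e)
     \<and> (\<forall>A\<in>GLk. Lplus p A > Lminus p A \<longrightarrow>
          (\<exists>\<epsilon>>0. \<forall>B\<in>GLk. cdist A B < \<epsilon> \<longrightarrow>
              Lplus p B > Lminus p B \<and> (\<exists>Ep Em. oseledets p B Ep Em))
        \<and> (diagonalizable A \<longrightarrow>
             loc_weak_holder GLk cdist rdist (Lplus p) A \<and>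
             loc_weak_holder GLk cdist rdist (Lminus p) A \<and>
             loc_weak_holder GLk cdist (L1dist p) (Eplus p) A \<and>
             loc_weak_holder GLk cdist (L1dist p) (Eminus p) A)
        \<and> (\<not> diagonalizable A \<longrightarrow>
             loc_holder GLk cdist rdist (Lplus p) A \<and>
             loc_holder GLk cdist rdist (Lminus p) A \<and>
             loc_holder GLk cdist (L1dist p) (Eplus p) A \<and>
             loc_holder GLk cdist (L1dist p) (Eminus p) A))"
  using Lyapunov_continuous[OF _ full_support] holder_near_gap[OF _ _ full_support]
  by (intro conjI ballI impI allI loc_holder_imp_weak) blast+

end
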